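(* Let $E/\mathbb{Q}$ be an elliptic curve with $E(\mathbb{Q})[2]\cong\mathbb{Z}/2\mathbb{Z}$, given by $y^2=x(x^2+ax+b)$ with $a,b\in\mathbb{Z}$, with discriminant $\Delta_E$ of this model, and let $d\in\mathcal{D}_{E/\mathbb{Q}}$. Then: (i) if $b<0$, $\mathrm{rk}_\varphi(E^{-d}/\mathbb{Q})=\mathrm{rk}_\varphi(E/\mathbb{Q})$; (ii) if $\Delta_E<0$ and $b>0$, $\mathrm{rk}_\varphi(E^{-d}/\mathbb{Q})=\mathrm{rk}_\varphi(E/\mathbb{Q})+\omega(d)$; (iii) if $\Delta_E>0$, $b>0$, $a<0$, then $\mathrm{rk}_\varphi(E^{-d}/\mathbb{Q})=\mathrm{rk}_\varphi(E/\mathbb{Q})+\omega(d)-\bigl(1+\mathrm{rank}_{\mathbb{F}_2}(\mathbf{A}_d)\bigr)$ if $\eta_\varphi(d)=1$, and $=\mathrm{rk}_\varphi(E/\mathbb{Q})+\omega(d)-\mathrm{rank}_{\mathbb{F}_2}(\widehat{\mathbf{A}}_d)$ if $\eta_\varphi(d)=0$; (iv) if $\Delta_E>0$, $b>0$, $a>0$, then $\mathrm{rk}_\varphi(E^{-d}/\mathbb{Q})=\mathrm{rk}_\varphi(E/\mathbb{Q})+\omega(d)+1-\mathrm{rank}_{\mathbb{F}_2}(\widetilde{\mathbf{A}}_d)$ if $\eta_\varphi(d)=1$, and $=\mathrm{rk}_\varphi(E/\mathbb{Q})+\omega(d)-\mathrm{rank}_{\mathbb{F}_2}(\overline{\mathbf{A}_d})$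 if $\eta_\varphi(d)=0$.
   Context: $N_E$ is the conductor of $E$; $\omega(d)$ is the number of prime factors of $d$. $\varphi:E\to E'$ is the $2$-isogeny with kernel $\langle(0,0)\rangle$, $E':y^2=x(x^2-2ax+a^2-4b)$. For squarefree $d$, $E^{d}:y^2=x(x^2+adx+bd^2)$ with its $2$-isogeny $\varphi$ with kernel generated by $(0,0)$. Identifying $E[\varphi]$ and $E^{-d}[\varphi]$ with $\mu_2$ via $(0,0)\mapsto-1$ gives $H^1(\mathbb{Q},\cdot)\cong\mathbb{Q}^\times/\mathbb{Q}^{\times2}$ and $H^1(\mathbb{Q}_v,\cdot)\cong\mathbb{Q}_v^\times/\mathbb{Q}_v^{\times 2}$. $\mathcal{L}_{\varphi,v}(E)$ is the image of the local Kummer map $E'(\mathbb{Q}_v)/\varphi(E(\mathbb{Q}_v))\to\mathbb{Q}_v^\times/\mathbb{Q}_v^{\times2}$; $\mathrm{Sel}^\varphi(E/\mathbb{Q})$ is the usual $\varphi$-Selmer group (classes whose localizations lie in $\mathcal{L}_{\varphi,v}(E)$ for all places $v$), and $\mathrm{rk}_\varphi(E/\mathbb{Q})=\dim_{\mathbb{F}_2}\mathrm{Sel}^\varphi(E/\mathbb{Q})$; similarly for $E^{-d}$. $\mathrm{Sel}^\varphi_{\mathcal{S}_d}(E/\mathbb{Q})$ is the set of $\alpha\in\mathbb{Q}^\times/\mathbb{Q}^{\times2}$ whose localization lies in $\mathcal{L}_{\varphi,v}(E)$ for every finite prime $v\nmid d$. $\mathcal{D}_{E/\mathbb{Q}}$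 is the set of products of an odd number $r\ge1$ of distinct primes $q$ such that every prime $v\mid 2N_E$ splits in $\mathbb{Q}(\sqrt{-q})$. When $b>0$, $\Delta_E>0$: for each prime $q\mid d$ fix a root $\beta\in\mathbb{Z}_q^\times$ of $x^2-2ax+(a^2-4b)$ (which splits over $\mathbb{Q}_q$), put $d_q=d/q$, and let $\mathcal{T}_d^+=\{q\mid d:\left(\frac{d_q}{q}\right)\ne(\beta,q)_q\}$, $\mathcal{T}_d^-=\{q\mid d:\left(\frac{d_q}{q}\right)=(\beta,q)_q\}$ (Legendre symbol, quadratic Hilbert symbol). Let $r_1=|\mathcal{T}_d^+|$, $r_2=|\mathcal{T}_d^-|$, $r=r_1+r_2=\omega(d)$. With rows and columns indexed by $\mathcal{T}_d^+\sqcup\mathcal{T}_d^-$ (in this order), let $\mathbf{A}_d\in\mathrm{Mat}_{r\times r}(\mathbb{F}_2)$ have $(p,q)$-entry $a_{p,q}$, where $a_{p,q}=0$ if $p=q$ or $\left(\frac{q}{p}\right)=1$ and $a_{p,q}=1$ if $\left(\frac{q}{p}\right)=-1$, except that the identity matrix $\mathbf{I}_{r_2}$ is added to the $\mathcal{T}_d^-\times\mathcal{T}_d^-$ block. For a matrix $\mathbf{M}$, $\overline{\mathbf{M}}$ is $\mathbf{M}$ plus the all-ones matrix of the same size. Let $\widetilde{\mathbf{A}}_d=[\mathbf{1}_{r\times1}\mid\mathbf{A}_d]\in\mathrm{Mat}_{r\times(r+1)}(\mathbb{F}_2)$ and $\widehat{\mathbf{A}}_d\in\mathrm{Mat}_{(r+1)\times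 r}(\mathbb{F}_2)$ the matrix with first row $\mathbf{1}_{1\times r}$ followed by the rows of $\overline{\mathbf{A}_d}$. Finally, $\eta_\varphi(d)=1$ if $\mathrm{Sel}^\varphi_{\mathcal{S}_d}(E/\mathbb{Q})$ contains an element represented by a squarefree integer $\alpha$ with either $\alpha>0$ and divisible by an odd number of primes of $d$, or $\alpha<0$ and divisible by an even number of primes of $d$; otherwise $\eta_\varphi(d)=0$. *)

theory Defs
  imports
    "Jordan_Normal_Form.DL_Rank"
    "HOL-Library.Z2"
    "HOL-Algebra.Algebraic_Closure"
    "HOL-Algebra.Elementary_Groups"
    "HOL-Algebra.Generated_Fields"
    "HOL-Algebra.Ideal_Product"
    "HOL-Number_Theory.Residues"
    "HOL-Computational_Algebra.Squarefree"
begin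

hide_const (open) Divisibility.prime

datatype place = Infinite_place | Finite_place nat

definition places :: "place set" where
  "places = insert Infinite_place (Finite_place ` {p. prime p})"

definition padic_val :: "nat \<Rightarrow> rat \<Rightarrow> int" where
  "padic_val p x =
     int (multiplicity (int p) (fst (quotient_of x))) - int (multiplicity (int p) (snd (quotient_of x)))"

fun place_abs :: "place \<Rightarrow> rat \<Rightarrow> real" where
  "place_abs Infinite_place x = \<bar>of_rat x\<bar>"
| "place_abs (Finite_place p) x = (if x = 0 then 0 else real p powi (- padic_val p x))"

definition cauchy_ring :: "place \<Rightarrow> (nat \<Rightarrow> rat) ring" where
  "cauchy_ring v =
     \<lparr>carrier = {f. \<forall>e>0. \<exists>N. \<forall>m\<ge>N. \<forall>n\<ge>N. place_abs v (f m - f n) < e},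
      monoid.mult = (\<lambda>f g n. f n * g n), one = (\<lambda>n. 1),
      zero = (\<lambda>n. 0), add = (\<lambda>f g n. f n + g n)\<rparr>"

definition null_sequences :: "place \<Rightarrow> (nat \<Rightarrow> rat) set" where
  "null_sequences v = {f. (\<lambda>n. place_abs v (f n)) \<longlonglongrightarrow> 0}"

definition completion :: "place \<Rightarrow> (nat \<Rightarrow> rat) set ring" where
  "completion v = cauchy_ring v Quot null_sequences v"

definition of_rat_completion :: "place \<Rightarrow> rat \<Rightarrow> (nat \<Rightarrow> rat) set" where
  "of_rat_completion v x = null_sequences v +>\<^bsub>cauchy_ring v\<^esub> (\<lambda>n. x)"

definition padic_integers :: "nat \<Rightarrow> (nat \<Rightarrow> rat) set ring" where
  "padic_integers p = (completion (Finite_place p))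
     \<lparr>carrier := {\<xi> \<in> carrier (completion (Finite_place p)).
                   \<exists>f\<in>\<xi>. \<forall>n. place_abs (Finite_place p) (f n) \<le> 1}\<rparr>"

definition hilbert_symbol :: "('a, 'm) ring_scheme \<Rightarrow> 'a \<Rightarrow> 'a \<Rightarrow> int" where
  "hilbert_symbol K x y =
     (if \<exists>u\<in>carrier K. \<exists>v\<in>carrier K. \<exists>w\<in>carrier K.
           (u, v, w) \<noteq> (\<zero>\<^bsub>K\<^esub>, \<zero>\<^bsub>K\<^esub>, \<zero>\<^bsub>K\<^esub>) \<and>
           w \<otimes>\<^bsub>K\<^esub> w = x \<otimes>\<^bsub>K\<^esub> (u \<otimes>\<^bsub>K\<^esub> u) \<oplus>\<^bsub>K\<^esub> y \<otimes>\<^bsub>K\<^esub> (v \<otimes>\<^bsub>K\<^esub> v)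
      then 1 else - 1)"

definition nonzero_squares :: "('a, 'm) ring_scheme \<Rightarrow> 'a set" where
  "nonzero_squares K = (\<lambda>x. x \<otimes>\<^bsub>K\<^esub> x) ` carrier (mult_of K)"

definition square_classes :: "('a, 'm) ring_scheme \<Rightarrow> 'a set monoid" where
  "square_classes K = mult_of K Mod nonzero_squares K"

definition square_class :: "('a, 'm) ring_scheme \<Rightarrow> 'a \<Rightarrow> 'a set" where
  "square_class K x = nonzero_squares K #>\<^bsub>mult_of K\<^esub> x"

definition localize :: "place \<Rightarrow> rat set \<Rightarrow> (nat \<Rightarrow> rat) set set" where
  "localize v c = the_elem ((\<lambda>x. square_class (completion v) (of_rat_completion v x)) ` c)"

datatype 'a point = Infinity | Affine 'a 'a

definition of_int_ring :: "('a, 'm) ring_scheme \<Rightarrow> int \<Rightarrow> 'a" where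
  "of_int_ring K n = [n] \<cdot>\<^bsub>K\<^esub> \<one>\<^bsub>K\<^esub>"

text \<open>The parameters \<open>a b\<close> always stand for the curve \<open>y\<^sup>2 = x (x\<^sup>2 + a x + b)\<close>.\<close>

definition ell_points :: "('a, 'm) ring_scheme \<Rightarrow> int \<Rightarrow> int \<Rightarrow> 'a point set" where
  "ell_points K a b = insert Infinity
     {Affine x y | x y. x \<in> carrier K \<and> y \<in> carrier K \<and>
        y \<otimes>\<^bsub>K\<^esub> y =
          x \<otimes>\<^bsub>K\<^esub> (x \<otimes>\<^bsub>K\<^esub> x \<oplus>\<^bsub>K\<^esub> of_int_ring K a \<otimes>\<^bsub>K\<^esub> x \<oplus>\<^bsub>K\<^esub> of_int_ring K b)}"

fun ell_add :: "('a, 'm) ring_scheme \<Rightarrow> int \<Rightarrow> int \<Rightarrow> 'a point \<Rightarrow> 'a point \<Rightarrow> 'a point" where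
  "ell_add K a b Infinity Q = Q"
| "ell_add K a b P Infinity = P"
| "ell_add K a b (Affine x1 y1) (Affine x2 y2) =
     (if x1 = x2 \<and> y1 = \<ominus>\<^bsub>K\<^esub> y2 then Infinity
      else let
        m = (if x1 = x2
             then (of_int_ring K 3 \<otimes>\<^bsub>K\<^esub> (x1 \<otimes>\<^bsub>K\<^esub> x1) \<oplus>\<^bsub>K\<^esub> of_int_ring K (2 * a) \<otimes>\<^bsub>K\<^esub> x1
                     \<oplus>\<^bsub>K\<^esub> of_int_ring K b) \<otimes>\<^bsub>K\<^esub> inv\<^bsub>K\<^esub> (of_int_ring K 2 \<otimes>\<^bsub>K\<^esub> y1)
             else (y2 \<ominus>\<^bsub>K\<^esub> y1) \<otimes>\<^bsub>K\<^esub> inv\<^bsub>K\<^esub> (x2 \<ominus>\<^bsub>K\<^esub> x1));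
        x3 = m \<otimes>\<^bsub>K\<^esub> m \<ominus>\<^bsub>K\<^esub> of_int_ring K a \<ominus>\<^bsub>K\<^esub> x1 \<ominus>\<^bsub>K\<^esub> x2
      in Affine x3 (m \<otimes>\<^bsub>K\<^esub> (x1 \<ominus>\<^bsub>K\<^esub> x3) \<ominus>\<^bsub>K\<^esub> y1))"

definition ell_group :: "('a, 'm) ring_scheme \<Rightarrow> int \<Rightarrow> int \<Rightarrow> 'a point monoid" where
  "ell_group K a b = \<lparr>carrier = ell_points K a b, monoid.mult = ell_add K a b, one = Infinity\<rparr>"

definition ell_torsion :: "('a, 'm) ring_scheme \<Rightarrow> int \<Rightarrow> int \<Rightarrow> nat \<Rightarrow> 'a point monoid" where
  "ell_torsion K a b n = (ell_group K a b)
     \<lparr>carrier := {P \<in> ell_points K a b. P [^]\<^bsub>ell_group K a b\<^esub> n = \<one>\<^bsub>ell_group K a b\<^esub>}\<rparr>"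

definition ell_disc :: "int \<Rightarrow> int \<Rightarrow> int" where
  "ell_disc a b = 16 * b\<^sup>2 * (a\<^sup>2 - 4 * b)"

text \<open>The isogeny from \<open>y\<^sup>2 = x (x\<^sup>2 + a x + b)\<close> with kernel generated by \<open>(0, 0)\<close> is
  \<open>(x, y) \<mapsto> (y\<^sup>2 / x\<^sup>2, y (b - x\<^sup>2) / x\<^sup>2)\<close>, with target
  \<open>y\<^sup>2 = x (x\<^sup>2 - 2 a x + a\<^sup>2 - 4 b)\<close>.\<close>

fun ell_isog :: "('a, 'm) ring_scheme \<Rightarrow> int \<Rightarrow> 'a point \<Rightarrow> 'a point" where
  "ell_isog K b Infinity = Infinity"
| "ell_isog K b (Affine x y) =
     (if x = \<zero>\<^bsub>K\<^esub> then Infinity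
      else let z = inv\<^bsub>K\<^esub> (x \<otimes>\<^bsub>K\<^esub> x) in
        Affine (y \<otimes>\<^bsub>K\<^esub> y \<otimes>\<^bsub>K\<^esub> z) (y \<otimes>\<^bsub>K\<^esub> (of_int_ring K b \<ominus>\<^bsub>K\<^esub> x \<otimes>\<^bsub>K\<^esub> x) \<otimes>\<^bsub>K\<^esub> z))"

definition absolute_galois ::
    "('a, 'm) ring_scheme \<Rightarrow>
      ((('a list \<times> nat) multiset \<Rightarrow> 'a) \<Rightarrow> (('a list \<times> nat) multiset \<Rightarrow> 'a)) set" where
  "absolute_galois K =
     {\<sigma> \<in> ring_iso (field.alg_closure K) (field.alg_closure K).
        \<forall>x\<in>carrier K. \<sigma> (ring.indexed_const K x) = ring.indexed_const K x}"

definition mu2_to_kernel :: "('a, 'm) ring_scheme \<Rightarrow> 'a \<Rightarrow> 'a point" where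
  "mu2_to_kernel L z = (if z = \<one>\<^bsub>L\<^esub> then Infinity else Affine \<zero>\<^bsub>L\<^esub> \<zero>\<^bsub>L\<^esub>)"

text \<open>The connecting homomorphism sends \<open>P \<in> E'(K)\<close> to the class of the cocycle
  \<open>\<sigma> \<mapsto> \<sigma> Q - Q\<close>, where \<open>Q \<in> E(L)\<close>, \<open>\<phi> Q = P\<close>, and \<open>L\<close> is an algebraic closure of \<open>K\<close>;
  the square class of \<open>\<alpha>\<close> corresponds to the class of \<open>\<sigma> \<mapsto> \<sigma> s / s\<close> with \<open>s\<^sup>2 = \<alpha>\<close>.
  As the Galois action on the kernel is trivial, so are all coboundaries, and two classes
  agree iff the cocycles agree.\<close>

definition kummer_related ::
    "('a, 'm) ring_scheme \<Rightarrow> int \<Rightarrow> int \<Rightarrow> 'a point \<Rightarrow> 'a \<Rightarrow> bool" where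
  "kummer_related K a b P \<alpha> \<longleftrightarrow>
     (let L = field.alg_closure K in
      \<exists>Q\<in>ell_points L a b. \<exists>s\<in>carrier L.
        ell_isog L b Q = map_point (ring.indexed_const K) P \<and>
        s \<otimes>\<^bsub>L\<^esub> s = ring.indexed_const K \<alpha> \<and>
        (\<forall>\<sigma>\<in>absolute_galois K.
           map_point \<sigma> Q = ell_add L a b Q (mu2_to_kernel L (\<sigma> s \<otimes>\<^bsub>L\<^esub> inv\<^bsub>L\<^esub> s))))"

definition kummer_image :: "('a, 'm) ring_scheme \<Rightarrow> int \<Rightarrow> int \<Rightarrow> 'a set set" where
  "kummer_image K a b =
     {square_class K \<alpha> | \<alpha> P. \<alpha> \<in> carrier (mult_of K) \<and>
        P \<in> ell_points K (- 2 * a) (a\<^sup>2 - 4 * b) \<and> kummer_related K a b P \<alpha>}"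

definition selmer :: "int \<Rightarrow> int \<Rightarrow> rat set set" where
  "selmer a b = {c \<in> carrier (square_classes class_ring).
     \<forall>v\<in>places. localize v c \<in> kummer_image (completion v) a b}"

definition relaxed_selmer :: "int \<Rightarrow> int \<Rightarrow> nat \<Rightarrow> rat set set" where
  "relaxed_selmer a b d = {c \<in> carrier (square_classes class_ring).
     \<forall>p. prime p \<and> \<not> p dvd d \<longrightarrow>
       localize (Finite_place p) c \<in> kummer_image (completion (Finite_place p)) a b}"

text \<open>A subgroup of exponent 2, written additively, as a vector space over \<^typ>\<open>bit\<close>.\<close>

definition bit_space :: "('a, 'm) monoid_scheme \<Rightarrow> 'a set \<Rightarrow> (bit, 'a) module" where
  "bit_space G S =
     \<lparr>carrier = S, monoid.mult = monoid.mult G, one = \<one>\<^bsub>G\<^esub>, zero = \<one>\<^bsub>G\<^esub>, add = monoid.mult G,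
      smult = (\<lambda>c x. if c = 0 then \<one>\<^bsub>G\<^esub> else x)\<rparr>"

definition selmer_rank :: "int \<Rightarrow> int \<Rightarrow> nat" where
  "selmer_rank a b =
     vectorspace.dim (class_ring :: bit ring) (bit_space (square_classes class_ring) (selmer a b))"

definition twist_selmer_rank :: "int \<Rightarrow> int \<Rightarrow> int \<Rightarrow> nat" where
  "twist_selmer_rank a b D = selmer_rank (a * D) (b * D\<^sup>2)"

definition ring_of_integers :: "complex set \<Rightarrow> complex ring" where
  "ring_of_integers L = class_ring\<lparr>carrier := {x \<in> L. algebraic_int x}\<rparr>"

definition quadratic_field :: "int \<Rightarrow> complex set" where
  "quadratic_field n = generate_field class_ring {csqrt (of_int n)}"

definition splits_in_quadratic_field :: "nat \<Rightarrow> int \<Rightarrow> bool" where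
  "splits_in_quadratic_field v n \<longleftrightarrow>
     (let R = ring_of_integers (quadratic_field n) in
      \<exists>I J. primeideal I R \<and> primeideal J R \<and> I \<noteq> J \<and>
        cgenideal R (of_nat v) = ideal_prod R I J)"

text \<open>\<open>Weierstrass a1 a2 a3 a4 a6\<close> is \<open>y\<^sup>2 + a1 x y + a3 y = x\<^sup>3 + a2 x\<^sup>2 + a4 x + a6\<close>.\<close>

datatype weierstrass = Weierstrass rat rat rat rat rat

fun change_variables :: "rat \<Rightarrow> rat \<Rightarrow> rat \<Rightarrow> rat \<Rightarrow> weierstrass \<Rightarrow> weierstrass" where
  "change_variables u r s t (Weierstrass a1 a2 a3 a4 a6) = Weierstrass
     ((a1 + 2 * s) / u)
     ((a2 - s * a1 + 3 * r - s\<^sup>2) / u ^ 2)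
     ((a3 + r * a1 + 2 * t) / u ^ 3)
     ((a4 - s * a3 + 2 * r * a2 - (t + r * s) * a1 + 3 * r\<^sup>2 - 2 * s * t) / u ^ 4)
     ((a6 + r * a4 + r\<^sup>2 * a2 + r ^ 3 - t * a3 - t\<^sup>2 - r * t * a1) / u ^ 6)"

fun weierstrass_c4 :: "weierstrass \<Rightarrow> rat" where
  "weierstrass_c4 (Weierstrass a1 a2 a3 a4 a6) =
     (let b2 = a1\<^sup>2 + 4 * a2; b4 = 2 * a4 + a1 * a3 in b2\<^sup>2 - 24 * b4)"

fun weierstrass_disc :: "weierstrass \<Rightarrow> rat" where
  "weierstrass_disc (Weierstrass a1 a2 a3 a4 a6) =
     (let b2 = a1\<^sup>2 + 4 * a2; b4 = 2 * a4 + a1 * a3; b6 = a3\<^sup>2 + 4 * a6;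
          b8 = a1\<^sup>2 * a6 + 4 * a2 * a6 - a1 * a3 * a4 + a2 * a3\<^sup>2 - a4\<^sup>2
      in - b2\<^sup>2 * b8 - 8 * b4 ^ 3 - 27 * b6\<^sup>2 + 9 * b2 * b4 * b6)"

fun integral_at :: "nat \<Rightarrow> weierstrass \<Rightarrow> bool" where
  "integral_at p (Weierstrass a1 a2 a3 a4 a6) \<longleftrightarrow>
     (\<forall>x\<in>{a1, a2, a3, a4, a6}. place_abs (Finite_place p) x \<le> 1)"

definition integral_models :: "nat \<Rightarrow> int \<Rightarrow> int \<Rightarrow> weierstrass set" where
  "integral_models p a b =
     {W. integral_at p W \<and>
         (\<exists>u r s t. u \<noteq> 0 \<and> W = change_variables u r s t (Weierstrass 0 (of_int a) 0 (of_int b) 0))}"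

definition minimal_models :: "nat \<Rightarrow> int \<Rightarrow> int \<Rightarrow> weierstrass set" where
  "minimal_models p a b =
     {W \<in> integral_models p a b. \<forall>W'\<in>integral_models p a b.
        place_abs (Finite_place p) (weierstrass_disc W') \<le> place_abs (Finite_place p) (weierstrass_disc W)}"

definition good_reduction :: "nat \<Rightarrow> int \<Rightarrow> int \<Rightarrow> bool" where
  "good_reduction p a b \<longleftrightarrow>
     (\<exists>W\<in>minimal_models p a b. place_abs (Finite_place p) (weierstrass_disc W) = 1)"

definition multiplicative_reduction :: "nat \<Rightarrow> int \<Rightarrow> int \<Rightarrow> bool" where
  "multiplicative_reduction p a b \<longleftrightarrow>
     (\<exists>W\<in>minimal_models p a b. place_abs (Finite_place p) (weierstrass_disc W) < 1 \<and>
        place_abs (Finite_place p) (weierstrass_c4 W) = 1)"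

definition torsion_field :: "int \<Rightarrow> int \<Rightarrow> nat \<Rightarrow> complex set" where
  "torsion_field a b l = generate_field class_ring (\<Union> (set_point ` carrier (ell_torsion class_ring a b l)))"

text \<open>Automorphisms are taken in \<^const>\<open>extensional\<close> form so that they can be counted.\<close>

definition ramification_group :: "complex set \<Rightarrow> complex set \<Rightarrow> nat \<Rightarrow> (complex \<Rightarrow> complex) set" where
  "ramification_group L P i =
     {\<sigma> \<in> ring_iso (class_ring\<lparr>carrier := L\<rparr>) (class_ring\<lparr>carrier := L\<rparr>) \<inter> extensional L.
        \<forall>x\<in>carrier (ring_of_integers L).
          \<sigma> x - x \<in> P [^]\<^bsub>ideals_set (ring_of_integers L)\<^esub> Suc i}"

text \<open>The wild part of the conductor exponent at \<open>p\<close> is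
  \<open>\<Sum>i\<ge>1. (g\<^sub>i / g\<^sub>0) dim (E[l] / E[l]\<^bsup>G\<^sub>i\<^esup>)\<close> for any prime \<open>l \<noteq> p\<close>, where \<open>G\<^sub>i\<close> (of order \<open>g\<^sub>i\<close>)
  are the lower ramification groups of \<open>\<rat>(E[l])\<close> at a prime above \<open>p\<close>, and the dimension is
  over the field with \<open>l\<close> elements. The sum is a natural number and depends neither on \<open>l\<close>
  nor on the prime above \<open>p\<close>.\<close>

definition wild_exponent :: "nat \<Rightarrow> int \<Rightarrow> int \<Rightarrow> real" where
  "wild_exponent p a b =
     (let l = (if p = 2 then 3 else 2);
          V = carrier (ell_torsion class_ring a b l);
          L = torsion_field a b l;
          P = (SOME P. primeideal P (ring_of_integers L) \<and> of_nat p \<in> P);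
          G = ramification_group L P
      in \<Sum>i. real (card (G (Suc i))) / real (card (G 0)) *
             log (real l)
               (real (card V) / real (card {Q \<in> V. \<forall>\<sigma>\<in>G (Suc i). map_point \<sigma> Q = Q})))"

definition conductor_exponent :: "nat \<Rightarrow> int \<Rightarrow> int \<Rightarrow> nat" where
  "conductor_exponent p a b =
     (if good_reduction p a b then 0
      else if multiplicative_reduction p a b then 1
      else 2 + nat \<lfloor>wild_exponent p a b\<rfloor>)"

definition conductor :: "int \<Rightarrow> int \<Rightarrow> nat" where
  "conductor a b =
     (\<Prod>p | prime p \<and> conductor_exponent p a b \<noteq> 0. p ^ conductor_exponent p a b)"

definition twist_set :: "int \<Rightarrow> int \<Rightarrow> nat set" where
  "twist_set a b =
     {\<Prod>S | S. finite S \<and> odd (card S) \<and>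
        (\<forall>q\<in>S. prime q \<and>
           (\<forall>v. prime v \<and> v dvd 2 * conductor a b \<longrightarrow> splits_in_quadratic_field v (- int q)))}"

definition omega :: "nat \<Rightarrow> nat" where
  "omega d = card (prime_factors d)"

definition local_roots :: "int \<Rightarrow> int \<Rightarrow> nat \<Rightarrow> (nat \<Rightarrow> (nat \<Rightarrow> rat) set) \<Rightarrow> bool" where
  "local_roots a b d \<beta> \<longleftrightarrow>
     (\<forall>q\<in>prime_factors d. let K = completion (Finite_place q) in
        \<beta> q \<in> Units (padic_integers q) \<and>
        \<beta> q \<otimes>\<^bsub>K\<^esub> \<beta> q \<oplus>\<^bsub>K\<^esub> of_int_ring K (- 2 * a) \<otimes>\<^bsub>K\<^esub> \<beta> q \<oplus>\<^bsub>K\<^esub> of_int_ring K (a\<^sup>2 - 4 * b) = \<zero>\<^bsub>K\<^esub>)"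

definition T_plus :: "nat \<Rightarrow> (nat \<Rightarrow> (nat \<Rightarrow> rat) set) \<Rightarrow> nat set" where
  "T_plus d \<beta> = {q \<in> prime_factors d.
     Legendre (int (d div q)) (int q) \<noteq>
       hilbert_symbol (completion (Finite_place q)) (\<beta> q) (of_rat_completion (Finite_place q) (of_nat q))}"

definition T_minus :: "nat \<Rightarrow> (nat \<Rightarrow> (nat \<Rightarrow> rat) set) \<Rightarrow> nat set" where
  "T_minus d \<beta> = {q \<in> prime_factors d.
     Legendre (int (d div q)) (int q) =
       hilbert_symbol (completion (Finite_place q)) (\<beta> q) (of_rat_completion (Finite_place q) (of_nat q))}"

definition T_list :: "nat \<Rightarrow> (nat \<Rightarrow> (nat \<Rightarrow> rat) set) \<Rightarrow> nat list" where
  "T_list d \<beta> = sorted_list_of_set (T_plus d \<beta>) @ sorted_list_of_set (T_minus d \<beta>)"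

definition matA :: "nat \<Rightarrow> (nat \<Rightarrow> (nat \<Rightarrow> rat) set) \<Rightarrow> bit mat" where
  "matA d \<beta> = mat (omega d) (omega d) (\<lambda>(i, j).
     let p = T_list d \<beta> ! i; q = T_list d \<beta> ! j in
     (if p = q \<or> Legendre (int q) (int p) = 1 then 0 else 1) +
     (if p = q \<and> p \<in> T_minus d \<beta> then 1 else 0))"

definition mat_bar :: "bit mat \<Rightarrow> bit mat" where
  "mat_bar M = M + mat (dim_row M) (dim_col M) (\<lambda>_. 1)"

definition matA_tilde :: "nat \<Rightarrow> (nat \<Rightarrow> (nat \<Rightarrow> rat) set) \<Rightarrow> bit mat" where
  "matA_tilde d \<beta> = mat (omega d) (omega d + 1) (\<lambda>(i, j).
     if j = 0 then 1 else matA d \<beta> $$ (i, j - 1))"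

definition matA_hat :: "nat \<Rightarrow> (nat \<Rightarrow> (nat \<Rightarrow> rat) set) \<Rightarrow> bit mat" where
  "matA_hat d \<beta> = mat (omega d + 1) (omega d) (\<lambda>(i, j).
     if i = 0 then 1 else mat_bar (matA d \<beta>) $$ (i - 1, j))"

definition bit_rank :: "bit mat \<Rightarrow> nat" where
  "bit_rank M = vec_space.rank (dim_row M) M"

definition eta :: "int \<Rightarrow> int \<Rightarrow> nat \<Rightarrow> nat" where
  "eta a b d =
     (if \<exists>\<alpha>::int. squarefree \<alpha> \<and> square_class class_ring (of_int \<alpha>) \<in> relaxed_selmer a b d \<and>
          (\<alpha> > 0 \<and> odd (card {p \<in> prime_factors d. int p dvd \<alpha>}) \<or>
           \<alpha> < 0 \<and> even (card {p \<in> prime_factors d. int p dvd \<alpha>}))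
      then 1 else 0)"

end

theory Submission
  imports
    Defs
    "HOL-Number_Theory.Number_Theory"
    "HOL-Library.Diagonal_Subsequence"
begin

text \<open>The Kummer image at a place consists of the classes \<open>\<alpha>\<close> for which the quartic
  \<open>\<alpha> n\<^sup>2 = (\<alpha> m\<^sup>2 - a e\<^sup>2)\<^sup>2 - 4 b e\<^sup>4\<close> has a nontrivial local point. Write a squarefree \<open>\<alpha>\<close> as
  \<open>s\<close> times the product of \<open>- q\<close> over the primes \<open>q\<close> of \<open>d\<close> dividing it. As \<open>- q\<close> is a square at
  every bad place, the conditions of the twist away from \<open>d\<close> and infinity are those of \<open>E\<close> on \<open>s\<close>.
  By quadratic reciprocity all bad primes are squares modulo \<open>q\<close>, so only the sign of \<open>s\<close> enters the
  condition at \<open>q\<close>, which becomes a row of a linear system over the field with two elements.\<close>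

text \<open>The Kummer image is defined by cocycles over an absolute Galois group, so enough
  automorphisms of an algebraic closure must be constructed first; as rationality is only tested on
  square roots, conjugations s -> -s extended by Zorn's lemma suffice. The conductor enters only
  through its support: at an odd prime p outside it, b and a^2 - 4 b have the same valuation 4 k,
  which cannot influence quadratic characters modulo q. Hence b and a^2 - 4 b are, up to powers of
  q^4, residues modulo q exactly when positive. This explains the cases by the signs of b and of the
  discriminant; the sign of a matters only at the real place, where twisting by the negative number
  -d reverses it. Ranks are compared by counting pairs (s, Y), with Y the set of primes of d
  dividing the class. For each sign of s the admissible Y solve a linear system, and ranks give the
  number of solutions. The value eta = 1 means that negative s occur, and then they are as many as
  the positive ones; this produces the shifts by 1 in the formulas.\<close>

section \<open>Extending automorphisms of an algebraic closure\<close>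

context field begin

text \<open>A homomorphism from a subring into the field is stored as its graph, so that extending
  it is inclusion and the union of a chain is again one. The last clause makes the relation single
  valued, by taking differences.\<close>

definition partial_hom :: "('a \<times> 'a) set => bool" where
 "partial_hom G \<longleftrightarrow> G \<subseteq> carrier R \<times> carrier R & (\<one>, \<one>) \<in> G &
   (\<forall>x y u v. (x, y) \<in> G --> (u, v) \<in> G --> (x \<oplus> u, y \<oplus> v) \<in> G & (x \<otimes> u, y \<otimes> v) \<in> G) &
   (\<forall>x y. (x, y) \<in> G --> (\<ominus> x, \<ominus> y) \<in> G) &
   (\<forall>y. (\<zero>, y) \<in> G --> y = \<zero>)"

lemma partial_homD:
 assumes "partial_hom G"
 shows "(x, y) \<in> G ==> x \<in> carrier R" "(x, y) \<in> G ==> y \<in> carrier R" "(\<one>, \<one>) \<in> G"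
  "(x, y) \<in> G ==> (u, v) \<in> G ==> (x \<oplus> u, y \<oplus> v) \<in> G"
  "(x, y) \<in> G ==> (u, v) \<in> G ==> (x \<otimes> u, y \<otimes> v) \<in> G"
  "(x, y) \<in> G ==> (\<ominus> x, \<ominus> y) \<in> G"
  "(\<zero>, y) \<in> G ==> y = \<zero>"
 using assms unfolding partial_hom_def by blast+

lemma partial_hom_unique:
 assumes G: "partial_hom G" and "(x, y) \<in> G" "(x, z) \<in> G"
 shows "y = z"
proof -
 have c: "x \<in> carrier R" "y \<in> carrier R" "z \<in> carrier R" using partial_homD(1,2)[OF G assms(2)] partial_homD(2)[OF G assms(3)] .
 have "(x \<oplus> \<ominus> x, y \<oplus> \<ominus> z) \<in> G"
  by (rule partial_homD(4)[OF G assms(2) partial_homD(6)[OF G assms(3)]])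
 then have "y \<oplus> \<ominus> z = \<zero>" unfolding r_neg[OF c(1)] by (rule partial_homD(7)[OF G])
 then show ?thesis using c by (simp add: r_right_minus_eq flip: minus_eq)
qed

definition partial_fun :: "('a \<times> 'a) set => 'a => 'a" where
 "partial_fun G x = (THE y. (x, y) \<in> G)"

lemma partial_fun_eq: "partial_hom G ==> (x, y) \<in> G ==> partial_fun G x = y"
 unfolding partial_fun_def by (rule the_equality) (auto intro: partial_hom_unique)

lemma partial_hom_domain_subring:
 assumes G: "partial_hom G" shows "subring (fst ` G) R"
proof (rule subringI)
 have mem: "x \<in> fst ` G" if "(x, y) \<in> G" for x y using image_eqI[OF _ that, of x fst] by simp
 show "fst ` G \<subseteq> carrier R" using partial_homD(1)[OF G] by (auto simp: image_subset_iff)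
 show "\<one> \<in> fst ` G" using mem[OF partial_homD(3)[OF G]] .
 fix h1 assume "h1 \<in> fst ` G"
 then obtain k1 where k1: "(h1, k1) \<in> G" by auto
 show "\<ominus> h1 \<in> fst ` G" using mem[OF partial_homD(6)[OF G k1]] .
 fix h2 assume "h2 \<in> fst ` G"
 then obtain k2 where k2: "(h2, k2) \<in> G" by auto
 show "h1 \<otimes> h2 \<in> fst ` G" using mem[OF partial_homD(5)[OF G k1 k2]] .
 show "h1 \<oplus> h2 \<in> fst ` G" using mem[OF partial_homD(4)[OF G k1 k2]] .
qed

lemma partial_fun_ring_hom:
 assumes G: "partial_hom G"
 shows "partial_fun G \<in> Ring.ring_hom (R\<lparr>carrier := fst ` G\<rparr>) R"
proof (rule ring_hom_memI)
 have mem: "(x, partial_fun G x) \<in> G" if x: "x \<in> carrier (R\<lparr>carrier := fst ` G\<rparr>)" for x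
 proof -
  from x obtain y where "(x, y) \<in> G" by auto
  then show ?thesis using partial_fun_eq[OF G \<open>(x, y) \<in> G\<close>] by simp
 qed
 show "partial_fun G x \<in> carrier R" if "x \<in> carrier (R\<lparr>carrier := fst ` G\<rparr>)" for x
  using partial_homD(2)[OF G mem[OF that]] .
 show "partial_fun G (x \<otimes>\<^bsub>R\<lparr>carrier := fst ` G\<rparr>\<^esub> y) = partial_fun G x \<otimes> partial_fun G y"
  if "x \<in> carrier (R\<lparr>carrier := fst ` G\<rparr>)" "y \<in> carrier (R\<lparr>carrier := fst ` G\<rparr>)" for x y
  using partial_fun_eq[OF G partial_homD(5)[OF G mem[OF that(1)] mem[OF that(2)]]] by simp
 show "partial_fun G (x \<oplus>\<^bsub>R\<lparr>carrier := fst ` G\<rparr>\<^esub> y) = partial_fun G x \<oplus> partial_fun G y"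
  if "x \<in> carrier (R\<lparr>carrier := fst ` G\<rparr>)" "y \<in> carrier (R\<lparr>carrier := fst ` G\<rparr>)" for x y
  using partial_fun_eq[OF G partial_homD(4)[OF G mem[OF that(1)] mem[OF that(2)]]] by simp
 show "partial_fun G \<one>\<^bsub>R\<lparr>carrier := fst ` G\<rparr>\<^esub> = \<one>"
  using partial_fun_eq[OF G partial_homD(3)[OF G]] by simp
qed

text \<open>For \<open>k\<close> algebraic over \<open>K\<close> the ring generated by
  \<open>k\<close> is already a field and lies in \<open>D\<close>, so it brings the inverse of
  \<open>k\<close> along.\<close>

lemma algebraic_intermediate_subfield:
 assumes K: "subfield K R" and alg: "\<And>x. x \<in> carrier R ==> (algebraic over K) x"
  and D: "subring D R" and KD: "K \<subseteq> D"
 shows "subfield D R"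
proof (rule subfieldI'[OF D])
 fix k assume k: "k \<in> D - {\<zero>}"
 then have kc: "k \<in> carrier R" using subringE(1)[OF D] by blast
 have sf: "subfield (simple_extension K k) R"
  by (rule iffD2[OF simple_extension_is_subfield[OF K kc] alg[OF kc]])
 have sub: "simple_extension K k \<subseteq> D"
  by (rule simple_extension_subring_incl[OF D KD DiffD1[OF k]])
 have "k \<in> simple_extension K k" using simple_extension_mem[OF subfieldE(1)[OF K] kc] .
 then have "inv k \<in> simple_extension K k" using subfield_m_inv(1)[OF sf] k by simp
 then show "inv k \<in> D" by (rule subsetD[OF sub])
qed

end

lemma (in algebraic_closure) exists_root_of_poly:
 assumes "p \<in> carrier (poly_ring L)" "degree p > 0"
 shows "\<exists>x\<in>carrier L. eval p x = \<zero>"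
proof -
 have "splitted p" using roots_over_carrier[OF assms(1)] .
 then have "size (roots p) = degree p" unfolding splitted_def .
 then have "roots p ~= {#}" using assms(2) by auto
 then obtain x where "x \<in># roots p" by (rule multiset_nonemptyE)
 then have "is_root p x" using roots_mem_iff_is_root[OF assms(1)] by simp
 then show ?thesis unfolding is_root_def by blast
qed

text \<open>One element is adjoined: \<open>z\<close> may be sent to any root \<open>w\<close> of
  the image of its minimal polynomial over the domain, and such a root exists because the field is
  algebraically closed.\<close>

lemma (in algebraic_closure) partial_hom_extend:
 assumes G: "partial_hom G" and K: "\<And>k. k \<in> K ==> (k, k) \<in> G" and z: "z \<in> carrier L"
 shows "\<exists>H. partial_hom H & G \<subseteq> H & z \<in> fst ` H"
proof -
 let ?D = "fst ` G" let ?s = "partial_fun G"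
 have D: "subring ?D L" using partial_hom_domain_subring[OF G] .
 have KD: "K \<subseteq> ?D" using K by (metis fst_conv image_eqI subsetI)
 have sf: "subfield ?D L"
  using algebraic_intermediate_subfield[OF subfield_axioms algebraic_extension D KD] .
 have DL: "?D \<subseteq> carrier L" using subringE(1)[OF D] .
 have Dr: "ring (L\<lparr>carrier := ?D\<rparr>)" using subring_is_ring[OF D] .
 have Df: "field (L\<lparr>carrier := ?D\<rparr>)" using subfield_iff(2)[OF sf] .
 interpret H: ring_hom_ring "L\<lparr>carrier := ?D\<rparr>" L ?s
  using ring_hom_ringI2[OF Dr ring_axioms partial_fun_ring_hom[OF G]] .
 have pc: "carrier (poly_ring (L\<lparr>carrier := ?D\<rparr>)) = carrier (?D[X]\<^bsub>L\<^esub>)"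
  using univ_poly_consistent[OF D] by simp
 have algz: "(algebraic over ?D) z"
  using algebraic_mono[OF KD algebraic_extension[OF z]] .
 define f where "f = Irr ?D z"
 have f: "f \<in> carrier (?D[X])" "eval f z = \<zero>" "pirreducible ?D f"
  unfolding f_def by (rule IrrE(1)[OF sf z algz], rule IrrE(4)[OF sf z algz], rule IrrE(2)[OF sf z algz])
 have mapc: "map ?s p \<in> carrier (poly_ring L)" if "p \<in> carrier (?D[X])" for p
  by (rule polynomial_hom[OF partial_fun_ring_hom[OF G] Df field_axioms], unfold pc, rule that)
 have degf: "degree f > 0"
  using pirreducible_degree[OF sf f(1) f(3)] by linarith
 have "\<exists>w\<in>carrier L. eval (map ?s f) w = \<zero>"
  by (rule exists_root_of_poly[OF mapc[OF f(1)]], unfold length_map, rule degf)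
 then obtain w where w: "w \<in> carrier L" "eval (map ?s f) w = \<zero>" by (elim bexE)
 \<comment> \<open>The graph of p(z) -> (image of p)(w) for all polynomials p over the domain. That
   it is single valued is the content of \<open>Hfun\<close>: p(z) = 0 makes p a multiple of
   \<open>f\<close>, and the image of \<open>f\<close> vanishes at \<open>w\<close>.\<close>
 define H where "H = {(eval p z, eval (map ?s p) w) | p. p \<in> carrier (?D[X])}"
 interpret UP: ring "?D[X]" using univ_poly_is_ring[OF D] .
 have setD: "set p \<subseteq> ?D" if "p \<in> carrier (?D[X])" for p
  by (rule polynomial_incl, unfold univ_poly_carrier, rule that)
 have setc: "set p \<subseteq> carrier L" if "p \<in> carrier (?D[X])" for p using setD[OF that] DL by blast
 have setm: "set (map ?s p) \<subseteq> carrier L" if "p \<in> carrier (?D[X])" for p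
  using H.hom_closed subsetD[OF setD[OF that]] unfolding set_map by (intro image_subsetI) simp
 have setD': "set p \<subseteq> carrier (L\<lparr>carrier := ?D\<rparr>)" if "p \<in> carrier (?D[X])" for p
  using setD[OF that] by simp
 have eadd: "eval (map ?s (p \<oplus>\<^bsub>?D[X]\<^esub> q)) w = eval (map ?s p) w \<oplus> eval (map ?s q) w"
  if "p \<in> carrier (?D[X])" "q \<in> carrier (?D[X])" for p q
 proof -
  have eq: "p \<oplus>\<^bsub>?D[X]\<^esub> q = ring.poly_add (L\<lparr>carrier := ?D\<rparr>) p q"
   unfolding univ_poly_add poly_add_consistent[OF D] ..
  have c': "set (map ?s (p \<oplus>\<^bsub>?D[X]\<^esub> q)) \<subseteq> carrier L"
   by (rule setm[OF UP.add.m_closed[OF that]])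
  have "eval (map ?s (p \<oplus>\<^bsub>?D[X]\<^esub> q)) w = eval (normalize (map ?s (p \<oplus>\<^bsub>?D[X]\<^esub> q))) w"
   using eval_normalize[OF c' w(1)] ..
  also have "\<dots> = eval (poly_add (map ?s p) (map ?s q)) w"
   unfolding eq H.poly_add_hom'[OF setD'[OF that(1)] setD'[OF that(2)]] ..
  also have "\<dots> = eval (map ?s p) w \<oplus> eval (map ?s q) w"
   using eval_poly_add[OF setm[OF that(1)] setm[OF that(2)] w(1)] .
  finally show ?thesis .
 qed
 have emul: "eval (map ?s (p \<otimes>\<^bsub>?D[X]\<^esub> q)) w = eval (map ?s p) w \<otimes> eval (map ?s q) w"
  if "p \<in> carrier (?D[X])" "q \<in> carrier (?D[X])" for p q
 proof -
  have eq: "p \<otimes>\<^bsub>?D[X]\<^esub> q = ring.poly_mult (L\<lparr>carrier := ?D\<rparr>) p q"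
   unfolding univ_poly_mult poly_mult_consistent[OF D] ..
  have c': "set (map ?s (p \<otimes>\<^bsub>?D[X]\<^esub> q)) \<subseteq> carrier L"
   by (rule setm[OF UP.m_closed[OF that]])
  have "eval (map ?s (p \<otimes>\<^bsub>?D[X]\<^esub> q)) w = eval (normalize (map ?s (p \<otimes>\<^bsub>?D[X]\<^esub> q))) w"
   using eval_normalize[OF c' w(1)] ..
  also have "\<dots> = eval (poly_mult (map ?s p) (map ?s q)) w"
   unfolding eq H.poly_mult_hom'[OF setD'[OF that(1)] setD'[OF that(2)]] ..
  also have "\<dots> = eval (map ?s p) w \<otimes> eval (map ?s q) w"
   using eval_poly_mult[OF setm[OF that(1)] setm[OF that(2)] w(1)] .
  finally show ?thesis .
 qed
 have zadd: "eval (p \<oplus>\<^bsub>?D[X]\<^esub> q) z = eval p z \<oplus> eval q z"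
  if "p \<in> carrier (?D[X])" "q \<in> carrier (?D[X])" for p q
  unfolding univ_poly_add by (rule eval_poly_add[OF setc[OF that(1)] setc[OF that(2)] z])
 have zmul: "eval (p \<otimes>\<^bsub>?D[X]\<^esub> q) z = eval p z \<otimes> eval q z"
  if "p \<in> carrier (?D[X])" "q \<in> carrier (?D[X])" for p q
  unfolding univ_poly_mult by (rule eval_poly_mult[OF setc[OF that(1)] setc[OF that(2)] z])
 have memH: "(eval p z, eval (map ?s p) w) \<in> H" if "p \<in> carrier (?D[X])" for p
  unfolding H_def by (rule CollectI, intro exI conjI, rule refl, rule that)
 have const: "(x, y) \<in> H" if "(x, y) \<in> G" for x y
 proof (cases "x = \<zero>")
  case True
  have "y = \<zero>" using that unfolding True by (rule partial_homD(7)[OF G])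
  moreover have "([] :: 'a list) \<in> carrier (?D[X])" using UP.zero_closed unfolding univ_poly_zero .
  ultimately show ?thesis using memH[of "[]"] True by (simp only: list.map eval.simps)
 next
  case False
  have xD: "x \<in> ?D" using that by (rule image_eqI[of _ fst "(x, y)", rotated]) simp
  have c: "[x] \<in> carrier (?D[X])" unfolding univ_poly_carrier[symmetric] polynomial_def using False xD by simp
  have "?s x = y" using partial_fun_eq[OF G that] .
  then show ?thesis using memH[OF c] partial_homD(1,2)[OF G that] by simp
 qed
 have one: "(\<one>, \<one>) \<in> H" by (rule const[OF partial_homD(3)[OF G]])
 have Hsub: "H \<subseteq> carrier L \<times> carrier L"
  unfolding H_def using eval_in_carrier[OF setc z] eval_in_carrier[OF setm w(1)] by blast
 have Hadd: "(x \<oplus> u, y \<oplus> v) \<in> H" and Hmul: "(x \<otimes> u, y \<otimes> v) \<in> H" if xy: "(x, y) \<in> H" "(u, v) \<in> H" for x y u v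
 proof -
  from xy obtain p q where p: "p \<in> carrier (?D[X])" "x = eval p z" "y = eval (map ?s p) w"
   and q: "q \<in> carrier (?D[X])" "u = eval q z" "v = eval (map ?s q) w" unfolding H_def by blast
  show "(x \<oplus> u, y \<oplus> v) \<in> H"
   using memH[OF UP.add.m_closed[OF p(1) q(1)]] unfolding zadd[OF p(1) q(1)] eadd[OF p(1) q(1)] p q .
  show "(x \<otimes> u, y \<otimes> v) \<in> H"
   using memH[OF UP.m_closed[OF p(1) q(1)]] unfolding zmul[OF p(1) q(1)] emul[OF p(1) q(1)] p q .
 qed
 have m1: "(\<ominus> \<one>, \<ominus> \<one>) \<in> H" by (rule const[OF partial_homD(6)[OF G partial_homD(3)[OF G]]])
 have Hneg: "(\<ominus> x, \<ominus> y) \<in> H" if "(x, y) \<in> H" for x y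
 proof -
  have c: "x \<in> carrier L" "y \<in> carrier L" using that Hsub by auto
  then show ?thesis using Hmul[OF m1 that] by (simp add: l_minus)
 qed
 have Hfun: "y = \<zero>" if "(\<zero>, y) \<in> H" for y
 proof -
  from that obtain p where p: "p \<in> carrier (?D[X])" "\<zero> = eval p z" "y = eval (map ?s p) w"
   unfolding H_def by blast
  have "f pdivides p" unfolding f_def using Irr_minimal[OF sf z algz p(1) p(2)[symmetric]] .
  then have "f divides\<^bsub>?D[X]\<^esub> p" using pdivides_iff_shell[OF sf f(1) p(1)] by simp
  then obtain q where q: "q \<in> carrier (?D[X])" "p = f \<otimes>\<^bsub>?D[X]\<^esub> q" unfolding factor_def by blast
  have "y = eval (map ?s f) w \<otimes> eval (map ?s q) w" unfolding p(3) q(2) using emul[OF f(1) q(1)] .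
  then show ?thesis using w(2) eval_in_carrier[OF setm[OF q(1)] w(1)] by simp
 qed
 have PH: "partial_hom H" unfolding partial_hom_def
  by (intro conjI allI impI Hsub one Hadd Hmul Hneg Hfun)
 have zH: "z \<in> fst ` H"
 proof -
  have "var L \<in> carrier (?D[X])" using var_closed(1)[OF D] .
  from memH[OF this] have "(z, eval (map ?s (var L)) w) \<in> H" unfolding eval_var[OF z] .
  then show ?thesis by (rule image_eqI[rotated]) simp
 qed
 show ?thesis using PH zH const by (intro exI[of _ H] conjI subrelI)
qed

text \<open>Only surjectivity needs an argument: y is a root of a polynomial over \<open>K\<close>,
  whose finitely many roots are permuted by the map because it is injective and fixes the
  coefficients.\<close>

lemma (in algebraic_closure) total_partial_hom_iso:
 assumes G: "partial_hom G" and K: "\<And>k. k \<in> K ==> (k, k) \<in> G" and tot: "fst ` G = carrier L"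
 shows "partial_fun G \<in> ring_iso L L"
proof -
 let ?s = "partial_fun G"
 have hom: "?s \<in> Ring.ring_hom L L" using partial_fun_ring_hom[OF G] unfolding tot by simp
 have fixK: "?s k = k" if "k \<in> K" for k using partial_fun_eq[OF G K[OF that]] .
 interpret H: ring_hom_ring L L ?s using ring_hom_ringI2[OF ring_axioms ring_axioms hom] .
 have inj: "inj_on ?s (carrier L)" using non_trivial_field_hom_is_inj[OF hom field_axioms field_axioms] .
 have "y \<in> ?s ` carrier L" if y: "y \<in> carrier L" for y
 proof -
  obtain p where p: "p \<in> carrier (K[X])" "p ~= []" "eval p y = \<zero>"
   using algebraicE[OF subfieldE(1)[OF subfield_axioms] y algebraic_extension[OF y]] .
  have pL: "p \<in> carrier (poly_ring L)" using carrier_polynomial_shell[OF subfieldE(1)[OF subfield_axioms] p(1)] .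
  have setp: "set p \<subseteq> K" by (rule polynomial_incl, unfold univ_poly_carrier, rule p(1))
  have setpL: "set p \<subseteq> carrier L" using setp subfieldE(3)[OF subfield_axioms] by blast
  have mp: "map ?s p = p" by (rule map_idI, rule fixK, rule subsetD[OF setp])
  define S where "S = {x. is_root p x}"
  have fin: "finite S" unfolding S_def using finite_number_of_roots[OF pL] .
  have Sc: "S \<subseteq> carrier L" unfolding S_def is_root_def by blast
  have "?s ` S \<subseteq> S"
  proof
   fix v assume "v \<in> ?s ` S"
   then obtain x where x: "x \<in> S" "v = ?s x" by (elim imageE)
   have xc: "x \<in> carrier L" by (rule subsetD[OF Sc x(1)])
   have "eval p v = ?s (eval p x)" using H.eval_hom'[OF xc setpL] mp x(2) by simp
   also have "\<dots> = \<zero>" using x unfolding S_def is_root_def by simp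
   finally show "v \<in> S" unfolding S_def is_root_def using x xc H.hom_closed p(2) by simp
  qed
  moreover have "inj_on ?s S" using inj Sc by (rule inj_on_subset)
  ultimately have "?s ` S = S" using fin by (simp add: endo_inj_surj)
  moreover have "y \<in> S" unfolding S_def is_root_def using y p by simp
  ultimately have "y \<in> ?s ` S" by simp
  then show ?thesis using image_mono[OF Sc] by (rule rev_subsetD)
 qed
 then have "?s ` carrier L = carrier L" using H.hom_closed by (intro subset_antisym image_subsetI subsetI)
 then show ?thesis unfolding ring_iso_def using hom inj by (simp add: bij_betw_def)
qed

text \<open>Zorn's lemma on the graphs containing \<open>G0\<close>; a maximal one has full domain
  by \<open>partial_hom_extend\<close>.\<close>

lemma (in algebraic_closure) partial_hom_extends_to_automorphism:
 assumes G0: "partial_hom G0" and K: "\<And>k. k \<in> K ==> (k, k) \<in> G0"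
 shows "\<exists>sig\<in>ring_iso L L. \<forall>x y. (x, y) \<in> G0 --> sig x = y"
proof -
 let ?A = "{G. partial_hom G & G0 \<subseteq> G}"
 have "\<exists>M\<in>?A. \<forall>Y\<in>?A. M \<subseteq> Y --> Y = M"
 proof (rule subset_Zorn_nonempty)
  show "?A ~= {}" using G0 by blast
  fix C assume C: "C ~= {}" "subset.chain ?A C"
  have CA: "C \<subseteq> ?A" and ch: "\<And>Y Z. Y \<in> C ==> Z \<in> C ==> Y \<subseteq> Z \<or> Z \<subseteq> Y"
   using C(2) unfolding subset_chain_def by simp_all
  have two: "\<exists>Y\<in>C. g \<in> Y & h \<in> Y" if gh: "g \<in> \<Union>C" "h \<in> \<Union>C" for g h
  proof -
   obtain Y Z where YZ: "Y \<in> C" "g \<in> Y" "Z \<in> C" "h \<in> Z" using gh by (elim UnionE)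
   from ch[OF YZ(1,3)] show ?thesis
   proof
    assume "Y \<subseteq> Z" then show ?thesis using YZ by (intro bexI[of _ Z]) auto
   next
    assume "Z \<subseteq> Y" then show ?thesis using YZ by (intro bexI[of _ Y]) auto
   qed
  qed
  have CD: "partial_hom Y" if "Y \<in> C" for Y using CA that by blast
  have "partial_hom (\<Union>C)" unfolding partial_hom_def
  proof (intro conjI allI impI)
   show "\<Union>C \<subseteq> carrier L \<times> carrier L" using CD unfolding partial_hom_def by (intro Union_least) simp
   obtain Y where "Y \<in> C" using C(1) by auto
   then show "(\<one>, \<one>) \<in> \<Union>C" using partial_homD(3)[OF CD] by (intro UnionI)
   show "(x \<oplus> u, y \<oplus> v) \<in> \<Union>C" "(x \<otimes> u, y \<otimes> v) \<in> \<Union>C"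
    if xy: "(x, y) \<in> \<Union>C" "(u, v) \<in> \<Union>C" for x y u v
   proof -
    obtain Y where Y: "Y \<in> C" "(x, y) \<in> Y" "(u, v) \<in> Y" using two[OF xy] by blast
    show "(x \<oplus> u, y \<oplus> v) \<in> \<Union>C" by (rule UnionI[OF Y(1) partial_homD(4)[OF CD[OF Y(1)] Y(2,3)]])
    show "(x \<otimes> u, y \<otimes> v) \<in> \<Union>C" by (rule UnionI[OF Y(1) partial_homD(5)[OF CD[OF Y(1)] Y(2,3)]])
   qed
   show "(\<ominus> x, \<ominus> y) \<in> \<Union>C" if xy: "(x, y) \<in> \<Union>C" for x y
   proof -
    obtain Y where Y: "Y \<in> C" "(x, y) \<in> Y" using xy by blast
    show ?thesis by (rule UnionI[OF Y(1) partial_homD(6)[OF CD[OF Y(1)] Y(2)]])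
   qed
   show "y = \<zero>" if xy: "(\<zero>, y) \<in> \<Union>C" for y
   proof -
    obtain Y where Y: "Y \<in> C" "(\<zero>, y) \<in> Y" using xy by blast
    show ?thesis by (rule partial_homD(7)[OF CD[OF Y(1)] Y(2)])
   qed
  qed
  moreover have "G0 \<subseteq> \<Union>C"
  proof -
   obtain Y where "Y \<in> C" using C(1) by auto
   then show ?thesis using CA by auto
  qed
  ultimately show "\<Union>C \<in> ?A" by simp
 qed
 then obtain M where M: "partial_hom M" "G0 \<subseteq> M" "\<And>Y. partial_hom Y ==> M \<subseteq> Y ==> Y = M"
  by (smt (verit, best) mem_Collect_eq order_trans)
 have KM: "(k, k) \<in> M" if "k \<in> K" for k by (rule subsetD[OF M(2) K[OF that]])
 have "fst ` M = carrier L"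
 proof
  show "fst ` M \<subseteq> carrier L" using subringE(1)[OF partial_hom_domain_subring[OF M(1)]] .
  show "carrier L \<subseteq> fst ` M"
  proof
   fix z assume "z \<in> carrier L"
   then have "\<exists>H. partial_hom H & M \<subseteq> H & z \<in> fst ` H"
    by (intro partial_hom_extend[OF M(1)] KM)
   then obtain H where "partial_hom H" "M \<subseteq> H" "z \<in> fst ` H" by (elim exE conjE)
   then show "z \<in> fst ` M" using M(3)[of H] by simp
  qed
 qed
 then have "partial_fun M \<in> ring_iso L L" using total_partial_hom_iso[OF M(1) KM] by simp
 moreover have "\<forall>x y. (x, y) \<in> G0 --> partial_fun M x = y"
  using partial_fun_eq[OF M(1) subsetD[OF M(2)]] by simp
 ultimately show ?thesis by (intro bexI)
qed

lemma (in cring) conjugate_mult_plus: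
 assumes "a \<in> carrier R" "b \<in> carrier R" "c \<in> carrier R" "d \<in> carrier R" "s \<in> carrier R"
 shows "(a \<oplus> b \<otimes> s) \<otimes> (c \<oplus> d \<otimes> s) = (a \<otimes> c \<oplus> b \<otimes> d \<otimes> (s \<otimes> s)) \<oplus> (a \<otimes> d \<oplus> b \<otimes> c) \<otimes> s"
 using assms by (simp add: l_distr r_distr a_ac m_ac)

lemma (in cring) conjugate_mult_minus:
 assumes "a \<in> carrier R" "b \<in> carrier R" "c \<in> carrier R" "d \<in> carrier R" "s \<in> carrier R"
 shows "(a \<ominus> b \<otimes> s) \<otimes> (c \<ominus> d \<otimes> s) = (a \<otimes> c \<oplus> b \<otimes> d \<otimes> (s \<otimes> s)) \<ominus> (a \<otimes> d \<oplus> b \<otimes> c) \<otimes> s"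
 using conjugate_mult_plus[of a b c d "\<ominus> s"] assms by (simp add: r_minus l_minus minus_eq)

text \<open>K + K s is closed under multiplication because s^2 lies in K, and u + v s -> u - v s is
  well defined there because s does not. This map is then extended to the whole closure.\<close>

lemma (in algebraic_closure) exists_conjugation:
 assumes s: "s \<in> carrier L" "s \<notin> K" "s \<otimes> s \<in> K"
 shows "\<exists>sig\<in>ring_iso L L. (\<forall>k\<in>K. sig k = k) & sig s = \<ominus> s"
proof -
 have KL: "K \<subseteq> carrier L" and Ks: "subring K L" using subfieldE[OF subfield_axioms] by auto
 note Kc = subringE[OF Ks]
 define G where "G = {(u \<oplus> v \<otimes> s, u \<ominus> v \<otimes> s) | u v. u \<in> K & v \<in> K}"
 have memG: "(u \<oplus> v \<otimes> s, u \<ominus> v \<otimes> s) \<in> G" if "u \<in> K" "v \<in> K" for u v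
  unfolding G_def using that by blast
 have Gsub: "G \<subseteq> carrier L \<times> carrier L"
 proof
  fix g assume "g \<in> G"
  then obtain u v where uv: "u \<in> K" "v \<in> K" "g = (u \<oplus> v \<otimes> s, u \<ominus> v \<otimes> s)" unfolding G_def by blast
  then have "u \<in> carrier L" "v \<in> carrier L" using KL by auto
  then show "g \<in> carrier L \<times> carrier L" unfolding uv(3) using s(1) by simp
 qed
 have KG: "(k, k) \<in> G" if "k \<in> K" for k
 proof -
  have "k \<in> carrier L" using that KL by auto
  then have "(k \<oplus> \<zero> \<otimes> s, k \<ominus> \<zero> \<otimes> s) = (k, k)" using s(1) by (simp add: minus_eq)
  then show ?thesis using memG[OF that Kc(2)] by simp
 qed
 have sG: "(s, \<ominus> s) \<in> G"
 proof -
  have "(\<zero> \<oplus> \<one> \<otimes> s, \<zero> \<ominus> \<one> \<otimes> s) = (s, \<ominus> s)" using s(1) by (simp add: minus_eq)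
  then show ?thesis using memG[OF Kc(2,3)] by simp
 qed
 have Gneg: "(\<ominus> x, \<ominus> y) \<in> G" if "(x, y) \<in> G" for x y
 proof -
  from that obtain u v where uv: "u \<in> K" "v \<in> K" "x = u \<oplus> v \<otimes> s" "y = u \<ominus> v \<otimes> s" unfolding G_def by blast
  have c: "u \<in> carrier L" "v \<in> carrier L" using uv KL by auto
  have e: "\<ominus> x = \<ominus> u \<oplus> (\<ominus> v) \<otimes> s" "\<ominus> y = \<ominus> u \<ominus> (\<ominus> v) \<otimes> s" unfolding uv using c s(1) by algebra+
  show ?thesis unfolding e by (rule memG[OF Kc(5)[OF uv(1)] Kc(5)[OF uv(2)]])
 qed
 have Gadd: "(x \<oplus> u, y \<oplus> v) \<in> G" and Gmul: "(x \<otimes> u, y \<otimes> v) \<in> G"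
  if h: "(x, y) \<in> G" "(u, v) \<in> G" for x y u v
 proof -
  from h obtain a b where ab: "a \<in> K" "b \<in> K" "x = a \<oplus> b \<otimes> s" "y = a \<ominus> b \<otimes> s" unfolding G_def by blast
  from h obtain c d where cd: "c \<in> K" "d \<in> K" "u = c \<oplus> d \<otimes> s" "v = c \<ominus> d \<otimes> s" unfolding G_def by blast
  have c: "a \<in> carrier L" "b \<in> carrier L" "c \<in> carrier L" "d \<in> carrier L" using ab cd KL by auto
  have e: "x \<oplus> u = (a \<oplus> c) \<oplus> (b \<oplus> d) \<otimes> s" "y \<oplus> v = (a \<oplus> c) \<ominus> (b \<oplus> d) \<otimes> s"
   unfolding ab cd using c s(1) by algebra+
  show "(x \<oplus> u, y \<oplus> v) \<in> G" unfolding e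
   by (rule memG[OF Kc(7)[OF ab(1) cd(1)] Kc(7)[OF ab(2) cd(2)]])
  have e': "x \<otimes> u = (a \<otimes> c \<oplus> b \<otimes> d \<otimes> (s \<otimes> s)) \<oplus> (a \<otimes> d \<oplus> b \<otimes> c) \<otimes> s"
   "y \<otimes> v = (a \<otimes> c \<oplus> b \<otimes> d \<otimes> (s \<otimes> s)) \<ominus> (a \<otimes> d \<oplus> b \<otimes> c) \<otimes> s"
   unfolding ab(3,4) cd(3,4) using c s(1) by (rule conjugate_mult_plus conjugate_mult_minus)+
  show "(x \<otimes> u, y \<otimes> v) \<in> G" unfolding e'
   by (rule memG[OF Kc(7)[OF Kc(6)[OF ab(1) cd(1)] Kc(6)[OF Kc(6)[OF ab(2) cd(2)] s(3)]]
      Kc(7)[OF Kc(6)[OF ab(1) cd(2)] Kc(6)[OF ab(2) cd(1)]]])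
 qed
 have Gfun: "y = \<zero>" if "(\<zero>, y) \<in> G" for y
 proof -
  from that obtain u v where uv: "u \<in> K" "v \<in> K" "\<zero> = u \<oplus> v \<otimes> s" "y = u \<ominus> v \<otimes> s" unfolding G_def by blast
  have c: "u \<in> carrier L" "v \<in> carrier L" using uv KL by auto
  show ?thesis
  proof (cases "v = \<zero>")
   case True
   have "u = \<zero>" using uv(3) c s(1) unfolding True by simp
   then show ?thesis using uv(4) s(1) unfolding True by (simp add: minus_eq)
  next
   case False
   then have iv: "inv v \<in> K" "inv v \<otimes> v = \<one>"
    using subfield_m_inv[OF subfield_axioms, of v] uv(2) by auto
   have ivc: "inv v \<in> carrier L" using iv KL by auto
   have "s = inv v \<otimes> v \<otimes> s" using iv s(1) by simp
   also have "\<dots> = inv v \<otimes> ((u \<oplus> v \<otimes> s) \<ominus> u)" using ivc c s(1) by algebra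
   also have "\<dots> = inv v \<otimes> (\<ominus> u)" using uv(3)[symmetric] c by (simp add: minus_eq)
   finally have "s = inv v \<otimes> (\<ominus> u)" .
   then have "s \<in> K" using Kc(6)[OF iv(1) Kc(5)[OF uv(1)]] by simp
   then show ?thesis using s(2) by simp
  qed
 qed
 have G: "partial_hom G" unfolding partial_hom_def
  by (intro conjI allI impI Gsub KG Kc(3) Gadd Gmul Gneg Gfun)
 have "\<exists>sig\<in>ring_iso L L. \<forall>x y. (x, y) \<in> G --> sig x = y"
  by (rule partial_hom_extends_to_automorphism[OF G KG])
 then obtain sig where sig: "sig \<in> ring_iso L L" "\<forall>x y. (x, y) \<in> G --> sig x = y" by (elim bexE)
 have "\<forall>k\<in>K. sig k = k" using sig(2) KG by simp
 moreover have "sig s = \<ominus> s" using sig(2) sG by simp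
 ultimately show ?thesis using sig(1) by (intro bexI conjI)
qed

text \<open>The part of the Galois correspondence that the descent uses: rationality is only ever
  tested on square roots. In characteristic 2 conjugation would be trivial.\<close>

lemma (in algebraic_closure) fixed_sqrt_in_base:
 assumes two: "\<one> \<oplus> \<one> ~= \<zero>" and s: "s \<in> carrier L" "s \<otimes> s \<in> K"
  and inv: "\<And>sig. sig \<in> ring_iso L L ==> (\<forall>k\<in>K. sig k = k) ==> sig s = s"
 shows "s \<in> K"
proof (rule ccontr)
 assume "s \<notin> K"
 from exists_conjugation[OF s(1) this s(2)]
 obtain sig where sig: "sig \<in> ring_iso L L" "\<forall>k\<in>K. sig k = k" "sig s = \<ominus> s" by (elim bexE conjE)
 have "\<ominus> s = s" using inv[OF sig(1,2)] sig(3) by simp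
 then have "s \<oplus> s = \<zero>" using l_neg[OF s(1)] by simp
 then have "(\<one> \<oplus> \<one>) \<otimes> s = \<zero>" using s(1) by (simp add: l_distr)
 then have "s = \<zero>" using two s(1) by (simp add: integral_iff)
 then show False using \<open>s \<notin> K\<close> subringE(2)[OF subfieldE(1)[OF subfield_axioms]] by simp
qed

section \<open>Integers in a ring, and multiplicativity of the descent map\<close>

context ring begin

lemma of_int_ring_closed [simp]: "of_int_ring R n \<in> carrier R"
 by (simp add: of_int_ring_def)

lemma of_int_ring_0 [simp]: "of_int_ring R 0 = \<zero>"
 by (simp add: of_int_ring_def add_pow_def)

lemma of_int_ring_1 [simp]: "of_int_ring R 1 = \<one>"
 by (simp add: of_int_ring_def)

lemma of_int_ring_add: "of_int_ring R (m + n) = of_int_ring R m \<oplus> of_int_ring R n"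
 unfolding of_int_ring_def by (rule add.int_pow_mult[OF one_closed])

lemma of_int_ring_neg: "of_int_ring R (- n) = \<ominus> of_int_ring R n"
 unfolding of_int_ring_def by (rule add.int_pow_neg[OF one_closed])

lemma of_int_ring_diff: "of_int_ring R (m - n) = of_int_ring R m \<ominus> of_int_ring R n"
 using of_int_ring_add[of m "- n"] by (simp add: of_int_ring_neg minus_eq)

lemma of_int_ring_mult: "of_int_ring R (m * n) = of_int_ring R m \<otimes> of_int_ring R n"
proof (induction m rule: int_induct[where k = 0])
 case base show ?case by simp
next
 case (step1 i)
 then show ?case by (simp add: distrib_right of_int_ring_add l_distr)
next
 case (step2 i)
 then show ?case by (simp add: left_diff_distrib of_int_ring_diff minus_eq l_distr l_minus)
qed

end

lemma (in ring_hom_ring) hom_of_int_ring: "h (of_int_ring R n) = of_int_ring S n"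
proof (induction n rule: int_induct[where k = 0])
 case base show ?case by simp
next
 case (step1 i)
 then show ?case by (simp add: R.of_int_ring_add S.of_int_ring_add)
next
 case (step2 i)
 then show ?case by (simp add: R.of_int_ring_diff S.of_int_ring_diff R.minus_eq S.minus_eq)
qed

text \<open>\<open>kummer_class A C al\<close> says that \<open>al\<close> is the class of the image of a point of
 \<open>y^2 = x (x^2 + A x + C)\<close> under the descent map \<open>(x, y) \<mapsto> x\<close>, \<open>(0, 0) \<mapsto> C\<close>, \<open>\<infinity> \<mapsto> 1\<close>.\<close>

definition is_square :: "('a, 'm) ring_scheme => 'a => bool" where
 "is_square K z \<longleftrightarrow> (\<exists>w\<in>carrier K. z = w \<otimes>\<^bsub>K\<^esub> w)"

definition kummer_class :: "('a, 'm) ring_scheme => 'a => 'a => 'a => bool" where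
 "kummer_class K A C al \<longleftrightarrow> is_square K al \<or> is_square K (al \<otimes>\<^bsub>K\<^esub> C) \<or>
   (\<exists>x\<in>carrier K. \<exists>y\<in>carrier K. x ~= \<zero>\<^bsub>K\<^esub> &
    y \<otimes>\<^bsub>K\<^esub> y = x \<otimes>\<^bsub>K\<^esub> (x \<otimes>\<^bsub>K\<^esub> x \<oplus>\<^bsub>K\<^esub> A \<otimes>\<^bsub>K\<^esub> x \<oplus>\<^bsub>K\<^esub> C) & is_square K (al \<otimes>\<^bsub>K\<^esub> x))"

context field begin

lemma is_squareI: "w \<in> carrier R ==> z = w \<otimes> w ==> is_square R z"
 unfolding is_square_def by (rule bexI)

lemma is_square_mult:
 assumes "is_square R x" "is_square R y" shows "is_square R (x \<otimes> y)"
proof -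
 from assms obtain v w where vw: "v \<in> carrier R" "x = v \<otimes> v" "w \<in> carrier R" "y = w \<otimes> w"
  unfolding is_square_def by (elim bexE)
 show ?thesis by (rule is_squareI[of "v \<otimes> w"]) (use vw in \<open>simp_all add: m_ac\<close>)
qed

lemma inv_closed': "x \<in> carrier R ==> x ~= \<zero> ==> inv x \<in> carrier R"
 and inv_l: "x \<in> carrier R ==> x ~= \<zero> ==> inv x \<otimes> x = \<one>"
 and inv_r: "x \<in> carrier R ==> x ~= \<zero> ==> x \<otimes> inv x = \<one>"
 by (simp_all add: field_Units)

lemma inv_neq_zero: "x \<in> carrier R ==> x ~= \<zero> ==> inv x ~= \<zero>"
 using inv_l[of x] by auto

lemma is_square_cancel:
 assumes "is_square R (z \<otimes> (w \<otimes> w))" and c: "z \<in> carrier R" "w \<in> carrier R" and "w ~= \<zero>"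
 shows "is_square R z"
proof -
 from assms obtain v where v: "v \<in> carrier R" "z \<otimes> (w \<otimes> w) = v \<otimes> v"
  unfolding is_square_def by (elim bexE)
 let ?u = "inv w"
 have u: "?u \<in> carrier R" "w \<otimes> ?u = \<one>" using inv_closed' inv_r assms by auto
 have "z = z \<otimes> ((w \<otimes> ?u) \<otimes> (w \<otimes> ?u))" using u c by simp
 also have "\<dots> = z \<otimes> (w \<otimes> w) \<otimes> (?u \<otimes> ?u)" using u(1) c by (simp add: m_ac)
 also have "\<dots> = (v \<otimes> ?u) \<otimes> (v \<otimes> ?u)" unfolding v(2) using u(1) v(1) by (simp add: m_ac)
 finally show ?thesis using u(1) v(1) by (intro is_squareI[of "v \<otimes> ?u"]) auto
qed

lemma line_square_expand:
 assumes "m \<in> carrier R" "x \<in> carrier R" "k \<in> carrier R"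
 shows "(m \<otimes> x \<oplus> k) \<otimes> (m \<otimes> x \<oplus> k) = m \<otimes> m \<otimes> (x \<otimes> x) \<oplus> (m \<otimes> k \<oplus> m \<otimes> k) \<otimes> x \<oplus> k \<otimes> k"
 using assms by (simp add: l_distr r_distr m_ac a_ac)

text \<open>The line y = m x + k meets the cubic where x^3 + (A - m^2) x^2 + (C - 2 m k) x - k^2 =
  0. Hypothesis \<open>mm\<close> is the value of the sum of the roots, and the conclusion is this
  equation at \<open>x1\<close> with m^2 eliminated.\<close>

lemma chord_relation:
 assumes c: "x1 \<in> carrier R" "x2 \<in> carrier R" "m \<in> carrier R" "k \<in> carrier R" "A \<in> carrier R" "C \<in> carrier R"
  "x3 \<in> carrier R" and mm: "m \<otimes> m = x3 \<oplus> A \<oplus> (x1 \<oplus> x2)"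
  and cur: "(m \<otimes> x1 \<oplus> k) \<otimes> (m \<otimes> x1 \<oplus> k) = x1 \<otimes> (x1 \<otimes> x1 \<oplus> A \<otimes> x1 \<oplus> C)"
 shows "k \<otimes> k \<oplus> x1 \<otimes> x1 \<otimes> x3 = x1 \<otimes> (C \<ominus> (m \<otimes> k \<oplus> m \<otimes> k) \<ominus> x1 \<otimes> x2)"
proof -
 define D where "D = m \<otimes> k \<oplus> m \<otimes> k"
 have Dc: "D \<in> carrier R" unfolding D_def using c by simp
 have "(k \<otimes> k \<oplus> x1 \<otimes> x1 \<otimes> x3 \<oplus> x1 \<otimes> (D \<oplus> x1 \<otimes> x2)) \<oplus> (A \<otimes> x1 \<otimes> x1 \<oplus> x1 \<otimes> x1 \<otimes> x1)
   = (x3 \<oplus> A \<oplus> (x1 \<oplus> x2)) \<otimes> (x1 \<otimes> x1) \<oplus> D \<otimes> x1 \<oplus> k \<otimes> k"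
  using c Dc by (simp add: l_distr r_distr m_ac a_ac)
 also have "\<dots> = x1 \<otimes> (x1 \<otimes> x1 \<oplus> A \<otimes> x1 \<oplus> C)"
  using cur unfolding line_square_expand[OF c(3,1,4)] mm D_def .
 also have "\<dots> = x1 \<otimes> C \<oplus> (A \<otimes> x1 \<otimes> x1 \<oplus> x1 \<otimes> x1 \<otimes> x1)"
  using c by (simp add: l_distr r_distr m_ac a_ac)
 finally have eq: "k \<otimes> k \<oplus> x1 \<otimes> x1 \<otimes> x3 \<oplus> x1 \<otimes> (D \<oplus> x1 \<otimes> x2) = x1 \<otimes> C"
  using c Dc by simp
 have "x1 \<otimes> (C \<ominus> D \<ominus> x1 \<otimes> x2) = x1 \<otimes> C \<ominus> x1 \<otimes> (D \<oplus> x1 \<otimes> x2)"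
  using c Dc by (simp add: minus_eq r_distr r_minus minus_add a_ac)
 also have "\<dots> = k \<otimes> k \<oplus> x1 \<otimes> x1 \<otimes> x3"
  unfolding eq[symmetric] using c Dc by (simp add: minus_eq a_assoc r_neg)
 finally show ?thesis unfolding D_def by simp
qed

lemma eq_zero_minus: "x \<in> carrier R ==> x \<ominus> x = \<zero>" by (simp add: minus_eq r_neg)

text \<open>The product of the three abscissas on a line is minus the constant term of the cubic in
  x, here the square k^2; this is why the descent map is multiplicative. If \<open>x3\<close> is
  zero the third point is the origin, whose descent value is \<open>C\<close> and not its abscissa,
  hence the extra clause.\<close>

lemma third_point_on_line:
 assumes c: "x1 \<in> carrier R" "x2 \<in> carrier R" "y1 \<in> carrier R" "y2 \<in> carrier R" "A \<in> carrier R" "C \<in> carrier R"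
  and ne: "x1 ~= x2"
  and y1: "y1 \<otimes> y1 = x1 \<otimes> (x1 \<otimes> x1 \<oplus> A \<otimes> x1 \<oplus> C)"
  and y2: "y2 \<otimes> y2 = x2 \<otimes> (x2 \<otimes> x2 \<oplus> A \<otimes> x2 \<oplus> C)"
 shows "\<exists>x3\<in>carrier R. \<exists>y3\<in>carrier R. \<exists>k\<in>carrier R.
  y3 \<otimes> y3 = x3 \<otimes> (x3 \<otimes> x3 \<oplus> A \<otimes> x3 \<oplus> C) & x1 \<otimes> x2 \<otimes> x3 = k \<otimes> k & (x3 = \<zero> --> C = x1 \<otimes> x2)"
proof -
 have dc: "x1 \<ominus> x2 \<in> carrier R" and d0: "x1 \<ominus> x2 ~= \<zero>" using c ne r_right_minus_eq by auto
 define m where "m = (y1 \<ominus> y2) \<otimes> inv (x1 \<ominus> x2)"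
 have mc: "m \<in> carrier R" unfolding m_def using c inv_closed'[OF dc d0] by simp
 have "m \<otimes> (x1 \<ominus> x2) = (y1 \<ominus> y2) \<otimes> (inv (x1 \<ominus> x2) \<otimes> (x1 \<ominus> x2))"
  unfolding m_def using c dc inv_closed'[OF dc d0] by (simp only: m_assoc minus_closed)
 then have mm: "m \<otimes> (x1 \<ominus> x2) = y1 \<ominus> y2" using inv_l[OF dc d0] c by simp
 define k where "k = y1 \<ominus> m \<otimes> x1"
 have kc: "k \<in> carrier R" unfolding k_def using c mc by simp
 have e1: "m \<otimes> x1 \<oplus> k = y1" unfolding k_def using c mc by algebra
 have "m \<otimes> x2 \<oplus> k = y1 \<ominus> m \<otimes> (x1 \<ominus> x2)" unfolding k_def using c mc by algebra
 also have "\<dots> = y2" unfolding mm using c by algebra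
 finally have e2: "m \<otimes> x2 \<oplus> k = y2" .
 define x3 where "x3 = m \<otimes> m \<ominus> A \<ominus> x1 \<ominus> x2"
 have x3c: "x3 \<in> carrier R" unfolding x3_def using c mc by simp
 have mm3: "m \<otimes> m = x3 \<oplus> A \<oplus> (x1 \<oplus> x2)" unfolding x3_def using c mc by algebra
 then have mm3': "m \<otimes> m = x3 \<oplus> A \<oplus> (x2 \<oplus> x1)" using c by (simp add: a_comm)
 define D where "D = m \<otimes> k \<oplus> m \<otimes> k"
 have Dc: "D \<in> carrier R" unfolding D_def using mc kc by simp
 \<comment> \<open>By Vieta \<open>H\<close> should be (x1 + x2) x3, since C - 2 m k is the second
   symmetric function of the abscissas. This is obtained by subtracting \<open>H1\<close> and
   \<open>H2\<close> and cancelling x1 - x2.\<close>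
 define H where "H = C \<ominus> D \<ominus> x1 \<otimes> x2"
 have Hc: "H \<in> carrier R" unfolding H_def using c Dc by simp
 have CH: "C = H \<oplus> D \<oplus> x1 \<otimes> x2" unfolding H_def using c Dc by algebra
 have H1: "k \<otimes> k \<oplus> x1 \<otimes> x1 \<otimes> x3 = x1 \<otimes> H"
  unfolding H_def D_def using chord_relation[OF c(1,2) mc kc c(5,6) x3c mm3] e1 y1 by simp
 have H2: "k \<otimes> k \<oplus> x2 \<otimes> x2 \<otimes> x3 = x2 \<otimes> H"
  unfolding H_def D_def m_comm[OF c(1,2)] using chord_relation[OF c(2,1) mc kc c(5,6) x3c mm3'] e2 y2 by simp
 have "(x1 \<ominus> x2) \<otimes> (H \<ominus> (x1 \<oplus> x2) \<otimes> x3) = (x1 \<otimes> H \<ominus> x1 \<otimes> x1 \<otimes> x3) \<ominus> (x2 \<otimes> H \<ominus> x2 \<otimes> x2 \<otimes> x3)"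
  using c Hc x3c by algebra
 also have "\<dots> = k \<otimes> k \<ominus> k \<otimes> k" unfolding H1[symmetric] H2[symmetric] using kc c x3c by (simp add: minus_eq a_assoc r_neg)
 also have "\<dots> = \<zero>" using kc by (simp add: eq_zero_minus)
 finally have "H \<ominus> (x1 \<oplus> x2) \<otimes> x3 = \<zero>"
  using integral[OF _ dc, of "H \<ominus> (x1 \<oplus> x2) \<otimes> x3"] d0 c Hc x3c by simp
 then have H3: "H = (x1 \<oplus> x2) \<otimes> x3" using c Hc x3c by simp
 have "k \<otimes> k \<oplus> x1 \<otimes> x1 \<otimes> x3 = x1 \<otimes> x2 \<otimes> x3 \<oplus> x1 \<otimes> x1 \<otimes> x3"
  unfolding H1 H3 using c x3c by (simp add: l_distr r_distr m_ac a_ac)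
 then have kk: "x1 \<otimes> x2 \<otimes> x3 = k \<otimes> k" using c x3c kc by simp
 have cur: "(m \<otimes> x3 \<oplus> k) \<otimes> (m \<otimes> x3 \<oplus> k) = x3 \<otimes> (x3 \<otimes> x3 \<oplus> A \<otimes> x3 \<oplus> C)"
  unfolding line_square_expand[OF mc x3c kc] mm3 kk[symmetric] CH H3 D_def[symmetric]
  using c Dc x3c by (simp add: l_distr r_distr m_ac a_ac)
 have "C = x1 \<otimes> x2" if z: "x3 = \<zero>"
 proof -
  have "k \<otimes> k = \<zero>" using kk z c by simp
  then have "k = \<zero>" using kc by (simp add: integral_iff)
  then have "D = \<zero>" unfolding D_def using mc by simp
  moreover have "H = \<zero>" unfolding H3 z using c by simp
  ultimately show ?thesis using CH c by simp
 qed
 then show ?thesis using cur kk x3c kc mc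
  by (intro bexI[of _ x3] bexI[of _ "m \<otimes> x3 \<oplus> k"] bexI[of _ k] conjI impI) auto
qed

text \<open>Adding (0, 0) sends the abscissa x to C / x; the ordinate C y / x^2 is that of the sum
  up to sign.\<close>

lemma translate_by_origin:
 assumes c: "x \<in> carrier R" "y \<in> carrier R" "A \<in> carrier R" "C \<in> carrier R" and x: "x ~= \<zero>"
  and y: "y \<otimes> y = x \<otimes> (x \<otimes> x \<oplus> A \<otimes> x \<oplus> C)"
 shows "(C \<otimes> inv x \<otimes> inv x \<otimes> y) \<otimes> (C \<otimes> inv x \<otimes> inv x \<otimes> y) =
  (C \<otimes> inv x) \<otimes> ((C \<otimes> inv x) \<otimes> (C \<otimes> inv x) \<oplus> A \<otimes> (C \<otimes> inv x) \<oplus> C)"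
proof -
 let ?u = "inv x"
 have u: "?u \<in> carrier R" "x \<otimes> ?u = \<one>" using inv_closed' inv_r c x by auto
 have "(C \<otimes> ?u \<otimes> ?u \<otimes> y) \<otimes> (C \<otimes> ?u \<otimes> ?u \<otimes> y) = C \<otimes> C \<otimes> ?u \<otimes> ?u \<otimes> ?u \<otimes> ?u \<otimes> (y \<otimes> y)"
  using u(1) c by (simp add: m_ac)
 also have "\<dots> = C \<otimes> C \<otimes> ?u \<otimes> (x \<otimes> ?u) \<otimes> ((x \<otimes> ?u) \<otimes> (x \<otimes> ?u) \<oplus> A \<otimes> (x \<otimes> ?u) \<otimes> ?u \<oplus> C \<otimes> ?u \<otimes> ?u)"
  unfolding y using u(1) c by (simp add: m_ac r_distr l_distr a_ac)
 also have "\<dots> = (C \<otimes> ?u) \<otimes> ((C \<otimes> ?u) \<otimes> (C \<otimes> ?u) \<oplus> A \<otimes> (C \<otimes> ?u) \<oplus> C)"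
  unfolding u(2) using u(1) c by (simp add: m_ac r_distr l_distr a_ac)
 finally show ?thesis .
qed

text \<open>Squares are the image of infinity, the class of \<open>C\<close> is combined with a
  point by translation by the origin, and two points are joined by a chord. Two points over the same
  abscissa have a square as product of their classes, so tangents do not occur.\<close>

lemma kummer_class_mult:
 assumes al: "al \<in> carrier R" "al' \<in> carrier R" and AC: "A \<in> carrier R" "C \<in> carrier R" "C ~= \<zero>"
  and k: "kummer_class R A C al" and k': "kummer_class R A C al'"
 shows "kummer_class R A C (al \<otimes> al')"
proof -
 define cur where "cur x y \<longleftrightarrow> x \<in> carrier R & y \<in> carrier R & x ~= \<zero> & y \<otimes> y = x \<otimes> (x \<otimes> x \<oplus> A \<otimes> x \<oplus> C)" for x y
 have kc: "kummer_class R A C z \<longleftrightarrow> is_square R z \<or> is_square R (z \<otimes> C) \<or> (\<exists>x y. cur x y & is_square R (z \<otimes> x))" for z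
  unfolding kummer_class_def cur_def by blast
 have sq_left: "kummer_class R A C (u \<otimes> v)" if "is_square R u" "kummer_class R A C v" "u \<in> carrier R" "v \<in> carrier R" for u v
 proof -
  from that(2)[unfolded kc] consider "is_square R v" | "is_square R (v \<otimes> C)" | x y where "cur x y" "is_square R (v \<otimes> x)" by blast
  then show ?thesis
  proof cases
   case 1 then show ?thesis unfolding kc using is_square_mult that(1) by simp
  next
   case 2 then have "is_square R ((u \<otimes> v) \<otimes> C)" using is_square_mult[OF that(1) 2] that AC by (simp add: m_assoc)
   then show ?thesis unfolding kc by simp
  next
   case (3 x y) then have "is_square R ((u \<otimes> v) \<otimes> x)" using is_square_mult[OF that(1) 3(2)] that unfolding cur_def by (simp add: m_assoc)
   then show ?thesis unfolding kc using 3(1) by auto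
  qed
 qed
 have C_pt: "kummer_class R A C (u \<otimes> v)" if h: "is_square R (u \<otimes> C)" "cur x y" "is_square R (v \<otimes> x)" "u \<in> carrier R" "v \<in> carrier R" for u v x y
 proof -
  have x: "x \<in> carrier R" "y \<in> carrier R" "x ~= \<zero>" "y \<otimes> y = x \<otimes> (x \<otimes> x \<oplus> A \<otimes> x \<oplus> C)" using h(2) unfolding cur_def by auto
  let ?u = "inv x"
  have i: "?u \<in> carrier R" "?u \<otimes> x = \<one>" "?u ~= \<zero>" using inv_closed' inv_l inv_neq_zero x by auto
  have cur': "cur (C \<otimes> ?u) (C \<otimes> ?u \<otimes> ?u \<otimes> y)" unfolding cur_def
   using translate_by_origin[OF x(1,2) AC(1,2) x(3,4)] i x AC by (simp add: integral_iff)
  have "(u \<otimes> v \<otimes> (C \<otimes> ?u)) \<otimes> (x \<otimes> x) = (u \<otimes> C) \<otimes> (v \<otimes> x) \<otimes> (?u \<otimes> x)"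
   using i(1) x h AC by (simp add: m_ac)
  also have "\<dots> = (u \<otimes> C) \<otimes> (v \<otimes> x)" using i x h AC by simp
  finally have "is_square R ((u \<otimes> v \<otimes> (C \<otimes> ?u)) \<otimes> (x \<otimes> x))" using is_square_mult[OF h(1,3)] by simp
  then have "is_square R (u \<otimes> v \<otimes> (C \<otimes> ?u))" using is_square_cancel i x h AC by simp
  then show ?thesis unfolding kc using cur' by auto
 qed
 have CC: "kummer_class R A C (u \<otimes> v)" if h: "is_square R (u \<otimes> C)" "is_square R (v \<otimes> C)" "u \<in> carrier R" "v \<in> carrier R" for u v
 proof -
  have "(u \<otimes> v) \<otimes> (C \<otimes> C) = (u \<otimes> C) \<otimes> (v \<otimes> C)" using h AC by (simp add: m_ac)
  then have "is_square R ((u \<otimes> v) \<otimes> (C \<otimes> C))" using is_square_mult[OF h(1,2)] by simp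
  then show ?thesis unfolding kc using is_square_cancel h AC by simp
 qed
 have pt_pt: "kummer_class R A C (u \<otimes> v)" if h: "cur x y" "is_square R (u \<otimes> x)" "cur x' y'" "is_square R (v \<otimes> x')" "u \<in> carrier R" "v \<in> carrier R" for u v x y x' y'
 proof -
  have x: "x \<in> carrier R" "y \<in> carrier R" "x ~= \<zero>" "y \<otimes> y = x \<otimes> (x \<otimes> x \<oplus> A \<otimes> x \<oplus> C)" using h(1) unfolding cur_def by auto
  have x': "x' \<in> carrier R" "y' \<in> carrier R" "x' ~= \<zero>" "y' \<otimes> y' = x' \<otimes> (x' \<otimes> x' \<oplus> A \<otimes> x' \<oplus> C)" using h(3) unfolding cur_def by auto
  have sq: "is_square R ((u \<otimes> x) \<otimes> (v \<otimes> x'))" using is_square_mult[OF h(2,4)] .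
  show ?thesis
  proof (cases "x = x'")
   case True
   have "(u \<otimes> v) \<otimes> (x \<otimes> x) = (u \<otimes> x) \<otimes> (v \<otimes> x')" using True h(5,6) x(1) by (simp add: m_ac)
   then have "is_square R (u \<otimes> v)" using sq is_square_cancel[of "u \<otimes> v" x] h(5,6) x by simp
   then show ?thesis unfolding kc by simp
  next
   case False
   from third_point_on_line[OF x(1) x'(1) x(2) x'(2) AC(1,2) False x(4) x'(4)]
   obtain x3 y3 k where t: "x3 \<in> carrier R" "y3 \<in> carrier R" "k \<in> carrier R"
    "y3 \<otimes> y3 = x3 \<otimes> (x3 \<otimes> x3 \<oplus> A \<otimes> x3 \<oplus> C)" "x \<otimes> x' \<otimes> x3 = k \<otimes> k" "x3 = \<zero> --> C = x \<otimes> x'"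
    by (elim bexE conjE)
   show ?thesis
   proof (cases "x3 = \<zero>")
    case True
    have "(u \<otimes> v) \<otimes> C = (u \<otimes> x) \<otimes> (v \<otimes> x')" using t(6) True h(5,6) x(1) x'(1) by (simp add: m_ac)
    then show ?thesis unfolding kc using sq by simp
   next
    case False
    have "((u \<otimes> v) \<otimes> x3) \<otimes> ((x \<otimes> x') \<otimes> (x \<otimes> x')) = ((u \<otimes> x) \<otimes> (v \<otimes> x')) \<otimes> (x \<otimes> x' \<otimes> x3)"
     using t(1) h(5,6) x(1) x'(1) by (simp add: m_ac)
    moreover have "is_square R (((u \<otimes> x) \<otimes> (v \<otimes> x')) \<otimes> (x \<otimes> x' \<otimes> x3))"
     unfolding t(5) by (rule is_square_mult[OF sq is_squareI[OF t(3) refl]])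
    ultimately have "is_square R ((u \<otimes> v) \<otimes> x3)"
     using is_square_cancel[of "(u \<otimes> v) \<otimes> x3" "x \<otimes> x'"] t(1) h(5,6) x x' by (simp add: integral_iff)
    moreover have "cur x3 y3" unfolding cur_def using t False by simp
    ultimately show ?thesis unfolding kc by auto
   qed
  qed
 qed
 from k[unfolded kc] consider "is_square R al" | "is_square R (al \<otimes> C)" | x y where "cur x y" "is_square R (al \<otimes> x)" by blast
 note cs = this
 from k'[unfolded kc] consider "is_square R al'" | "is_square R (al' \<otimes> C)" | x y where "cur x y" "is_square R (al' \<otimes> x)" by blast
 note cs' = this
 have comm: "al \<otimes> al' = al' \<otimes> al" using al by (rule m_comm)
 from cs show ?thesis
 proof cases
  case 1 then show ?thesis using sq_left k' al by simp
 next
  case 2 note a = this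
  from cs' show ?thesis
  proof cases
   case 1 then show ?thesis unfolding comm using sq_left k al by simp
  next
   case 2 then show ?thesis using CC a al by simp
  next
   case (3 x y) then show ?thesis using C_pt[OF a 3] al by simp
  qed
 next
  case (3 x y) note a = this
  from cs' show ?thesis
  proof cases
   case 1 then show ?thesis unfolding comm using sq_left k al by simp
  next
   case 2 then show ?thesis unfolding comm using C_pt[OF 2 a] al by simp
  next
   case (3 x' y') then show ?thesis using pt_pt[OF a 3] al by simp
  qed
 qed
qed

end

section \<open>Galois cocycles and the descent map\<close>

lemma (in algebraic_closure) exists_sqrt:
 assumes z: "z \<in> carrier L"
 shows "\<exists>w\<in>carrier L. w \<otimes> w = z"
proof -
 let ?p = "[\<one>, \<zero>, \<ominus> z]"
 have "?p \<in> carrier (poly_ring L)"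
  unfolding univ_poly_carrier[symmetric] polynomial_def using z by simp
 then have "\<exists>w\<in>carrier L. eval ?p w = \<zero>" by (rule exists_root_of_poly) simp
 then obtain w where w: "w \<in> carrier L" "eval ?p w = \<zero>" by (elim bexE)
 have "w \<otimes> w \<oplus> \<ominus> z = \<zero>" using w z by (simp add: numeral_2_eq_2)
 then have "w \<otimes> w = z" using w(1) z by (simp flip: minus_eq)
 then show ?thesis using w(1) by (rule bexI)
qed

text \<open>\<open>L\<close> is any algebraic closure that contains a copy of \<open>K\<close>
  through \<iota>, since elements of \<open>K\<close> and of its closure have different types.
  Assumption \<open>two\<close> keeps the square roots s and -s apart.\<close>

locale kummer_setup = K: field K + L: algebraic_closure L "\<iota> ` carrier K" + hom: ring_hom_ring K L \<iota>
 for K :: "('k, 'm) ring_scheme" and L :: "('l, 'n) ring_scheme" and \<iota> +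
 assumes two: "\<one>\<^bsub>L\<^esub> \<oplus>\<^bsub>L\<^esub> \<one>\<^bsub>L\<^esub> ~= \<zero>\<^bsub>L\<^esub>"
begin

definition galois :: "('l => 'l) set" where
 "galois = {sig \<in> ring_iso L L. \<forall>x\<in>carrier K. sig (\<iota> x) = \<iota> x}"

lemma galois_hom: "sig \<in> galois ==> ring_hom_ring L L sig"
 unfolding galois_def ring_iso_def by (auto intro: ring_hom_ringI2 L.ring_axioms)

lemma galois_base: "sig \<in> galois ==> x \<in> carrier K ==> sig (\<iota> x) = \<iota> x"
 unfolding galois_def by simp

lemma galois_inv:
 assumes sig: "sig \<in> galois" and x: "x \<in> carrier L" "x ~= \<zero>\<^bsub>L\<^esub>"
 shows "sig (inv\<^bsub>L\<^esub> x) = inv\<^bsub>L\<^esub> (sig x)"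
proof -
 interpret S: ring_hom_ring L L sig by (rule galois_hom[OF sig])
 have "sig (inv\<^bsub>L\<^esub> x) \<otimes>\<^bsub>L\<^esub> sig x = \<one>\<^bsub>L\<^esub>"
  using S.hom_mult[of "inv\<^bsub>L\<^esub> x" x] L.inv_l[OF x] L.inv_closed'[OF x] x by simp
 moreover have "sig x \<in> carrier L" "sig (inv\<^bsub>L\<^esub> x) \<in> carrier L" using x L.inv_closed'[OF x] by auto
 ultimately show ?thesis by (metis L.comm_inv_char L.m_comm)
qed

lemma iota_inj: "x \<in> carrier K ==> y \<in> carrier K ==> \<iota> x = \<iota> y ==> x = y"
 using non_trivial_field_hom_is_inj[OF hom.homh K.field_axioms L.field_axioms] by (auto dest: inj_onD)

lemma fixed_square_root:
 assumes z: "z \<in> carrier L" "z \<otimes>\<^bsub>L\<^esub> z = \<iota> x" and x: "x \<in> carrier K"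
  and inv: "\<And>sig. sig \<in> galois ==> sig z = z"
 shows "is_square K x"
proof -
 have "z \<in> \<iota> ` carrier K"
 proof (rule L.fixed_sqrt_in_base[OF two z(1)])
  show "z \<otimes>\<^bsub>L\<^esub> z \<in> \<iota> ` carrier K" unfolding z(2) using x by (rule imageI)
  fix sig assume "sig \<in> ring_iso L L" "\<forall>k\<in>\<iota> ` carrier K. sig k = k"
  then show "sig z = z" by (intro inv) (simp add: galois_def)
 qed
 then obtain w where w: "w \<in> carrier K" "z = \<iota> w" by (elim imageE)
 have "\<iota> x = \<iota> (w \<otimes>\<^bsub>K\<^esub> w)" using z(2) w by simp
 then have "x = w \<otimes>\<^bsub>K\<^esub> w" using iota_inj[OF x] w(1) by simp
 then show ?thesis using w(1) by (intro K.is_squareI)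
qed

lemma galois_sqrt:
 assumes sig: "sig \<in> galois" and s: "s \<in> carrier L" "s \<otimes>\<^bsub>L\<^esub> s = \<iota> x" and x: "x \<in> carrier K"
 shows "sig s = s \<or> sig s = \<ominus>\<^bsub>L\<^esub> s"
proof -
 interpret S: ring_hom_ring L L sig by (rule galois_hom[OF sig])
 have sc: "sig s \<in> carrier L" using s by simp
 have "sig s \<otimes>\<^bsub>L\<^esub> sig s = s \<otimes>\<^bsub>L\<^esub> s" using S.hom_mult[OF s(1) s(1)] galois_base[OF sig x] s(2) by simp
 then have "(sig s \<ominus>\<^bsub>L\<^esub> s) \<otimes>\<^bsub>L\<^esub> (sig s \<oplus>\<^bsub>L\<^esub> s) = \<zero>\<^bsub>L\<^esub>"
  using sc s(1) by (simp add: L.minus_eq L.l_distr L.r_distr L.l_minus L.r_minus L.a_assoc L.m_comm L.r_neg2 L.r_neg)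
 then have "sig s \<ominus>\<^bsub>L\<^esub> s = \<zero>\<^bsub>L\<^esub> \<or> sig s \<oplus>\<^bsub>L\<^esub> s = \<zero>\<^bsub>L\<^esub>"
  using L.integral_iff sc s(1) by simp
 then show ?thesis using sc s(1) L.minus_equality by auto
qed

definition related :: "int => int => 'k point => 'k => bool" where
 "related a b P al \<longleftrightarrow> (\<exists>Q\<in>ell_points L a b. \<exists>s\<in>carrier L.
    ell_isog L b Q = map_point \<iota> P & s \<otimes>\<^bsub>L\<^esub> s = \<iota> al &
    (\<forall>sig\<in>galois. map_point sig Q = ell_add L a b Q (mu2_to_kernel L (sig s \<otimes>\<^bsub>L\<^esub> inv\<^bsub>L\<^esub> s))))"

lemma mu2_eq:
 assumes "s \<in> carrier L" "s ~= \<zero>\<^bsub>L\<^esub>" "t \<in> carrier L"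
 shows "mu2_to_kernel L (t \<otimes>\<^bsub>L\<^esub> inv\<^bsub>L\<^esub> s) = (if t = s then Infinity else Affine \<zero>\<^bsub>L\<^esub> \<zero>\<^bsub>L\<^esub>)"
proof -
 have "t = s" if "t \<otimes>\<^bsub>L\<^esub> inv\<^bsub>L\<^esub> s = \<one>\<^bsub>L\<^esub>"
 proof -
  have "t = t \<otimes>\<^bsub>L\<^esub> (inv\<^bsub>L\<^esub> s \<otimes>\<^bsub>L\<^esub> s)" using assms L.inv_l by simp
  also have "\<dots> = t \<otimes>\<^bsub>L\<^esub> inv\<^bsub>L\<^esub> s \<otimes>\<^bsub>L\<^esub> s" using assms L.inv_closed' by (simp add: L.m_assoc)
  finally show ?thesis using that assms by simp
 qed
 moreover have "s \<otimes>\<^bsub>L\<^esub> inv\<^bsub>L\<^esub> s = \<one>\<^bsub>L\<^esub>" using assms L.inv_r by simp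
 ultimately show ?thesis unfolding mu2_to_kernel_def by auto
qed

text \<open>Writing the ordinate as \<open>t\<close> times the abscissa makes \<open>t\<close> the
  slope of the chord to (0, 0), so no division remains in the sum.\<close>

lemma add_kernel_point:
 assumes c: "U \<in> carrier L" "t \<in> carrier L" and U: "U ~= \<zero>\<^bsub>L\<^esub>"
 shows "ell_add L a b (Affine U (t \<otimes>\<^bsub>L\<^esub> U)) (Affine \<zero>\<^bsub>L\<^esub> \<zero>\<^bsub>L\<^esub>) =
  (let U' = t \<otimes>\<^bsub>L\<^esub> t \<ominus>\<^bsub>L\<^esub> of_int_ring L a \<ominus>\<^bsub>L\<^esub> U in Affine U' (\<ominus>\<^bsub>L\<^esub> (t \<otimes>\<^bsub>L\<^esub> U')))"
proof -
 have nX: "\<ominus>\<^bsub>L\<^esub> U \<in> carrier L" "\<ominus>\<^bsub>L\<^esub> U ~= \<zero>\<^bsub>L\<^esub>" using c U by auto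
 have z: "\<zero>\<^bsub>L\<^esub> \<ominus>\<^bsub>L\<^esub> w = \<ominus>\<^bsub>L\<^esub> w" if "w \<in> carrier L" for w using that by (simp add: L.minus_eq)
 have "(\<zero>\<^bsub>L\<^esub> \<ominus>\<^bsub>L\<^esub> t \<otimes>\<^bsub>L\<^esub> U) \<otimes>\<^bsub>L\<^esub> inv\<^bsub>L\<^esub> (\<zero>\<^bsub>L\<^esub> \<ominus>\<^bsub>L\<^esub> U) = t \<otimes>\<^bsub>L\<^esub> (\<ominus>\<^bsub>L\<^esub> U) \<otimes>\<^bsub>L\<^esub> inv\<^bsub>L\<^esub> (\<ominus>\<^bsub>L\<^esub> U)"
  using c by (simp add: z L.r_minus)
 also have "\<dots> = t" using c nX L.inv_r[OF nX] L.inv_closed'[OF nX] by (simp only: L.m_assoc L.r_one)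
 finally have m: "(\<zero>\<^bsub>L\<^esub> \<ominus>\<^bsub>L\<^esub> t \<otimes>\<^bsub>L\<^esub> U) \<otimes>\<^bsub>L\<^esub> inv\<^bsub>L\<^esub> (\<zero>\<^bsub>L\<^esub> \<ominus>\<^bsub>L\<^esub> U) = t" .
 let ?U' = "t \<otimes>\<^bsub>L\<^esub> t \<ominus>\<^bsub>L\<^esub> of_int_ring L a \<ominus>\<^bsub>L\<^esub> U"
 have U'c: "?U' \<in> carrier L" using c by simp
 have x3: "?U' \<ominus>\<^bsub>L\<^esub> \<zero>\<^bsub>L\<^esub> = ?U'" using U'c by (simp add: L.minus_eq)
 have "t \<otimes>\<^bsub>L\<^esub> (U \<ominus>\<^bsub>L\<^esub> Y) \<ominus>\<^bsub>L\<^esub> t \<otimes>\<^bsub>L\<^esub> U = \<ominus>\<^bsub>L\<^esub> (t \<otimes>\<^bsub>L\<^esub> Y)" if "Y \<in> carrier L" for Y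
  using c that by algebra
 then show ?thesis using U U'c by (simp add: m x3 Let_def)
qed

text \<open>The slope t = Y / U is a square root of the abscissa of the image under the isogeny, and
  t^2 - a - U is the abscissa of the point translated by (0, 0); the two abscissas have product
  \<open>b\<close>.\<close>

lemma curve_point_param:
 assumes c: "U \<in> carrier L" "Y \<in> carrier L" and U: "U ~= \<zero>\<^bsub>L\<^esub>"
  and cur: "Y \<otimes>\<^bsub>L\<^esub> Y = U \<otimes>\<^bsub>L\<^esub> (U \<otimes>\<^bsub>L\<^esub> U \<oplus>\<^bsub>L\<^esub> of_int_ring L a \<otimes>\<^bsub>L\<^esub> U \<oplus>\<^bsub>L\<^esub> of_int_ring L b)"
 obtains t where "t \<in> carrier L" "Y = t \<otimes>\<^bsub>L\<^esub> U"
  "Y \<otimes>\<^bsub>L\<^esub> Y \<otimes>\<^bsub>L\<^esub> inv\<^bsub>L\<^esub> (U \<otimes>\<^bsub>L\<^esub> U) = t \<otimes>\<^bsub>L\<^esub> t"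
  "U \<otimes>\<^bsub>L\<^esub> (t \<otimes>\<^bsub>L\<^esub> t \<ominus>\<^bsub>L\<^esub> of_int_ring L a \<ominus>\<^bsub>L\<^esub> U) = of_int_ring L b"
proof -
 define t where "t = Y \<otimes>\<^bsub>L\<^esub> inv\<^bsub>L\<^esub> U"
 have i: "inv\<^bsub>L\<^esub> U \<in> carrier L" "inv\<^bsub>L\<^esub> U \<otimes>\<^bsub>L\<^esub> U = \<one>\<^bsub>L\<^esub>" using L.inv_closed' L.inv_l c U by auto
 have tc: "t \<in> carrier L" unfolding t_def using c i by simp
 have Y: "Y = t \<otimes>\<^bsub>L\<^esub> U" unfolding t_def using c i by (simp add: L.m_assoc)
 have XX: "U \<otimes>\<^bsub>L\<^esub> U \<in> carrier L" "U \<otimes>\<^bsub>L\<^esub> U ~= \<zero>\<^bsub>L\<^esub>" using c U by (auto simp: L.integral_iff)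
 have "Y \<otimes>\<^bsub>L\<^esub> Y \<otimes>\<^bsub>L\<^esub> inv\<^bsub>L\<^esub> (U \<otimes>\<^bsub>L\<^esub> U) = (t \<otimes>\<^bsub>L\<^esub> t) \<otimes>\<^bsub>L\<^esub> ((U \<otimes>\<^bsub>L\<^esub> U) \<otimes>\<^bsub>L\<^esub> inv\<^bsub>L\<^esub> (U \<otimes>\<^bsub>L\<^esub> U))"
  unfolding Y using tc c L.inv_closed'[OF XX] by (simp add: L.m_ac)
 then have sq: "Y \<otimes>\<^bsub>L\<^esub> Y \<otimes>\<^bsub>L\<^esub> inv\<^bsub>L\<^esub> (U \<otimes>\<^bsub>L\<^esub> U) = t \<otimes>\<^bsub>L\<^esub> t" using L.inv_r[OF XX] tc by simp
 let ?S = "U \<otimes>\<^bsub>L\<^esub> U \<oplus>\<^bsub>L\<^esub> of_int_ring L a \<otimes>\<^bsub>L\<^esub> U \<oplus>\<^bsub>L\<^esub> of_int_ring L b"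
 have "U \<otimes>\<^bsub>L\<^esub> (t \<otimes>\<^bsub>L\<^esub> t \<otimes>\<^bsub>L\<^esub> U) = U \<otimes>\<^bsub>L\<^esub> ?S" using cur unfolding Y using tc c by (simp add: L.m_ac)
 then have S: "t \<otimes>\<^bsub>L\<^esub> t \<otimes>\<^bsub>L\<^esub> U = ?S" using L.m_lcancel[OF U c(1)] tc c by simp
 have "U \<otimes>\<^bsub>L\<^esub> (t \<otimes>\<^bsub>L\<^esub> t \<ominus>\<^bsub>L\<^esub> of_int_ring L a \<ominus>\<^bsub>L\<^esub> U) = t \<otimes>\<^bsub>L\<^esub> t \<otimes>\<^bsub>L\<^esub> U \<ominus>\<^bsub>L\<^esub> of_int_ring L a \<otimes>\<^bsub>L\<^esub> U \<ominus>\<^bsub>L\<^esub> U \<otimes>\<^bsub>L\<^esub> U"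
  using tc c L.of_int_ring_closed[of a] by algebra
 also have "\<dots> = of_int_ring L b" unfolding S using c L.of_int_ring_closed[of a] L.of_int_ring_closed[of b] by algebra
 finally show thesis using that tc Y sq by blast
qed

lemma galois_split:
 assumes s: "s \<in> carrier L" "s ~= \<zero>\<^bsub>L\<^esub>" "s \<otimes>\<^bsub>L\<^esub> s = \<iota> al" and al: "al \<in> carrier K" and sig: "sig \<in> galois"
 obtains "sig s = s" | "sig s ~= s" "sig s = \<ominus>\<^bsub>L\<^esub> s"
proof (cases "sig s = s")
 case False then show thesis using galois_sqrt[OF sig s(1,3) al] that(2) by simp
qed (rule that)

text \<open>An automorphism that negates s moves Q to Q + (0, 0), hence negates the slope t; one
  that fixes s fixes Q and t. So s t is invariant, and its square is \<open>al\<close> times the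
  abscissa of \<open>P\<close>.\<close>

lemma related_imp_kummer_class:
 assumes ab: "of_int_ring L b ~= \<zero>\<^bsub>L\<^esub>"
  and P: "P \<in> ell_points K (- 2 * a) (a\<^sup>2 - 4 * b)" and al: "al \<in> carrier K" "al ~= \<zero>\<^bsub>K\<^esub>"
  and rel: "related a b P al"
 shows "kummer_class K (of_int_ring K (- 2 * a)) (of_int_ring K (a\<^sup>2 - 4 * b)) al"
proof -
 from rel obtain Q s where Q: "Q \<in> ell_points L a b" and s: "s \<in> carrier L" "s \<otimes>\<^bsub>L\<^esub> s = \<iota> al"
  and isog: "ell_isog L b Q = map_point \<iota> P"
  and gal: "\<forall>sig\<in>galois. map_point sig Q = ell_add L a b Q (mu2_to_kernel L (sig s \<otimes>\<^bsub>L\<^esub> inv\<^bsub>L\<^esub> s))"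
  unfolding related_def by blast
 have \<iota>al: "\<iota> al ~= \<zero>\<^bsub>L\<^esub>" using iota_inj[of al "\<zero>\<^bsub>K\<^esub>"] al by auto
 have s0: "s ~= \<zero>\<^bsub>L\<^esub>" using s \<iota>al by auto
 have act: "map_point sig Q = ell_add L a b Q (if sig s = s then Infinity else Affine \<zero>\<^bsub>L\<^esub> \<zero>\<^bsub>L\<^esub>)" if "sig \<in> galois" for sig
 proof -
  interpret S: ring_hom_ring L L sig by (rule galois_hom[OF that])
  show ?thesis using gal that mu2_eq[OF s(1) s0, of "sig s"] s(1) by simp
 qed
 show ?thesis
 proof (cases P)
  case Infinity
  have Qc: "Q = Infinity \<or> Q = Affine \<zero>\<^bsub>L\<^esub> \<zero>\<^bsub>L\<^esub>"
   using isog Q unfolding Infinity ell_points_def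
   by (cases Q) (auto simp: Let_def L.integral_iff split: if_splits)
  have "sig s = s" if sig: "sig \<in> galois" for sig
  proof (rule ccontr)
   interpret S: ring_hom_ring L L sig by (rule galois_hom[OF sig])
   assume "sig s ~= s"
   then have "map_point sig Q = ell_add L a b Q (Affine \<zero>\<^bsub>L\<^esub> \<zero>\<^bsub>L\<^esub>)" using act[OF sig] by simp
   then show False using Qc by auto
  qed
  then have "is_square K al" using fixed_square_root[OF s al(1)] by simp
  then show ?thesis unfolding kummer_class_def by simp
 next
  case (Affine x y)
  have xy: "x \<in> carrier K" "y \<in> carrier K" "y \<otimes>\<^bsub>K\<^esub> y = x \<otimes>\<^bsub>K\<^esub> (x \<otimes>\<^bsub>K\<^esub> x \<oplus>\<^bsub>K\<^esub> of_int_ring K (- 2 * a) \<otimes>\<^bsub>K\<^esub> x \<oplus>\<^bsub>K\<^esub> of_int_ring K (a\<^sup>2 - 4 * b))"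
   using P unfolding Affine ell_points_def by auto
  obtain U Y where XY: "Q = Affine U Y" "U ~= \<zero>\<^bsub>L\<^esub>" "Y \<otimes>\<^bsub>L\<^esub> Y \<otimes>\<^bsub>L\<^esub> inv\<^bsub>L\<^esub> (U \<otimes>\<^bsub>L\<^esub> U) = \<iota> x"
   using isog unfolding Affine by (cases Q) (auto simp: Let_def split: if_splits)
  have c: "U \<in> carrier L" "Y \<in> carrier L"
   and cur: "Y \<otimes>\<^bsub>L\<^esub> Y = U \<otimes>\<^bsub>L\<^esub> (U \<otimes>\<^bsub>L\<^esub> U \<oplus>\<^bsub>L\<^esub> of_int_ring L a \<otimes>\<^bsub>L\<^esub> U \<oplus>\<^bsub>L\<^esub> of_int_ring L b)"
   using Q unfolding XY(1) ell_points_def by auto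
  obtain t where t: "t \<in> carrier L" "Y = t \<otimes>\<^bsub>L\<^esub> U" "t \<otimes>\<^bsub>L\<^esub> t = \<iota> x"
   "U \<otimes>\<^bsub>L\<^esub> (t \<otimes>\<^bsub>L\<^esub> t \<ominus>\<^bsub>L\<^esub> of_int_ring L a \<ominus>\<^bsub>L\<^esub> U) = of_int_ring L b"
   using curve_point_param[OF c XY(2) cur] XY(3) by metis
  define U' where "U' = t \<otimes>\<^bsub>L\<^esub> t \<ominus>\<^bsub>L\<^esub> of_int_ring L a \<ominus>\<^bsub>L\<^esub> U"
  have U'c: "U' \<in> carrier L" unfolding U'_def using c t(1) by simp
  have U'0: "U' ~= \<zero>\<^bsub>L\<^esub>" using t(4) ab c unfolding U'_def[symmetric] by auto
  have actXt: "(sig s = s & sig U = U & sig t = t) \<or> (sig s = \<ominus>\<^bsub>L\<^esub> s & sig U = U' & sig t = \<ominus>\<^bsub>L\<^esub> t)" if sig: "sig \<in> galois" for sig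
  proof -
   interpret S: ring_hom_ring L L sig by (rule galois_hom[OF sig])
   have sigt: "sig t \<in> carrier L" using t by simp
   from s(1) s0 s(2) al(1) sig show ?thesis
   proof (cases rule: galois_split)
    case 1
    then have h: "sig U = U" "sig Y = Y" using act[OF sig] unfolding XY(1) by auto
    have "sig t \<otimes>\<^bsub>L\<^esub> U = t \<otimes>\<^bsub>L\<^esub> U" using h(2) S.hom_mult[OF t(1) c(1)] unfolding t(2) h(1) by simp
    then have "sig t = t" using L.m_rcancel[OF XY(2) c(1)] sigt t(1) by simp
    then show ?thesis using 1 h by simp
   next
    case 2
    then have "map_point sig Q = ell_add L a b (Affine U (t \<otimes>\<^bsub>L\<^esub> U)) (Affine \<zero>\<^bsub>L\<^esub> \<zero>\<^bsub>L\<^esub>)"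
     using act[OF sig] unfolding XY(1) t(2) by simp
    then have h: "sig U = U'" "sig Y = \<ominus>\<^bsub>L\<^esub> (t \<otimes>\<^bsub>L\<^esub> U')"
     unfolding add_kernel_point[OF c(1) t(1) XY(2)] Let_def U'_def[symmetric] XY(1) by auto
    have "sig t \<otimes>\<^bsub>L\<^esub> U' = (\<ominus>\<^bsub>L\<^esub> t) \<otimes>\<^bsub>L\<^esub> U'"
     using h(2) S.hom_mult[OF t(1) c(1)] U'c t(1) unfolding t(2) h(1) by (simp add: L.l_minus)
    then have "sig t = \<ominus>\<^bsub>L\<^esub> t" using L.m_rcancel[OF U'0 U'c] sigt t(1) by simp
    then show ?thesis using 2 h by simp
   qed
  qed
  show ?thesis
  proof (cases "x = \<zero>\<^bsub>K\<^esub>")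
   case False
   have "is_square K (al \<otimes>\<^bsub>K\<^esub> x)"
   proof (rule fixed_square_root[of "s \<otimes>\<^bsub>L\<^esub> t"])
    show "s \<otimes>\<^bsub>L\<^esub> t \<in> carrier L" using s t by simp
    have "s \<otimes>\<^bsub>L\<^esub> t \<otimes>\<^bsub>L\<^esub> (s \<otimes>\<^bsub>L\<^esub> t) = (s \<otimes>\<^bsub>L\<^esub> s) \<otimes>\<^bsub>L\<^esub> (t \<otimes>\<^bsub>L\<^esub> t)" using s(1) t(1) by (simp add: L.m_ac)
    then show "s \<otimes>\<^bsub>L\<^esub> t \<otimes>\<^bsub>L\<^esub> (s \<otimes>\<^bsub>L\<^esub> t) = \<iota> (al \<otimes>\<^bsub>K\<^esub> x)" using s(2) t(3) al xy by simp
    show "al \<otimes>\<^bsub>K\<^esub> x \<in> carrier K" using al xy by simp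
    fix sig assume sig: "sig \<in> galois"
    interpret S: ring_hom_ring L L sig by (rule galois_hom[OF sig])
    show "sig (s \<otimes>\<^bsub>L\<^esub> t) = s \<otimes>\<^bsub>L\<^esub> t" using actXt[OF sig] s(1) t(1) by (auto simp: L.l_minus L.r_minus)
   qed
   then show ?thesis unfolding kummer_class_def using xy False by blast
  next
   case True
   have t0: "t = \<zero>\<^bsub>L\<^esub>" using t(1,3) unfolding True by (simp add: L.integral_iff)
   have XX: "U \<oplus>\<^bsub>L\<^esub> U' = \<ominus>\<^bsub>L\<^esub> of_int_ring L a" unfolding U'_def t0 using c L.of_int_ring_closed[of a] by algebra
   have prod: "U \<otimes>\<^bsub>L\<^esub> U' = of_int_ring L b" using t(4) unfolding U'_def .
   \<comment> \<open>For P = (0, 0) the slope t vanishes and carries no sign. The difference of the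
     two abscissas above P replaces it: it changes sign together with s, and its square is the
     discriminant a^2 - 4 b.\<close>
   define del0 where "del0 = U \<ominus>\<^bsub>L\<^esub> U'"
   have del0c: "del0 \<in> carrier L" unfolding del0_def using c U'c by simp
   have "del0 \<otimes>\<^bsub>L\<^esub> del0 = (U \<oplus>\<^bsub>L\<^esub> U') \<otimes>\<^bsub>L\<^esub> (U \<oplus>\<^bsub>L\<^esub> U') \<ominus>\<^bsub>L\<^esub> (U \<otimes>\<^bsub>L\<^esub> U' \<oplus>\<^bsub>L\<^esub> U \<otimes>\<^bsub>L\<^esub> U' \<oplus>\<^bsub>L\<^esub> U \<otimes>\<^bsub>L\<^esub> U' \<oplus>\<^bsub>L\<^esub> U \<otimes>\<^bsub>L\<^esub> U')"
    unfolding del0_def using c(1) U'c by algebra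
   also have "\<dots> = of_int_ring L (a * a - (b + b + b + b))"
    unfolding XX prod L.of_int_ring_diff L.of_int_ring_mult L.of_int_ring_add by (simp add: L.l_minus L.r_minus)
   also have "a * a - (b + b + b + b) = a^2 - 4 * b" by (simp add: power2_eq_square)
   finally have del02: "del0 \<otimes>\<^bsub>L\<^esub> del0 = \<iota> (of_int_ring K (a^2 - 4 * b))" by (simp add: hom.hom_of_int_ring)
   have "is_square K (al \<otimes>\<^bsub>K\<^esub> of_int_ring K (a^2 - 4 * b))"
   proof (rule fixed_square_root[of "s \<otimes>\<^bsub>L\<^esub> del0"])
    show "s \<otimes>\<^bsub>L\<^esub> del0 \<in> carrier L" using s del0c by simp
    have "s \<otimes>\<^bsub>L\<^esub> del0 \<otimes>\<^bsub>L\<^esub> (s \<otimes>\<^bsub>L\<^esub> del0) = (s \<otimes>\<^bsub>L\<^esub> s) \<otimes>\<^bsub>L\<^esub> (del0 \<otimes>\<^bsub>L\<^esub> del0)" using s(1) del0c by (simp add: L.m_ac)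
    then show "s \<otimes>\<^bsub>L\<^esub> del0 \<otimes>\<^bsub>L\<^esub> (s \<otimes>\<^bsub>L\<^esub> del0) = \<iota> (al \<otimes>\<^bsub>K\<^esub> of_int_ring K (a^2 - 4 * b))" using s(2) del02 al by simp
    show "al \<otimes>\<^bsub>K\<^esub> of_int_ring K (a^2 - 4 * b) \<in> carrier K" using al by simp
    fix sig assume sig: "sig \<in> galois"
    interpret S: ring_hom_ring L L sig by (rule galois_hom[OF sig])
    have "sig (U \<oplus>\<^bsub>L\<^esub> U') = U \<oplus>\<^bsub>L\<^esub> U'" unfolding XX using S.hom_of_int_ring by simp
    then have sum: "sig U \<oplus>\<^bsub>L\<^esub> sig U' = U \<oplus>\<^bsub>L\<^esub> U'" using c U'c by simp
    have sigU': "sig U' \<in> carrier L" using U'c by simp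
    have "sig del0 = del0" if "sig U = U" using sum that c U'c sigU' unfolding del0_def by (simp add: L.minus_eq)
    moreover have "sig del0 = \<ominus>\<^bsub>L\<^esub> del0" if h: "sig U = U'"
    proof -
     have "U' \<oplus>\<^bsub>L\<^esub> sig U' = U' \<oplus>\<^bsub>L\<^esub> U" using sum h c U'c by (simp add: L.a_comm)
     then have "sig U' = U" using c U'c sigU' by simp
     then have "sig del0 = U' \<ominus>\<^bsub>L\<^esub> U" unfolding del0_def using h c U'c by (simp add: L.minus_eq)
     then show ?thesis unfolding del0_def using c(1) U'c by (simp add: L.minus_eq L.minus_add L.a_comm)
    qed
    ultimately show "sig (s \<otimes>\<^bsub>L\<^esub> del0) = s \<otimes>\<^bsub>L\<^esub> del0" using actXt[OF sig] s(1) del0c by (auto simp: L.l_minus L.r_minus)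
   qed
   then show ?thesis unfolding kummer_class_def by simp
  qed
 qed
qed

text \<open>The preimage Q is rebuilt from its invariants: the abscissas U and V of the two points
  above (x, y) have sum x - a and product b, so they are half of x - a minus or plus
  \<open>del0\<close>, which is V - U. The image under the isogeny has ordinate t (V - U), whence
  the condition that t times \<open>del0\<close> is y.\<close>

lemma relatedI:
 assumes P: "x \<in> carrier K" "y \<in> carrier K" and b: "of_int_ring L b ~= \<zero>\<^bsub>L\<^esub>"
  and c: "t \<in> carrier L" "del0 \<in> carrier L" "s \<in> carrier L" and s: "s ~= \<zero>\<^bsub>L\<^esub>" "s \<otimes>\<^bsub>L\<^esub> s = \<iota> al"
  and al: "al \<in> carrier K"
  and t: "t \<otimes>\<^bsub>L\<^esub> t = \<iota> x" "t \<otimes>\<^bsub>L\<^esub> del0 = \<iota> y"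
  and del0: "del0 \<otimes>\<^bsub>L\<^esub> del0 = (\<iota> x \<ominus>\<^bsub>L\<^esub> of_int_ring L a) \<otimes>\<^bsub>L\<^esub> (\<iota> x \<ominus>\<^bsub>L\<^esub> of_int_ring L a) \<ominus>\<^bsub>L\<^esub> of_int_ring L 4 \<otimes>\<^bsub>L\<^esub> of_int_ring L b"
  and act: "\<And>sig. sig \<in> galois ==> (sig s = s & sig t = t & sig del0 = del0) \<or>
   (sig s ~= s & sig t = \<ominus>\<^bsub>L\<^esub> t & sig del0 = \<ominus>\<^bsub>L\<^esub> del0)"
 shows "related a b (Affine x y) al"
proof -
 let ?a = "of_int_ring L a" let ?b = "of_int_ring L b"
 define h where "h = inv\<^bsub>L\<^esub> (\<one>\<^bsub>L\<^esub> \<oplus>\<^bsub>L\<^esub> \<one>\<^bsub>L\<^esub>)"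
 have h: "h \<in> carrier L" "h \<otimes>\<^bsub>L\<^esub> (\<one>\<^bsub>L\<^esub> \<oplus>\<^bsub>L\<^esub> \<one>\<^bsub>L\<^esub>) = \<one>\<^bsub>L\<^esub>"
  unfolding h_def using L.inv_closed'[OF _ two] L.inv_l[OF _ two] by auto
 have hh: "h \<oplus>\<^bsub>L\<^esub> h = \<one>\<^bsub>L\<^esub>" using h by (simp add: L.r_distr)
 have ix: "\<iota> x \<in> carrier L" using P by simp
 define w where "w = \<iota> x \<ominus>\<^bsub>L\<^esub> ?a"
 have wc: "w \<in> carrier L" unfolding w_def using ix by simp
 define U where "U = h \<otimes>\<^bsub>L\<^esub> (w \<ominus>\<^bsub>L\<^esub> del0)"
 define V where "V = h \<otimes>\<^bsub>L\<^esub> (w \<oplus>\<^bsub>L\<^esub> del0)"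
 have Uc: "U \<in> carrier L" and Vc: "V \<in> carrier L" unfolding U_def V_def using wc h c by auto
 have sum: "U \<oplus>\<^bsub>L\<^esub> V = w"
 proof -
  have "U \<oplus>\<^bsub>L\<^esub> V = (h \<oplus>\<^bsub>L\<^esub> h) \<otimes>\<^bsub>L\<^esub> w" unfolding U_def V_def using wc h(1) c(2) by algebra
  then show ?thesis using hh wc by simp
 qed
 have dif: "V \<ominus>\<^bsub>L\<^esub> U = del0"
 proof -
  have "V \<ominus>\<^bsub>L\<^esub> U = (h \<oplus>\<^bsub>L\<^esub> h) \<otimes>\<^bsub>L\<^esub> del0" unfolding U_def V_def using wc h(1) c(2) by algebra
  then show ?thesis using hh c by simp
 qed
 have four: "of_int_ring L 4 = (\<one>\<^bsub>L\<^esub> \<oplus>\<^bsub>L\<^esub> \<one>\<^bsub>L\<^esub>) \<otimes>\<^bsub>L\<^esub> (\<one>\<^bsub>L\<^esub> \<oplus>\<^bsub>L\<^esub> \<one>\<^bsub>L\<^esub>)"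
  using L.of_int_ring_mult[of "1 + 1" "1 + 1"] L.of_int_ring_add[of 1 1] by simp
 have prod: "U \<otimes>\<^bsub>L\<^esub> V = ?b"
 proof -
  have "U \<otimes>\<^bsub>L\<^esub> V = (h \<otimes>\<^bsub>L\<^esub> h) \<otimes>\<^bsub>L\<^esub> (w \<otimes>\<^bsub>L\<^esub> w \<ominus>\<^bsub>L\<^esub> del0 \<otimes>\<^bsub>L\<^esub> del0)" unfolding U_def V_def using wc h(1) c(2) by algebra
  also have "w \<otimes>\<^bsub>L\<^esub> w \<ominus>\<^bsub>L\<^esub> del0 \<otimes>\<^bsub>L\<^esub> del0 = of_int_ring L 4 \<otimes>\<^bsub>L\<^esub> ?b"
   unfolding del0 w_def[symmetric] using wc L.of_int_ring_closed[of 4] L.of_int_ring_closed[of b] by algebra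
  also have "(h \<otimes>\<^bsub>L\<^esub> h) \<otimes>\<^bsub>L\<^esub> (of_int_ring L 4 \<otimes>\<^bsub>L\<^esub> ?b) = (h \<otimes>\<^bsub>L\<^esub> (\<one>\<^bsub>L\<^esub> \<oplus>\<^bsub>L\<^esub> \<one>\<^bsub>L\<^esub>)) \<otimes>\<^bsub>L\<^esub> (h \<otimes>\<^bsub>L\<^esub> (\<one>\<^bsub>L\<^esub> \<oplus>\<^bsub>L\<^esub> \<one>\<^bsub>L\<^esub>)) \<otimes>\<^bsub>L\<^esub> ?b"
   unfolding four using h(1) by (simp add: L.m_ac)
  finally show ?thesis unfolding h(2) by simp
 qed
 have U0: "U ~= \<zero>\<^bsub>L\<^esub>" using prod b Vc by auto
 let ?Q = "Affine U (t \<otimes>\<^bsub>L\<^esub> U)"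
 have V_eq: "t \<otimes>\<^bsub>L\<^esub> t \<ominus>\<^bsub>L\<^esub> ?a \<ominus>\<^bsub>L\<^esub> U = V"
  unfolding t(1) w_def[symmetric] sum[symmetric] using Uc Vc by algebra
 have tU: "t \<otimes>\<^bsub>L\<^esub> t = U \<oplus>\<^bsub>L\<^esub> V \<oplus>\<^bsub>L\<^esub> ?a"
  unfolding sum w_def t(1) using ix L.of_int_ring_closed[of a] by algebra
 have "(t \<otimes>\<^bsub>L\<^esub> U) \<otimes>\<^bsub>L\<^esub> (t \<otimes>\<^bsub>L\<^esub> U) = (t \<otimes>\<^bsub>L\<^esub> t) \<otimes>\<^bsub>L\<^esub> (U \<otimes>\<^bsub>L\<^esub> U)" using c Uc by (simp add: L.m_ac)
 also have "\<dots> = U \<otimes>\<^bsub>L\<^esub> (U \<otimes>\<^bsub>L\<^esub> U \<oplus>\<^bsub>L\<^esub> ?a \<otimes>\<^bsub>L\<^esub> U \<oplus>\<^bsub>L\<^esub> U \<otimes>\<^bsub>L\<^esub> V)"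
  unfolding tU using Uc Vc by (simp add: L.m_ac L.a_ac L.l_distr L.r_distr)
 finally have Q: "?Q \<in> ell_points L a b" unfolding ell_points_def prod using Uc c by auto
 have UU: "U \<otimes>\<^bsub>L\<^esub> U \<in> carrier L" "U \<otimes>\<^bsub>L\<^esub> U ~= \<zero>\<^bsub>L\<^esub>" using Uc U0 by (auto simp: L.integral_iff)
 note UUi = L.inv_closed'[OF UU] L.inv_r[OF UU]
 have i1: "(t \<otimes>\<^bsub>L\<^esub> U) \<otimes>\<^bsub>L\<^esub> (t \<otimes>\<^bsub>L\<^esub> U) \<otimes>\<^bsub>L\<^esub> inv\<^bsub>L\<^esub> (U \<otimes>\<^bsub>L\<^esub> U) = \<iota> x"
 proof -
  have "(t \<otimes>\<^bsub>L\<^esub> U) \<otimes>\<^bsub>L\<^esub> (t \<otimes>\<^bsub>L\<^esub> U) \<otimes>\<^bsub>L\<^esub> inv\<^bsub>L\<^esub> (U \<otimes>\<^bsub>L\<^esub> U) = (t \<otimes>\<^bsub>L\<^esub> t) \<otimes>\<^bsub>L\<^esub> (U \<otimes>\<^bsub>L\<^esub> U \<otimes>\<^bsub>L\<^esub> inv\<^bsub>L\<^esub> (U \<otimes>\<^bsub>L\<^esub> U))"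
   using c Uc UUi(1) by (simp add: L.m_ac)
  then show ?thesis using UUi(2) t(1) ix by simp
 qed
 have i2: "(t \<otimes>\<^bsub>L\<^esub> U) \<otimes>\<^bsub>L\<^esub> (?b \<ominus>\<^bsub>L\<^esub> U \<otimes>\<^bsub>L\<^esub> U) \<otimes>\<^bsub>L\<^esub> inv\<^bsub>L\<^esub> (U \<otimes>\<^bsub>L\<^esub> U) = \<iota> y"
 proof -
  have "?b \<ominus>\<^bsub>L\<^esub> U \<otimes>\<^bsub>L\<^esub> U = U \<otimes>\<^bsub>L\<^esub> (V \<ominus>\<^bsub>L\<^esub> U)" unfolding prod[symmetric] using Uc Vc by algebra
  then have "(t \<otimes>\<^bsub>L\<^esub> U) \<otimes>\<^bsub>L\<^esub> (?b \<ominus>\<^bsub>L\<^esub> U \<otimes>\<^bsub>L\<^esub> U) \<otimes>\<^bsub>L\<^esub> inv\<^bsub>L\<^esub> (U \<otimes>\<^bsub>L\<^esub> U) = (t \<otimes>\<^bsub>L\<^esub> del0) \<otimes>\<^bsub>L\<^esub> (U \<otimes>\<^bsub>L\<^esub> U \<otimes>\<^bsub>L\<^esub> inv\<^bsub>L\<^esub> (U \<otimes>\<^bsub>L\<^esub> U))"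
   unfolding dif using c Uc UUi(1) by (simp add: L.m_ac)
  then show ?thesis using UUi(2) t(2) P by simp
 qed
 have iso: "ell_isog L b ?Q = map_point \<iota> (Affine x y)" using U0 i1 i2 by (simp add: Let_def)
 have gal: "map_point sig ?Q = ell_add L a b ?Q (mu2_to_kernel L (sig s \<otimes>\<^bsub>L\<^esub> inv\<^bsub>L\<^esub> s))" if sig: "sig \<in> galois" for sig
 proof -
  interpret S: ring_hom_ring L L sig by (rule galois_hom[OF sig])
  have "sig (\<one>\<^bsub>L\<^esub> \<oplus>\<^bsub>L\<^esub> \<one>\<^bsub>L\<^esub>) = \<one>\<^bsub>L\<^esub> \<oplus>\<^bsub>L\<^esub> \<one>\<^bsub>L\<^esub>" by simp
  then have sigh: "sig h = h" unfolding h_def using galois_inv[OF sig _ two] by simp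
  have sigw: "sig w = w" unfolding w_def using galois_base[OF sig P(1)] S.hom_of_int_ring ix by (simp add: L.minus_eq)
  have sc: "sig s \<in> carrier L" using c by simp
  from act[OF sig] show ?thesis
  proof (elim disjE conjE)
   assume e: "sig s = s" "sig t = t" "sig del0 = del0"
   have "sig U = U" unfolding U_def using sigh sigw e wc h c by (simp add: L.minus_eq)
   then show ?thesis unfolding mu2_eq[OF c(3) s(1) sc] using e c Uc by simp
  next
   assume e: "sig s ~= s" "sig t = \<ominus>\<^bsub>L\<^esub> t" "sig del0 = \<ominus>\<^bsub>L\<^esub> del0"
   have "sig U = V" unfolding U_def V_def using sigh sigw e wc h c by (simp add: L.minus_eq)
   then show ?thesis unfolding mu2_eq[OF c(3) s(1) sc]
    using e c Uc Vc add_kernel_point[OF Uc c(1) U0, of a b] V_eq by (simp add: Let_def L.l_minus)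
  qed
 qed
 show ?thesis unfolding related_def using Q c(3) iso s(2) gal by (intro bexI conjI ballI)
qed

lemma neg_neq_self: "s \<in> carrier L ==> s ~= \<zero>\<^bsub>L\<^esub> ==> \<ominus>\<^bsub>L\<^esub> s ~= s"
proof
 assume s: "s \<in> carrier L" "s ~= \<zero>\<^bsub>L\<^esub>" "\<ominus>\<^bsub>L\<^esub> s = s"
 then have "s \<oplus>\<^bsub>L\<^esub> s = \<zero>\<^bsub>L\<^esub>" using L.l_neg[of s] by simp
 then have "(\<one>\<^bsub>L\<^esub> \<oplus>\<^bsub>L\<^esub> \<one>\<^bsub>L\<^esub>) \<otimes>\<^bsub>L\<^esub> s = \<zero>\<^bsub>L\<^esub>" using s(1) by (simp add: L.l_distr)
 then show False using two s by (simp add: L.integral_iff)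
qed

text \<open>In the two finite cases a square root r of the descent value v carries the sign
  character of the point; v is x for a point with nonzero abscissa and a^2 - 4 b for the origin.
  Since al v = w^2, the quotient w / r is a square root of \<open>al\<close> with the same
  character.\<close>

lemma kummer_class_imp_related:
 assumes ab: "of_int_ring L b ~= \<zero>\<^bsub>L\<^esub>" "of_int_ring K (a^2 - 4 * b) ~= \<zero>\<^bsub>K\<^esub>"
  and al: "al \<in> carrier K" "al ~= \<zero>\<^bsub>K\<^esub>"
  and k: "kummer_class K (of_int_ring K (- 2 * a)) (of_int_ring K (a\<^sup>2 - 4 * b)) al"
 shows "\<exists>P\<in>ell_points K (- 2 * a) (a\<^sup>2 - 4 * b). related a b P al"
proof -
 let ?C = "of_int_ring K (a\<^sup>2 - 4 * b)" let ?A = "of_int_ring K (- 2 * a)"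
 have \<iota>al: "\<iota> al ~= \<zero>\<^bsub>L\<^esub>" using iota_inj[of al "\<zero>\<^bsub>K\<^esub>"] al by auto
 have C_eq: "of_int_ring L (a^2 - 4 * b) = of_int_ring L a \<otimes>\<^bsub>L\<^esub> of_int_ring L a \<ominus>\<^bsub>L\<^esub> of_int_ring L 4 \<otimes>\<^bsub>L\<^esub> of_int_ring L b"
  by (simp add: power2_eq_square L.of_int_ring_diff L.of_int_ring_mult)
 have root: "\<exists>P\<in>ell_points K (- 2 * a) (a\<^sup>2 - 4 * b). related a b P al"
  if P: "Affine x y \<in> ell_points K (- 2 * a) (a\<^sup>2 - 4 * b)" and v: "v \<in> carrier K" "v ~= \<zero>\<^bsub>K\<^esub>" and w: "w \<in> carrier K" "al \<otimes>\<^bsub>K\<^esub> v = w \<otimes>\<^bsub>K\<^esub> w"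
   and t: "t \<in> carrier L" "del0 \<in> carrier L" "r \<in> carrier L" "r \<otimes>\<^bsub>L\<^esub> r = \<iota> v" "t \<otimes>\<^bsub>L\<^esub> t = \<iota> x" "t \<otimes>\<^bsub>L\<^esub> del0 = \<iota> y"
   and d: "del0 \<otimes>\<^bsub>L\<^esub> del0 = (\<iota> x \<ominus>\<^bsub>L\<^esub> of_int_ring L a) \<otimes>\<^bsub>L\<^esub> (\<iota> x \<ominus>\<^bsub>L\<^esub> of_int_ring L a) \<ominus>\<^bsub>L\<^esub> of_int_ring L 4 \<otimes>\<^bsub>L\<^esub> of_int_ring L b"
   and sign: "\<And>sig. sig \<in> galois ==> sig r = r ==> sig t = t & sig del0 = del0"
    "\<And>sig. sig \<in> galois ==> sig r = \<ominus>\<^bsub>L\<^esub> r ==> sig t = \<ominus>\<^bsub>L\<^esub> t & sig del0 = \<ominus>\<^bsub>L\<^esub> del0"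
  for x y v w t del0 r
 proof -
  have xy: "x \<in> carrier K" "y \<in> carrier K" using P unfolding ell_points_def by auto
  have \<iota>v: "\<iota> v ~= \<zero>\<^bsub>L\<^esub>" using iota_inj[of v "\<zero>\<^bsub>K\<^esub>"] v by auto
  have r0: "r ~= \<zero>\<^bsub>L\<^esub>" using t(3,4) \<iota>v by auto
  have ri: "inv\<^bsub>L\<^esub> r \<in> carrier L" "r \<otimes>\<^bsub>L\<^esub> inv\<^bsub>L\<^esub> r = \<one>\<^bsub>L\<^esub>" using L.inv_closed' L.inv_r t r0 by auto
  define s where "s = \<iota> w \<otimes>\<^bsub>L\<^esub> inv\<^bsub>L\<^esub> r"
  have sc: "s \<in> carrier L" unfolding s_def using w ri by simp
  have "s \<otimes>\<^bsub>L\<^esub> s = \<iota> (w \<otimes>\<^bsub>K\<^esub> w) \<otimes>\<^bsub>L\<^esub> (inv\<^bsub>L\<^esub> r \<otimes>\<^bsub>L\<^esub> inv\<^bsub>L\<^esub> r)" unfolding s_def using w ri by (simp add: L.m_ac)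
  also have "\<dots> = \<iota> al \<otimes>\<^bsub>L\<^esub> (r \<otimes>\<^bsub>L\<^esub> r) \<otimes>\<^bsub>L\<^esub> (inv\<^bsub>L\<^esub> r \<otimes>\<^bsub>L\<^esub> inv\<^bsub>L\<^esub> r)" unfolding w(2)[symmetric] t(4) using al v by simp
  also have "\<dots> = \<iota> al \<otimes>\<^bsub>L\<^esub> (r \<otimes>\<^bsub>L\<^esub> inv\<^bsub>L\<^esub> r) \<otimes>\<^bsub>L\<^esub> (r \<otimes>\<^bsub>L\<^esub> inv\<^bsub>L\<^esub> r)" using al t(3) ri(1) by (simp add: L.m_ac)
  finally have ss: "s \<otimes>\<^bsub>L\<^esub> s = \<iota> al" using ri al by simp
  have s0: "s ~= \<zero>\<^bsub>L\<^esub>" using ss \<iota>al by auto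
  have "related a b (Affine x y) al"
  proof (rule relatedI[OF xy ab(1) t(1,2) sc s0 ss al(1) t(5,6) d])
   fix sig assume sig: "sig \<in> galois"
   interpret S: ring_hom_ring L L sig by (rule galois_hom[OF sig])
   have sigs: "sig s = \<iota> w \<otimes>\<^bsub>L\<^esub> inv\<^bsub>L\<^esub> (sig r)" unfolding s_def using galois_inv[OF sig t(3) r0] galois_base[OF sig w(1)] w ri by simp
   from galois_sqrt[OF sig t(3,4) v(1)]
   show "(sig s = s & sig t = t & sig del0 = del0) \<or> (sig s ~= s & sig t = \<ominus>\<^bsub>L\<^esub> t & sig del0 = \<ominus>\<^bsub>L\<^esub> del0)"
   proof
    assume r: "sig r = r"
    then have "sig s = s" by (simp only: sigs) (simp only: s_def)
    then show ?thesis using sign(1)[OF sig r] by simp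
   next
    assume r: "sig r = \<ominus>\<^bsub>L\<^esub> r"
    have "inv\<^bsub>L\<^esub> (\<ominus>\<^bsub>L\<^esub> r) = \<ominus>\<^bsub>L\<^esub> (inv\<^bsub>L\<^esub> r)"
    proof (rule L.comm_inv_char)
     show "\<ominus>\<^bsub>L\<^esub> r \<otimes>\<^bsub>L\<^esub> \<ominus>\<^bsub>L\<^esub> (inv\<^bsub>L\<^esub> r) = \<one>\<^bsub>L\<^esub>" using t(3) ri by (simp add: L.l_minus L.r_minus)
    qed (use t(3) ri in auto)
    then have "sig s = \<iota> w \<otimes>\<^bsub>L\<^esub> (\<ominus>\<^bsub>L\<^esub> (inv\<^bsub>L\<^esub> r))" by (simp only: sigs r)
    also have "\<dots> = \<ominus>\<^bsub>L\<^esub> s" unfolding s_def using w ri by (simp add: L.r_minus)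
    finally have "sig s = \<ominus>\<^bsub>L\<^esub> s" .
    then show ?thesis using sign(2)[OF sig r] neg_neq_self[OF sc s0] by simp
   qed
  qed
  then show ?thesis using P by (rule bexI)
 qed
 from k consider (one) "is_square K al" | (origin) "is_square K (al \<otimes>\<^bsub>K\<^esub> ?C)"
  | (point) x y where "x \<in> carrier K" "y \<in> carrier K" "x ~= \<zero>\<^bsub>K\<^esub>"
   "y \<otimes>\<^bsub>K\<^esub> y = x \<otimes>\<^bsub>K\<^esub> (x \<otimes>\<^bsub>K\<^esub> x \<oplus>\<^bsub>K\<^esub> ?A \<otimes>\<^bsub>K\<^esub> x \<oplus>\<^bsub>K\<^esub> ?C)" "is_square K (al \<otimes>\<^bsub>K\<^esub> x)"
  unfolding kummer_class_def by blast
 then show ?thesis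
 proof cases
  case one
  then obtain w where w: "w \<in> carrier K" "al = w \<otimes>\<^bsub>K\<^esub> w" unfolding is_square_def by (elim bexE)
  have wc: "\<iota> w \<in> carrier L" and w0: "\<iota> w ~= \<zero>\<^bsub>L\<^esub>" using w \<iota>al by auto
  have "related a b Infinity al" unfolding related_def
  proof (intro bexI[of _ Infinity] bexI[of _ "\<iota> w"] conjI ballI)
   fix sig assume sig: "sig \<in> galois"
   show "map_point sig Infinity = ell_add L a b Infinity (mu2_to_kernel L (sig (\<iota> w) \<otimes>\<^bsub>L\<^esub> inv\<^bsub>L\<^esub> \<iota> w))"
    unfolding galois_base[OF sig w(1)] mu2_eq[OF wc w0 wc] by simp
  qed (use w in \<open>auto simp: ell_points_def\<close>)
  then show ?thesis by (intro bexI[of _ Infinity]) (auto simp: ell_points_def)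
 next
  case origin
  then obtain w where w: "w \<in> carrier K" "al \<otimes>\<^bsub>K\<^esub> ?C = w \<otimes>\<^bsub>K\<^esub> w" unfolding is_square_def by (elim bexE)
  from L.exists_sqrt[of "\<iota> ?C"] obtain r where r: "r \<in> carrier L" "r \<otimes>\<^bsub>L\<^esub> r = \<iota> ?C" by auto
  have z: "\<iota> \<zero>\<^bsub>K\<^esub> \<ominus>\<^bsub>L\<^esub> of_int_ring L a = \<ominus>\<^bsub>L\<^esub> of_int_ring L a" by (simp add: L.minus_eq)
  show ?thesis
  proof (rule root[OF _ _ ab(2) w L.zero_closed r(1) r(1,2)])
   show "Affine \<zero>\<^bsub>K\<^esub> \<zero>\<^bsub>K\<^esub> \<in> ell_points K (- 2 * a) (a\<^sup>2 - 4 * b)" unfolding ell_points_def by simp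
   show "r \<otimes>\<^bsub>L\<^esub> r = (\<iota> \<zero>\<^bsub>K\<^esub> \<ominus>\<^bsub>L\<^esub> of_int_ring L a) \<otimes>\<^bsub>L\<^esub> (\<iota> \<zero>\<^bsub>K\<^esub> \<ominus>\<^bsub>L\<^esub> of_int_ring L a) \<ominus>\<^bsub>L\<^esub> of_int_ring L 4 \<otimes>\<^bsub>L\<^esub> of_int_ring L b"
    unfolding r(2) hom.hom_of_int_ring C_eq z by (simp add: L.l_minus L.r_minus)
   fix sig assume sig: "sig \<in> galois"
   interpret S: ring_hom_ring L L sig by (rule galois_hom[OF sig])
   show "sig \<zero>\<^bsub>L\<^esub> = \<zero>\<^bsub>L\<^esub> & sig r = r" if "sig r = r" using that by simp
   show "sig \<zero>\<^bsub>L\<^esub> = \<ominus>\<^bsub>L\<^esub> \<zero>\<^bsub>L\<^esub> & sig r = \<ominus>\<^bsub>L\<^esub> r" if "sig r = \<ominus>\<^bsub>L\<^esub> r" using that by simp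
  qed (use r in auto)
 next
  case (point x y)
  then obtain w where w: "w \<in> carrier K" "al \<otimes>\<^bsub>K\<^esub> x = w \<otimes>\<^bsub>K\<^esub> w" unfolding is_square_def by (elim bexE)
  have ix: "\<iota> x \<in> carrier L" "\<iota> x ~= \<zero>\<^bsub>L\<^esub>" and iy: "\<iota> y \<in> carrier L" using iota_inj[of x "\<zero>\<^bsub>K\<^esub>"] point by auto
  from L.exists_sqrt[OF ix(1)] obtain r where r: "r \<in> carrier L" "r \<otimes>\<^bsub>L\<^esub> r = \<iota> x" by auto
  have r0: "r ~= \<zero>\<^bsub>L\<^esub>" using r ix by auto
  have ri: "inv\<^bsub>L\<^esub> r \<in> carrier L" "r \<otimes>\<^bsub>L\<^esub> inv\<^bsub>L\<^esub> r = \<one>\<^bsub>L\<^esub>" using L.inv_closed' L.inv_r r r0 by auto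
  define del0 where "del0 = \<iota> y \<otimes>\<^bsub>L\<^esub> inv\<^bsub>L\<^esub> r"
  have del0c: "del0 \<in> carrier L" unfolding del0_def using iy ri by simp
  have "r \<otimes>\<^bsub>L\<^esub> del0 = \<iota> y \<otimes>\<^bsub>L\<^esub> (r \<otimes>\<^bsub>L\<^esub> inv\<^bsub>L\<^esub> r)" unfolding del0_def using iy ri(1) r(1) by (simp add: L.m_ac)
  then have rdel0: "r \<otimes>\<^bsub>L\<^esub> del0 = \<iota> y" using ri iy by simp
  let ?w = "\<iota> x \<ominus>\<^bsub>L\<^esub> of_int_ring L a"
  have A_eq: "of_int_ring L (- 2 * a) = \<ominus>\<^bsub>L\<^esub> (of_int_ring L a \<oplus>\<^bsub>L\<^esub> of_int_ring L a)"
   using L.of_int_ring_neg[of "a + a"] L.of_int_ring_add[of a a] by simp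
  have "\<iota> x \<otimes>\<^bsub>L\<^esub> (del0 \<otimes>\<^bsub>L\<^esub> del0) = (r \<otimes>\<^bsub>L\<^esub> del0) \<otimes>\<^bsub>L\<^esub> (r \<otimes>\<^bsub>L\<^esub> del0)" unfolding r(2)[symmetric] using r(1) del0c by (simp add: L.m_ac)
  also have "\<dots> = \<iota> (y \<otimes>\<^bsub>K\<^esub> y)" unfolding rdel0 using point(2) by simp
  also have "\<dots> = \<iota> x \<otimes>\<^bsub>L\<^esub> (\<iota> x \<otimes>\<^bsub>L\<^esub> \<iota> x \<oplus>\<^bsub>L\<^esub> of_int_ring L (- 2 * a) \<otimes>\<^bsub>L\<^esub> \<iota> x \<oplus>\<^bsub>L\<^esub> of_int_ring L (a\<^sup>2 - 4 * b))"
   unfolding point(4) using point(1)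
   by (simp only: hom.hom_mult hom.hom_add hom.hom_of_int_ring K.m_closed K.a_closed K.of_int_ring_closed)
  finally have "del0 \<otimes>\<^bsub>L\<^esub> del0 = \<iota> x \<otimes>\<^bsub>L\<^esub> \<iota> x \<oplus>\<^bsub>L\<^esub> of_int_ring L (- 2 * a) \<otimes>\<^bsub>L\<^esub> \<iota> x \<oplus>\<^bsub>L\<^esub> of_int_ring L (a\<^sup>2 - 4 * b)"
   using L.m_lcancel[OF ix(2,1)] ix(1) del0c by simp
  also have "\<dots> = ?w \<otimes>\<^bsub>L\<^esub> ?w \<ominus>\<^bsub>L\<^esub> of_int_ring L 4 \<otimes>\<^bsub>L\<^esub> of_int_ring L b"
   unfolding A_eq C_eq using ix(1) L.of_int_ring_closed[of a] L.of_int_ring_closed[of b] L.of_int_ring_closed[of 4] by algebra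
  finally have d: "del0 \<otimes>\<^bsub>L\<^esub> del0 = ?w \<otimes>\<^bsub>L\<^esub> ?w \<ominus>\<^bsub>L\<^esub> of_int_ring L 4 \<otimes>\<^bsub>L\<^esub> of_int_ring L b" .
  show ?thesis
  proof (rule root[OF _ point(1,3) w r(1) del0c r r(2) rdel0 d])
   show "Affine x y \<in> ell_points K (- 2 * a) (a\<^sup>2 - 4 * b)" unfolding ell_points_def using point by simp
   fix sig assume sig: "sig \<in> galois"
   interpret S: ring_hom_ring L L sig by (rule galois_hom[OF sig])
   have e: "sig del0 = \<iota> y \<otimes>\<^bsub>L\<^esub> inv\<^bsub>L\<^esub> (sig r)" unfolding del0_def using galois_inv[OF sig r(1) r0] galois_base[OF sig point(2)] iy ri by simp
   show "sig r = r & sig del0 = del0" if "sig r = r"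
    by (simp only: e that) (simp only: del0_def)
   have "inv\<^bsub>L\<^esub> (\<ominus>\<^bsub>L\<^esub> r) = \<ominus>\<^bsub>L\<^esub> (inv\<^bsub>L\<^esub> r)"
   proof (rule L.comm_inv_char)
    show "\<ominus>\<^bsub>L\<^esub> r \<otimes>\<^bsub>L\<^esub> \<ominus>\<^bsub>L\<^esub> (inv\<^bsub>L\<^esub> r) = \<one>\<^bsub>L\<^esub>" using r ri by (simp add: L.l_minus L.r_minus)
   qed (use r ri in auto)
   then show "sig r = \<ominus>\<^bsub>L\<^esub> r & sig del0 = \<ominus>\<^bsub>L\<^esub> del0" if "sig r = \<ominus>\<^bsub>L\<^esub> r"
    unfolding e that unfolding del0_def using iy ri by (simp add: L.r_minus)
  qed
 qed
qed

end

text \<open>The cocycle definition of the Kummer image becomes the explicit descent map; no Galois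
  theory enters after this point.\<close>

theorem kummer_image_eq:
 fixes K :: "('a, 'm) ring_scheme"
 assumes K: "field K" and two: "\<one>\<^bsub>K\<^esub> \<oplus>\<^bsub>K\<^esub> \<one>\<^bsub>K\<^esub> ~= \<zero>\<^bsub>K\<^esub>"
  and ab: "of_int_ring K b ~= \<zero>\<^bsub>K\<^esub>" "of_int_ring K (a^2 - 4 * b) ~= \<zero>\<^bsub>K\<^esub>"
 shows "kummer_image K a b = {square_class K al | al. al \<in> carrier (mult_of K) &
  kummer_class K (of_int_ring K (- 2 * a)) (of_int_ring K (a\<^sup>2 - 4 * b)) al}"
proof -
 interpret K: field K by (rule K)
 let ?L = "field.alg_closure K" let ?i = "ring.indexed_const K :: 'a => ('a list \<times> nat) multiset => 'a"
 interpret L: algebraic_closure ?L "?i ` carrier K" by (rule K.alg_closureE(1))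
 interpret hom: ring_hom_ring K ?L ?i
  by (rule ring_hom_ringI2[OF K.ring_axioms L.ring_axioms K.alg_closureE(2)])
 have inj: "inj_on ?i (carrier K)"
  by (rule K.indexed_const_inj_on)
 have nz: "?i x ~= \<zero>\<^bsub>?L\<^esub>" if "x \<in> carrier K" "x ~= \<zero>\<^bsub>K\<^esub>" for x
 proof
  assume "?i x = \<zero>\<^bsub>?L\<^esub>"
  then have "?i x = ?i \<zero>\<^bsub>K\<^esub>" by (rule trans[OF _ hom.hom_zero[symmetric]])
  then show False using inj_onD[OF inj, of x "\<zero>\<^bsub>K\<^esub>"] that by simp
 qed
 have "?i (\<one>\<^bsub>K\<^esub> \<oplus>\<^bsub>K\<^esub> \<one>\<^bsub>K\<^esub>) ~= \<zero>\<^bsub>?L\<^esub>" by (rule nz[OF _ two]) simp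
 then have two': "\<one>\<^bsub>?L\<^esub> \<oplus>\<^bsub>?L\<^esub> \<one>\<^bsub>?L\<^esub> ~= \<zero>\<^bsub>?L\<^esub>"
  unfolding hom.hom_add[OF K.one_closed K.one_closed] hom.hom_one .
 interpret kummer_setup K ?L ?i by unfold_locales (rule two')
 have b': "of_int_ring ?L b ~= \<zero>\<^bsub>?L\<^esub>" using nz[OF _ ab(1)] by (simp add: hom.hom_of_int_ring)
 have rel: "kummer_related K a b P al \<longleftrightarrow> related a b P al" for P al
  unfolding kummer_related_def related_def absolute_galois_def galois_def Let_def by simp
 have "(\<exists>P. P \<in> ell_points K (- 2 * a) (a\<^sup>2 - 4 * b) & kummer_related K a b P al) \<longleftrightarrow>
   kummer_class K (of_int_ring K (- 2 * a)) (of_int_ring K (a\<^sup>2 - 4 * b)) al"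
  if "al \<in> carrier (mult_of K)" for al
 proof -
  have al: "al \<in> carrier K" "al ~= \<zero>\<^bsub>K\<^esub>" using that by auto
  show ?thesis unfolding rel
   using related_imp_kummer_class[OF b' _ al] kummer_class_imp_related[OF b' ab(2) al] by auto
 qed
 then show ?thesis unfolding kummer_image_def by blast
qed

section \<open>Residues, Hensel lifting and solubility modulo prime powers\<close>

lemma prime_odd_gt_2: "prime (p::int) ==> odd p ==> 2 < p"
 using prime_gt_1_int[of p] by (cases "p = 2") auto

lemma dvd_shift: "(p::int) dvd x - y ==> p dvd x \<longleftrightarrow> p dvd y"
 using dvd_add_right_iff[of p "x - y" y] by simp

lemma odd_prime_not_dvd_four:
 assumes "prime (p::int)" "odd p" shows "~ p dvd 2" "~ p dvd 4"
proof -
 show "~ p dvd 2" using prime_odd_gt_2[OF assms] zdvd_not_zless[of 2 p] by simp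
 then show "~ p dvd 4" using prime_dvd_mult_iff[OF assms(1), of 2 2] by simp
qed

lemma QuadRes_iff_dvd: "QuadRes p u \<longleftrightarrow> (\<exists>y. p dvd y^2 - u)"
 by (simp add: QuadRes_def cong_iff_dvd_diff)

lemma QuadRes_cong: "p dvd u - v ==> QuadRes p u \<longleftrightarrow> QuadRes p v"
proof -
 assume "p dvd u - v"
 then have "[u = v] (mod p)" by (simp add: cong_iff_dvd_diff)
 then show ?thesis unfolding QuadRes_def by (meson cong_sym cong_trans)
qed

text \<open>Euler's criterion gives the equality modulo \<open>p\<close>, and both sides lie in {-1,
  0, 1}, so their difference is smaller than \<open>p\<close>.\<close>

lemma Legendre_mult_odd_prime:
 assumes "prime p" "2 < (p::int)"
 shows "Legendre (u * v) p = Legendre u p * Legendre v p"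
proof -
 have P: "prime (nat p)" "2 < nat p" using assms by auto
 have e: "[Legendre x p = x ^ ((nat p - 1) div 2)] (mod p)" for x
  using euler_criterion[OF P, of x] assms by simp
 have "[Legendre (u * v) p = Legendre u p * Legendre v p] (mod p)"
  using e[of "u * v"] cong_mult[OF e[of u] e[of v]] unfolding power_mult_distrib
  by (meson cong_sym cong_trans)
 then have d: "p dvd Legendre (u * v) p - Legendre u p * Legendre v p" by (simp add: cong_iff_dvd_diff)
 have r: "Legendre x p \<in> {-1, 0, 1}" for x by (simp add: Legendre_def)
 have "\<bar>Legendre (u * v) p - Legendre u p * Legendre v p\<bar> \<le> 2"
  using r[of u] r[of v] r[of "u * v"] by auto
 then have "\<bar>Legendre (u * v) p - Legendre u p * Legendre v p\<bar> < \<bar>p\<bar>" using assms by linarith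
 then show ?thesis using dvd_imp_le_int[OF _ d] by fastforce
qed

lemma QuadRes_mult_iff:
 assumes "prime p" "2 < (p::int)" "~ p dvd u" "~ p dvd v"
 shows "QuadRes p (u * v) \<longleftrightarrow> (QuadRes p u \<longleftrightarrow> QuadRes p v)"
proof -
 have "~ p dvd u * v" using assms by (simp add: prime_dvd_mult_iff)
 then show ?thesis using Legendre_mult_odd_prime[OF assms(1,2), of u v] assms(3,4)
  by (auto simp: Legendre_def cong_0_iff split: if_splits)
qed

lemma QuadRes_square: "QuadRes p (x^2)"
 unfolding QuadRes_def by (rule exI[of _ x]) simp

text \<open>Newton's correction subtracts p^M k / (2 y); the divisor is a unit since p is odd and y
  stays congruent to the unit x.\<close>

lemma hensel_odd:
 assumes p: "prime (p::int)" "odd p" and x: "~ p dvd x" "p dvd x^2 - u"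
 shows "\<exists>y. p ^ M dvd y^2 - u & p dvd y - x"
proof (induction M)
 case 0 show ?case by (rule exI[of _ x]) simp
next
 case (Suc M)
 show ?case
 proof (cases "M = 0")
  case True then show ?thesis using x by (intro exI[of _ x]) simp
 next
  case False
  from Suc obtain y where y: "p ^ M dvd y^2 - u" "p dvd y - x" by blast
  from y(1) obtain k where k: "y^2 - u = p ^ M * k" by blast
  have ny: "~ p dvd y" using x(1) dvd_shift[OF y(2)] by simp
  have "coprime (2 * y) p"
  proof -
   have "~ p dvd 2 * y" using ny prime_dvd_mult_iff[OF p(1)] odd_prime_not_dvd_four[OF p] by blast
   then have "coprime p (2 * y)" by (rule prime_imp_coprime[OF p(1)])
   then show ?thesis by (subst coprime_commute)
  qed
  then obtain w where w: "[2 * y * w = 1] (mod p)" using cong_solve_coprime_int by blast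
  define y' where "y' = y + p ^ M * (- k * w)"
  have "y'\<^sup>2 - u = (y\<^sup>2 - u) + p ^ M * (2 * y * (- k * w)) + p ^ M * p ^ M * (k * w)\<^sup>2"
   unfolding y'_def by (simp add: power2_eq_square algebra_simps)
  also have "\<dots> = p ^ M * (k * (1 - 2 * y * w)) + p ^ M * p ^ M * (k * w)^2" unfolding k by (simp add: algebra_simps)
  finally have e: "y'^2 - u = p ^ M * (k * (1 - 2 * y * w)) + p ^ M * p ^ M * (k * w)^2" .
  have "p dvd 1 - 2 * y * w" using w by (simp add: cong_iff_dvd_diff dvd_diff_commute)
  then have "p ^ Suc M dvd p ^ M * (k * (1 - 2 * y * w))" by (simp add: mult.commute mult_dvd_mono)
  moreover have "p dvd p ^ M" using False by (simp add: dvd_power)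
  then have "p ^ Suc M dvd p ^ M * p ^ M * (k * w)^2" by (simp add: mult.commute mult_dvd_mono)
  ultimately have "p ^ Suc M dvd y'^2 - u" unfolding e by (rule dvd_add)
  moreover have "p dvd y' - x"
  proof -
   have "y' - x = (y - x) + p ^ M * (- k * w)" unfolding y'_def by simp
   then show ?thesis using y(2) \<open>p dvd p ^ M\<close> by (metis dvd_add dvd_mult2)
  qed
  ultimately show ?thesis by blast
 qed
qed

text \<open>The induction runs modulo 2^(M + 3), since a root modulo 8 is the first that always
  lifts. An odd quotient \<open>k\<close> is repaired by adding 2^(M + 2) to y, which changes y^2 by
  2^(M + 3) y up to a multiple of 2^(M + 4), and y is odd.\<close>

lemma hensel_two:
 assumes u: "(u::int) mod 8 = 1"
 shows "\<exists>y. 2 ^ M dvd y^2 - u & odd y"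
proof -
 have "\<exists>y. 2 ^ (M + 3) dvd y^2 - u & odd y"
 proof (induction M)
  case 0
  have "8 dvd 1 - u" using u by presburger
  then show ?case by (intro exI[of _ 1]) simp
 next
  case (Suc M)
  then obtain y where y: "2 ^ (M + 3) dvd y^2 - u" "odd y" by blast
  from y(1) obtain k where k: "y^2 - u = 2 ^ (M + 3) * k" by blast
  show ?case
  proof (cases "even k")
   case True
   then obtain l where "k = 2 * l" by blast
   then have "y^2 - u = 2 ^ (Suc M + 3) * l" unfolding k by (simp add: power_add)
   then have "2 ^ (Suc M + 3) dvd y^2 - u" by simp
   then show ?thesis using y(2) by blast
  next
   case False
   define y' where "y' = y + 2 ^ (M + 2)"
   have "y'^2 - u = 2 ^ (M + 3) * (k + y) + 2 ^ (Suc M + 3) * 2 ^ M"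
    using k unfolding y'_def by (simp add: power2_eq_square algebra_simps power_add)
   moreover have "2 dvd k + y" using False y(2) by simp
   then obtain l where "k + y = 2 * l" by blast
   then have "2 ^ (M + 3) * (k + y) = 2 ^ (Suc M + 3) * l" by (simp add: power_add)
   then have "(2::int) ^ (Suc M + 3) dvd 2 ^ (M + 3) * (k + y)" by simp
   ultimately have "2 ^ (Suc M + 3) dvd y'^2 - u" by simp
   moreover have "odd y'" unfolding y'_def using y(2) by simp
   ultimately show ?thesis by blast
  qed
 qed
 then show ?thesis using power_le_dvd[of 2 "M + 3" _ M] by (metis le_add1)
qed

text \<open>The quartic multiplied by \<open>al\<close>, with N = al n, so that only integers occur.
  Primitivity is asked of (m, e) alone. By compactness, solutions modulo all powers of p amount to a
  local point; this is \<open>local_sol_iff_padic_sol\<close>.\<close>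

definition padic_sol :: "int => int => int => int => bool" where
 "padic_sol p a b al \<longleftrightarrow> (\<forall>M. \<exists>m e N. ~ (p dvd m & p dvd e) &
   p ^ M dvd N^2 - al * ((al * m^2 - a * e^2)^2 - 4 * b * e ^ 4))"

lemma QuadRes_lift:
 assumes p: "prime (p::int)" "odd p" and u: "~ p dvd u" "QuadRes p u"
 shows "\<exists>y. p ^ M dvd y^2 - u"
proof -
 from u(2) obtain x where x: "p dvd x^2 - u" unfolding QuadRes_iff_dvd by blast
 have "~ p dvd x"
 proof
  assume "p dvd x"
  then have "p dvd x^2" by (simp add: power2_eq_square)
  then show False using dvd_shift[OF x] u(1) by simp
 qed
 then show ?thesis using hensel_odd[OF p _ x] by blast
qed

text \<open>A root of \<open>(x - a)^2 = 4 b\<close> modulo \<open>p\<close> lifts, and the 2-torsion point \<open>(w, 0)\<close> gives the class \<open>w\<close>.\<close>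

lemma padic_sol_root:
 assumes p: "prime (p::int)" "odd p" and b: "~ p dvd b" and gam: "~ p dvd gam"
  and w: "p dvd (w - a)^2 - 4 * b" "~ p dvd w" "QuadRes p (gam * w)"
 shows "\<exists>m. p ^ M dvd (gam * m^2 - a)^2 - 4 * b"
proof (cases "M = 0")
 case False
 have n4b: "~ p dvd 4 * b"
 proof -
  show ?thesis using b prime_dvd_mult_iff[OF p(1), of 4 b] odd_prime_not_dvd_four[OF p] by simp
 qed
 have "~ p dvd w - a"
 proof
  assume "p dvd w - a"
  then have "p dvd (w - a)^2" by (simp add: power2_eq_square)
  then show False using dvd_shift[OF w(1)] n4b by simp
 qed
 from hensel_odd[OF p this w(1), of M] obtain y where y: "p ^ M dvd y^2 - 4 * b" "p dvd y - (w - a)" by blast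
 define v where "v = y + a"
 have vw: "p dvd v - w" using y(2) unfolding v_def by (simp add: algebra_simps)
 have nv: "~ p dvd v" using dvd_shift[OF vw] w(2) by simp
 have "p dvd gam * v - gam * w" using vw by (metis dvd_mult right_diff_distrib)
 then have "QuadRes p (gam * v)" using w(3) QuadRes_cong by blast
 moreover have "~ p dvd gam * v" using nv gam prime_dvd_mult_iff[OF p(1)] by blast
 ultimately obtain t where t: "p ^ M dvd t^2 - gam * v" using QuadRes_lift[OF p] by blast
 have "coprime gam (p ^ M)" using prime_imp_coprime[OF p(1) gam] by (simp add: coprime_commute)
 then obtain i where i: "[gam * i = 1] (mod p ^ M)" using cong_solve_coprime_int by blast
 have t': "[t^2 = gam * v] (mod p ^ M)" using t by (simp add: cong_iff_dvd_diff)
 have "[gam * (t * i)^2 = (gam * i) * i * t^2] (mod p ^ M)" by (simp add: power2_eq_square algebra_simps)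
 also have "[(gam * i) * i * t^2 = 1 * i * (gam * v)] (mod p ^ M)" by (intro cong_mult i t' cong_refl)
 also have "[1 * i * (gam * v) = (gam * i) * v] (mod p ^ M)" by (simp add: algebra_simps)
 also have "[(gam * i) * v = 1 * v] (mod p ^ M)" by (intro cong_mult i cong_refl)
 finally have "[gam * (t * i)^2 = v] (mod p ^ M)" by simp
 then have "[(gam * (t * i)^2 - a)^2 - 4 * b = (v - a)^2 - 4 * b] (mod p ^ M)"
  by (intro cong_diff cong_pow cong_refl)
 moreover have "p ^ M dvd (v - a)^2 - 4 * b" unfolding v_def using y(1) by simp
 ultimately have "p ^ M dvd (gam * (t * i)^2 - a)^2 - 4 * b" by (metis cong_dvd_iff)
 then show ?thesis by blast
qed simp

text \<open>A counting argument in place of the Hasse bound. If f(z) = (g z^2 - a)^2 - 4 b were a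
  nonzero square Y(z)^2 for all units z, then A(z) = g z^2 - a - Y(z) would always be a unit, its
  product with B(z) = g z^2 - a + Y(z) being 4 b. But z -> A(z) is injective on p residues, and only
  p - 1 values are available.\<close>

lemma exists_point_with_nonresidue_abscissa:
 assumes p: "prime (p::int)" "2 < p" and b: "~ p dvd 4 * b" and c: "~ p dvd a^2 - 4 * b" "QuadRes p (a^2 - 4 * b)"
  and g: "~ p dvd g"
 shows "\<exists>z. ~ p dvd z & (p dvd (g * z^2 - a)^2 - 4 * b \<or> ~ QuadRes p ((g * z^2 - a)^2 - 4 * b))"
proof (rule ccontr)
 assume "~ ?thesis"
 then have all: "~ p dvd (g * z^2 - a)^2 - 4 * b" "QuadRes p ((g * z^2 - a)^2 - 4 * b)" if "~ p dvd z" for z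
  using that by blast+
 define h where "h = (p - 1) div 2"
 have ph: "p = 2 * h + 1" unfolding h_def using prime_odd_int[OF p] by presburger
 have odd2: "~ p dvd 2" using p zdvd_not_zless[of 2 p] by simp
 let ?f = "%z. (g * z^2 - a)^2 - 4 * b"
 have small: "~ p dvd z" if "z \<in> {-h..h}" "z ~= 0" for z
 proof
  assume "p dvd z"
  then have "\<bar>p\<bar> \<le> \<bar>z\<bar>" using that(2) by (simp add: dvd_imp_le_int)
  then show False using that(1) ph p by auto
 qed
 have "\<exists>y. p dvd y^2 - ?f z" if "z \<in> {-h..h}" for z
 proof (cases "z = 0")
  case True then show ?thesis using c(2) unfolding QuadRes_iff_dvd by simp
 next
  case False then show ?thesis using all(2)[OF small[OF that]] unfolding QuadRes_iff_dvd by simp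
 qed
 then have "\<forall>z\<in>{-h..h}. \<exists>y. p dvd y^2 - ?f z" by (rule ballI)
 from bchoice[OF this] obtain Y0 where Y0': "\<forall>z\<in>{-h..h}. p dvd (Y0 z)^2 - ?f z" by (elim exE)
 have Y0: "p dvd (Y0 z)^2 - ?f z" if "z \<in> {-h..h}" for z using Y0' that by (rule bspec)
 \<comment> \<open>The root is chosen odd in z for nonzero z, so that z and -z, which give the same
   f, still give different values of A.\<close>
 define Y where "Y z = (if z < 0 then - Y0 (- z) else Y0 z)" for z :: int
 have Y: "p dvd (Y z)^2 - ?f z" if "z \<in> {-h..h}" for z
  using Y0[of z] Y0[of "- z"] that unfolding Y_def by auto
 have Yneg: "Y (- z) = - Y z" if "z ~= 0" for z using that unfolding Y_def by auto
 have nY: "~ p dvd Y z" if "z \<in> {-h..h}" "z ~= 0" for z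
 proof
  assume "p dvd Y z"
  then have "p dvd (Y z)^2" by (simp add: power2_eq_square)
  then have "p dvd ?f z" using dvd_shift[OF Y[OF that(1)]] by simp
  then show False using all(1)[OF small[OF that]] by simp
 qed
 define A where "A z = g * z^2 - a - Y z" for z
 define B where "B z = g * z^2 - a + Y z" for z
 have AB: "p dvd A z * B z - 4 * b" if "z \<in> {-h..h}" for z
 proof -
  have e: "A z * B z - 4 * b = - ((Y z)\<^sup>2 - ?f z)" unfolding A_def B_def by (simp add: power2_eq_square algebra_simps)
  show ?thesis unfolding e using Y[OF that] by (simp only: dvd_minus_iff)
 qed
 have nA: "~ p dvd A z" if "z \<in> {-h..h}" for z
 proof
  assume "p dvd A z"
  then have "p dvd A z * B z" by simp
  then show False using dvd_shift[OF AB[OF that]] b by simp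
 qed
 have inj: "inj_on (%z. A z mod p) {-h..h}"
 proof (rule inj_onI)
  fix z z' assume z: "z \<in> {-h..h}" "z' \<in> {-h..h}" and eq: "A z mod p = A z' mod p"
  have dA: "p dvd A z - A z'" using eq by (simp add: mod_eq_dvd_iff)
  have "A z * (B z - B z') = (A z * B z - 4 * b) - (A z' * B z' - 4 * b) - (A z - A z') * B z'" by (simp add: algebra_simps)
  moreover have "p dvd (A z * B z - 4 * b) - (A z' * B z' - 4 * b) - (A z - A z') * B z'"
   by (intro dvd_diff dvd_mult2 AB z dA)
  ultimately have "p dvd A z * (B z - B z')" by simp
  then have dB: "p dvd B z - B z'" using nA[OF z(1)] prime_dvd_mult_iff[OF p(1)] by blast
  have "2 * (g * (z^2 - z'^2)) = (A z - A z') + (B z - B z')" unfolding A_def B_def by (simp add: algebra_simps)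
  then have "p dvd 2 * (g * (z^2 - z'^2))" using dvd_add[OF dA dB] by simp
  then have "p dvd z^2 - z'^2" using odd2 g prime_dvd_mult_iff[OF p(1)] by simp
  moreover have "z^2 - z'^2 = (z - z') * (z + z')" by (simp add: power2_eq_square algebra_simps)
  ultimately have "p dvd (z - z') * (z + z')" by simp
  then have "p dvd z - z' \<or> p dvd z + z'" using prime_dvd_mult_iff[OF p(1)] by blast
  moreover have "z = z'" if "p dvd z - z'"
  proof (rule ccontr)
   assume "z ~= z'"
   then have "\<bar>p\<bar> \<le> \<bar>z - z'\<bar>" using that by (simp add: dvd_imp_le_int)
   then show False using z ph p by auto
  qed
  moreover have "z' = - z" if "p dvd z + z'"
  proof (rule ccontr)
   assume "z' ~= - z"
   then have "\<bar>p\<bar> \<le> \<bar>z + z'\<bar>" using that by (intro dvd_imp_le_int) auto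
   then show False using z ph p by auto
  qed
  moreover have "z = z'" if "z' = - z"
  proof (rule ccontr)
   assume ne: "z ~= z'"
   then have z0: "z ~= 0" using that by auto
   have "2 * Y z = B z - B z'" using Yneg[OF z0] that unfolding A_def B_def by simp
   then have "p dvd 2 * Y z" using dB by simp
   then show False using odd2 nY[OF z(1) z0] prime_dvd_mult_iff[OF p(1)] by blast
  qed
  ultimately show "z = z'" by blast
 qed
 have "(%z. A z mod p) ` {-h..h} \<subseteq> {1..p - 1}"
 proof
  fix v assume "v \<in> (%z. A z mod p) ` {-h..h}"
  then obtain z where z: "z \<in> {-h..h}" "v = A z mod p" by blast
  have "v ~= 0" using nA[OF z(1)] z(2) by auto
  moreover have "0 \<le> v" "v < p" using p z(2) by auto
  ultimately show "v \<in> {1..p - 1}" by auto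
 qed
 then have "card {-h..h} \<le> card {1..p - 1}" by (rule card_inj_on_le[OF inj]) simp
 then show False using ph p by simp
qed

lemma padic_solI: "(\<And>M. \<exists>m e N. ~ (p dvd m & p dvd e) &
   p ^ M dvd N^2 - al * ((al * m^2 - a * e^2)^2 - 4 * b * e ^ 4)) ==> padic_sol p a b al"
 unfolding padic_sol_def by blast

lemma padic_sol_square:
 assumes p: "prime (p::int)" "odd p" and al: "~ p dvd al" "QuadRes p al"
 shows "padic_sol p a b al"
proof (rule padic_solI)
 fix M
 obtain y where y: "p ^ M dvd y^2 - al" using QuadRes_lift[OF p al] by blast
 have "(y * al)^2 - al * ((al * 1^2 - a * 0^2)^2 - 4 * b * 0 ^ 4) = al^2 * (y^2 - al)" by (simp add: power2_eq_square algebra_simps)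
 then have "p ^ M dvd (y * al)^2 - al * ((al * 1^2 - a * 0^2)^2 - 4 * b * 0 ^ 4)" using y by simp
 moreover have "~ (p dvd 1 & p dvd 0)" using p by auto
 ultimately show "\<exists>m e N. ~ (p dvd m & p dvd e) & p ^ M dvd N^2 - al * ((al * m^2 - a * e^2)^2 - 4 * b * e ^ 4)" by blast
qed

lemma padic_sol_origin:
 assumes p: "prime (p::int)" "odd p" and al: "~ p dvd al * c" "QuadRes p (al * c)" and c: "a^2 - 4 * b = c * D^2"
 shows "padic_sol p a b al"
proof (rule padic_solI)
 fix M
 obtain y where y: "p ^ M dvd y^2 - al * c" using QuadRes_lift[OF p al] by blast
 have "(y * D)^2 - al * ((al * 0^2 - a * 1^2)^2 - 4 * b * 1 ^ 4) = (y * D)^2 - al * (a^2 - 4 * b)" by (simp add: power2_eq_square)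
 also have "\<dots> = D^2 * (y^2 - al * c)" unfolding c by (simp add: power2_eq_square algebra_simps)
 finally have "p ^ M dvd (y * D)^2 - al * ((al * 0^2 - a * 1^2)^2 - 4 * b * 1 ^ 4)" using y by simp
 moreover have "~ (p dvd 0 & p dvd 1)" using p by auto
 ultimately show "\<exists>m e N. ~ (p dvd m & p dvd e) & p ^ M dvd N^2 - al * ((al * m^2 - a * e^2)^2 - 4 * b * e ^ 4)" by blast
qed

text \<open>At a prime of good reduction every unit class is in the Kummer image. A residue comes
  from infinity. If \<open>al\<close> and a^2 - 4 b are both nonresidues, the origin serves. In the
  remaining case \<open>exists_point_with_nonresidue_abscissa\<close> supplies m with e = 1, where a
  zero of the quartic modulo p leads to a 2-torsion point.\<close>

lemma padic_sol_unit:
 assumes p: "prime (p::int)" "odd p" and b: "~ p dvd b" and c: "~ p dvd a^2 - 4 * b" and al: "~ p dvd al"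
 shows "padic_sol p a b al"
proof -
 have p2: "2 < p" using prime_odd_gt_2[OF p] .
 have n4b: "~ p dvd 4 * b"
 proof -
  show ?thesis using b prime_dvd_mult_iff[OF p(1), of 4 b] odd_prime_not_dvd_four[OF p] by simp
 qed
 consider "QuadRes p al" | "~ QuadRes p al" "~ QuadRes p (a^2 - 4 * b)" | "~ QuadRes p al" "QuadRes p (a^2 - 4 * b)" by blast
 then show ?thesis
 proof cases
  case 1 then show ?thesis using padic_sol_square[OF p al] by blast
 next
  case 2
  then have "QuadRes p (al * (a^2 - 4 * b))" using QuadRes_mult_iff[OF p(1) p2 al c] by blast
  moreover have "~ p dvd al * (a^2 - 4 * b)" using al c prime_dvd_mult_iff[OF p(1)] by blast
  ultimately show ?thesis using padic_sol_origin[OF p, of al "a^2 - 4 * b" a b 1] by simp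
 next
  case 3
  from exists_point_with_nonresidue_abscissa[OF p(1) p2 n4b c 3(2) al] obtain z where
   z: "~ p dvd z" "p dvd (al * z^2 - a)^2 - 4 * b \<or> ~ QuadRes p ((al * z^2 - a)^2 - 4 * b)" by blast
  have az: "~ p dvd al * z^2" using al z(1) prime_dvd_mult_iff[OF p(1)] by (simp add: power2_eq_square)
  show ?thesis
  proof (cases "p dvd (al * z^2 - a)^2 - 4 * b")
   case True
   have sq: "QuadRes p (al * (al * z^2))" using QuadRes_square[of p "al * z"] by (simp add: power2_eq_square algebra_simps)
   show ?thesis
   proof (rule padic_solI)
    fix M
    obtain m where "p ^ M dvd (al * m^2 - a)^2 - 4 * b" using padic_sol_root[OF p b al True az sq] by blast
    then have "p ^ M dvd 0^2 - al * ((al * m^2 - a * 1^2)^2 - 4 * b * 1 ^ 4)" by simp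
    moreover have "~ (p dvd m & p dvd 1)" using p by auto
    ultimately show "\<exists>m e N. ~ (p dvd m & p dvd e) & p ^ M dvd N^2 - al * ((al * m^2 - a * e^2)^2 - 4 * b * e ^ 4)" by blast
   qed
  next
   case False
   let ?F = "(al * z^2 - a)^2 - 4 * b"
   have "QuadRes p (al * ?F)" using QuadRes_mult_iff[OF p(1) p2 al False] 3(1) z(2) False by blast
   moreover have "~ p dvd al * ?F" using al False prime_dvd_mult_iff[OF p(1)] by blast
   ultimately have lift: "\<exists>y. p ^ M dvd y^2 - al * ?F" for M using QuadRes_lift[OF p] by blast
   show ?thesis
   proof (rule padic_solI)
    fix M
    obtain y where "p ^ M dvd y^2 - al * ?F" using lift by blast
    then have "p ^ M dvd y^2 - al * ((al * z^2 - a * 1^2)^2 - 4 * b * 1 ^ 4)" by simp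
    moreover have "~ (p dvd z & p dvd 1)" using p by auto
    ultimately show "\<exists>m e N. ~ (p dvd m & p dvd e) & p ^ M dvd N^2 - al * ((al * m^2 - a * e^2)^2 - 4 * b * e ^ 4)" by blast
   qed
  qed
 qed
qed

lemma prime_power_unit_not_square:
 assumes p: "prime (p::int)" and u: "~ p dvd u" and "odd k" and "p ^ Suc k dvd N^2 - p ^ k * u"
 shows False
proof -
 have "p ^ k dvd N^2 - p ^ k * u" using power_le_dvd[OF assms(4), of k] by simp
 from dvd_shift[OF this] have "p ^ k dvd N^2" by simp
 define j where "j = k div 2"
 have k: "k = 2 * j + 1" using \<open>odd k\<close> unfolding j_def by presburger
 have N0: "N ~= 0"
 proof
  assume "N = 0"
  then have "p ^ k * p dvd p ^ k * u" using assms(4) by (simp add: mult.commute)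
  then show False using u p by (simp add: dvd_mult_cancel_left)
 qed
 have p0: "p ~= 0" and pu: "~ is_unit p" using p by auto
 have "multiplicity p (N^2) \<ge> k" using \<open>p ^ k dvd N^2\<close> N0 pu by (intro multiplicity_geI) auto
 moreover have "multiplicity p (N^2) = 2 * multiplicity p N"
  by (rule prime_elem_multiplicity_power_distrib[OF prime_imp_prime_elem[OF p] N0])
 ultimately have "multiplicity p (N^2) \<ge> Suc k" using k by presburger
 then have "p ^ Suc k dvd N^2" by (rule multiplicity_dvd')
 then have "p ^ k * p dvd p ^ k * u" using dvd_shift[OF assms(4)] by (simp add: mult.commute)
 then show False using u p0 by (simp add: dvd_mult_cancel_left)
qed

text \<open>The right side has valuation exactly 1 if p does not divide e, and exactly 3 if it does;
  both are odd, so it is no square. Precision p^4 sees both cases.\<close>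

lemma not_padic_sol_ramified:
 assumes p: "prime (p::int)" and c: "~ p dvd a^2 - 4 * b" and al: "al = p * gam" "~ p dvd gam"
 shows "~ padic_sol p a b al"
proof
 assume "padic_sol p a b al"
 then obtain m e N where me: "~ (p dvd m & p dvd e)"
  and N: "p ^ 4 dvd N^2 - al * ((al * m^2 - a * e^2)^2 - 4 * b * e ^ 4)" unfolding padic_sol_def by blast
 show False
 proof (cases "p dvd e")
  case False
  define u where "u = gam * ((a^2 - 4 * b) * e ^ 4) + p * (gam * (p * gam^2 * m ^ 4 - 2 * a * gam * m^2 * e^2))"
  have "al * ((al * m^2 - a * e^2)^2 - 4 * b * e ^ 4) = p ^ 1 * u"
   unfolding u_def al(1) by (simp add: power2_eq_square power4_eq_xxxx algebra_simps)
  moreover have "~ p dvd gam * ((a^2 - 4 * b) * e ^ 4)"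
   using al(2) c False prime_dvd_mult_iff[OF p] prime_dvd_power_iff[OF p] by simp
  then have "~ p dvd u" unfolding u_def by (simp add: dvd_add_left_iff)
  moreover have "p ^ Suc 1 dvd p ^ 4" by (rule le_imp_power_dvd) simp
  ultimately show False using prime_power_unit_not_square[OF p, of u 1 N] dvd_trans[OF _ N, of "p ^ Suc 1"] by simp
 next
  case True
  then obtain f where f: "e = p * f" by blast
  have m: "~ p dvd m" using me True by blast
  define u where "u = gam ^ 3 * m ^ 4 + p * (gam * ((a^2 - 4 * b) * f ^ 4 * p - 2 * a * gam * m^2 * f^2))"
  have "al * ((al * m^2 - a * e^2)^2 - 4 * b * e ^ 4) = p ^ 3 * u"
   unfolding u_def al(1) f by (simp add: power2_eq_square power3_eq_cube power4_eq_xxxx algebra_simps)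
  moreover have "~ p dvd gam ^ 3 * m ^ 4" using al(2) m prime_dvd_mult_iff[OF p] prime_dvd_power_iff[OF p] by simp
  then have "~ p dvd u" unfolding u_def by (simp add: dvd_add_left_iff)
  ultimately show False using prime_power_unit_not_square[OF p, of u 3 N] N by simp
 qed
qed

lemma QuadRes_divide_square:
 assumes q: "prime (q::int)" and that: "q dvd y^2 - v * w^2" "~ q dvd w"
 shows "QuadRes q v"
proof -
 have "coprime w q" using prime_imp_coprime[OF q that(2)] by (simp add: coprime_commute)
 then obtain i where i: "[w * i = 1] (mod q)" using cong_solve_coprime_int by blast
 have "[y^2 = v * w^2] (mod q)" using that(1) by (simp add: cong_iff_dvd_diff)
 then have "[y^2 * i^2 = v * w^2 * i^2] (mod q)" by (intro cong_mult cong_refl)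
 also have "[v * w^2 * i^2 = v * (w * i)^2] (mod q)" by (simp add: power_mult_distrib algebra_simps)
 also have "[v * (w * i)^2 = v * 1^2] (mod q)" by (intro cong_mult cong_pow i cong_refl)
 finally have "[(y * i)^2 = v] (mod q)" by (simp add: power_mult_distrib)
 then show ?thesis unfolding QuadRes_def by blast
qed

text \<open>If q does not divide m, the right side is al (al m^2)^2 modulo \<open>q\<close>. If it
  does, N is divisible by q, and dividing by q^2 leaves al (a^2 - 4 b) (D1 e^2)^2. The alternatives
  are the classes of infinity and of the origin.\<close>

lemma padic_sol_twist_unit:
 assumes q: "prime (q::int)" and D: "D = q * D1" "~ q dvd D1" and al: "~ q dvd al"
  and sol: "padic_sol q (a * D) (b * D^2) al"
 shows "QuadRes q al \<or> QuadRes q (al * (a^2 - 4 * b))"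
proof -
 from sol obtain m e N where me: "~ (q dvd m & q dvd e)"
  and N: "q ^ 3 dvd N^2 - al * ((al * m^2 - a * D * e^2)^2 - 4 * (b * D^2) * e ^ 4)" unfolding padic_sol_def by blast
 show ?thesis
 proof (cases "q dvd m")
  case False
  have "N^2 - al * ((al * m^2 - a * D * e^2)^2 - 4 * (b * D^2) * e ^ 4) =
    (N^2 - al * (al * m^2)^2) + q * (al * D1 * e^2 * (2 * a * al * m^2 - (a^2 - 4 * b) * D * e^2))"
   unfolding D(1) by (simp add: power2_eq_square power4_eq_xxxx algebra_simps)
  moreover have "q dvd q ^ 3" by simp
  ultimately have "q dvd N^2 - al * (al * m^2)^2" using dvd_trans[OF _ N, of q] by (metis dvd_add_left_iff dvd_triv_left)
  moreover have "~ q dvd al * m^2" using al False prime_dvd_mult_iff[OF q] by (simp add: power2_eq_square)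
  ultimately show ?thesis using QuadRes_divide_square[OF q] by blast
 next
  case True
  then obtain m1 where m1: "m = q * m1" by blast
  have e: "~ q dvd e" using me True by blast
  let ?X = "al * (a^2 - 4 * b) * (D1 * e^2)^2 + q * (al * (q * al^2 * m1 ^ 4 - 2 * a * D1 * al * m1^2 * e^2))"
  have eq: "al * ((al * m^2 - a * D * e^2)^2 - 4 * (b * D^2) * e ^ 4) = q^2 * ?X"
   unfolding D(1) m1 by (simp add: power2_eq_square power4_eq_xxxx algebra_simps)
  have "q^2 dvd N^2 - q^2 * ?X" using N unfolding eq by (rule power_le_dvd) simp
  from dvd_shift[OF this] have "q^2 dvd N^2" by simp
  then have "q dvd N" by (simp add: pow_divides_pow_iff)
  then obtain N1 where N1: "N = q * N1" by blast
  have "q^2 * q dvd q^2 * (N1^2 - ?X)" using N unfolding eq N1 power_mult_distrib right_diff_distrib[symmetric] by (simp only: power3_eq_cube power2_eq_square)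
  then have "q dvd N1^2 - ?X" using q by (subst (asm) dvd_mult_cancel_left) auto
  then have "q dvd (N1^2 - ?X) + q * (al * (q * al^2 * m1 ^ 4 - 2 * a * D1 * al * m1^2 * e^2))" by (intro dvd_add) auto
  then have "q dvd N1^2 - al * (a^2 - 4 * b) * (D1 * e^2)^2" by simp
  moreover have "~ q dvd D1 * e^2" using D(2) e prime_dvd_mult_iff[OF q] by (simp add: power2_eq_square)
  ultimately show ?thesis using QuadRes_divide_square[OF q] by blast
 qed
qed

text \<open>The right side is q^3 times D1^3 gam times a quartic form in (m, e). By parity of the
  valuation q must divide the form, and dividing by e^4 gives the root w = gam (m / e)^2.\<close>

lemma padic_sol_twist_ramified:
 assumes q: "prime (q::int)" and D: "D = q * D1" "~ q dvd D1" and gam: "~ q dvd gam"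
  and sol: "padic_sol q (a * D) (b * D^2) (D * gam)"
 shows "\<exists>w. q dvd (w - a)^2 - 4 * b & QuadRes q (gam * w)"
proof -
 from sol obtain m e N where me: "~ (q dvd m & q dvd e)"
  and N: "q ^ 4 dvd N^2 - D * gam * ((D * gam * m^2 - a * D * e^2)^2 - 4 * (b * D^2) * e ^ 4)" unfolding padic_sol_def by blast
 let ?B = "(gam * m^2 - a * e^2)^2 - 4 * b * e ^ 4"
 have eq: "D * gam * ((D * gam * m^2 - a * D * e^2)^2 - 4 * (b * D^2) * e ^ 4) = q ^ 3 * (D1 ^ 3 * gam * ?B)"
  unfolding D(1) by (simp add: power2_eq_square power3_eq_cube power4_eq_xxxx algebra_simps)
 have "q dvd D1 ^ 3 * gam * ?B" using prime_power_unit_not_square[OF q, of "D1 ^ 3 * gam * ?B" 3 N] N unfolding eq by auto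
 then have B: "q dvd ?B" using D(2) gam prime_dvd_mult_iff[OF q] prime_dvd_power_iff[OF q] by auto
 have e: "~ q dvd e"
 proof
  assume e: "q dvd e"
  have "?B = gam\<^sup>2 * m ^ 4 + e * (e * (- 2 * a * gam * m\<^sup>2 + (a\<^sup>2 - 4 * b) * e\<^sup>2))" by (simp add: power2_eq_square power4_eq_xxxx algebra_simps)
  then have "q dvd gam^2 * m ^ 4" using B e by (metis dvd_add_left_iff dvd_mult2)
  then have "q dvd m" using gam prime_dvd_mult_iff[OF q] prime_dvd_power_iff[OF q] by simp
  then show False using me e by blast
 qed
 have "coprime e q" using prime_imp_coprime[OF q e] by (simp add: coprime_commute)
 then obtain i where i: "[e * i = 1] (mod q)" using cong_solve_coprime_int by blast
 define w where "w = gam * (m * i)^2"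
 have "[(w - a)^2 - 4 * b = (w - a * 1^2)^2 - 4 * b * 1 ^ 4] (mod q)" by simp
 also have "[(w - a * 1^2)^2 - 4 * b * 1 ^ 4 = (w - a * (e * i)^2)^2 - 4 * b * (e * i) ^ 4] (mod q)"
  using cong_sym[OF i] by (intro cong_diff cong_mult cong_pow cong_refl)
 also have "(w - a * (e * i)^2)^2 - 4 * b * (e * i) ^ 4 = i ^ 4 * ?B"
  unfolding w_def by (simp add: power2_eq_square power4_eq_xxxx algebra_simps)
 finally have "q dvd (w - a)^2 - 4 * b" using B by (metis cong_dvd_iff dvd_mult)
 moreover have "QuadRes q (gam * w)" using QuadRes_square[of q "gam * (m * i)"] unfolding w_def by (simp add: power2_eq_square algebra_simps)
 ultimately show ?thesis by blast
qed

text \<open>The root lifts to a zero of the quartic, so \<open>N = 0\<close> solves the equation: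
  the class is that of a 2-torsion point.\<close>

lemma padic_sol_twist_ramifiedI:
 assumes q: "prime (q::int)" "odd q" and b: "~ q dvd b" and gam: "~ q dvd gam"
  and w: "q dvd (w - a)^2 - 4 * b" "~ q dvd w" "QuadRes q (gam * w)"
 shows "padic_sol q (a * D) (b * D^2) (D * gam)"
proof (rule padic_solI)
 fix M
 obtain m where m: "q ^ M dvd (gam * m^2 - a)^2 - 4 * b" using padic_sol_root[OF q b gam w] by blast
 have "0\<^sup>2 - D * gam * ((D * gam * m\<^sup>2 - a * D * 1\<^sup>2)\<^sup>2 - 4 * (b * D\<^sup>2) * 1 ^ 4) = - (D * gam * D\<^sup>2) * ((gam * m\<^sup>2 - a)\<^sup>2 - 4 * b)"
  by (simp add: power2_eq_square algebra_simps)
 then have "q ^ M dvd 0^2 - D * gam * ((D * gam * m^2 - a * D * 1^2)^2 - 4 * (b * D^2) * 1 ^ 4)" using m by (metis dvd_mult)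
 moreover have "~ (q dvd m & q dvd 1)" using q by auto
 ultimately show "\<exists>m e N. ~ (q dvd m & q dvd e) &
   q ^ M dvd N^2 - D * gam * ((D * gam * m^2 - a * D * e^2)^2 - 4 * (b * D^2) * e ^ 4)" by blast
qed

section \<open>Absolute values and completions of the rationals\<close>

lemma padic_val_fraction:
 assumes p: "prime p" and ab: "a ~= 0" "b ~= (0::int)"
 shows "padic_val p (of_int a / of_int b) = int (multiplicity (int p) a) - int (multiplicity (int p) b)"
proof -
 obtain n d where nd: "quotient_of (of_int a / of_int b) = (n, d)" by (cases "quotient_of (of_int a / of_int b)")
 have d: "d > 0" using quotient_of_denom_pos[OF nd] .
 have eq: "(of_int a / of_int b :: rat) = of_int n / of_int d" using quotient_of_div[OF nd] .
 then have "(of_int (a * d) :: rat) = of_int (n * b)" using ab d by (simp add: field_simps)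
 then have e: "a * d = n * b" by (simp only: of_int_eq_iff)
 have n: "n ~= 0" using e ab d by auto
 have pe: "prime_elem (int p)" using p by simp
 have "multiplicity (int p) a + multiplicity (int p) d = multiplicity (int p) n + multiplicity (int p) b"
  using prime_elem_multiplicity_mult_distrib[OF pe ab(1), of d] prime_elem_multiplicity_mult_distrib[OF pe n ab(2)] e d by simp
 then show ?thesis unfolding padic_val_def nd by simp
qed

lemma padic_val_of_int: "prime p ==> n ~= 0 ==> padic_val p (of_int n) = int (multiplicity (int p) n)"
 using padic_val_fraction[of p n 1] by simp

lemma rat_fraction: obtains a b where "x = (of_int a / of_int b :: rat)" "b ~= 0"
 using quotient_of_div[of x] quotient_of_denom_pos[of x] by (cases "quotient_of x") fastforce

lemma padic_val_mult:
 assumes p: "prime p" and "x ~= 0" "y ~= 0"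
 shows "padic_val p (x * y) = padic_val p x + padic_val p y"
proof -
 obtain a b where x: "x = of_int a / of_int b" "b ~= 0" by (rule rat_fraction)
 obtain c d where y: "y = of_int c / of_int d" "d ~= 0" by (rule rat_fraction)
 have ac: "a ~= 0" "c ~= 0" using assms x y by auto
 have "x * y = of_int (a * c) / of_int (b * d)" using x y by simp
 moreover have pe: "prime_elem (int p)" using p by simp
 ultimately show ?thesis
  using padic_val_fraction[OF p ac(1) x(2)] padic_val_fraction[OF p ac(2) y(2)]
   padic_val_fraction[OF p, of "a * c" "b * d"] ac x y
   prime_elem_multiplicity_mult_distrib[OF pe ac] prime_elem_multiplicity_mult_distrib[OF pe x(2) y(2)]
  by simp
qed

lemma padic_val_add:
 assumes p: "prime p" and "x ~= 0" "y ~= 0" "x + y ~= 0"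
 shows "padic_val p (x + y) \<ge> min (padic_val p x) (padic_val p y)"
proof -
 obtain a b where x: "x = of_int a / of_int b" "b ~= 0" by (rule rat_fraction)
 obtain c d where y: "y = of_int c / of_int d" "d ~= 0" by (rule rat_fraction)
 have ac: "a ~= 0" "c ~= 0" using assms x y by auto
 have pe: "prime_elem (int p)" using p by simp
 have eq: "x + y = of_int (a * d + c * b) / of_int (b * d)" using x y by (simp add: field_simps)
 have nz: "a * d + c * b ~= 0" using assms(4) unfolding eq by (metis div_0 of_int_0)
 let ?m = "multiplicity (int p)"
 have "int p ^ min (?m (a * d)) (?m (c * b)) dvd a * d + c * b"
  by (intro dvd_add; rule multiplicity_dvd') auto
 then have "?m (a * d + c * b) \<ge> min (?m (a * d)) (?m (c * b))"
  using nz p by (intro multiplicity_geI) auto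
 then show ?thesis
  unfolding eq using padic_val_fraction[OF p nz, of "b * d"] padic_val_fraction[OF p ac(1) x(2)] padic_val_fraction[OF p ac(2) y(2)]
   prime_elem_multiplicity_mult_distrib[OF pe ac(1) y(2)] prime_elem_multiplicity_mult_distrib[OF pe ac(2) x(2)]
   prime_elem_multiplicity_mult_distrib[OF pe x(2) y(2)] x y by (simp add: min_def split: if_splits)
qed

lemma place_abs_mult:
 assumes "v \<in> places" shows "place_abs v (x * y) = place_abs v x * place_abs v y"
proof (cases v)
 case Infinite_place then show ?thesis by (simp add: of_rat_mult abs_mult)
next
 case (Finite_place p)
 then have p: "prime p" using assms unfolding places_def by auto
 then have "real p ~= 0" by auto
 then have "real p powi (- (m + n)) = real p powi (- m) * real p powi (- n)" for m n
  using power_int_add[of "real p" "- m" "- n"] by simp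
 then show ?thesis using Finite_place padic_val_mult[OF p, of x y] by (cases "x = 0 \<or> y = 0") auto
qed

lemma place_abs_ultra:
 assumes p: "prime p"
 shows "place_abs (Finite_place p) (x + y) \<le> max (place_abs (Finite_place p) x) (place_abs (Finite_place p) y)"
proof -
 have p1: "real p \<ge> 1" using prime_ge_1_nat[OF p] by simp
 show ?thesis
 proof (cases "x = 0 \<or> y = 0 \<or> x + y = 0")
  case True then show ?thesis using p1 by (auto simp: le_max_iff_disj)
 next
  case False
  then have "min (padic_val p x) (padic_val p y) \<le> padic_val p (x + y)" using padic_val_add[OF p] by blast
  then have "- padic_val p (x + y) \<le> - padic_val p x \<or> - padic_val p (x + y) \<le> - padic_val p y" by linarith
  then have "real p powi (- padic_val p (x + y)) \<le> real p powi (- padic_val p x) \<or> real p powi (- padic_val p (x + y)) \<le> real p powi (- padic_val p y)"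
   using p1 power_int_increasing[of _ _ "real p"] by blast
  then show ?thesis using False by (auto simp: le_max_iff_disj)
 qed
qed

lemma place_abs_nonneg [simp]: "place_abs v x \<ge> 0"
 by (cases v) auto

lemma place_abs_0 [simp]: "place_abs v 0 = 0"
 by (cases v) auto

lemma place_abs_eq_0: "v \<in> places ==> place_abs v x = 0 \<longleftrightarrow> x = 0"
 by (cases v) (auto simp: places_def dest: prime_gt_0_nat)

lemma place_abs_1 [simp]: "v \<in> places ==> place_abs v 1 = 1"
proof -
 assume v: "v \<in> places"
 have "place_abs v 1 = place_abs v 1 * place_abs v 1" using place_abs_mult[OF v, of 1 1] by simp
 then show ?thesis using place_abs_eq_0[OF v, of 1] by simp
qed

lemma place_abs_minus: "v \<in> places ==> place_abs v (- x) = place_abs v x"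
proof -
 assume v: "v \<in> places"
 have "(place_abs v (- x))\<^sup>2 = (place_abs v x)\<^sup>2" using place_abs_mult[OF v, of "- x" "- x"] place_abs_mult[OF v, of x x] by (simp add: power2_eq_square)
 then show ?thesis by (simp add: power2_eq_iff_nonneg)
qed

lemma place_abs_triangle:
 assumes "v \<in> places" shows "place_abs v (x + y) \<le> place_abs v x + place_abs v y"
proof (cases v)
 case Infinite_place
 then show ?thesis using abs_triangle_ineq[of "of_rat x :: real" "of_rat y"] by (simp add: of_rat_add)
next
 case (Finite_place p)
 then have "prime p" using assms unfolding places_def by auto
 then have "place_abs v (x + y) \<le> max (place_abs v x) (place_abs v y)" unfolding Finite_place by (rule place_abs_ultra)
 then show ?thesis using place_abs_nonneg[of v x] place_abs_nonneg[of v y] by linarith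
qed

lemma place_abs_of_int_pow_dvd:
 assumes p: "prime p"
 shows "place_abs (Finite_place p) (of_int n) \<le> real p powi (- int M) \<longleftrightarrow> int p ^ M dvd n"
proof (cases "n = 0")
 case False
 have "real p > 1" using prime_gt_1_nat[OF p] by simp
 then have "place_abs (Finite_place p) (of_int n) \<le> real p powi (- int M) \<longleftrightarrow> - padic_val p (of_int n) \<le> - int M"
 proof -
  have "real p powi m \<le> real p powi k \<longleftrightarrow> m \<le> k" for m k
   using power_int_strict_increasing[of k m "real p"] power_int_increasing[of m k "real p"] \<open>real p > 1\<close>
   by (cases "m \<le> k") auto
  then show ?thesis using False by simp
 qed
 also have "\<dots> \<longleftrightarrow> M \<le> multiplicity (int p) n" using padic_val_of_int[OF p False] by simp
 also have "\<dots> \<longleftrightarrow> int p ^ M dvd n"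
  by (rule power_dvd_iff_le_multiplicity[symmetric]) (use False not_prime_unit[of "int p"] p in auto)
 finally show ?thesis .
qed (use prime_gt_0_nat[OF p] in auto)

lemma place_abs_of_int_le_1: "prime p ==> place_abs (Finite_place p) (of_int n) \<le> 1"
 using place_abs_of_int_pow_dvd[of p n 0] by simp

lemma place_abs_of_int_eq_1: "prime p ==> place_abs (Finite_place p) (of_int n) = 1 \<longleftrightarrow> ~ int p dvd n"
proof -
 assume p: "prime p"
 have p1: "real p > 1" using prime_gt_1_nat[OF p] by simp
 show ?thesis
 proof (cases "n = 0")
  case False
  have "real p ^ m = 1 \<longleftrightarrow> m = 0" for m using one_less_power[OF p1, of m] by (cases m) auto
  then have "place_abs (Finite_place p) (of_int n) = 1 \<longleftrightarrow> multiplicity (int p) n = 0"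
   using False padic_val_of_int[OF p False] by (simp add: power_int_minus)
  moreover have "multiplicity (int p) n > 0 \<longleftrightarrow> int p dvd n"
   by (rule multiplicity_gt_zero_iff[OF False]) (use not_prime_unit[of "int p"] p in auto)
  ultimately show ?thesis by auto
 qed simp
qed

definition cauchy_seq :: "place => (nat => rat) => bool" where
 "cauchy_seq v f \<longleftrightarrow> (\<forall>e>0. \<exists>N. \<forall>m\<ge>N. \<forall>n\<ge>N. place_abs v (f m - f n) < e)"

definition null_seq :: "place => (nat => rat) => bool" where
 "null_seq v f \<longleftrightarrow> (%n. place_abs v (f n)) \<longlonglongrightarrow> 0"

lemma cauchy_ring_simps [simp]:
 "carrier (cauchy_ring v) = {f. cauchy_seq v f}"
 "f \<otimes>\<^bsub>cauchy_ring v\<^esub> g = (%n. f n * g n)" "f \<oplus>\<^bsub>cauchy_ring v\<^esub> g = (%n. f n + g n)"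
 "\<one>\<^bsub>cauchy_ring v\<^esub> = (%n. 1)" "\<zero>\<^bsub>cauchy_ring v\<^esub> = (%n. 0)"
 by (simp_all add: cauchy_ring_def cauchy_seq_def)

lemma null_sequences_eq: "null_sequences v = {f. null_seq v f}"
 by (simp add: null_sequences_def null_seq_def)

context
 fixes v assumes v: "v \<in> places"
begin

lemma null_seq_iff: "null_seq v f \<longleftrightarrow> (\<forall>e>0. \<exists>N. \<forall>n\<ge>N. place_abs v (f n) < e)"
 unfolding null_seq_def LIMSEQ_iff by simp

lemma place_abs_diff: "place_abs v (x - y) \<le> place_abs v x + place_abs v y"
 using place_abs_triangle[OF v, of x "- y"] place_abs_minus[OF v, of y] by simp

lemma cauchy_seq_const: "cauchy_seq v (%n. x)"
 by (simp add: cauchy_seq_def)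

lemma cauchy_seq_add: assumes "cauchy_seq v f" "cauchy_seq v g" shows "cauchy_seq v (%n. f n + g n)"
 unfolding cauchy_seq_def
proof (intro allI impI)
 fix e :: real assume "e > 0"
 then have e2: "e / 2 > 0" by simp
 obtain N1 where N1: "\<And>m n. m \<ge> N1 ==> n \<ge> N1 ==> place_abs v (f m - f n) < e / 2" using assms(1) e2 unfolding cauchy_seq_def by blast
 obtain N2 where N2: "\<And>m n. m \<ge> N2 ==> n \<ge> N2 ==> place_abs v (g m - g n) < e / 2" using assms(2) e2 unfolding cauchy_seq_def by blast
 show "\<exists>N. \<forall>m\<ge>N. \<forall>n\<ge>N. place_abs v (f m + g m - (f n + g n)) < e"
 proof (intro exI[of _ "max N1 N2"] allI impI)
  fix m n assume "max N1 N2 \<le> m" "max N1 N2 \<le> n"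
  then have "place_abs v (f m - f n) < e / 2" "place_abs v (g m - g n) < e / 2" using N1 N2 by auto
  moreover have eq: "f m + g m - (f n + g n) = (f m - f n) + (g m - g n)" by simp
  ultimately show "place_abs v (f m + g m - (f n + g n)) < e"
   using place_abs_triangle[OF v, of "f m - f n" "g m - g n"] unfolding eq by linarith
 qed
qed

lemma cauchy_seq_bounded: assumes "cauchy_seq v f" shows "\<exists>B>0. \<forall>n. place_abs v (f n) \<le> B"
proof -
 have "(1::real) > 0" by simp
 then obtain N where N: "\<And>m n. m \<ge> N ==> n \<ge> N ==> place_abs v (f m - f n) < 1" using assms unfolding cauchy_seq_def by blast
 define B where "B = Max ((%n. place_abs v (f n)) ` {..N}) + 1"
 have le: "place_abs v (f n) \<le> B - 1" if "n \<le> N" for n unfolding B_def using that by simp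
 have B: "B > 0" using le[of N] place_abs_nonneg[of v "f N"] by linarith
 have "place_abs v (f n) \<le> B" for n
 proof (cases "n \<le> N")
  case True then show ?thesis using le[of n] by simp
 next
  case False
  then have "place_abs v (f n - f N) < 1" using N by simp
  moreover have "place_abs v (f n) \<le> place_abs v (f n - f N) + place_abs v (f N)" using place_abs_triangle[OF v, of "f n - f N" "f N"] by simp
  ultimately show ?thesis using le[of N] by simp
 qed
 then show ?thesis using B by blast
qed

lemma null_seq_mult_bounded:
 assumes "null_seq v f" "\<And>n. place_abs v (g n) \<le> B" shows "null_seq v (%n. f n * g n)"
 unfolding null_seq_iff
proof (intro allI impI)
 fix e :: real assume e: "e > 0"
 have B: "B \<ge> 0" using assms(2)[of 0] place_abs_nonneg[of v "g 0"] by linarith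
 have "e / (B + 1) > 0" using e B by simp
 then obtain N where N: "\<And>n. n \<ge> N ==> place_abs v (f n) < e / (B + 1)"
  using assms(1) unfolding null_seq_iff by blast
 show "\<exists>N. \<forall>n\<ge>N. place_abs v (f n * g n) < e"
 proof (intro exI[of _ N] allI impI)
  fix n assume "N \<le> n"
  have "place_abs v (f n * g n) \<le> place_abs v (f n) * (B + 1)"
   unfolding place_abs_mult[OF v] using assms(2)[of n] by (intro mult_left_mono) auto
  also have "\<dots> < e / (B + 1) * (B + 1)" using N[OF \<open>N \<le> n\<close>] B by (intro mult_strict_right_mono) auto
  finally show "place_abs v (f n * g n) < e" using B by simp
 qed
qed

lemma null_seq_add: assumes "null_seq v f" "null_seq v g" shows "null_seq v (%n. f n + g n)"
proof -
 have "(%n. place_abs v (f n) + place_abs v (g n)) \<longlonglongrightarrow> 0 + 0" using assms unfolding null_seq_def by (rule tendsto_add)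
 then have "(%n. place_abs v (f n) + place_abs v (g n)) \<longlonglongrightarrow> 0" by simp
 then show ?thesis unfolding null_seq_def
  by (rule tendsto_sandwich[OF _ _ tendsto_const, rotated 2]) (auto intro: always_eventually place_abs_triangle[OF v])
qed

lemma null_seq_minus: "null_seq v f ==> null_seq v (%n. - f n)"
 unfolding null_seq_def by (simp only: place_abs_minus[OF v])

lemma cauchy_seq_mult: assumes f: "cauchy_seq v f" and g: "cauchy_seq v g" shows "cauchy_seq v (%n. f n * g n)"
 unfolding cauchy_seq_def
proof (intro allI impI)
 fix e :: real assume e: "e > 0"
 obtain B where B: "B > 0" "\<And>n. place_abs v (f n) \<le> B" using cauchy_seq_bounded[OF f] by blast
 obtain D where D: "D > 0" "\<And>n. place_abs v (g n) \<le> D" using cauchy_seq_bounded[OF g] by blast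
 have "e / (2 * D) > 0" "e / (2 * B) > 0" using e B D by auto
 then obtain N1 N2 where N1: "\<And>m n. m \<ge> N1 ==> n \<ge> N1 ==> place_abs v (f m - f n) < e / (2 * D)"
  and N2: "\<And>m n. m \<ge> N2 ==> n \<ge> N2 ==> place_abs v (g m - g n) < e / (2 * B)" using f g unfolding cauchy_seq_def by meson
 show "\<exists>N. \<forall>m\<ge>N. \<forall>n\<ge>N. place_abs v (f m * g m - f n * g n) < e"
 proof (intro exI[of _ "max N1 N2"] allI impI)
  fix m n assume "max N1 N2 \<le> m" "max N1 N2 \<le> n"
  then have a: "place_abs v (f m - f n) < e / (2 * D)" "place_abs v (g m - g n) < e / (2 * B)" using N1 N2 by auto
  have "f m * g m - f n * g n = (f m - f n) * g m + (g m - g n) * f n" by (simp add: algebra_simps)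
  then have "place_abs v (f m * g m - f n * g n) \<le> place_abs v (f m - f n) * place_abs v (g m) + place_abs v (g m - g n) * place_abs v (f n)"
   using place_abs_triangle[OF v, of "(f m - f n) * g m" "(g m - g n) * f n"] by (simp only: place_abs_mult[OF v])
  also have "\<dots> \<le> place_abs v (f m - f n) * D + place_abs v (g m - g n) * B"
   using B(2)[of n] D(2)[of m] by (intro add_mono mult_left_mono) auto
  also have "\<dots> < e / (2 * D) * D + e / (2 * B) * B"
   using a B(1) D(1) by (intro add_strict_mono mult_strict_right_mono)
  also have "\<dots> = e" using B(1) D(1) by simp
  finally show "place_abs v (f m * g m - f n * g n) < e" .
 qed
qed

lemma cauchy_seq_minus: "cauchy_seq v f ==> cauchy_seq v (%n. - f n)"
 using cauchy_seq_mult[OF cauchy_seq_const[of "-1"]] by simp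

lemma null_imp_cauchy: assumes "null_seq v f" shows "cauchy_seq v f"
 unfolding cauchy_seq_def
proof (intro allI impI)
 fix e :: real assume "e > 0"
 then have "e / 2 > 0" by simp
 then obtain N where N: "\<And>n. n \<ge> N ==> place_abs v (f n) < e / 2" using assms unfolding null_seq_iff by blast
 show "\<exists>N. \<forall>m\<ge>N. \<forall>n\<ge>N. place_abs v (f m - f n) < e"
 proof (intro exI[of _ N] allI impI)
  fix m n assume "N \<le> m" "N \<le> n"
  then show "place_abs v (f m - f n) < e" using N[of m] N[of n] place_abs_diff[of "f m" "f n"] by linarith
 qed
qed

lemma cauchy_not_null_bounded_below:
 assumes f: "cauchy_seq v f" "~ null_seq v f"
 shows "\<exists>c>0. \<exists>N. \<forall>n\<ge>N. place_abs v (f n) \<ge> c"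
proof -
 from f(2) obtain e where e: "e > 0" "\<And>N. \<exists>n\<ge>N. place_abs v (f n) \<ge> e" unfolding null_seq_iff by (meson not_le)
 have "e / 2 > 0" using e by simp
 then obtain N where N: "\<And>m n. m \<ge> N ==> n \<ge> N ==> place_abs v (f m - f n) < e / 2" using f(1) unfolding cauchy_seq_def by blast
 obtain k where k: "k \<ge> N" "place_abs v (f k) \<ge> e" using e(2) by blast
 have "place_abs v (f n) \<ge> e / 2" if "n \<ge> N" for n
 proof -
  have "place_abs v (f k) \<le> place_abs v (f k - f n) + place_abs v (f n)" using place_abs_triangle[OF v, of "f k - f n" "f n"] by simp
  then show ?thesis using N[OF k(1) that] k(2) by linarith
 qed
 then show ?thesis using e(1) by (intro exI[of _ "e / 2"]) auto
qed

lemma cauchy_cring: "cring (cauchy_ring v)"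
proof (rule cringI)
 show "abelian_group (cauchy_ring v)"
 proof (rule abelian_groupI)
  fix f assume "f \<in> carrier (cauchy_ring v)"
  then show "\<exists>g\<in>carrier (cauchy_ring v). g \<oplus>\<^bsub>cauchy_ring v\<^esub> f = \<zero>\<^bsub>cauchy_ring v\<^esub>"
   using cauchy_seq_minus by (intro bexI[of _ "%n. - f n"]) auto
 qed (auto simp: cauchy_seq_add cauchy_seq_const add_ac)
 show "comm_monoid (cauchy_ring v)"
  by (rule comm_monoidI) (auto simp: cauchy_seq_mult cauchy_seq_const mult_ac)
qed (auto simp: algebra_simps)

lemma null_ideal: "ideal (null_sequences v) (cauchy_ring v)"
proof (rule idealI)
 interpret cring "cauchy_ring v" by (rule cauchy_cring)
 show "ring (cauchy_ring v)" by (rule ring_axioms)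
 have inv: "\<ominus>\<^bsub>cauchy_ring v\<^esub> f = (%n. - f n)" if "cauchy_seq v f" for f
  using minus_equality[of "%n. - f n" f] that cauchy_seq_minus by simp
 show "subgroup (null_sequences v) (add_monoid (cauchy_ring v))"
 proof (rule add.subgroupI)
  show "null_sequences v \<subseteq> carrier (cauchy_ring v)" by (auto simp: null_sequences_eq null_imp_cauchy)
  show "null_sequences v ~= {}" by (auto simp: null_sequences_eq null_seq_def intro!: exI[of _ "%n. 0"])
  show "\<ominus>\<^bsub>cauchy_ring v\<^esub> f \<in> null_sequences v" if "f \<in> null_sequences v" for f
   using that inv null_imp_cauchy null_seq_minus by (simp add: null_sequences_eq)
  show "f \<oplus>\<^bsub>cauchy_ring v\<^esub> g \<in> null_sequences v" if "f \<in> null_sequences v" "g \<in> null_sequences v" for f g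
   using that null_seq_add by (simp add: null_sequences_eq)
 qed
 have m: "null_seq v (%n. f n * g n)" if "null_seq v f" "cauchy_seq v g" for f g
  using null_seq_mult_bounded[OF that(1)] cauchy_seq_bounded[OF that(2)] by blast
 show "f \<otimes>\<^bsub>cauchy_ring v\<^esub> g \<in> null_sequences v" if "g \<in> null_sequences v" "f \<in> carrier (cauchy_ring v)" for f g
  using m[of g f] that by (simp add: null_sequences_eq mult.commute)
 show "g \<otimes>\<^bsub>cauchy_ring v\<^esub> f \<in> null_sequences v" if "g \<in> null_sequences v" "f \<in> carrier (cauchy_ring v)" for f g
  using m[of g f] that by (simp add: null_sequences_eq)
qed

lemma cauchy_inverse:
 assumes f: "cauchy_seq v f" "~ null_seq v f"
 shows "\<exists>g. cauchy_seq v g & null_seq v (%n. f n * g n - 1)"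
proof -
 obtain c N where c: "c > 0" and N: "\<And>n. n \<ge> N ==> place_abs v (f n) \<ge> c" using cauchy_not_null_bounded_below[OF f] by blast
 \<comment> \<open>The finitely many initial terms at which \<open>f\<close> may vanish get the
   value 1 / 0 = 0; both claims concern only large indices.\<close>
 define g where "g n = 1 / f n" for n
 have nz: "f n ~= 0" if "n \<ge> N" for n using N[OF that] c by auto
 have "cauchy_seq v g" unfolding cauchy_seq_def
 proof (intro allI impI)
  fix e :: real assume "e > 0"
  then have "e * (c * c) > 0" using c by simp
  then obtain M where M: "\<And>m n. m \<ge> M ==> n \<ge> M ==> place_abs v (f m - f n) < e * (c * c)" using f(1) unfolding cauchy_seq_def by blast
  show "\<exists>N. \<forall>m\<ge>N. \<forall>n\<ge>N. place_abs v (g m - g n) < e"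
  proof (intro exI[of _ "max M N"] allI impI)
   fix m n assume mn: "max M N \<le> m" "max M N \<le> n"
   have z: "f m ~= 0" "f n ~= 0" using nz mn by auto
   have "(g m - g n) * (f m * f n) = f n - f m" unfolding g_def using z by (simp add: field_simps)
   then have "place_abs v (g m - g n) * (place_abs v (f m) * place_abs v (f n)) = place_abs v (f n - f m)" by (metis place_abs_mult[OF v])
   moreover have "place_abs v (g m - g n) * (c * c) \<le> place_abs v (g m - g n) * (place_abs v (f m) * place_abs v (f n))"
    using N[of m] N[of n] mn c by (intro mult_left_mono mult_mono) auto
   moreover have "place_abs v (f n - f m) < e * (c * c)" using M mn by simp
   ultimately have "place_abs v (g m - g n) * (c * c) < e * (c * c)" by linarith
   then show "place_abs v (g m - g n) < e" using c by simp
  qed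
 qed
 moreover have "null_seq v (%n. f n * g n - 1)" unfolding null_seq_iff
 proof (intro allI impI)
  fix e :: real assume "e > 0"
  then show "\<exists>N. \<forall>n\<ge>N. place_abs v (f n * g n - 1) < e" using nz by (intro exI[of _ N]) (simp add: g_def)
 qed
 ultimately show ?thesis by blast
qed

text \<open>The ideal of null sequences is maximal: an ideal containing any other Cauchy sequence
  contains, by \<open>cauchy_inverse\<close>, the constant 1 up to a null sequence.\<close>

lemma completion_field: "field (completion v)"
proof -
 interpret R: cring "cauchy_ring v" by (rule cauchy_cring)
 interpret N: ideal "null_sequences v" "cauchy_ring v" by (rule null_ideal)
 have inv: "\<ominus>\<^bsub>cauchy_ring v\<^esub> f = (%n. - f n)" if "cauchy_seq v f" for f
  using R.minus_equality[of "%n. - f n" f] that cauchy_seq_minus by simp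
 have "maximalideal (null_sequences v) (cauchy_ring v)"
 proof (rule maximalidealI[OF null_ideal])
  have "~ null_seq v (%n. 1)" unfolding null_seq_def using place_abs_1[OF v] by (simp add: tendsto_const_iff)
  then show "carrier (cauchy_ring v) ~= null_sequences v" using cauchy_seq_const[of 1] by (auto simp: null_sequences_eq)
  fix J assume J: "ideal J (cauchy_ring v)" "null_sequences v \<subseteq> J" "J \<subseteq> carrier (cauchy_ring v)"
  interpret J: ideal J "cauchy_ring v" by (rule J(1))
  show "J = null_sequences v \<or> J = carrier (cauchy_ring v)"
  proof (cases "J = null_sequences v")
   case False
   then obtain f where f: "f \<in> J" "f \<notin> null_sequences v" using J(2) by blast
   have fc: "cauchy_seq v f" "~ null_seq v f" using f J(3) by (auto simp: null_sequences_eq)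
   obtain g where g: "cauchy_seq v g" "null_seq v (%n. f n * g n - 1)" using cauchy_inverse[OF fc] by blast
   have a: "(%n. f n * g n) \<in> J" using J.I_r_closed[OF f(1), of g] g(1) by simp
   have "null_seq v (%n. - (f n * g n - 1))" using null_seq_minus[OF g(2)] .
   then have "(%n. - (f n * g n - 1)) \<in> J" using J(2) by (auto simp: null_sequences_eq)
   from J.a_closed[OF a this] have "\<one>\<^bsub>cauchy_ring v\<^esub> \<in> J" by simp
   then show ?thesis using J.one_imp_carrier by simp
  qed simp
 qed
 then show ?thesis unfolding completion_def by (rule maximalideal.quotient_is_field[OF _ cauchy_cring])
qed

definition lim_class :: "(nat => rat) => (nat => rat) set" where
 "lim_class f = null_sequences v +>\<^bsub>cauchy_ring v\<^esub> f"

lemma lim_class_hom: "ring_hom_ring (cauchy_ring v) (completion v) lim_class"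
proof -
 interpret R: cring "cauchy_ring v" by (rule cauchy_cring)
 interpret N: ideal "null_sequences v" "cauchy_ring v" by (rule null_ideal)
 show ?thesis using N.rcos_ring_hom_ring unfolding completion_def lim_class_def[abs_def] .
qed

lemma completion_carrierE:
 assumes "\<xi> \<in> carrier (completion v)" obtains f where "cauchy_seq v f" "\<xi> = lim_class f"
 using assms unfolding completion_def FactRing_def A_RCOSETS_def' lim_class_def by auto

lemma lim_class_closed: "cauchy_seq v f ==> lim_class f \<in> carrier (completion v)"
 and lim_class_mult: "cauchy_seq v f ==> cauchy_seq v g ==> lim_class f \<otimes>\<^bsub>completion v\<^esub> lim_class g = lim_class (%n. f n * g n)"
 and lim_class_add: "cauchy_seq v f ==> cauchy_seq v g ==> lim_class f \<oplus>\<^bsub>completion v\<^esub> lim_class g = lim_class (%n. f n + g n)"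
 and lim_class_zero: "\<zero>\<^bsub>completion v\<^esub> = lim_class (%n. 0)"
 and lim_class_one: "\<one>\<^bsub>completion v\<^esub> = lim_class (%n. 1)"
proof -
 interpret H: ring_hom_ring "cauchy_ring v" "completion v" lim_class by (rule lim_class_hom)
 show "cauchy_seq v f ==> lim_class f \<in> carrier (completion v)" using H.hom_closed[of f] by simp
 show "cauchy_seq v f ==> cauchy_seq v g ==> lim_class f \<otimes>\<^bsub>completion v\<^esub> lim_class g = lim_class (%n. f n * g n)"
  using H.hom_mult[of f g] by simp
 show "cauchy_seq v f ==> cauchy_seq v g ==> lim_class f \<oplus>\<^bsub>completion v\<^esub> lim_class g = lim_class (%n. f n + g n)"
  using H.hom_add[of f g] by simp
 show "\<zero>\<^bsub>completion v\<^esub> = lim_class (%n. 0)" using H.hom_zero by simp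
 show "\<one>\<^bsub>completion v\<^esub> = lim_class (%n. 1)" using H.hom_one by simp
qed

lemma lim_class_eq_0: "cauchy_seq v f ==> lim_class f = \<zero>\<^bsub>completion v\<^esub> \<longleftrightarrow> null_seq v f"
proof -
 assume f: "cauchy_seq v f"
 interpret N: ideal "null_sequences v" "cauchy_ring v" by (rule null_ideal)
 have "\<zero>\<^bsub>completion v\<^esub> = null_sequences v" unfolding completion_def FactRing_def by simp
 moreover have "lim_class f = null_sequences v \<longleftrightarrow> f \<in> null_sequences v"
  unfolding lim_class_def using N.a_rcos_const N.a_rcos_self f by (metis cauchy_ring_simps(1) mem_Collect_eq)
 ultimately show ?thesis by (simp add: null_sequences_eq)
qed

lemma lim_class_eq: "cauchy_seq v f ==> cauchy_seq v g ==> lim_class f = lim_class g \<longleftrightarrow> null_seq v (%n. f n - g n)"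
proof -
 assume f: "cauchy_seq v f" and g: "cauchy_seq v g"
 interpret K: field "completion v" by (rule completion_field)
 have mg: "cauchy_seq v (%n. - g n)" using g by (rule cauchy_seq_minus)
 have d: "cauchy_seq v (%n. f n - g n)" using cauchy_seq_add[OF f mg] by simp
 have "lim_class (%n. - g n) \<oplus>\<^bsub>completion v\<^esub> lim_class g = \<zero>\<^bsub>completion v\<^esub>" using lim_class_add[OF mg g] lim_class_zero by simp
 then have neg: "lim_class (%n. - g n) = \<ominus>\<^bsub>completion v\<^esub> lim_class g"
  using K.minus_equality[of "lim_class (%n. - g n)" "lim_class g"] lim_class_closed g mg by simp
 have "lim_class (%n. f n - g n) = lim_class f \<ominus>\<^bsub>completion v\<^esub> lim_class g"
  using lim_class_add[OF f mg] neg by (simp add: K.minus_eq)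
 then show ?thesis using lim_class_eq_0[OF d] K.r_right_minus_eq[of "lim_class f" "lim_class g"] lim_class_closed f g by simp
qed

lemma of_rat_completion_eq: "of_rat_completion v x = lim_class (%n. x)"
 by (simp add: of_rat_completion_def lim_class_def)

lemma of_int_ring_completion: "of_int_ring (completion v) n = lim_class (%k. of_int n)"
proof -
 interpret K: field "completion v" by (rule completion_field)
 show ?thesis
 proof (induction n rule: int_induct[where k = 0])
  case base show ?case using lim_class_zero by simp
 next
  case (step1 i)
  then show ?case using lim_class_add[OF cauchy_seq_const cauchy_seq_const, of "of_int i" 1]
   by (simp add: K.of_int_ring_add lim_class_one)
 next
  case (step2 i)
  have "of_int_ring (completion v) (i - 1) = of_int_ring (completion v) i \<oplus>\<^bsub>completion v\<^esub> \<ominus>\<^bsub>completion v\<^esub> \<one>\<^bsub>completion v\<^esub>"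
   by (simp add: K.of_int_ring_diff K.minus_eq)
  moreover have "\<ominus>\<^bsub>completion v\<^esub> \<one>\<^bsub>completion v\<^esub> = lim_class (%k. - 1)"
   using K.minus_equality[of "lim_class (%k. - 1)" "\<one>\<^bsub>completion v\<^esub>"] lim_class_add[OF cauchy_seq_const cauchy_seq_const, of "- 1" 1]
    lim_class_closed[OF cauchy_seq_const] by (simp add: lim_class_one lim_class_zero)
  ultimately show ?case using step2 lim_class_add[OF cauchy_seq_const cauchy_seq_const, of "of_int i" "- 1"] by simp
 qed
qed

lemma lim_class_const_eq_0: "lim_class (%n. x) = \<zero>\<^bsub>completion v\<^esub> \<longleftrightarrow> x = 0"
 using lim_class_eq_0[OF cauchy_seq_const, of x] place_abs_eq_0[OF v, of x] by (simp add: null_seq_def tendsto_const_iff)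

lemma of_int_ring_completion_eq_0: "of_int_ring (completion v) n = \<zero>\<^bsub>completion v\<^esub> \<longleftrightarrow> n = 0"
 unfolding of_int_ring_completion lim_class_const_eq_0 by simp

end

section \<open>Integral models and good reduction at odd primes\<close>

definition padic_integral :: "nat => rat => bool" where
 "padic_integral p x \<longleftrightarrow> place_abs (Finite_place p) x \<le> 1"

context
 fixes p :: nat assumes p: "prime p"
begin

lemma finite_place_in_places: "Finite_place p \<in> places"
 using p by (simp add: places_def)

lemma padic_integral_add: "padic_integral p x ==> padic_integral p y ==> padic_integral p (x + y)"
 unfolding padic_integral_def using place_abs_ultra[OF p, of x y] by linarith

lemma padic_integral_mult: "padic_integral p x ==> padic_integral p y ==> padic_integral p (x * y)"
 unfolding padic_integral_def using place_abs_mult[OF finite_place_in_places, of x y]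
 by (simp add: mult_le_one)

lemma padic_integral_minus: "padic_integral p x ==> padic_integral p (- x)"
 unfolding padic_integral_def by (simp add: place_abs_minus[OF finite_place_in_places] del: place_abs.simps)

lemma padic_integral_of_int: "padic_integral p (of_int n)"
 unfolding padic_integral_def using place_abs_of_int_le_1[OF p] .

lemma padic_integral_diff: "padic_integral p x ==> padic_integral p y ==> padic_integral p (x - y)"
 using padic_integral_add[of x "- y"] padic_integral_minus[of y] by simp

lemma padic_integral_numeral: "padic_integral p (numeral n)"
 using padic_integral_of_int[of "numeral n"] by simp

lemma padic_integral_power: "padic_integral p x ==> padic_integral p (x ^ k)"
 by (induction k) (auto intro: padic_integral_mult padic_integral_of_int[of 1, simplified])

lemmas padic_integral_intros =
 padic_integral_add padic_integral_mult padic_integral_minus padic_integral_diff padic_integral_of_int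
 padic_integral_numeral padic_integral_power

lemma padic_integral_half: "odd p ==> padic_integral p (2 * x) ==> padic_integral p x"
proof -
 assume "odd p" "padic_integral p (2 * x)"
 have "~ int p dvd 2"
  using odd_prime_not_dvd_four(1)[of "int p"] p \<open>odd p\<close> by simp
 then have "place_abs (Finite_place p) 2 = 1" using place_abs_of_int_eq_1[OF p, of 2] by simp
 then show ?thesis using \<open>padic_integral p (2 * x)\<close> place_abs_mult[OF finite_place_in_places, of 2 x]
  unfolding padic_integral_def by (simp del: place_abs.simps)
qed

text \<open>If the absolute value of x exceeded 1, the cube would dominate, as the other terms are
  at most the square of that absolute value.\<close>

lemma padic_integral_cubic_root:
 assumes c: "padic_integral p a2" "padic_integral p a4" "padic_integral p a6"
  and root: "x ^ 3 + a2 * x^2 + a4 * x + a6 = 0"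
 shows "padic_integral p x"
proof (rule ccontr)
 let ?N = "place_abs (Finite_place p)"
 note mult = place_abs_mult[OF finite_place_in_places]
 assume "~ padic_integral p x"
 then have x: "?N x > 1" unfolding padic_integral_def by simp
 have c': "?N a2 \<le> 1" "?N a4 \<le> 1" "?N a6 \<le> 1" using c unfolding padic_integral_def by auto
 have x3: "x ^ 3 = - (a2 * x\<^sup>2 + (a4 * x + a6))" using root by (simp add: add_eq_0_iff2 add.assoc)
 have "?N (x ^ 3) = ?N (a2 * x^2 + (a4 * x + a6))" by (simp only: x3 place_abs_minus[OF finite_place_in_places])
 also have "\<dots> \<le> max (?N (a2 * x^2)) (max (?N (a4 * x)) (?N a6))"
  using place_abs_ultra[OF p, of "a2 * x^2" "a4 * x + a6"] place_abs_ultra[OF p, of "a4 * x" a6] by linarith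
 also have "\<dots> \<le> (?N x)^2"
 proof -
  have x2: "?N x \<le> (?N x)^2" using x by (simp add: power2_eq_square del: place_abs.simps)
  have "?N (a2 * x^2) \<le> (?N x)^2"
   using mult_right_mono[OF c'(1), of "(?N x)^2"] by (simp add: mult power2_eq_square del: place_abs.simps)
  moreover have "?N (a4 * x) \<le> (?N x)^2" using mult_right_mono[OF c'(2), of "?N x"] x2 by (simp add: mult del: place_abs.simps)
  moreover have "?N a6 \<le> (?N x)^2" using c'(3) x x2 by linarith
  ultimately show ?thesis by simp
 qed
 finally have "?N x * (?N x)^2 \<le> 1 * (?N x)^2" by (simp add: mult power3_eq_cube power2_eq_square del: place_abs.simps)
 then show False using x by (simp del: place_abs.simps)
qed

text \<open>For odd \<open>p\<close> completing the square is integral and leads to an integral y^2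
  = cubic. The point (0, 0) has moved to the root -r / u^2 of this monic cubic, which is therefore
  integral. Moving it back shows that each integral model has the discriminant of an integral model
  of the original shape.\<close>

lemma integral_models_disc:
 assumes odd: "odd p" and W: "W \<in> integral_models p a b"
 shows "\<exists>u al \<beta>. u ~= 0 & of_int a = al * u^2 & of_int b = \<beta> * u ^ 4 & padic_integral p al & padic_integral p \<beta> &
  weierstrass_disc W = 16 * \<beta>^2 * (al^2 - 4 * \<beta>)"
proof -
 from W obtain u r s t where u: "u ~= 0" and We: "W = change_variables u r s t (Weierstrass 0 (of_int a) 0 (of_int b) 0)"
  and int: "integral_at p W" unfolding integral_models_def by blast
 define S where "S = s / u" define T where "T = t / u ^ 3" define \<rho> where "\<rho> = r / u^2"
 define al where "al = of_int a / u^2" define \<beta> where "\<beta> = of_int b / u ^ 4"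
 have st: "s = S * u" "t = T * u ^ 3" "r = \<rho> * u^2" "of_int a = al * u^2" "of_int b = \<beta> * u ^ 4"
  unfolding S_def T_def \<rho>_def al_def \<beta>_def using u by auto
 define a2 where "a2 = al + 3 * \<rho> - S\<^sup>2"
 define a4 where "a4 = \<beta> + 2 * \<rho> * al + 3 * \<rho>^2 - 2 * S * T"
 define a6 where "a6 = \<rho> * \<beta> + \<rho>^2 * al + \<rho> ^ 3 - T^2"
 have e1: "2 * s / u = 2 * S" unfolding S_def by simp
 have e2: "(of_int a + 3 * r - s^2) / u ^ 2 = a2"
  unfolding a2_def st using u by (simp add: field_simps power2_eq_square)
 have e3: "2 * t / u ^ 3 = 2 * T" unfolding T_def by simp
 have "of_int b + 2 * r * of_int a + 3 * r^2 - 2 * s * t = a4 * u ^ 4"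
  unfolding a4_def st by (simp add: algebra_simps power2_eq_square power3_eq_cube power4_eq_xxxx)
 then have e4: "(of_int b + 2 * r * of_int a + 3 * r^2 - 2 * s * t) / u ^ 4 = a4" using u by simp
 have "r * of_int b + r^2 * of_int a + r ^ 3 - t^2 = a6 * u ^ 6"
  unfolding a6_def st by (simp add: algebra_simps power2_eq_square power3_eq_cube eval_nat_numeral)
 then have e6: "(r * of_int b + r^2 * of_int a + r ^ 3 - t^2) / u ^ 6 = a6" using u by simp
 have We': "W = Weierstrass (2 * S) a2 (2 * T) a4 a6"
  unfolding We change_variables.simps using e1 e2 e3 e4 e6 by simp
 have "padic_integral p (2 * S)" "padic_integral p a2" "padic_integral p (2 * T)" "padic_integral p a4" "padic_integral p a6"
  using int unfolding We' padic_integral_def by auto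
 note i = this
 have S: "padic_integral p S" and T: "padic_integral p T" using padic_integral_half[OF odd] i by auto
 define A2 where "A2 = al + 3 * \<rho>" define A4 where "A4 = \<beta> + 2 * \<rho> * al + 3 * \<rho>^2" define A6 where "A6 = \<rho> * \<beta> + \<rho>^2 * al + \<rho> ^ 3"
 have A: "A2 = a2 + S^2" "A4 = a4 + 2 * (S * T)" "A6 = a6 + T^2" unfolding A2_def A4_def A6_def a2_def a4_def a6_def by simp_all
 have Ai: "padic_integral p A2" "padic_integral p A4" "padic_integral p A6" unfolding A using i S T by (auto intro!: padic_integral_intros)
 have "(- \<rho>) ^ 3 + A2 * (- \<rho>)\<^sup>2 + A4 * (- \<rho>) + A6 = 0"
  unfolding A2_def A4_def A6_def by (simp add: algebra_simps power2_eq_square power3_eq_cube)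
 then have "padic_integral p (- \<rho>)" using padic_integral_cubic_root[OF Ai] by blast
 then have \<rho>: "padic_integral p \<rho>" using padic_integral_minus[of "- \<rho>"] by simp
 have "al = A2 - 3 * \<rho>" unfolding A2_def by simp
 then have al: "padic_integral p al" using Ai \<rho> by (auto intro!: padic_integral_intros)
 have "\<beta> = A4 - 2 * \<rho> * al - 3 * \<rho>\<^sup>2" unfolding A4_def by simp
 then have \<beta>: "padic_integral p \<beta>" using Ai \<rho> al by (auto intro!: padic_integral_intros)
 have "weierstrass_disc W = 16 * \<beta>^2 * (al^2 - 4 * \<beta>)"
 proof -
  have b2: "(2 * S)^2 + 4 * a2 = 4 * A2" and b4: "2 * a4 + 2 * S * (2 * T) = 2 * A4" and b6: "(2 * T)^2 + 4 * a6 = 4 * A6"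
   unfolding A by (simp_all add: power2_eq_square algebra_simps)
  have b8: "(2 * S)^2 * a6 + 4 * a2 * a6 - 2 * S * (2 * T) * a4 + a2 * (2 * T)^2 - a4^2 = 4 * A2 * A6 - A4^2"
   unfolding A by (simp add: power2_eq_square algebra_simps)
  have "weierstrass_disc W = - (4 * A2)\<^sup>2 * (4 * A2 * A6 - A4\<^sup>2) - 8 * (2 * A4) ^ 3 - 27 * (4 * A6)\<^sup>2 + 9 * (4 * A2) * (2 * A4) * (4 * A6)"
   unfolding We' weierstrass_disc.simps Let_def b2 b4 b6 b8 ..
  also have "\<dots> = 16 * (A2^2 * A4^2 - 4 * A2 ^ 3 * A6 - 4 * A4 ^ 3 - 27 * A6^2 + 18 * A2 * A4 * A6)"
   by (simp add: power2_eq_square power3_eq_cube algebra_simps)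
  also have "\<dots> = 16 * \<beta>^2 * (al^2 - 4 * \<beta>)"
   unfolding A2_def A4_def A6_def by (simp add: power2_eq_square power3_eq_cube algebra_simps)
  finally show ?thesis .
 qed
 then show ?thesis using u st al \<beta> by blast
qed

text \<open>The unit discriminant 16 \<beta>^2 (al^2 - 4 \<beta>) has integral factors, so \<beta>
  and al^2 - 4 \<beta> are units. Then b and a^2 - 4 b both have valuation 4 v(u), and
  \<open>k\<close> is v(u), nonnegative because b is an integer.\<close>

lemma good_reduction_scaling:
 assumes odd: "odd p" and good: "good_reduction p a b" and disc: "ell_disc a b ~= 0"
 shows "\<exists>k a' b'. a = int p ^ (2 * k) * a' & b = int p ^ (4 * k) * b' & ~ int p dvd b' & ~ int p dvd a'^2 - 4 * b'"
proof -
 let ?N = "place_abs (Finite_place p)" let ?v = "padic_val p"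
 note mult = place_abs_mult[OF finite_place_in_places]
 from good obtain W where W: "W \<in> integral_models p a b" "?N (weierstrass_disc W) = 1"
  unfolding good_reduction_def minimal_models_def by blast
 from integral_models_disc[OF odd W(1)] obtain u al \<beta> where u: "u ~= 0" and ab: "of_int a = al * u^2" "of_int b = \<beta> * u ^ 4"
  and i: "padic_integral p al" "padic_integral p \<beta>" and d: "weierstrass_disc W = 16 * \<beta>^2 * (al^2 - 4 * \<beta>)" by blast
 have le: "?N \<beta> \<le> 1" "?N (al^2 - 4 * \<beta>) \<le> 1" "?N 16 \<le> 1"
  using i padic_integral_numeral unfolding padic_integral_def[symmetric] by (auto intro!: padic_integral_intros)
 have one: "?N 16 * (?N \<beta> * ?N \<beta>) * ?N (al^2 - 4 * \<beta>) = 1" using W(2) unfolding d by (simp add: mult power2_eq_square del: place_abs.simps)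
 have N\<beta>: "?N \<beta> = 1" and Nc: "?N (al^2 - 4 * \<beta>) = 1"
 proof -
  have nn: "0 \<le> ?N 16" "0 \<le> ?N \<beta>" "0 \<le> ?N (al^2 - 4 * \<beta>)" by (rule place_abs_nonneg)+
  have bb: "?N \<beta> * ?N \<beta> \<le> ?N \<beta>" using le(1) nn(2) by (rule mult_left_le)
  have "?N 16 * (?N \<beta> * ?N \<beta>) \<le> ?N \<beta>" using mult_right_mono[OF le(3), of "?N \<beta> * ?N \<beta>"] bb nn by simp
  then have "?N 16 * (?N \<beta> * ?N \<beta>) \<le> 1" using le(1) by linarith
  then have "1 \<le> ?N (al^2 - 4 * \<beta>)" using mult_right_mono[of "?N 16 * (?N \<beta> * ?N \<beta>)" 1 "?N (al^2 - 4 * \<beta>)"] one nn by simp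
  then show c: "?N (al^2 - 4 * \<beta>) = 1" using le(2) by linarith
  then show "?N \<beta> = 1" using one \<open>?N 16 * (?N \<beta> * ?N \<beta>) \<le> ?N \<beta>\<close> le(1) by simp
 qed
 have p1: "real p > 1" using prime_gt_1_nat[OF p] by simp
 have \<beta>0: "\<beta> ~= 0" and c0: "al^2 - 4 * \<beta> ~= 0" using N\<beta> Nc by auto
 have b0: "b ~= 0" using ab(2) \<beta>0 u by auto
 have pw: "real p powi n = 1 \<longleftrightarrow> n = 0" for n
  using power_int_strict_increasing[of n 0 "real p"] power_int_strict_increasing[of 0 n "real p"] p1 by (cases n "0::int" rule: linorder_cases) auto
 have v\<beta>: "?v \<beta> = 0" and vc: "?v (al^2 - 4 * \<beta>) = 0" using N\<beta> Nc \<beta>0 c0 pw by auto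
 have u2: "?v (u^2) = 2 * ?v u" using padic_val_mult[OF p u u] by (simp add: power2_eq_square)
 have u4: "?v (u ^ 4) = 4 * ?v u" using padic_val_mult[OF p, of "u^2" "u^2"] u u2 by (simp add: power4_eq_xxxx power2_eq_square mult.assoc)
 have vb: "int (multiplicity (int p) b) = 4 * ?v u"
  using padic_val_of_int[OF p b0] padic_val_mult[OF p \<beta>0, of "u ^ 4"] u v\<beta> u4 unfolding ab(2) by simp
 have eqc: "of_int (a^2 - 4 * b) = (al^2 - 4 * \<beta>) * u ^ 4" using ab by (simp add: power2_eq_square power4_eq_xxxx algebra_simps)
 have cz: "a^2 - 4 * b ~= 0"
 proof
  assume "a^2 - 4 * b = 0"
  then have "(of_int (a^2 - 4 * b) :: rat) = 0" by (simp only: of_int_0)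
  then show False unfolding eqc using c0 u by simp
 qed
 have vcc: "int (multiplicity (int p) (a^2 - 4 * b)) = 4 * ?v u"
  using padic_val_of_int[OF p cz] padic_val_mult[OF p c0, of "u ^ 4"] u vc u4 unfolding eqc by simp
 define k where "k = nat (?v u)"
 have k: "?v u = int k" unfolding k_def using vb by simp
 have mb: "multiplicity (int p) b = 4 * k" and mc: "multiplicity (int p) (a^2 - 4 * b) = 4 * k" using vb vcc k by auto
 have pu: "~ is_unit (int p)" using p not_prime_unit[of "int p"] by auto
 have pd: "int p ^ (2 * k) dvd a"
 proof (cases "a = 0")
  case False
  then have al0: "al ~= 0" using ab(1) by auto
  have "?N al \<le> 1" using i(1) unfolding padic_integral_def .
  then have "?v al \<ge> 0" using al0 power_int_strict_increasing[of 0 "- ?v al" "real p"] p1 by (cases "?v al \<ge> 0") auto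
  then have "int (multiplicity (int p) a) \<ge> 2 * int k"
   using padic_val_of_int[OF p False] padic_val_mult[OF p al0, of "u^2"] u u2 k unfolding ab(1) by simp
  then show ?thesis by (intro multiplicity_dvd') simp
 qed simp
 then obtain a' where a': "a = int p ^ (2 * k) * a'" by blast
 have "int p ^ (4 * k) dvd b" using mb by (intro multiplicity_dvd') simp
 then obtain b' where b': "b = int p ^ (4 * k) * b'" by blast
 have nb: "~ int p dvd b'"
 proof
  assume "int p dvd b'"
  then have "int p ^ Suc (4 * k) dvd b" unfolding b' by (simp add: mult_dvd_mono mult.commute)
  then have "Suc (4 * k) \<le> multiplicity (int p) b" using b0 pu by (intro multiplicity_geI) auto
  then show False using mb by simp
 qed
 have c': "a^2 - 4 * b = int p ^ (4 * k) * (a'^2 - 4 * b')"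
  unfolding a' b' by (simp add: power_mult_distrib power_mult[symmetric] algebra_simps)
 have nc: "~ int p dvd a'^2 - 4 * b'"
 proof
  assume "int p dvd a'^2 - 4 * b'"
  then have "int p ^ Suc (4 * k) dvd a^2 - 4 * b" unfolding c' by (simp add: mult_dvd_mono mult.commute)
  then have "Suc (4 * k) \<le> multiplicity (int p) (a^2 - 4 * b)" using cz pu by (intro multiplicity_geI) auto
  then show False using mc by simp
 qed
 show ?thesis using a' b' nb nc by blast
qed

text \<open>The given model is itself minimal, because the discriminant of any integral model has
  absolute value at most 1.\<close>

lemma good_reduction_of_unit_disc:
 assumes "~ int p dvd ell_disc a b"
 shows "good_reduction p a b"
proof -
 let ?W = "Weierstrass 0 (of_int a) 0 (of_int b) 0"
 have W: "?W \<in> integral_models p a b"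
 proof -
  have "integral_at p ?W" using place_abs_of_int_le_1[OF p] by (simp del: place_abs.simps(2))
  moreover have "?W = change_variables 1 0 0 0 ?W" by simp
  ultimately show ?thesis unfolding integral_models_def by (intro CollectI conjI exI[of _ 1] exI[of _ 0]) auto
 qed
 have "weierstrass_disc ?W = of_int (ell_disc a b)"
  by (simp add: ell_disc_def Let_def power2_eq_square power3_eq_cube algebra_simps)
 then have d: "place_abs (Finite_place p) (weierstrass_disc ?W) = 1"
  using assms place_abs_of_int_eq_1[OF p] by (simp del: place_abs.simps weierstrass_disc.simps)
 have "place_abs (Finite_place p) (weierstrass_disc W') \<le> 1" if "W' \<in> integral_models p a b" for W'
 proof -
  obtain a1 a2 a3 a4 a6 where W': "W' = Weierstrass a1 a2 a3 a4 a6" by (cases W')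
  have "integral_at p W'" using that unfolding integral_models_def by blast
  then have "padic_integral p a1" "padic_integral p a2" "padic_integral p a3" "padic_integral p a4" "padic_integral p a6"
   unfolding W' padic_integral_def by auto
  then have "padic_integral p (weierstrass_disc W')"
   unfolding W' weierstrass_disc.simps Let_def by (intro padic_integral_intros)
  then show ?thesis unfolding padic_integral_def .
 qed
 then have "?W \<in> minimal_models p a b" unfolding minimal_models_def using W d by (simp del: place_abs.simps weierstrass_disc.simps)
 then show ?thesis unfolding good_reduction_def using d by blast
qed

end

lemma not_dvd_conductor:
 assumes p: "prime p" and disc: "ell_disc a b ~= 0" and nd: "~ p dvd 2 * conductor a b"
 shows "odd p" "good_reduction p a b"
proof -
 show "odd p"
 proof
  assume "even p"
  then have "p = 2" using p primes_dvd_imp_eq[OF two_is_prime_nat p] by simp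
  then show False using nd by simp
 qed
 let ?S = "{p. prime p & conductor_exponent p a b ~= 0}"
 \<comment> \<open>Finiteness matters, since a product over an infinite set would be 1 by
   convention. Only primes dividing the discriminant of the model can occur.\<close>
 have fin: "finite ?S"
 proof (rule finite_subset)
  show "?S \<subseteq> {q. q dvd nat \<bar>ell_disc a b\<bar>}"
  proof
   fix q assume "q \<in> ?S"
   then have q: "prime q" "~ good_reduction q a b" unfolding conductor_exponent_def by auto
   then have "int q dvd ell_disc a b" using good_reduction_of_unit_disc by blast
   then have "int q dvd int (nat \<bar>ell_disc a b\<bar>)" by simp
   then show "q \<in> {q. q dvd nat \<bar>ell_disc a b\<bar>}" by (simp only: int_dvd_int_iff mem_Collect_eq)
  qed
  show "finite {q. q dvd nat \<bar>ell_disc a b\<bar>}" using disc by (intro finite_divisors_nat) simp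
 qed
 show "good_reduction p a b"
 proof (rule ccontr)
  assume "~ good_reduction p a b"
  then have e: "conductor_exponent p a b ~= 0" unfolding conductor_exponent_def by simp
  then have "p ^ conductor_exponent p a b dvd conductor a b"
   unfolding conductor_def using fin p by (intro dvd_prodI) auto
  then have "p dvd conductor a b" using e by (metis dvd_power dvd_trans neq0_conv)
  then show False using nd by simp
 qed
qed

section \<open>Counting over the field with two elements\<close>

lemma bit_field: "field (class_ring :: bit ring)"
 by (rule class_field)

lemma card_UNIV_bit: "card (UNIV :: bit set) = 2" and finite_UNIV_bit: "finite (UNIV :: bit set)"
proof -
 have u: "(UNIV :: bit set) = {0, 1}" by (auto intro: bit_not_zero_iff[THEN iffD1])
 show "card (UNIV :: bit set) = 2" by (subst u) simp
 show "finite (UNIV :: bit set)" by (subst u) simp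
qed

text \<open>Coordinates in a basis are arbitrary functions from it to two elements. Through this all
  dimensions are compared by counting.\<close>

lemma bit_vectorspace_card:
 assumes V: "vectorspace (class_ring :: bit ring) V" and fin: "finite (carrier V)"
 shows "card (carrier V) = 2 ^ vectorspace.dim class_ring V"
proof -
 interpret V: vectorspace "class_ring :: bit ring" V by (rule V)
 have "V.gen_set (carrier V)"
  using V.in_own_span[of "carrier V"] V.span_is_subset2[of "carrier V"] by auto
 then have "V.fin_dim" unfolding V.fin_dim_def using fin by blast
 then obtain B where B: "finite B" "B \<subseteq> carrier V" "V.basis B"
  using V.finite_basis_exists unfolding V.basis_def by auto
 have crit: "\<forall>v. v \<in> carrier V --> (\<exists>!a. a \<in> B \<rightarrow>\<^sub>E carrier (class_ring :: bit ring) & V.lincomb a B = v)"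
  using V.basis_criterion[OF B(1,2)] B(3) by blast
 let ?S = "B \<rightarrow>\<^sub>E (UNIV :: bit set)"
 have "bij_betw (%a. V.lincomb a B) ?S (carrier V)"
  unfolding bij_betw_def
 proof
  have cl: "V.lincomb a B \<in> carrier V" if "a \<in> ?S" for a
   using V.lincomb_closed[OF B(2), of a] by auto
  show "inj_on (%a. V.lincomb a B) ?S"
  proof (rule inj_onI)
   fix x y assume xy: "x \<in> ?S" "y \<in> ?S" "V.lincomb x B = V.lincomb y B"
   have "\<exists>!a. a \<in> ?S & V.lincomb a B = V.lincomb x B" using crit cl[OF xy(1)] by simp
   then show "x = y" using xy by auto
  qed
  show "(%a. V.lincomb a B) ` ?S = carrier V"
  proof
   show "(%a. V.lincomb a B) ` ?S \<subseteq> carrier V" using cl by blast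
   show "carrier V \<subseteq> (%a. V.lincomb a B) ` ?S"
   proof
    fix u assume "u \<in> carrier V"
    then have "\<exists>a. a \<in> ?S & V.lincomb a B = u" using crit by auto
    then show "u \<in> (%a. V.lincomb a B) ` ?S" by blast
   qed
  qed
 qed
 then have "card (carrier V) = card ?S" by (simp add: bij_betw_same_card)
 also have "\<dots> = 2 ^ card B" using B(1) by (simp add: card_PiE card_UNIV_bit)
 finally show ?thesis using V.dim_basis[OF B(1,3)] by simp
qed

text \<open>Exponent 2 is what distributivity over 1 + 1 = 0 demands.\<close>

lemma bit_space_vectorspace:
 assumes G: "comm_group G" and S: "subgroup S G" and ex: "\<And>x. x \<in> S ==> x \<otimes>\<^bsub>G\<^esub> x = \<one>\<^bsub>G\<^esub>"
 shows "vectorspace (class_ring :: bit ring) (bit_space G S)"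
proof -
 interpret G: comm_group G by (rule G)
 have SG: "x \<in> carrier G" if "x \<in> S" for x using subgroup.subset[OF S] that by blast
 note cl = subgroup.m_closed[OF S] subgroup.one_closed[OF S]
 have sim: "carrier (bit_space G S) = S" "x \<oplus>\<^bsub>bit_space G S\<^esub> y = x \<otimes>\<^bsub>G\<^esub> y" "\<zero>\<^bsub>bit_space G S\<^esub> = \<one>\<^bsub>G\<^esub>"
  "c \<odot>\<^bsub>bit_space G S\<^esub> x = (if c = 0 then \<one>\<^bsub>G\<^esub> else x)" for x y c
  by (simp_all add: bit_space_def)
 have ab: "abelian_group (bit_space G S)"
 proof (rule abelian_groupI)
  fix x assume "x \<in> carrier (bit_space G S)"
  then have "x \<in> S" by (simp add: sim)
  then show "\<exists>y\<in>carrier (bit_space G S). y \<oplus>\<^bsub>bit_space G S\<^esub> x = \<zero>\<^bsub>bit_space G S\<^esub>"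
   using ex by (intro bexI[of _ x]) (auto simp: sim)
 next
  fix x y z assume "x \<in> carrier (bit_space G S)" "y \<in> carrier (bit_space G S)" "z \<in> carrier (bit_space G S)"
  then have "x \<in> S" "y \<in> S" "z \<in> S" by (simp_all only: sim)
  note c = this this[THEN SG]
  show "x \<oplus>\<^bsub>bit_space G S\<^esub> y \<oplus>\<^bsub>bit_space G S\<^esub> z = x \<oplus>\<^bsub>bit_space G S\<^esub> (y \<oplus>\<^bsub>bit_space G S\<^esub> z)" unfolding sim using c by (intro G.m_assoc)
  show "x \<oplus>\<^bsub>bit_space G S\<^esub> y = y \<oplus>\<^bsub>bit_space G S\<^esub> x" unfolding sim using c by (intro G.m_comm)
 qed (use cl SG in \<open>auto simp: sim\<close>)
 have cr: "cring (class_ring :: bit ring)" by (rule domain.axioms(1)[OF field.axioms(1)[OF bit_field]])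
 have "Module.module (class_ring :: bit ring) (bit_space G S)"
 proof (rule moduleI[OF cr ab])
  fix c d :: bit and x assume "x \<in> carrier (bit_space G S)"
  then have x: "x \<in> S" by (simp add: sim)
  show "(c \<oplus>\<^bsub>class_ring\<^esub> d) \<odot>\<^bsub>bit_space G S\<^esub> x = (c \<odot>\<^bsub>bit_space G S\<^esub> x) \<oplus>\<^bsub>bit_space G S\<^esub> (d \<odot>\<^bsub>bit_space G S\<^esub> x)"
   using ex[OF x] SG[OF x] by (cases c; cases d) (simp_all add: sim)
  show "(c \<otimes>\<^bsub>class_ring\<^esub> d) \<odot>\<^bsub>bit_space G S\<^esub> x = c \<odot>\<^bsub>bit_space G S\<^esub> (d \<odot>\<^bsub>bit_space G S\<^esub> x)"
   by (cases c; cases d) (simp_all add: sim)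
 qed (use cl SG in \<open>auto simp: sim\<close>)
 then show ?thesis unfolding vectorspace_def using bit_field by simp
qed

text \<open>Rank-nullity in counting form: the nonempty fibres are cosets of the kernel, and the
  image is the column space, with 2^rank elements.\<close>

lemma bit_rank_nullity:
 assumes M: "M \<in> carrier_mat nr nc"
 shows "card {x \<in> carrier_vec nc. M *\<^sub>v x = 0\<^sub>v nr} * 2 ^ bit_rank M = 2 ^ nc"
proof -
 interpret vec_space "TYPE(bit)" nr .
 let ?A = "carrier_vec nc :: bit vec set"
 have finV: "finite (carrier_vec n :: bit vec set)" and cardV: "card (carrier_vec n :: bit vec set) = 2 ^ n" for n
 proof -
  have "bij_betw (%f. vec n f) ({..<n} \<rightarrow>\<^sub>E (UNIV :: bit set)) (carrier_vec n)"
  proof (rule bij_betwI[where g = "%x. restrict (%i. x $ i) {..<n}"])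
   show "restrict (($) (vec n f)) {..<n} = f" if "f \<in> {..<n} \<rightarrow>\<^sub>E UNIV" for f
    using that by (auto simp: PiE_def extensional_def restrict_def)
  qed auto
  moreover have "finite ({..<n} \<rightarrow>\<^sub>E (UNIV :: bit set))" by (rule finite_PiE) (auto simp: finite_UNIV_bit)
  ultimately show "finite (carrier_vec n :: bit vec set)" "card (carrier_vec n :: bit vec set) = 2 ^ n"
   using bij_betw_finite bij_betw_same_card[of _ _ "carrier_vec n"] by (fastforce simp: card_PiE card_UNIV_bit)+
 qed
 let ?f = "%x. M *\<^sub>v x"
 let ?K = "{x \<in> ?A. ?f x = 0\<^sub>v nr}"
 have fc: "?f x \<in> carrier_vec nr" if "x \<in> ?A" for x using M that by simp
 have fiber: "card {x \<in> ?A. ?f x = y} = card ?K" if y: "y \<in> ?f ` ?A" for y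
 proof -
  obtain x0 where x0: "x0 \<in> ?A" "y = ?f x0" using y by blast
  have "bij_betw (%x. x + x0) ?K {x \<in> ?A. ?f x = y}"
  proof (rule bij_betwI[where g = "%x. x - x0"])
   show "(%x. x + x0) \<in> ?K \<rightarrow> {x \<in> ?A. ?f x = y}"
    using x0 M fc[OF x0(1)] by (auto simp: mult_add_distrib_mat_vec)
   show "(%x. x - x0) \<in> {x \<in> ?A. ?f x = y} \<rightarrow> ?K"
    using x0 M fc[OF x0(1)] by (auto simp: mult_minus_distrib_mat_vec)
   show "x + x0 - x0 = x" if "x \<in> ?K" for x using that x0 by (intro eq_vecI) auto
   show "x - x0 + x0 = x" if "x \<in> {x \<in> ?A. ?f x = y}" for x using that x0 by (intro eq_vecI) auto
  qed
  then show ?thesis by (simp add: bij_betw_same_card)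
 qed
 have "card ?A = (\<Sum>y\<in>?f ` ?A. card {x \<in> ?A. ?f x = y})"
  using finV[of nc] by (intro sum.image_gen[of ?A "%_. 1::nat" ?f, simplified])
 also have "\<dots> = card (?f ` ?A) * card ?K" using fiber by simp
 finally have 1: "2 ^ nc = card (?f ` ?A) * card ?K" using cardV[of nc] by simp
 have im: "col_space M = ?f ` ?A"
  using col_space_eq[OF M] M by auto
 have vs: "vectorspace class_ring (vs (span (set (cols M))))"
  by (rule subspace_is_vs[OF span_is_subspace]) (use M cols_dim[of M] in auto)
 have carr: "carrier (vs (span (set (cols M)))) = ?f ` ?A" using im unfolding col_space_def by simp
 have "card (?f ` ?A) = 2 ^ vectorspace.dim class_ring (vs (span (set (cols M))))"
  using bit_vectorspace_card[OF vs] finV[of nc] unfolding carr by simp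
 also have "vectorspace.dim class_ring (vs (span (set (cols M)))) = bit_rank M"
  unfolding bit_rank_def using M rank_def[of M] by simp
 finally show ?thesis using 1 by (simp add: mult.commute)
qed

section \<open>Splitting in imaginary quadratic fields\<close>

lemma class_ring_simps [simp]:
 "carrier (class_ring :: 'a::{one,zero,plus,times} ring) = UNIV"
 "x \<otimes>\<^bsub>class_ring\<^esub> y = x * y" "x \<oplus>\<^bsub>class_ring\<^esub> y = x + y" "\<one>\<^bsub>class_ring\<^esub> = 1" "\<zero>\<^bsub>class_ring\<^esub> = 0"
 by simp_all

lemma class_ring_field: "field (class_ring :: 'a::field ring)"
 by (rule class_field)

lemma class_ring_a_inv: "\<ominus>\<^bsub>class_ring\<^esub> (x::'a::field) = - x"
proof -
 have "abelian_group (class_ring :: 'a ring)" by (rule ring.is_abelian_group[OF field.is_ring[OF class_ring_field]])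
 then show ?thesis using abelian_group.minus_equality[of class_ring "- x" x] by simp
qed

lemma class_ring_m_inv: "x ~= 0 ==> inv\<^bsub>class_ring\<^esub> (x::'a::field) = inverse x"
proof -
 have "comm_monoid (class_ring :: 'a ring)"
  by (rule cring.axioms(2)[OF domain.axioms(1)[OF field.axioms(1)[OF class_ring_field]]])
 moreover assume "x ~= 0"
 ultimately show ?thesis using comm_monoid.comm_inv_char[of class_ring x "inverse x"] by simp
qed

lemma quadratic_form_mult:
 assumes "w * w = of_int n" "x = of_rat r + of_rat s * w" "y = of_rat r' + of_rat s' * (w::complex)"
 shows "x * y = of_rat (r * r' + s * s' * of_int n) + of_rat (r * s' + s * r') * w"
proof -
 have "x * y = of_rat r * of_rat r' + of_rat s * of_rat s' * (w * w) + (of_rat r * of_rat s' + of_rat s * of_rat r') * w"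
  unfolding assms(2,3) by (simp add: algebra_simps)
 then show ?thesis unfolding assms(1) by (simp add: of_rat_add of_rat_mult)
qed

lemma quadratic_field_form:
 assumes "x \<in> quadratic_field n"
 shows "\<exists>r s. x = of_rat r + of_rat s * csqrt (of_int n)"
 using assms unfolding quadratic_field_def
proof (induction rule: generate_field.induct)
 case one
 show ?case by (rule exI[of _ 1], rule exI[of _ 0]) simp
next
 case (incl h)
 then show ?case by (intro exI[of _ 0] exI[of _ 1]) simp
next
 case (a_inv h)
 then obtain r s where "h = of_rat r + of_rat s * csqrt (of_int n)" by blast
 then show ?case unfolding class_ring_a_inv by (intro exI[of _ "- r"] exI[of _ "- s"]) (simp add: of_rat_minus)
next
 case (m_inv h)
 let ?w = "csqrt (of_int n)"
 have w2: "?w * ?w = of_int n" by (metis power2_csqrt power2_eq_square)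
 obtain r s where h: "h = of_rat r + of_rat s * ?w" using m_inv by blast
 have h0: "h ~= 0" using m_inv by simp
 define y where "y = of_rat r + of_rat (- s) * ?w"
 let ?d = "r * r + s * - s * of_int n"
 have prod: "h * y = of_rat ?d"
  unfolding quadratic_form_mult[OF w2 h y_def] by (simp only: mult_minus_right mult.commute[of s r] add.left_inverse add_neg_numeral_simps of_rat_0 mult_zero_left add_0_right)
 show ?case
 proof (cases "y = 0")
  case False
  have d0: "(of_rat ?d :: complex) ~= 0" unfolding prod[symmetric] using h0 False by simp
  have "h * (y / of_rat ?d) = 1" using prod d0 by simp
  then have "inverse h = y / of_rat ?d" by (rule inverse_unique)
  also have "\<dots> = of_rat (r / ?d) + of_rat (- s / ?d) * ?w"
   unfolding y_def of_rat_divide by (simp only: add_divide_distrib times_divide_eq_left)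
  finally show ?thesis unfolding class_ring_m_inv[OF h0] by (intro exI)
 next
  \<comment> \<open>If \<open>n\<close> is a perfect square the conjugate may vanish although
    \<open>h\<close> does not; then \<open>h\<close> is the rational number 2 r.\<close>
  case True
  then have "of_rat s * ?w = of_rat r" unfolding y_def of_rat_minus by simp
  then have h': "h = of_rat (r + r)" unfolding h by (simp only: of_rat_add)
  have "inverse h = of_rat (inverse (r + r)) + of_rat 0 * ?w" unfolding h' by (simp only: of_rat_inverse of_rat_0 mult_zero_left add_0_right)
  then show ?thesis unfolding class_ring_m_inv[OF h0] by (intro exI)
 qed
next
 case (eng_add h1 h2)
 then obtain r s r' s' where "h1 = of_rat r + of_rat s * csqrt (of_int n)" "h2 = of_rat r' + of_rat s' * csqrt (of_int n)" by blast
 then show ?case by (intro exI[of _ "r + r'"] exI[of _ "s + s'"]) (simp add: of_rat_add algebra_simps)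
next
 case (eng_mult h1 h2)
 let ?w = "csqrt (of_int n)"
 have w2: "?w * ?w = of_int n" by (metis power2_csqrt power2_eq_square)
 obtain r s r' s' where h: "h1 = of_rat r + of_rat s * ?w" "h2 = of_rat r' + of_rat s' * ?w" using eng_mult by blast
 show ?case unfolding class_ring_simps quadratic_form_mult[OF w2 h] by (intro exI) (rule refl)
qed

lemma cnj_csqrt_neg: "n < 0 ==> cnj (csqrt (of_int n)) = - csqrt (of_int n)"
 by (rule complex_eqI) (auto simp: csqrt.sel cmod_def)

lemma quadratic_field_cnj:
 assumes n: "n < 0" and "x \<in> quadratic_field n"
 shows "cnj x \<in> quadratic_field n"
 using assms(2) unfolding quadratic_field_def
proof (induction rule: generate_field.induct)
 case one then show ?case using generate_field.one[of class_ring "{csqrt (of_int n)}"] by simp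
next
 case (incl h)
 have "\<ominus>\<^bsub>class_ring\<^esub> csqrt (of_int n) \<in> generate_field class_ring {csqrt (of_int n)}"
  by (intro generate_field.a_inv generate_field.incl) simp
 then show ?case using incl cnj_csqrt_neg[OF n] by (simp add: class_ring_a_inv)
next
 case (a_inv h) then show ?case using generate_field.a_inv[OF a_inv.IH] by (simp add: class_ring_a_inv)
next
 case (m_inv h)
 have "h ~= 0" "cnj h ~= 0" using m_inv by auto
 moreover have "inv\<^bsub>class_ring\<^esub> (cnj h) \<in> generate_field class_ring {csqrt (of_int n)}"
  by (rule generate_field.m_inv) (use m_inv calculation in auto)
 ultimately show ?case by (simp add: class_ring_m_inv)
next
 case (eng_add h1 h2) then show ?case using generate_field.eng_add[OF eng_add.IH] by simp
next
 case (eng_mult h1 h2) then show ?case using generate_field.eng_mult[OF eng_mult.IH] by simp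
qed

lemma quadratic_field_of_int: "of_int k \<in> quadratic_field n"
 unfolding quadratic_field_def
proof (induction k rule: int_induct[where k = 0])
 case base
 have "(1::complex) \<in> generate_field class_ring {csqrt (of_int n)}"
  using generate_field.one[of class_ring "{csqrt (of_int n)}"] by simp
 from generate_field.eng_add[OF this generate_field.a_inv[OF this]] show ?case by (simp add: class_ring_a_inv)
next
 case (step1 i)
 have "(1::complex) \<in> generate_field class_ring {csqrt (of_int n)}"
  using generate_field.one[of class_ring "{csqrt (of_int n)}"] by simp
 from generate_field.eng_add[OF step1(2) this] show ?case by simp
next
 case (step2 i)
 have "(1::complex) \<in> generate_field class_ring {csqrt (of_int n)}"
  using generate_field.one[of class_ring "{csqrt (of_int n)}"] by simp
 from generate_field.eng_add[OF step2(2) generate_field.a_inv[OF this]] show ?case by (simp add: class_ring_a_inv)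
qed

text \<open>The square of the denominator of s divides the squarefree number q.\<close>

lemma rat_square_times_prime_int:
 assumes q: "prime (q::nat)" and e: "of_nat q * (s::rat)^2 = of_int k"
 shows "\<exists>m. s = of_int m"
proof -
 obtain a b where ab: "quotient_of s = (a, b)" by (cases "quotient_of s")
 have b: "b > 0" and cop: "coprime a b" and s: "s = of_int a / of_int b"
  using quotient_of_denom_pos[OF ab] quotient_of_coprime[OF ab] quotient_of_div[OF ab] by auto
 have "of_int (int q * a^2) = (of_int (k * b^2) :: rat)" using e b unfolding s by (simp add: field_simps power_divide)
 then have "int q * a^2 = k * b^2" by (simp only: of_int_eq_iff)
 then have "b^2 dvd int q * a^2" by simp
 moreover have "coprime (b^2) (a^2)" using cop by (simp add: coprime_commute)
 ultimately have "b^2 dvd int q" by (simp add: coprime_dvd_mult_left_iff)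
 moreover have "squarefree (int q)" using q by (simp add: squarefree_prime)
 ultimately have "is_unit b" unfolding squarefree_def by blast
 then have "b = 1" using b by simp
 then show ?thesis using s by auto
qed

text \<open>Every power of the denominator of y divides \<open>d\<close>, so the denominator is
  1.\<close>

lemma rat_int_of_bounded_powers:
 fixes y :: rat and d :: int
 assumes d: "d > 0" and int: "\<And>k. of_int d * y ^ k \<in> \<int>"
 shows "y \<in> \<int>"
proof -
 obtain g h where gh: "quotient_of y = (g, h)" by (cases "quotient_of y")
 have h: "h > 0" and cop: "coprime g h" and y: "y = of_int g / of_int h"
  using quotient_of_denom_pos[OF gh] quotient_of_coprime[OF gh] quotient_of_div[OF gh] by auto
 have dvd: "h ^ k dvd d" for k
 proof -
  obtain z where "of_int d * y ^ k = of_int z" using int[of k] by (auto simp: Ints_def)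
  then have "(of_int (d * g ^ k) :: rat) = of_int (z * h ^ k)" using h unfolding y by (simp add: field_simps power_divide)
  then have "d * g ^ k = z * h ^ k" by (simp only: of_int_eq_iff)
  then have "h ^ k dvd d * g ^ k" by simp
  moreover have "coprime (h ^ k) (g ^ k)" using cop by (simp add: coprime_commute)
  ultimately show ?thesis by (simp add: coprime_dvd_mult_left_iff)
 qed
 have "h = 1"
 proof (rule ccontr)
  assume "h ~= 1"
  then have h2: "2 \<le> h" using h by simp
  have "d < 2 ^ nat d" using d of_nat_less_two_power[of "nat d", where 'a = int] by simp
  also have "\<dots> \<le> h ^ nat d" using h2 by (rule power_mono) simp
  also have "\<dots> \<le> d" using dvd d by (rule zdvd_imp_le)
  finally show False by simp
 qed
 then show ?thesis using y by simp
qed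

lemma complex_of_rat_eq: "(of_rat z :: complex) = of_real (of_rat z)"
 by (cases z) (simp add: of_rat_rat)

lemma cnj_of_rat: "cnj (of_rat z) = of_rat z"
 by (simp add: complex_of_rat_eq)

lemma cmod_quadratic:
 assumes n: "n < 0"
 shows "(cmod (of_rat r + of_rat s * csqrt (of_int n)))^2 = of_rat (r * r - s * s * of_int n)"
proof -
 let ?w = "csqrt (of_int n)"
 have w2: "?w * ?w = of_int n" by (metis power2_csqrt power2_eq_square)
 have cw: "cnj ?w = - ?w" by (rule cnj_csqrt_neg[OF n])
 have cr: "cnj (of_rat z) = of_rat z" for z
  by (rule cnj_of_rat)
 let ?x = "of_rat r + of_rat s * ?w"
 have "of_real ((cmod ?x)^2) = ?x * cnj ?x" by (simp only: complex_norm_square)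
 also have "cnj ?x = of_rat r - of_rat s * ?w" unfolding complex_cnj_add complex_cnj_mult cw cr by simp
 also have "?x * (of_rat r - of_rat s * ?w) = of_rat r * of_rat r - of_rat s * of_rat s * (?w * ?w)"
  by (simp only: ring_distribs) (simp add: mult_ac)
 also have "\<dots> = of_rat (r * r - s * s * of_int n)" unfolding w2 by (simp add: of_rat_diff of_rat_mult)
 also have "\<dots> = of_real (of_rat (r * r - s * s * of_int n))" by (rule complex_of_rat_eq)
 finally show ?thesis by (simp only: of_real_eq_iff)
qed

text \<open>The monic equation of x keeps all d x^k in the lattice Z + Z sqrt(n), for one common
  denominator d. Taking norms, d^2 times the k-th power of the norm of x is an integer for all k,
  and \<open>rat_int_of_bounded_powers\<close> applies.\<close>

lemma quadratic_norm_int: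
 assumes n: "n < 0" and x: "x = of_rat r + of_rat s * csqrt (of_int n)" and xi: "algebraic_int x"
 shows "r * r - s * s * of_int n \<in> \<int>"
proof -
 let ?w = "csqrt (of_int n)"
 have w2: "?w * ?w = of_int n" by (metis power2_csqrt power2_eq_square)
 from xi obtain p where p: "Polynomial.coeff p (Polynomial.degree p) = 1" "\<And>i. Polynomial.coeff p i \<in> \<int>" "poly p x = 0"
  by (auto simp: algebraic_int.simps)
 define \<Lambda> where "\<Lambda> = {of_int a + of_int b * ?w | a b. True}"
 have \<Lambda>add: "y + z \<in> \<Lambda>" if "y \<in> \<Lambda>" "z \<in> \<Lambda>" for y z
 proof -
  from that obtain a b a' b' where "y = of_int a + of_int b * ?w" "z = of_int a' + of_int b' * ?w" unfolding \<Lambda>_def by blast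
  then have "y + z = of_int (a + a') + of_int (b + b') * ?w" by (simp add: algebra_simps)
  then show ?thesis unfolding \<Lambda>_def by blast
 qed
 have \<Lambda>mul: "of_int c * y \<in> \<Lambda>" if "y \<in> \<Lambda>" for y c
 proof -
  from that obtain a b where "y = of_int a + of_int b * ?w" unfolding \<Lambda>_def by blast
  then have "of_int c * y = of_int (c * a) + of_int (c * b) * ?w" by (simp add: algebra_simps)
  then show ?thesis unfolding \<Lambda>_def by blast
 qed
 have \<Lambda>0: "0 \<in> \<Lambda>" unfolding \<Lambda>_def by (rule CollectI, rule exI[of _ 0], rule exI[of _ 0]) simp
 have \<Lambda>sum: "sum f A \<in> \<Lambda>" if "finite A" "\<And>i. i \<in> A ==> f i \<in> \<Lambda>" for f and A :: "nat set"
  using that by (induction A rule: finite_induct) (auto intro: \<Lambda>add \<Lambda>0)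
 have pow: "\<exists>r' s'. x ^ k = of_rat r' + of_rat s' * ?w" for k
 proof (induction k)
  case 0 show ?case by (rule exI[of _ 1], rule exI[of _ 0]) simp
 next
  case (Suc k)
  then obtain r' s' where "x ^ k = of_rat r' + of_rat s' * ?w" by blast
  from quadratic_form_mult[OF w2 x this] show ?case by auto
 qed
 have den: "\<exists>d>0. \<forall>k<m. of_int d * x ^ k \<in> \<Lambda>" for m
 proof (induction m)
  case 0 show ?case by (rule exI[of _ 1]) simp
 next
  case (Suc m)
  then obtain d where d: "d > 0" "\<forall>k<m. of_int d * x ^ k \<in> \<Lambda>" by blast
  obtain r' s' where rs: "x ^ m = of_rat r' + of_rat s' * ?w" using pow by blast
  obtain a1 b1 where a1: "quotient_of r' = (a1, b1)" by (cases "quotient_of r'")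
  obtain a2 b2 where a2: "quotient_of s' = (a2, b2)" by (cases "quotient_of s'")
  have b: "b1 > 0" "b2 > 0" using quotient_of_denom_pos[OF a1] quotient_of_denom_pos[OF a2] by auto
  have r': "of_rat r' = (of_int a1 / of_int b1 :: complex)" "of_rat s' = (of_int a2 / of_int b2 :: complex)"
   using quotient_of_div[OF a1] quotient_of_div[OF a2] by (simp_all add: of_rat_divide)
  have "of_int (b1 * b2) * x ^ m = of_int (b2 * a1) + of_int (b1 * a2) * ?w"
   unfolding rs r' using b by (simp add: field_simps)
  then have "of_int (b1 * b2) * x ^ m \<in> \<Lambda>" unfolding \<Lambda>_def by blast
  from \<Lambda>mul[OF this, of d] have 1: "of_int (d * (b1 * b2)) * x ^ m \<in> \<Lambda>" by (simp add: mult_ac)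
  have 2: "of_int (d * (b1 * b2)) * x ^ k \<in> \<Lambda>" if "k < m" for k
  proof -
   have "of_int (b1 * b2) * (of_int d * x ^ k) \<in> \<Lambda>" using \<Lambda>mul d(2) that by blast
   then show ?thesis by (simp add: mult_ac)
  qed
  show ?case using 1 2 d(1) b by (intro exI[of _ "d * (b1 * b2)"]) (auto simp: less_Suc_eq)
 qed
 obtain d where d: "d > 0" "\<forall>k<Polynomial.degree p. of_int d * x ^ k \<in> \<Lambda>" using den by blast
 have all: "of_int d * x ^ k \<in> \<Lambda>" for k
 proof (induction k rule: less_induct)
  case (less k)
  show ?case
  proof (cases "k < Polynomial.degree p")
   case True then show ?thesis using d(2) by blast
  next
   case False
   then obtain j where k: "k = j + Polynomial.degree p" by (metis add.commute le_iff_add not_less)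
   \<comment> \<open>The equation of x multiplied by x^j expresses x^k through lower powers, with
     integer coefficients because \<open>p\<close> is monic.\<close>
   have "0 = x ^ j * poly p x" using p(3) by simp
   also have "\<dots> = (\<Sum>i<Polynomial.degree p. Polynomial.coeff p i * x ^ (j + i)) + x ^ k"
    unfolding poly_altdef k sum_distrib_left lessThan_Suc_atMost[symmetric] using p(1)
    by (simp add: power_add mult_ac)
   finally have xk: "x ^ k = - (\<Sum>i<Polynomial.degree p. Polynomial.coeff p i * x ^ (j + i))" by (simp add: eq_neg_iff_add_eq_0 add.commute)
   have "of_int d * x ^ k = (\<Sum>i<Polynomial.degree p. (- Polynomial.coeff p i) * (of_int d * x ^ (j + i)))"
    unfolding xk by (simp add: sum_distrib_left sum_negf mult_ac)
   also have "\<dots> \<in> \<Lambda>"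
   proof (rule \<Lambda>sum)
    fix i assume i: "i \<in> {..<Polynomial.degree p}"
    obtain c where c: "Polynomial.coeff p i = of_int c" using p(2)[of i] by (auto simp: Ints_def)
    have "j + i < k" using i k by simp
    from \<Lambda>mul[OF less[OF this], of "- c"] show "(- Polynomial.coeff p i) * (of_int d * x ^ (j + i)) \<in> \<Lambda>" unfolding c by simp
   qed simp
   finally show ?thesis .
  qed
 qed
 let ?N = "r * r - s * s * of_int n"
 have "of_int (d^2) * ?N ^ k \<in> \<int>" for k
 proof -
  obtain a b where ab: "of_int d * x ^ k = of_int a + of_int b * ?w" using all[of k] unfolding \<Lambda>_def by blast
  have "(cmod (of_int d * x ^ k))^2 = (of_int d)^2 * ((cmod x)^2) ^ k"
   by (simp add: norm_mult norm_power power_mult_distrib power_mult[symmetric] mult.commute)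
  also have "(cmod x)^2 = of_rat ?N" unfolding x by (rule cmod_quadratic[OF n])
  finally have e1: "(cmod (of_int d * x ^ k))^2 = of_rat (of_int (d^2) * ?N ^ k)" by (simp add: of_rat_mult of_rat_power)
  have "(cmod (of_int d * x ^ k))^2 = of_rat (of_int a * of_int a - of_int b * of_int b * of_int n)"
   unfolding ab using cmod_quadratic[OF n, of "of_int a" "of_int b"] by simp
  then have "of_int (d^2) * ?N ^ k = of_int a * of_int a - of_int b * of_int b * of_int n"
   unfolding e1 by (simp only: of_rat_eq_iff)
  also have "\<dots> = of_int (a * a - b * b * n)" by simp
  finally show ?thesis by simp
 qed
 then show ?thesis using rat_int_of_bounded_powers[of "d^2" ?N] d(1) by simp
qed

text \<open>The trace of x is the norm of x + 1 minus the norm of x minus 1, so integral norms will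
  give integral traces.\<close>

lemma algebraic_int_plus_one:
 assumes "algebraic_int (x::complex)" shows "algebraic_int (x + 1)"
proof -
 from assms obtain p where p: "Polynomial.coeff p (Polynomial.degree p) = 1" "\<forall>i. Polynomial.coeff p i \<in> \<int>" "poly p x = 0"
  by (auto simp: algebraic_int.simps)
 let ?q = "pcompose p [:-1, 1:]"
 have "Polynomial.coeff ?q (Polynomial.degree ?q) = 1" using p(1) by (subst lead_coeff_comp) auto
 moreover have "\<forall>i. Polynomial.coeff ?q i \<in> \<int>"
 proof
  fix i
  show "Polynomial.coeff ?q i \<in> \<int>" by (rule coeff_pcompose_semiring_closed) (use p(2) in \<open>auto simp: coeff_pCons split: nat.splits\<close>)
 qed
 moreover have "poly ?q (x + 1) = 0" using p(3) by (simp add: poly_pcompose)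
 ultimately show ?thesis by (auto simp: algebraic_int.simps)
qed

text \<open>A number x in one of the two prime ideals but not in the other takes the place of an
  explicit ring of integers. Its norm N lies in both ideals, so v divides N. Its conjugate lies in
  the second ideal, so if v divided the trace T, then x would lie there as well. The relation is the
  discriminant of X^2 - T X + N, with m twice the coefficient of the square root in x.\<close>

lemma splits_imp_trace_norm:
 assumes q: "prime q" and v: "prime v" and spl: "splits_in_quadratic_field v (- int q)"
 shows "\<exists>T N m :: int. ~ int v dvd T & int v dvd N & T\<^sup>2 - 4 * N = - int q * m\<^sup>2"
proof -
 let ?F = "quadratic_field (- int q)"
 let ?R = "ring_of_integers ?F"
 have n0: "- int q < 0" using prime_gt_0_nat[OF q] by simp
 from spl obtain I J where I: "primeideal I ?R" and J: "primeideal J ?R" and ne: "I ~= J"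
  and IJ: "cgenideal ?R (of_nat v) = ideal_prod ?R I J"
  unfolding splits_in_quadratic_field_def Let_def by blast
 have Rs [simp]: "x \<otimes>\<^bsub>?R\<^esub> y = x * y" "x \<oplus>\<^bsub>?R\<^esub> y = x + y" "\<one>\<^bsub>?R\<^esub> = 1" "carrier ?R = {x \<in> ?F. algebraic_int x}" for x y
  unfolding ring_of_integers_def by simp_all
 have intR: "of_int k \<in> carrier ?R" for k using quadratic_field_of_int by simp
 interpret I: primeideal I ?R by (rule I)
 interpret J: primeideal J ?R by (rule J)
 have vgen: "of_nat v \<in> cgenideal ?R (of_nat v)"
  using I.cgenideal_self intR[of "int v"] by simp
 have "ideal_prod ?R I J \<subseteq> I \<inter> J" using I.ideal_prod_inter[OF I.is_ideal J.is_ideal] .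
 then have vI: "of_int (int v) \<in> I" and vJ: "of_int (int v) \<in> J" using vgen unfolding IJ by auto
 have dvdI: "int v dvd k" if "of_int k \<in> P" "primeideal P ?R" "of_int (int v) \<in> P" for P k
 proof (rule ccontr)
  interpret P: primeideal P ?R by (rule that(2))
  assume "~ int v dvd k"
  then have "coprime (int v) k" using v by (simp add: prime_imp_coprime)
  then obtain x y where xy: "x * int v + y * k = 1" using bezout_int[of "int v" k] by (metis coprime_imp_gcd_eq_1)
  have "of_int x * of_int (int v) \<in> P" using P.I_l_closed[OF that(3) intR[of x]] by simp
  moreover have "of_int y * of_int k \<in> P" using P.I_l_closed[OF that(1) intR[of y]] by simp
  ultimately have "of_int x * of_int (int v) + of_int y * of_int k \<in> P" using P.a_closed by simp
  moreover have "of_int x * of_int (int v) + of_int y * of_int k = (1 :: complex)" using xy by (metis of_int_1 of_int_add of_int_mult)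
  ultimately have "1 \<in> P" by simp
  then have "P = carrier ?R" using P.one_imp_carrier by simp
  then show False using P.I_notcarr by simp
 qed
 have main: "\<exists>T N m :: int. ~ int v dvd T & int v dvd N & T\<^sup>2 - 4 * N = - int q * m\<^sup>2"
  if P: "primeideal P ?R" "of_int (int v) \<in> P" and Q: "primeideal Q ?R" "of_int (int v) \<in> Q" and x: "x \<in> P" "x \<notin> Q" for P Q x
 proof -
  interpret P: primeideal P ?R by (rule P(1))
  interpret Q: primeideal Q ?R by (rule Q(1))
  let ?w = "csqrt (of_int (- int q))"
  have xR: "x \<in> carrier ?R" using P.Icarr[OF x(1)] .
  then have xF: "x \<in> ?F" and xi: "algebraic_int x" by auto
  have cR: "cnj x \<in> carrier ?R" using quadratic_field_cnj[OF n0 xF] xi by simp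
  obtain r s where rs: "x = of_rat r + of_rat s * ?w" using quadratic_field_form[OF xF] by blast
  have w2: "?w * ?w = of_int (- int q)" by (metis power2_csqrt power2_eq_square)
  have cw: "cnj ?w = - ?w" by (rule cnj_csqrt_neg[OF n0])
  have cr: "cnj (of_rat z) = of_rat z" for z by (rule cnj_of_rat)
  have cx: "cnj x = of_rat r - of_rat s * ?w" unfolding rs complex_cnj_add complex_cnj_mult cw cr by simp
  have "x + cnj x = of_rat r + of_rat r" unfolding cx unfolding rs by (simp only: add_diff_eq diff_add_eq) simp
  then have sum: "x + cnj x = of_rat (2 * r)" by (simp add: of_rat_mult)
  have "x * cnj x = of_rat r * of_rat r - of_rat s * of_rat s * (?w * ?w)"
   unfolding cx unfolding rs by (simp only: ring_distribs) (simp add: mult_ac)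
  also have "\<dots> = of_rat (r * r + s * s * of_nat q)" unfolding w2 by (simp add: of_rat_add of_rat_mult)
  finally have prod: "x * cnj x = of_rat (r * r + s * s * of_nat q)" .
  have i1: "r * r + s * s * of_nat q \<in> \<int>" using quadratic_norm_int[OF n0 rs xi] by simp
  have rs1: "x + 1 = of_rat (r + 1) + of_rat s * ?w" unfolding rs by (simp add: of_rat_add)
  have i2: "(r + 1) * (r + 1) + s * s * of_nat q \<in> \<int>"
   using quadratic_norm_int[OF n0 rs1 algebraic_int_plus_one[OF xi]] by simp
  have "2 * r = ((r + 1) * (r + 1) + s * s * of_nat q) - (r * r + s * s * of_nat q) - 1" by (simp add: algebra_simps)
  then have "2 * r \<in> \<int>" using Ints_diff[OF Ints_diff[OF i2 i1] Ints_1] by simp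
  then obtain T where T': "2 * r = of_int T" by (auto simp: Ints_def)
  from i1 obtain N where N': "r * r + s * s * of_nat q = of_int N" by (auto simp: Ints_def)
  have T: "x + cnj x = of_int T" unfolding sum T' by simp
  have N: "x * cnj x = of_int N" unfolding prod N' by simp
  have "x * cnj x \<in> P" using P.I_r_closed[OF x(1) cR] by simp
  then have vN: "int v dvd N" using dvdI[OF _ P] N by simp
  then obtain j where j: "N = int v * j" by blast
  have "of_int N \<in> Q" using Q.I_r_closed[OF Q(2) intR[of j]] unfolding j by simp
  then have "x * cnj x \<in> Q" unfolding N .
  then have cQ: "cnj x \<in> Q" using Q.I_prime[OF xR cR] x(2) by auto
  have vT: "~ int v dvd T"
  proof
   assume "int v dvd T"
   then obtain j where j: "T = int v * j" by blast
   have "of_int T \<in> Q" using Q.I_r_closed[OF Q(2) intR[of j]] unfolding j by simp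
   moreover have "of_int (- 1) * cnj x \<in> Q" using Q.I_l_closed[OF cQ intR[of "-1"]] by simp
   ultimately have "of_int T + of_int (- 1) * cnj x \<in> Q" using Q.a_closed[of "of_int T" "of_int (- 1) * cnj x"] by (simp only: Rs)
   moreover have "of_int T + of_int (- 1) * cnj x = x" unfolding T[symmetric] by simp
   ultimately show False using x(2) by simp
  qed
  have eq: "of_nat q * (2 * s)^2 = of_int (4 * N - T^2)"
  proof -
   have "of_int (4 * N - T^2) = 4 * (of_int N :: rat) - (of_int T)^2" by simp
   also have "\<dots> = of_nat q * (2 * s)^2" unfolding N'[symmetric] T'[symmetric] by (simp add: power2_eq_square algebra_simps)
   finally show ?thesis by simp
  qed
  obtain m where m: "2 * s = of_int m" using rat_square_times_prime_int[OF q eq] by blast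
  have "(of_int (int q * m^2) :: rat) = of_int (4 * N - T^2)" using eq unfolding m by simp
  then have "int q * m^2 = 4 * N - T^2" by (simp only: of_int_eq_iff)
  then show ?thesis using vT vN by (intro exI[of _ T] exI[of _ N] exI[of _ m]) simp
 qed
 from ne have "(\<exists>x. x \<in> I & x \<notin> J) \<or> (\<exists>x. x \<in> J & x \<notin> I)" by blast
 then show ?thesis using main[OF I vI J vJ] main[OF J vJ I vI] by blast
qed

text \<open>Modulo v the relation reads T^2 = -q m^2 with T a unit; hence q and m are units too, and
  division by m^2 gives the residue.\<close>

lemma splits_odd:
 assumes q: "prime q" and v: "prime v" and spl: "splits_in_quadratic_field v (- int q)"
 shows "~ v dvd q" "QuadRes (int v) (- int q)"
proof -
 from splits_imp_trace_norm[OF assms] obtain T N m :: int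
  where h: "~ int v dvd T" "int v dvd N" "T\<^sup>2 - 4 * N = - int q * m\<^sup>2" by blast
 have pv: "prime (int v)" using v by simp
 have "T\<^sup>2 - (- int q) * m\<^sup>2 = 4 * N" using h(3) by simp
 then have d: "int v dvd T\<^sup>2 - (- int q) * m\<^sup>2" using h(2) by simp
 have T2: "~ int v dvd T^2" using h(1) prime_dvd_power_iff[OF pv] by simp
 then have nd: "~ int v dvd (- int q) * m\<^sup>2" using dvd_shift[OF d] by simp
 show "~ v dvd q"
 proof
  assume "v dvd q"
  then have "int v dvd - int q" by simp
  then have "int v dvd (- int q) * m\<^sup>2" by (rule dvd_mult2)
  then show False using nd by simp
 qed
 have "~ int v dvd m" using nd by (auto simp: power2_eq_square)
 then show "QuadRes (int v) (- int q)" using QuadRes_divide_square[OF pv d] by simp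
qed

lemma odd_square_int:
 assumes "odd (x :: int)" obtains z where "x^2 = 8 * z + 1"
proof -
 obtain y where y: "x = 2 * y + 1" using assms by (rule oddE)
 have "even (y * (y + 1))" by simp
 then obtain z where z: "y * (y + 1) = 2 * z" by (rule evenE)
 have "x^2 = 4 * (y * (y + 1)) + 1" unfolding y by (simp add: power2_eq_square algebra_simps)
 also have "\<dots> = 8 * z + 1" unfolding z by simp
 finally show ?thesis by (rule that)
qed

text \<open>Odd squares are 1 modulo 8 and 4 N vanishes modulo 8, so -q is 1 modulo 8.\<close>

lemma splits_two:
 assumes q: "prime q" and spl: "splits_in_quadratic_field 2 (- int q)"
 shows "q mod 8 = 7"
proof -
 from splits_imp_trace_norm[OF q two_is_prime_nat spl] obtain T N m :: int
  where h': "~ int 2 dvd T" "int 2 dvd N" and h: "T\<^sup>2 - 4 * N = - int q * m\<^sup>2" by (elim exE conjE)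
 have T: "odd T" and N: "even N" using h'(1) h'(2) by simp_all
 have m: "odd m"
 proof
  assume "even m"
  then have "even (T^2 - 4 * N)" unfolding h by simp
  then show False using T by simp
 qed
 obtain k where k: "N = 2 * k" using N by (rule evenE)
 obtain y where y: "T^2 = 8 * y + 1" using T by (rule odd_square_int)
 obtain z where z: "m^2 = 8 * z + 1" using m by (rule odd_square_int)
 define w where "w = int q * z"
 have "8 * y + 1 - 8 * k = - (8 * w + int q)" using h unfolding y z k w_def by (simp add: algebra_simps)
 then have "int q = 8 * (k - y - w) - 1" by presburger
 then have "int q mod 8 = 7" by presburger
 then show ?thesis by presburger
qed

section \<open>Quartics over completions\<close>

text \<open>This merges the three alternatives of \<open>kummer_class\<close> into one equation by x
  = al (m / e)^2: e = 0 is the point at infinity and m = 0 is the origin.\<close>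

definition quartic_sol :: "('a, 'm) ring_scheme => 'a => 'a => 'a => bool" where
 "quartic_sol K A C al \<longleftrightarrow> (\<exists>m\<in>carrier K. \<exists>e\<in>carrier K. \<exists>n\<in>carrier K. ~ (m = \<zero>\<^bsub>K\<^esub> & e = \<zero>\<^bsub>K\<^esub>) &
   al \<otimes>\<^bsub>K\<^esub> (n \<otimes>\<^bsub>K\<^esub> n) = (al \<otimes>\<^bsub>K\<^esub> (m \<otimes>\<^bsub>K\<^esub> m)) \<otimes>\<^bsub>K\<^esub> (al \<otimes>\<^bsub>K\<^esub> (m \<otimes>\<^bsub>K\<^esub> m)) \<oplus>\<^bsub>K\<^esub>
    A \<otimes>\<^bsub>K\<^esub> (al \<otimes>\<^bsub>K\<^esub> (m \<otimes>\<^bsub>K\<^esub> m)) \<otimes>\<^bsub>K\<^esub> (e \<otimes>\<^bsub>K\<^esub> e) \<oplus>\<^bsub>K\<^esub> C \<otimes>\<^bsub>K\<^esub> ((e \<otimes>\<^bsub>K\<^esub> e) \<otimes>\<^bsub>K\<^esub> (e \<otimes>\<^bsub>K\<^esub> e)))"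

context field begin

lemma quartic_solI:
 assumes "m \<in> carrier R" "e \<in> carrier R" "n \<in> carrier R" "~ (m = \<zero> & e = \<zero>)"
  "al \<otimes> (n \<otimes> n) = (al \<otimes> (m \<otimes> m)) \<otimes> (al \<otimes> (m \<otimes> m)) \<oplus> A \<otimes> (al \<otimes> (m \<otimes> m)) \<otimes> (e \<otimes> e) \<oplus> C \<otimes> ((e \<otimes> e) \<otimes> (e \<otimes> e))"
 shows "quartic_sol R A C al"
 unfolding quartic_sol_def using assms by (intro bexI conjI)

lemma kummer_class_imp_quartic:
 assumes c: "al \<in> carrier R" "al ~= \<zero>" "A \<in> carrier R" "C \<in> carrier R" and k: "kummer_class R A C al"
 shows "quartic_sol R A C al"
proof -
 let ?i = "inv al"
 have i: "?i \<in> carrier R" "al \<otimes> ?i = \<one>" using inv_closed' inv_r c by auto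
 from k consider (one) "is_square R al" | (origin) "is_square R (al \<otimes> C)"
  | (point) x y where "x \<in> carrier R" "y \<in> carrier R" "x ~= \<zero>" "y \<otimes> y = x \<otimes> (x \<otimes> x \<oplus> A \<otimes> x \<oplus> C)" "is_square R (al \<otimes> x)"
  unfolding kummer_class_def by blast
 then show ?thesis
 proof cases
  case one
  then obtain w where w: "w \<in> carrier R" "al = w \<otimes> w" unfolding is_square_def by (elim bexE)
  show ?thesis by (rule quartic_solI[of \<one> \<zero> w]) (use w c in \<open>simp_all add: m_assoc\<close>)
 next
  case origin
  then obtain w where w: "w \<in> carrier R" "al \<otimes> C = w \<otimes> w" unfolding is_square_def by (elim bexE)
  have "al \<otimes> ((w \<otimes> ?i) \<otimes> (w \<otimes> ?i)) = (al \<otimes> ?i) \<otimes> (w \<otimes> w) \<otimes> ?i" using c(1) i(1) w(1) by (simp add: m_ac)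
  also have "\<dots> = (al \<otimes> ?i) \<otimes> C" unfolding w(2)[symmetric] using c i by (simp add: m_ac)
  finally have e: "al \<otimes> ((w \<otimes> ?i) \<otimes> (w \<otimes> ?i)) = C" using i c by simp
  show ?thesis by (rule quartic_solI[of \<zero> \<one> "w \<otimes> ?i"]) (use e w c i in simp_all)
 next
  case (point x y)
  then obtain w where w: "w \<in> carrier R" "al \<otimes> x = w \<otimes> w" unfolding is_square_def by (elim bexE)
  have w0: "w ~= \<zero>" using w(2) point(1,3) c by (auto simp: integral_iff)
  let ?j = "inv w"
  have j: "?j \<in> carrier R" "w \<otimes> ?j = \<one>" using inv_closed' inv_r w(1) w0 by auto
  let ?F = "x \<otimes> x \<oplus> A \<otimes> x \<oplus> C"
  have Fc: "?F \<in> carrier R" using point c by simp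
  have "al \<otimes> ((w \<otimes> ?i) \<otimes> (w \<otimes> ?i)) = (al \<otimes> ?i) \<otimes> (w \<otimes> w) \<otimes> ?i" using c(1) i(1) w(1) by (simp add: m_ac)
  also have "\<dots> = (al \<otimes> ?i) \<otimes> ((al \<otimes> ?i) \<otimes> x)" unfolding w(2)[symmetric] using c(1) i(1) point(1) by (simp add: m_ac)
  finally have m: "al \<otimes> ((w \<otimes> ?i) \<otimes> (w \<otimes> ?i)) = x" using i point(1) by simp
  have "al \<otimes> ((y \<otimes> ?j) \<otimes> (y \<otimes> ?j)) = (al \<otimes> (y \<otimes> y)) \<otimes> (?j \<otimes> ?j)" using c j(1) point(2) by (simp add: m_ac)
  also have "\<dots> = (al \<otimes> x) \<otimes> ?F \<otimes> (?j \<otimes> ?j)" unfolding point(4) using c j(1) point(1) Fc by (simp add: m_assoc)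
  also have "\<dots> = (w \<otimes> ?j) \<otimes> (w \<otimes> ?j) \<otimes> ?F" unfolding w(2) using j(1) w(1) Fc by (simp add: m_ac)
  finally have n: "al \<otimes> ((y \<otimes> ?j) \<otimes> (y \<otimes> ?j)) = ?F" using j Fc by simp
  show ?thesis by (rule quartic_solI[of "w \<otimes> ?i" \<one> "y \<otimes> ?j"]) (use m n w c i j point in simp_all)
 qed
qed

lemma quartic_imp_kummer_class:
 assumes c: "al \<in> carrier R" "al ~= \<zero>" "A \<in> carrier R" "C \<in> carrier R" and q: "quartic_sol R A C al"
 shows "kummer_class R A C al"
proof -
 from q obtain m e n where mc: "m \<in> carrier R" "e \<in> carrier R" "n \<in> carrier R" and ne: "~ (m = \<zero> & e = \<zero>)"
  and eq: "al \<otimes> (n \<otimes> n) = (al \<otimes> (m \<otimes> m)) \<otimes> (al \<otimes> (m \<otimes> m)) \<oplus> A \<otimes> (al \<otimes> (m \<otimes> m)) \<otimes> (e \<otimes> e) \<oplus> C \<otimes> ((e \<otimes> e) \<otimes> (e \<otimes> e))"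
  unfolding quartic_sol_def by (elim bexE conjE)
 show ?thesis
 proof (cases "e = \<zero>")
  case True
  have "al \<otimes> (n \<otimes> n) = al \<otimes> (al \<otimes> ((m \<otimes> m) \<otimes> (m \<otimes> m)))" using eq mc c unfolding True by (simp add: m_ac)
  then have "n \<otimes> n = al \<otimes> ((m \<otimes> m) \<otimes> (m \<otimes> m))" using m_lcancel[OF c(2,1)] mc c by simp
  then have "is_square R (al \<otimes> ((m \<otimes> m) \<otimes> (m \<otimes> m)))" using mc(3) by (intro is_squareI[of n]) auto
  then have "is_square R al" using is_square_cancel[of al "m \<otimes> m"] c mc ne True by (simp add: integral_iff)
  then show ?thesis unfolding kummer_class_def by simp
 next
  case False
  let ?u = "inv e"
  have u: "?u \<in> carrier R" "e \<otimes> ?u = \<one>" using inv_closed' inv_r mc False by auto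
  define k where "k = m \<otimes> ?u" define l where "l = n \<otimes> (?u \<otimes> ?u)"
  have kc: "k \<in> carrier R" "l \<in> carrier R" unfolding k_def l_def using mc u by auto
  let ?x = "al \<otimes> (k \<otimes> k)"
  have xc: "?x \<in> carrier R" using c kc by simp
  have "al \<otimes> (l \<otimes> l) = al \<otimes> (n \<otimes> n) \<otimes> ((?u \<otimes> ?u) \<otimes> (?u \<otimes> ?u))" unfolding l_def using c mc u(1) by (simp add: m_ac)
  also have "\<dots> = ?x \<otimes> ?x \<oplus> A \<otimes> ?x \<otimes> ((e \<otimes> ?u) \<otimes> (e \<otimes> ?u)) \<oplus> C \<otimes> (((e \<otimes> ?u) \<otimes> (e \<otimes> ?u)) \<otimes> ((e \<otimes> ?u) \<otimes> (e \<otimes> ?u)))"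
   unfolding eq k_def using c mc u(1) by (simp add: m_ac l_distr r_distr)
  finally have l: "al \<otimes> (l \<otimes> l) = ?x \<otimes> ?x \<oplus> A \<otimes> ?x \<oplus> C" unfolding u(2) using c xc by simp
  show ?thesis
  proof (cases "k = \<zero>")
   case True
   have "al \<otimes> (l \<otimes> l) = C" using l c unfolding True by simp
   then have "al \<otimes> C = (al \<otimes> l) \<otimes> (al \<otimes> l)" using c kc by (auto simp: m_ac)
   then have "is_square R (al \<otimes> C)" using c kc by (intro is_squareI[of "al \<otimes> l"]) auto
   then show ?thesis unfolding kummer_class_def by simp
  next
   case False
   have "(al \<otimes> k \<otimes> l) \<otimes> (al \<otimes> k \<otimes> l) = ?x \<otimes> (al \<otimes> (l \<otimes> l))" using c kc by (simp add: m_ac)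
   then have "(al \<otimes> k \<otimes> l) \<otimes> (al \<otimes> k \<otimes> l) = ?x \<otimes> (?x \<otimes> ?x \<oplus> A \<otimes> ?x \<oplus> C)" unfolding l .
   moreover have "?x ~= \<zero>" using c kc False by (simp add: integral_iff)
   moreover have "is_square R (al \<otimes> ?x)" by (rule is_squareI[of "al \<otimes> k"]) (use c kc in \<open>auto simp: m_ac\<close>)
   moreover have "al \<otimes> k \<otimes> l \<in> carrier R" using c kc by simp
   ultimately show ?thesis unfolding kummer_class_def using xc by blast
  qed
 qed
qed

text \<open>In the quartic a twist by w^2 only rescales e by w.\<close>

lemma kummer_class_twist_square:
 assumes c: "al \<in> carrier R" "al ~= \<zero>" "A \<in> carrier R" "C \<in> carrier R" "w \<in> carrier R" "w ~= \<zero>"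
 shows "kummer_class R (A \<otimes> (w \<otimes> w)) (C \<otimes> ((w \<otimes> w) \<otimes> (w \<otimes> w))) al \<longleftrightarrow> kummer_class R A C al"
proof
 let ?A = "A \<otimes> (w \<otimes> w)" let ?C = "C \<otimes> ((w \<otimes> w) \<otimes> (w \<otimes> w))"
 have AC: "?A \<in> carrier R" "?C \<in> carrier R" using c by auto
 assume "kummer_class R ?A ?C al"
 then have "quartic_sol R ?A ?C al" by (rule kummer_class_imp_quartic[OF c(1,2) AC])
 then obtain m e n where mc: "m \<in> carrier R" "e \<in> carrier R" "n \<in> carrier R" and ne: "~ (m = \<zero> & e = \<zero>)"
  and eq: "al \<otimes> (n \<otimes> n) = (al \<otimes> (m \<otimes> m)) \<otimes> (al \<otimes> (m \<otimes> m)) \<oplus> ?A \<otimes> (al \<otimes> (m \<otimes> m)) \<otimes> (e \<otimes> e) \<oplus> ?C \<otimes> ((e \<otimes> e) \<otimes> (e \<otimes> e))"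
  unfolding quartic_sol_def by (elim bexE conjE)
 have "quartic_sol R A C al"
 proof (rule quartic_solI[of m "e \<otimes> w" n])
  show "~ (m = \<zero> & e \<otimes> w = \<zero>)" using ne c mc by (simp add: integral_iff)
 qed (use mc c eq in \<open>auto simp: m_ac\<close>)
 then show "kummer_class R A C al" by (rule quartic_imp_kummer_class[OF c(1-4)])
next
 let ?A = "A \<otimes> (w \<otimes> w)" let ?C = "C \<otimes> ((w \<otimes> w) \<otimes> (w \<otimes> w))"
 have AC: "?A \<in> carrier R" "?C \<in> carrier R" using c by auto
 let ?j = "inv w"
 have j: "?j \<in> carrier R" "w \<otimes> ?j = \<one>" "?j ~= \<zero>" using inv_closed' inv_r inv_neq_zero c by auto
 assume "kummer_class R A C al"
 then have "quartic_sol R A C al" by (rule kummer_class_imp_quartic[OF c(1-4)])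
 then obtain m e n where mc: "m \<in> carrier R" "e \<in> carrier R" "n \<in> carrier R" and ne: "~ (m = \<zero> & e = \<zero>)"
  and eq: "al \<otimes> (n \<otimes> n) = (al \<otimes> (m \<otimes> m)) \<otimes> (al \<otimes> (m \<otimes> m)) \<oplus> A \<otimes> (al \<otimes> (m \<otimes> m)) \<otimes> (e \<otimes> e) \<oplus> C \<otimes> ((e \<otimes> e) \<otimes> (e \<otimes> e))"
  unfolding quartic_sol_def by (elim bexE conjE)
 have "quartic_sol R ?A ?C al"
 proof (rule quartic_solI[of m "e \<otimes> ?j" n])
  show "~ (m = \<zero> & e \<otimes> ?j = \<zero>)" using ne j mc by (simp add: integral_iff)
  let ?o = "w \<otimes> ?j"
  have "(al \<otimes> (m \<otimes> m)) \<otimes> (al \<otimes> (m \<otimes> m)) \<oplus> ?A \<otimes> (al \<otimes> (m \<otimes> m)) \<otimes> ((e \<otimes> ?j) \<otimes> (e \<otimes> ?j)) \<oplus> ?C \<otimes> (((e \<otimes> ?j) \<otimes> (e \<otimes> ?j)) \<otimes> ((e \<otimes> ?j) \<otimes> (e \<otimes> ?j)))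
   = (al \<otimes> (m \<otimes> m)) \<otimes> (al \<otimes> (m \<otimes> m)) \<oplus> A \<otimes> (al \<otimes> (m \<otimes> m)) \<otimes> (e \<otimes> e) \<otimes> (?o \<otimes> ?o) \<oplus> C \<otimes> ((e \<otimes> e) \<otimes> (e \<otimes> e)) \<otimes> (?o \<otimes> ?o \<otimes> (?o \<otimes> ?o))"
   using mc c j(1) by (simp add: m_ac)
  also have "\<dots> = al \<otimes> (n \<otimes> n)" unfolding j(2) eq using mc c by simp
  finally show "al \<otimes> (n \<otimes> n) = (al \<otimes> (m \<otimes> m)) \<otimes> (al \<otimes> (m \<otimes> m)) \<oplus> ?A \<otimes> (al \<otimes> (m \<otimes> m)) \<otimes> ((e \<otimes> ?j) \<otimes> (e \<otimes> ?j)) \<oplus> ?C \<otimes> (((e \<otimes> ?j) \<otimes> (e \<otimes> ?j)) \<otimes> ((e \<otimes> ?j) \<otimes> (e \<otimes> ?j)))" by simp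
 qed (use mc j in auto)
 then show "kummer_class R ?A ?C al" by (rule quartic_imp_kummer_class[OF c(1,2) AC])
qed

end

definition local_sol :: "place => int => int => int => bool" where
 "local_sol v a b al \<longleftrightarrow> kummer_class (completion v) (of_int_ring (completion v) (- 2 * a))
   (of_int_ring (completion v) (a^2 - 4 * b)) (of_int_ring (completion v) al)"

text \<open>The quartic with A = -2 a and C = a^2 - 4 b after completing the square, read on Cauchy
  representatives.\<close>

definition seq_sol :: "place => int => int => int => bool" where
 "seq_sol v a b al \<longleftrightarrow> (\<exists>m e n. cauchy_seq v m & cauchy_seq v e & cauchy_seq v n & ~ (null_seq v m & null_seq v e) &
   null_seq v (%k. of_int al * (n k)^2 - ((of_int al * (m k)^2 - of_int a * (e k)^2)^2 - 4 * of_int b * (e k) ^ 4)))"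

lemma local_sol_iff_seq_sol:
 assumes v: "v \<in> places" and al: "al ~= 0"
 shows "local_sol v a b al \<longleftrightarrow> seq_sol v a b al"
proof -
 interpret K: field "completion v" by (rule completion_field[OF v])
 note cs = cauchy_seq_const[OF v] cauchy_seq_mult[OF v] cauchy_seq_add[OF v]
 note hom = lim_class_mult[OF v] lim_class_add[OF v]
 let ?A = "of_int_ring (completion v) (- 2 * a)" let ?C = "of_int_ring (completion v) (a\<^sup>2 - 4 * b)" let ?a = "of_int_ring (completion v) al"
 have a0: "?a ~= \<zero>\<^bsub>completion v\<^esub>" using of_int_ring_completion_eq_0[OF v] al by simp
 have "local_sol v a b al \<longleftrightarrow> quartic_sol (completion v) ?A ?C ?a"
  unfolding local_sol_def using K.kummer_class_imp_quartic[of ?a ?A ?C] K.quartic_imp_kummer_class[of ?a ?A ?C] a0 by auto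
 also have "\<dots> \<longleftrightarrow> seq_sol v a b al"
 proof -
  let ?L = "lim_class v"
  have key: "?a \<otimes>\<^bsub>completion v\<^esub> (?L n \<otimes>\<^bsub>completion v\<^esub> ?L n) = (?a \<otimes>\<^bsub>completion v\<^esub> (?L m \<otimes>\<^bsub>completion v\<^esub> ?L m)) \<otimes>\<^bsub>completion v\<^esub> (?a \<otimes>\<^bsub>completion v\<^esub> (?L m \<otimes>\<^bsub>completion v\<^esub> ?L m)) \<oplus>\<^bsub>completion v\<^esub>
    ?A \<otimes>\<^bsub>completion v\<^esub> (?a \<otimes>\<^bsub>completion v\<^esub> (?L m \<otimes>\<^bsub>completion v\<^esub> ?L m)) \<otimes>\<^bsub>completion v\<^esub> (?L e \<otimes>\<^bsub>completion v\<^esub> ?L e) \<oplus>\<^bsub>completion v\<^esub> ?C \<otimes>\<^bsub>completion v\<^esub> ((?L e \<otimes>\<^bsub>completion v\<^esub> ?L e) \<otimes>\<^bsub>completion v\<^esub> (?L e \<otimes>\<^bsub>completion v\<^esub> ?L e))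
   \<longleftrightarrow> null_seq v (%k. of_int al * (n k)^2 - ((of_int al * (m k)^2 - of_int a * (e k)^2)^2 - 4 * of_int b * (e k) ^ 4))" (is "?E \<longleftrightarrow> _")
   if s: "cauchy_seq v m" "cauchy_seq v e" "cauchy_seq v n" for m e n
  proof -
   let ?l = "%k. of_int al * (n k * n k)"
   let ?r = "%k. (of_int al * (m k * m k)) * (of_int al * (m k * m k)) + of_int (- 2 * a) * (of_int al * (m k * m k)) * (e k * e k) + of_int (a\<^sup>2 - 4 * b) * ((e k * e k) * (e k * e k))"
   have c: "cauchy_seq v ?l" "cauchy_seq v ?r" by (intro cs s)+
   have "?E \<longleftrightarrow> ?L ?l = ?L ?r" unfolding of_int_ring_completion[OF v] using s by (simp only: hom cs)
   also have "\<dots> \<longleftrightarrow> null_seq v (%k. ?l k - ?r k)" by (rule lim_class_eq[OF v c])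
   also have "(%k. ?l k - ?r k) = (%k. of_int al * (n k)^2 - ((of_int al * (m k)^2 - of_int a * (e k)^2)^2 - 4 * of_int b * (e k) ^ 4))"
    by (rule ext) (simp add: power2_eq_square power4_eq_xxxx algebra_simps)
   finally show ?thesis .
  qed
  show ?thesis
  proof
   assume "quartic_sol (completion v) ?A ?C ?a"
   then obtain M E N where MEN: "M \<in> carrier (completion v)" "E \<in> carrier (completion v)" "N \<in> carrier (completion v)" "~ (M = \<zero>\<^bsub>completion v\<^esub> & E = \<zero>\<^bsub>completion v\<^esub>)"
    "?a \<otimes>\<^bsub>completion v\<^esub> (N \<otimes>\<^bsub>completion v\<^esub> N) = (?a \<otimes>\<^bsub>completion v\<^esub> (M \<otimes>\<^bsub>completion v\<^esub> M)) \<otimes>\<^bsub>completion v\<^esub> (?a \<otimes>\<^bsub>completion v\<^esub> (M \<otimes>\<^bsub>completion v\<^esub> M)) \<oplus>\<^bsub>completion v\<^esub>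
    ?A \<otimes>\<^bsub>completion v\<^esub> (?a \<otimes>\<^bsub>completion v\<^esub> (M \<otimes>\<^bsub>completion v\<^esub> M)) \<otimes>\<^bsub>completion v\<^esub> (E \<otimes>\<^bsub>completion v\<^esub> E) \<oplus>\<^bsub>completion v\<^esub> ?C \<otimes>\<^bsub>completion v\<^esub> ((E \<otimes>\<^bsub>completion v\<^esub> E) \<otimes>\<^bsub>completion v\<^esub> (E \<otimes>\<^bsub>completion v\<^esub> E))"
    unfolding quartic_sol_def by (elim bexE conjE)
   obtain m where m: "cauchy_seq v m" "M = ?L m" using completion_carrierE[OF v MEN(1)] .
   obtain e where e: "cauchy_seq v e" "E = ?L e" using completion_carrierE[OF v MEN(2)] .
   obtain n where n: "cauchy_seq v n" "N = ?L n" using completion_carrierE[OF v MEN(3)] .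
   have "~ (null_seq v m & null_seq v e)" using MEN(4) unfolding m(2) e(2) lim_class_eq_0[OF v m(1)] lim_class_eq_0[OF v e(1)] .
   then show "seq_sol v a b al" unfolding seq_sol_def using MEN(5) m e n key by blast
  next
   assume "seq_sol v a b al"
   then obtain m e n where s: "cauchy_seq v m" "cauchy_seq v e" "cauchy_seq v n" "~ (null_seq v m & null_seq v e)"
    "null_seq v (%k. of_int al * (n k)^2 - ((of_int al * (m k)^2 - of_int a * (e k)^2)^2 - 4 * of_int b * (e k) ^ 4))" unfolding seq_sol_def by blast
   show "quartic_sol (completion v) ?A ?C ?a"
   proof (rule K.quartic_solI)
    show "?L m \<in> carrier (completion v)" "?L e \<in> carrier (completion v)" "?L n \<in> carrier (completion v)" using lim_class_closed[OF v] s by auto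
    show "~ (?L m = \<zero>\<^bsub>completion v\<^esub> & ?L e = \<zero>\<^bsub>completion v\<^esub>)" unfolding lim_class_eq_0[OF v s(1)] lim_class_eq_0[OF v s(2)] by (rule s(4))
   qed (use key[OF s(1-3)] s(5) in blast)
  qed
 qed
 finally show ?thesis .
qed

lemma local_sol_twist_square:
 assumes v: "v \<in> places" and al: "al ~= 0" and D: "D ~= 0" "is_square (completion v) (of_int_ring (completion v) D)"
 shows "local_sol v (a * D) (b * D^2) al \<longleftrightarrow> local_sol v a b al"
proof -
 interpret K: field "completion v" by (rule completion_field[OF v])
 obtain w where w: "w \<in> carrier (completion v)" "of_int_ring (completion v) D = w \<otimes>\<^bsub>completion v\<^esub> w" using D(2) unfolding is_square_def by (elim bexE)
 have w0: "w ~= \<zero>\<^bsub>completion v\<^esub>" 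
 proof
  assume "w = \<zero>\<^bsub>completion v\<^esub>"
  then have "of_int_ring (completion v) D = \<zero>\<^bsub>completion v\<^esub>" unfolding w(2) by simp
  then show False using D(1) unfolding of_int_ring_completion_eq_0[OF v] by simp
 qed
 have a0: "of_int_ring (completion v) al ~= \<zero>\<^bsub>completion v\<^esub>" using of_int_ring_completion_eq_0[OF v] al by simp
 have e1: "of_int_ring (completion v) (- 2 * (a * D)) = of_int_ring (completion v) (- 2 * a) \<otimes>\<^bsub>completion v\<^esub> (w \<otimes>\<^bsub>completion v\<^esub> w)"
  unfolding w(2)[symmetric] K.of_int_ring_mult[symmetric] mult.assoc ..
 have "(a * D)^2 - 4 * (b * D^2) = (a^2 - 4 * b) * (D * D)" by (simp add: power2_eq_square algebra_simps)
 note D4 = this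
 have e2: "of_int_ring (completion v) ((a * D)^2 - 4 * (b * D^2)) = of_int_ring (completion v) (a^2 - 4 * b) \<otimes>\<^bsub>completion v\<^esub> ((w \<otimes>\<^bsub>completion v\<^esub> w) \<otimes>\<^bsub>completion v\<^esub> (w \<otimes>\<^bsub>completion v\<^esub> w))"
  unfolding w(2)[symmetric] D4 K.of_int_ring_mult ..
 show ?thesis unfolding local_sol_def e1 e2
  by (rule K.kummer_class_twist_square[OF K.of_int_ring_closed a0 K.of_int_ring_closed K.of_int_ring_closed w(1) w0])
qed

text \<open>Sequential compactness of the p-adic integers: by pigeonhole the n-th refinement of the
  sequence is constant modulo p^n, and the diagonal subsequence is Cauchy.\<close>

lemma padic_cauchy_subsequence:
 fixes x :: "nat => int"
 assumes p: "prime p"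
 shows "\<exists>r. strict_mono r & cauchy_seq (Finite_place p) (%k. of_int (x (r k)))"
proof -
 let ?P = "%n (s :: nat => nat). \<forall>i j :: nat. int p ^ n dvd x (s i) - x (s j)"
 interpret subseqs ?P
 proof
  fix n and s :: "nat => nat" assume "strict_mono s"
  let ?f = "%i. x (s i) mod int p ^ n"
  have pos: "int p ^ n > 0" using prime_gt_0_nat[OF p] by simp
  have "finite (?f ` UNIV)"
  proof (rule finite_subset)
   show "range ?f \<subseteq> {0..<int p ^ n}" using pos by auto
  qed simp
  then obtain i0 where i0: "infinite {i \<in> UNIV. ?f i = ?f i0}" using pigeonhole_infinite[of UNIV ?f] by auto
  let ?S = "{i. ?f i = ?f i0}"
  have inf: "infinite ?S" using i0 by simp
  have "?f (enumerate ?S i) = ?f i0" for i using enumerate_in_set[OF inf, of i] by simp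
  then have A: "\<forall>i j. int p ^ n dvd x ((s \<circ> enumerate ?S) i) - x ((s \<circ> enumerate ?S) j)" by (simp flip: mod_eq_dvd_iff)
  have B: "strict_mono (enumerate ?S)" using inf by (rule strict_mono_enumerate)
  show "\<exists>r'. strict_mono r' & ?P n (s \<circ> r')" by (rule exI[of _ "enumerate ?S"], rule conjI[OF B A])
 qed
 \<comment> \<open>The k-th refinement governs the diagonal sequence only from index
   \<open>Suc k\<close> on, hence the shift.\<close>
 have h: "?P k (diagseq \<circ> ((+) (Suc k)))" for k by (rule diagseq_holds) auto
 have dv: "int p ^ k dvd x (diagseq m) - x (diagseq n)" if "m \<ge> Suc k" "n \<ge> Suc k" for k m n
  using h[of k, rule_format, of "m - Suc k" "n - Suc k"] that by simp
 have p1: "real p > 1" using prime_gt_1_nat[OF p] by simp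
 have "cauchy_seq (Finite_place p) (%k. of_int (x (diagseq k)))" unfolding cauchy_seq_def
 proof (intro allI impI)
  fix e :: real assume e: "e > 0"
  have "inverse (real p) < 1" "inverse (real p) > 0" using p1 by (auto simp: inverse_less_1_iff)
  then obtain k where k: "inverse (real p) ^ k < e" using e real_arch_pow_inv[of e "inverse (real p)"] by auto
  show "\<exists>N. \<forall>m\<ge>N. \<forall>n\<ge>N. place_abs (Finite_place p) (of_int (x (diagseq m)) - of_int (x (diagseq n))) < e"
  proof (intro exI[of _ "Suc k"] allI impI)
   fix m n assume "Suc k \<le> m" "Suc k \<le> n"
   then have "place_abs (Finite_place p) (of_int (x (diagseq m) - x (diagseq n))) \<le> real p powi (- int k)"
    using place_abs_of_int_pow_dvd[OF p] dv by blast
   also have "\<dots> = inverse (real p) ^ k" by (simp add: power_int_minus power_inverse)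
   finally show "place_abs (Finite_place p) (of_int (x (diagseq m)) - of_int (x (diagseq n))) < e" using k by simp
  qed
 qed
 then show ?thesis using subseq_diagseq by blast
qed

lemma cauchy_seq_subseq: assumes "cauchy_seq v f" "strict_mono (r :: nat => nat)" shows "cauchy_seq v (%k. f (r k))"
 unfolding cauchy_seq_def
proof (intro allI impI)
 fix e :: real assume "e > 0"
 then obtain N where N: "\<And>m n. m \<ge> N ==> n \<ge> N ==> place_abs v (f m - f n) < e" using assms(1) unfolding cauchy_seq_def by blast
 show "\<exists>N. \<forall>m\<ge>N. \<forall>n\<ge>N. place_abs v (f (r m) - f (r n)) < e"
  using N seq_suble[OF assms(2)] by (intro exI[of _ N]) (meson order_trans)
qed

lemma null_seq_of_dvd:
 assumes p: "prime p" and d: "\<And>k. int p ^ k dvd x k"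
 shows "null_seq (Finite_place p) (%k. of_int (x k))"
 unfolding null_seq_def
proof (rule tendsto_sandwich[OF _ _ tendsto_const])
 have p1: "real p > 1" using prime_gt_1_nat[OF p] by simp
 show "\<forall>\<^sub>F k in sequentially. 0 \<le> place_abs (Finite_place p) (of_int (x k))" by (intro always_eventually allI place_abs_nonneg)
 show "\<forall>\<^sub>F k in sequentially. place_abs (Finite_place p) (of_int (x k)) \<le> inverse (real p) ^ k"
 proof (intro always_eventually allI)
  fix k
  have "place_abs (Finite_place p) (of_int (x k)) \<le> real p powi (- int k)" using place_abs_of_int_pow_dvd[OF p] d by blast
  then show "place_abs (Finite_place p) (of_int (x k)) \<le> inverse (real p) ^ k" by (simp add: power_int_minus power_inverse del: place_abs.simps)
 qed
 show "(%k. inverse (real p) ^ k) \<longlonglongrightarrow> 0" using p1 by (intro LIMSEQ_power_zero) (simp add: inverse_less_1_iff)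
qed

text \<open>Compactness of the \<open>p\<close>-adic integers: solutions modulo all powers of \<open>p\<close> accumulate.\<close>

lemma padic_compactness:
 assumes p: "prime p" and Q: "\<And>M. \<exists>x y z. Q M x y z" and mono: "\<And>M M' x y z. M \<le> M' ==> Q M' x y z ==> Q M x y z"
 shows "\<exists>f g h. cauchy_seq (Finite_place p) (%k. of_int (f k)) & cauchy_seq (Finite_place p) (%k. of_int (g k)) &
  cauchy_seq (Finite_place p) (%k. of_int (h k)) & (\<forall>k. Q k (f k) (g k) (h k))"
proof -
 have "\<forall>M. \<exists>t. Q M (fst t) (fst (snd t)) (snd (snd t))" using Q by (metis fst_conv snd_conv)
 from choice[OF this] obtain t where t: "\<And>M. Q M (fst (t M)) (fst (snd (t M))) (snd (snd (t M)))" by blast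
 let ?x = "%M. fst (t M)" let ?y = "%M. fst (snd (t M))" let ?z = "%M. snd (snd (t M))"
 obtain r1 where r1: "strict_mono r1" "cauchy_seq (Finite_place p) (%k. of_int (?x (r1 k)))" using padic_cauchy_subsequence[OF p, of ?x] by blast
 obtain r2 where r2: "strict_mono r2" "cauchy_seq (Finite_place p) (%k. of_int (?y (r1 (r2 k))))" using padic_cauchy_subsequence[OF p, of "%k. ?y (r1 k)"] by blast
 obtain r3 where r3: "strict_mono r3" "cauchy_seq (Finite_place p) (%k. of_int (?z (r1 (r2 (r3 k)))))" using padic_cauchy_subsequence[OF p, of "%k. ?z (r1 (r2 k))"] by blast
 define r where "r k = r1 (r2 (r3 k))" for k
 have sm: "strict_mono r" using r1(1) r2(1) r3(1) unfolding r_def strict_mono_def by simp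
 have "k \<le> r k" for k using seq_suble[OF sm] .
 then have Qr: "Q k (?x (r k)) (?y (r k)) (?z (r k))" for k using mono t by blast
 have "strict_mono (%k. r2 (r3 k))" using r2(1) r3(1) unfolding strict_mono_def by simp
 then have cx: "cauchy_seq (Finite_place p) (%k. of_int (?x (r k)))" unfolding r_def using cauchy_seq_subseq[OF r1(2)] by blast
 have cy: "cauchy_seq (Finite_place p) (%k. of_int (?y (r k)))" unfolding r_def using cauchy_seq_subseq[OF r2(2) r3(1)] .
 have cz: "cauchy_seq (Finite_place p) (%k. of_int (?z (r k)))" unfolding r_def using r3(2) .
 show ?thesis by (rule exI[of _ "%k. ?x (r k)"], rule exI[of _ "%k. ?y (r k)"], rule exI[of _ "%k. ?z (r k)"]) (intro conjI allI cx cy cz Qr)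
qed

lemma of_int_square_in_completion:
 assumes p: "prime p" and D: "\<And>M. \<exists>y. int p ^ M dvd y^2 - D"
 shows "is_square (completion (Finite_place p)) (of_int_ring (completion (Finite_place p)) D)"
proof -
 let ?v = "Finite_place p"
 have v: "?v \<in> places" using p by (simp add: places_def)
 interpret K: field "completion ?v" by (rule completion_field[OF v])
 have "\<exists>f g h. cauchy_seq ?v (%k. of_int (f k)) & cauchy_seq ?v (%k. of_int (g k)) &
  cauchy_seq ?v (%k. of_int (h k)) & (\<forall>k. int p ^ k dvd (f k)^2 - D)"
  by (rule padic_compactness[OF p, where Q = "%M x y z. int p ^ M dvd x^2 - D"]) (use D in \<open>auto intro: power_le_dvd\<close>)
 then obtain x where X: "cauchy_seq ?v (%k. of_int (x k))" "\<And>k. int p ^ k dvd (x k)^2 - D" by blast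
 have "null_seq ?v (%k. of_int ((x k)^2 - D))" using null_seq_of_dvd[OF p X(2)] .
 moreover have "(%k. of_int ((x k)^2 - D)) = (%k. of_int (x k) * of_int (x k) - (of_int D :: rat))" by (simp add: power2_eq_square)
 ultimately have "lim_class ?v (%k. of_int (x k) * of_int (x k)) = lim_class ?v (%k. of_int D)"
  using lim_class_eq[OF v cauchy_seq_mult[OF v X(1) X(1)] cauchy_seq_const[OF v]] by simp
 then show ?thesis unfolding of_int_ring_completion[OF v]
  using lim_class_mult[OF v X(1) X(1)] lim_class_closed[OF v X(1)] by (intro K.is_squareI) auto
qed

text \<open>Compactness turns the congruences into convergent sequences. The limit is nontrivial
  because at no index are m and e both divisible by p, and dividing N by \<open>al\<close> returns
  to the variable n of the quartic.\<close>

lemma padic_sol_imp_local_sol: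
 assumes p: "prime p" and al: "al ~= 0" and s: "padic_sol (int p) a b al"
 shows "local_sol (Finite_place p) a b al"
proof -
 let ?v = "Finite_place p"
 have v: "?v \<in> places" using p by (simp add: places_def)
 let ?G = "%m e N. N^2 - al * ((al * m^2 - a * e^2)^2 - 4 * b * e ^ 4)"
 let ?Q = "%M m e N. ~ (int p dvd m & int p dvd e) & int p ^ M dvd ?G m e N"
 have "\<exists>f g h. cauchy_seq ?v (%k. of_int (f k)) & cauchy_seq ?v (%k. of_int (g k)) & cauchy_seq ?v (%k. of_int (h k)) & (\<forall>k. ?Q k (f k) (g k) (h k))"
  by (rule padic_compactness[OF p, where Q = ?Q]) (use s in \<open>auto simp: padic_sol_def intro: power_le_dvd\<close>)
 then obtain m e N where c: "cauchy_seq ?v (%k. of_int (m k))" "cauchy_seq ?v (%k. of_int (e k))" "cauchy_seq ?v (%k. of_int (N k))"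
  and Q: "\<And>k. ?Q k (m k) (e k) (N k)" by blast
 let ?n = "%k. of_int (N k) * (1 / of_int al)"
 have "seq_sol ?v a b al" unfolding seq_sol_def
 proof (rule exI[of _ "%k. of_int (m k)"], rule exI[of _ "%k. of_int (e k)"], rule exI[of _ ?n], intro conjI c)
  show "cauchy_seq ?v ?n" by (intro cauchy_seq_mult[OF v] cauchy_seq_const[OF v] c)
  show "~ (null_seq ?v (%k. of_int (m k)) & null_seq ?v (%k. of_int (e k)))"
  proof
   assume "null_seq ?v (%k. of_int (m k)) & null_seq ?v (%k. of_int (e k))"
   moreover have "(0::real) < 1" by simp
   ultimately obtain N1 N2 where "\<And>n. n \<ge> N1 ==> place_abs ?v (of_int (m n)) < 1" "\<And>n. n \<ge> N2 ==> place_abs ?v (of_int (e n)) < 1"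
    unfolding null_seq_iff[OF v] by meson
   then have "place_abs ?v (of_int (m (max N1 N2))) < 1" "place_abs ?v (of_int (e (max N1 N2))) < 1" by simp_all
   then have "place_abs ?v (of_int (m (max N1 N2))) ~= 1" "place_abs ?v (of_int (e (max N1 N2))) ~= 1" by simp_all
   then show False using Q[of "max N1 N2"] unfolding place_abs_of_int_eq_1[OF p] by blast
  qed
  have n: "null_seq ?v (%k. of_int (?G (m k) (e k) (N k)))" by (rule null_seq_of_dvd[OF p]) (use Q in blast)
  have "null_seq ?v (%k. of_int (?G (m k) (e k) (N k)) * (1 / of_int al))" by (rule null_seq_mult_bounded[OF v n]) (rule order_refl)
  also have "(%k. of_int (?G (m k) (e k) (N k)) * (1 / of_int al :: rat)) = (%k. of_int al * (?n k)^2 - ((of_int al * (of_int (m k))^2 - of_int a * (of_int (e k))^2)^2 - 4 * of_int b * (of_int (e k)) ^ 4))"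
  proof
   have aux: "(x^2 - A * H) * (1 / A) = A * (x * (1 / A))^2 - H" if "A ~= 0" for x A H :: rat using that by (simp add: field_simps power2_eq_square)
   have "of_int al ~= (0 :: rat)" using al by simp
   then show "of_int (?G (m k) (e k) (N k)) * (1 / of_int al :: rat) = of_int al * (?n k)^2 - ((of_int al * (of_int (m k))^2 - of_int a * (of_int (e k))^2)^2 - 4 * of_int b * (of_int (e k)) ^ 4)" for k
    unfolding of_int_diff of_int_mult of_int_power of_int_numeral by (rule aux)
  qed
  finally show "null_seq ?v (%k. of_int al * (?n k)^2 - ((of_int al * (of_int (m k))^2 - of_int a * (of_int (e k))^2)^2 - 4 * of_int b * (of_int (e k)) ^ 4))" .
 qed
 then show ?thesis using local_sol_iff_seq_sol[OF v al] by blast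
qed

text \<open>The reduced denominator is prime to p, so it can be inverted modulo p^M.\<close>

lemma padic_integer_approx:
 assumes p: "prime p" and x: "place_abs (Finite_place p) x \<le> 1"
 shows "\<exists>z. place_abs (Finite_place p) (x - of_int z) \<le> real p powi (- int M)"
proof (cases "x = 0")
 case True then show ?thesis by (intro exI[of _ 0]) simp
next
 case False
 let ?v = "Finite_place p"
 have v: "?v \<in> places" using p by (simp add: places_def)
 obtain a b where ab: "quotient_of x = (a, b)" by (cases "quotient_of x")
 have b: "b > 0" and cop: "coprime a b" and xe: "x = of_int a / of_int b"
  using quotient_of_denom_pos[OF ab] quotient_of_coprime[OF ab] quotient_of_div[OF ab] by auto
 have nb: "~ int p dvd b"
 proof
  assume pb: "int p dvd b"
  then have "~ int p dvd a" using cop p by (metis coprime_common_divisor not_prime_unit prime_nat_int_transfer)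
  then have a1: "place_abs ?v (of_int a) = 1" using place_abs_of_int_eq_1[OF p] by blast
  have "place_abs ?v (of_int b) ~= 1" using place_abs_of_int_eq_1[OF p] pb by blast
  then have b1: "place_abs ?v (of_int b) < 1" using place_abs_of_int_le_1[OF p, of b] by linarith
  have "place_abs ?v x * place_abs ?v (of_int b) = 1" using a1 place_abs_mult[OF v, of x "of_int b"] b unfolding xe by simp
  moreover have "place_abs ?v x * place_abs ?v (of_int b) \<le> place_abs ?v (of_int b)" using mult_right_mono[OF x, of "place_abs ?v (of_int b)"] by simp
  ultimately show False using b1 by linarith
 qed
 then have "coprime (int p) b" using p by (simp add: prime_imp_coprime)
 then have "coprime b (int p ^ M)" by (simp add: coprime_commute)
 then obtain i where i: "[b * i = 1] (mod int p ^ M)" using cong_solve_coprime_int by blast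
 have "a - b * (a * i) = a * (1 - b * i)" by (simp add: algebra_simps)
 moreover have "int p ^ M dvd 1 - b * i" using i by (simp add: cong_iff_dvd_diff dvd_diff_commute)
 ultimately have "int p ^ M dvd a - b * (a * i)" by simp
 then have le: "place_abs ?v (of_int (a - b * (a * i))) \<le> real p powi (- int M)" using place_abs_of_int_pow_dvd[OF p] by blast
 have "(x - of_int (a * i)) * of_int b = of_int (a - b * (a * i))" unfolding xe using b by (simp add: field_simps)
 then have "place_abs ?v (x - of_int (a * i)) * place_abs ?v (of_int b) = place_abs ?v (of_int (a - b * (a * i)))" using place_abs_mult[OF v] by metis
 moreover have "place_abs ?v (of_int b) = 1" using nb place_abs_of_int_eq_1[OF p] by blast
 ultimately show ?thesis using le by (intro exI[of _ "a * i"]) simp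
qed

text \<open>Congruence of \<open>p\<close>-integral rationals up to an error \<open>del0\<close>.\<close>

definition padic_near :: "nat => real => rat => rat => bool" where
 "padic_near p del0 x y \<longleftrightarrow> place_abs (Finite_place p) x \<le> 1 & place_abs (Finite_place p) y \<le> 1 & place_abs (Finite_place p) (x - y) \<le> del0"

lemma padic_near_add:
 assumes p: "prime p" and "padic_near p del0 x y" "padic_near p del0 x' y'" shows "padic_near p del0 (x + x') (y + y')"
proof -
 have "(x + x') - (y + y') = (x - y) + (x' - y')" by simp
 note e = this
 show ?thesis using assms(2,3) unfolding padic_near_def e
  by (intro conjI order_trans[OF place_abs_ultra[OF p]] max.boundedI) (elim conjE, assumption)+
qed

lemma padic_near_mult:
 assumes p: "prime p" and h: "padic_near p del0 x y" "padic_near p del0 x' y'" shows "padic_near p del0 (x * x') (y * y')"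
proof -
 let ?v = "Finite_place p"
 have v: "?v \<in> places" using p by (simp add: places_def)
 note m = place_abs_mult[OF v]
 have d: "0 \<le> del0" using h(1) place_abs_nonneg[of ?v "x - y"] unfolding padic_near_def by linarith
 have e: "x * x' - y * y' = x * (x' - y') + (x - y) * y'" by (simp add: algebra_simps)
 have "place_abs ?v (x * (x' - y')) \<le> 1 * del0" unfolding m using h unfolding padic_near_def by (intro mult_mono) auto
 moreover have "place_abs ?v ((x - y) * y') \<le> del0 * 1" unfolding m using h d unfolding padic_near_def by (intro mult_mono) auto
 ultimately have "place_abs ?v (x * x' - y * y') \<le> del0" unfolding e using place_abs_ultra[OF p, of "x * (x' - y')" "(x - y) * y'"] by (simp del: place_abs.simps)
 moreover have "place_abs ?v (x * x') \<le> 1" "place_abs ?v (y * y') \<le> 1" unfolding m using h unfolding padic_near_def by (auto intro: mult_le_one)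
 ultimately show ?thesis unfolding padic_near_def by blast
qed

lemma padic_near_of_int: "prime p ==> 0 \<le> del0 ==> padic_near p del0 (of_int n) (of_int n)"
 unfolding padic_near_def using place_abs_of_int_le_1 by simp

lemma padic_near_diff:
 assumes p: "prime p" and h: "padic_near p del0 x y" "padic_near p del0 x' y'" shows "padic_near p del0 (x - x') (y - y')"
proof -
 have d: "0 \<le> del0" using h(1) place_abs_nonneg[of "Finite_place p" "x - y"] unfolding padic_near_def by linarith
 have "padic_near p del0 (of_int (- 1) * x') (of_int (- 1) * y')" by (intro padic_near_mult[OF p] padic_near_of_int[OF p d] h)
 then show ?thesis using padic_near_add[OF p h(1)] by fastforce
qed

text \<open>Dividing by the entry of largest absolute value makes the triple integral with one entry
  equal to 1. The uniform bound \<open>eps\<close> limits how much an error term can grow by this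
  division.\<close>

lemma padic_scaled_sequences:
 assumes p: "prime p" and c: "cauchy_seq (Finite_place p) x" "cauchy_seq (Finite_place p) y" "cauchy_seq (Finite_place p) z"
  and nn: "~ (null_seq (Finite_place p) x & null_seq (Finite_place p) y & null_seq (Finite_place p) z)"
 shows "\<exists>eps>0. \<exists>K. \<forall>k\<ge>K. \<exists>t. place_abs (Finite_place p) t \<ge> eps & place_abs (Finite_place p) (x k / t) \<le> 1 &
  place_abs (Finite_place p) (y k / t) \<le> 1 & place_abs (Finite_place p) (z k / t) \<le> 1 & (x k = t \<or> y k = t \<or> z k = t)"
proof -
 let ?v = "Finite_place p"
 have v: "?v \<in> places" using p by (simp add: places_def)
 have "\<exists>eps>0. \<exists>K. \<forall>k\<ge>K. place_abs ?v (x k) \<ge> eps \<or> place_abs ?v (y k) \<ge> eps \<or> place_abs ?v (z k) \<ge> eps"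
  using nn cauchy_not_null_bounded_below[OF v c(1)] cauchy_not_null_bounded_below[OF v c(2)] cauchy_not_null_bounded_below[OF v c(3)] by meson
 then obtain eps K where e: "eps > 0" "\<And>k. k \<ge> K ==> place_abs ?v (x k) \<ge> eps \<or> place_abs ?v (y k) \<ge> eps \<or> place_abs ?v (z k) \<ge> eps" by blast
 have le: "place_abs ?v (s / t) \<le> 1" if "place_abs ?v s \<le> place_abs ?v t" "place_abs ?v t \<ge> eps" for s t
 proof -
  have t: "t ~= 0" "place_abs ?v t > 0" using that(2) e(1) by (auto simp del: place_abs.simps)
  have "place_abs ?v (s / t) * place_abs ?v t = place_abs ?v s" using place_abs_mult[OF v, of "s / t" t] t(1) by simp
  then show ?thesis using that(1) t(2) by (metis mult_cancel_right1 mult_less_cancel_right_pos not_le order.strict_trans1 mult_1)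
 qed
 show ?thesis
 proof (intro exI[of _ eps] conjI e(1) exI[of _ K] allI impI)
  fix k assume k: "K \<le> k"
  let ?a = "place_abs ?v (x k)" let ?b = "place_abs ?v (y k)" let ?c = "place_abs ?v (z k)"
  consider "?b \<le> ?a" "?c \<le> ?a" | "?a \<le> ?b" "?c \<le> ?b" | "?a \<le> ?c" "?b \<le> ?c" by linarith
  then show "\<exists>t. place_abs ?v t \<ge> eps & place_abs ?v (x k / t) \<le> 1 & place_abs ?v (y k / t) \<le> 1 & place_abs ?v (z k / t) \<le> 1 & (x k = t \<or> y k = t \<or> z k = t)"
  proof cases
   case 1
   then have g: "?a \<ge> eps" using e(2)[OF k] by linarith
   show ?thesis by (intro exI[of _ "x k"] conjI g le order_refl 1 disjI1 refl)
  next
   case 2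
   then have g: "?b \<ge> eps" using e(2)[OF k] by linarith
   show ?thesis by (intro exI[of _ "y k"] conjI g le order_refl 2 disjI2[OF disjI1] refl)
  next
   case 3
   then have g: "?c \<ge> eps" using e(2)[OF k] by linarith
   show ?thesis by (intro exI[of _ "z k"] conjI g le order_refl 3 disjI2[OF disjI2] refl)
  qed
 qed
qed

lemma padic_near_pow_dvd:
 assumes p: "prime p" and n: "padic_near p (real p powi (- int M)) x (of_int z)" and x: "place_abs (Finite_place p) x \<le> real p powi (- int M)"
 shows "int p ^ M dvd z"
proof -
 have v: "Finite_place p \<in> places" using p by (simp add: places_def)
 have "of_int z = x + - (x - of_int z)" by simp
 then have "place_abs (Finite_place p) (of_int z) \<le> max (place_abs (Finite_place p) x) (place_abs (Finite_place p) (x - of_int z))"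
  using place_abs_ultra[OF p, of x "- (x - of_int z)"] place_abs_minus[OF v] by metis
 then show ?thesis using n x unfolding padic_near_def place_abs_of_int_pow_dvd[OF p, symmetric] by linarith
qed

lemma padic_near_exists:
 assumes p: "prime p" and x: "place_abs (Finite_place p) x \<le> 1"
 shows "\<exists>z. padic_near p (real p powi (- int M)) x (of_int z)"
 using padic_integer_approx[OF p x, of M] x place_abs_of_int_le_1[OF p] unfolding padic_near_def by blast

lemma padic_near_one_not_dvd:
 assumes p: "prime p" and n: "padic_near p (real p powi (- int (Suc M))) 1 (of_int z)"
 shows "~ int p dvd z"
proof
 assume d: "int p dvd z"
 have "place_abs (Finite_place p) (of_int (1 - z)) \<le> real p powi (- int (Suc M))" using n unfolding padic_near_def by simp
 then have "int p ^ Suc M dvd 1 - z" unfolding place_abs_of_int_pow_dvd[OF p] .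
 then have "int p dvd 1 - z" using dvd_mult_left by auto
 then have "int p dvd 1" using d by (metis add.commute diff_add_cancel dvd_add)
 then show False using p by auto
qed

lemma place_abs_square_le_1:
 assumes p: "prime p" and x: "place_abs (Finite_place p) (x * x) \<le> 1"
 shows "place_abs (Finite_place p) x \<le> 1"
proof (rule ccontr)
 have v: "Finite_place p \<in> places" using p by (simp add: places_def)
 assume "~ ?thesis"
 then have "1 < place_abs (Finite_place p) x * place_abs (Finite_place p) x" by (simp add: less_1_mult del: place_abs.simps)
 then show False using x unfolding place_abs_mult[OF v] by linarith
qed

text \<open>The quartic is weighted homogeneous: m and e are divided by t, and n by t^2. The
  normalised solution is then replaced by nearby integers.\<close>

lemma local_sol_imp_padic_sol:
 assumes p: "prime p" and al: "al ~= 0" and s: "local_sol (Finite_place p) a b al"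
 shows "padic_sol (int p) a b al"
proof (rule padic_solI)
 fix M
 let ?v = "Finite_place p"
 \<comment> \<open>One power more than \<open>M\<close> is kept, so that the entry equal to 1 is
   approximated by an integer prime to p even for \<open>M\<close> = 0.\<close>
 let ?d = "real p powi (- int (Suc M))"
 have v: "?v \<in> places" using p by (simp add: places_def)
 have d0: "0 < ?d" using prime_gt_0_nat[OF p] by simp
 have d1: "?d \<le> 1" using prime_gt_1_nat[OF p] by (simp add: power_int_minus inverse_le_1_iff one_le_power del: of_nat_Suc power_Suc flip: power_int_of_nat)
 from s obtain m e n where c: "cauchy_seq ?v m" "cauchy_seq ?v e" "cauchy_seq ?v n" and nn: "~ (null_seq ?v m & null_seq ?v e)"
  and eq: "null_seq ?v (%k. of_int al * (n k)^2 - ((of_int al * (m k)^2 - of_int a * (e k)^2)^2 - 4 * of_int b * (e k) ^ 4))" (is "null_seq _ ?F")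
  unfolding local_sol_iff_seq_sol[OF v al] seq_sol_def by blast
 from padic_scaled_sequences[OF p c(1,2,2)] nn obtain eps K where e0: "eps > 0" and K: "\<And>k. k \<ge> K ==> \<exists>t. place_abs ?v t \<ge> eps & place_abs ?v (m k / t) \<le> 1 &
  place_abs ?v (e k / t) \<le> 1 & place_abs ?v (e k / t) \<le> 1 & (m k = t \<or> e k = t \<or> e k = t)" by blast
 \<comment> \<open>Normalising divides the error by t^4, and t has absolute value at least
   \<open>eps\<close>.\<close>
 have "eps ^ 4 * ?d > 0" using e0 d0 by simp
 then obtain K' where K': "\<And>k. k \<ge> K' ==> place_abs ?v (?F k) < eps ^ 4 * ?d" using eq unfolding null_seq_iff[OF v] by blast
 define k where "k = max K K'"
 obtain t where t: "place_abs ?v t \<ge> eps" "place_abs ?v (m k / t) \<le> 1" "place_abs ?v (e k / t) \<le> 1" "m k = t \<or> e k = t" using K[of k] unfolding k_def by auto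
 have Fk: "place_abs ?v (?F k) < eps ^ 4 * ?d" using K' unfolding k_def by simp
 have t0: "t ~= 0" using t(1) e0 by (auto simp del: place_abs.simps)
 define m' where "m' = m k / t" define e' where "e' = e k / t" define N' where "N' = of_int al * n k / t^2"
 define H where "H = of_int al * ((of_int al * m' * m' - of_int a * e' * e') * (of_int al * m' * m' - of_int a * e' * e') - of_int (4 * b) * (e' * e' * (e' * e')))"
 have small: "place_abs ?v (N' * N' - H) \<le> ?d"
 proof -
  have "(N' * N' - H) * (t * t * (t * t)) = of_int al * ?F k"
   unfolding N'_def H_def m'_def e'_def using t0 by (simp add: field_simps power2_eq_square power4_eq_xxxx)
  then have "place_abs ?v (N' * N' - H) * (place_abs ?v t * place_abs ?v t * (place_abs ?v t * place_abs ?v t)) = place_abs ?v (of_int al) * place_abs ?v (?F k)"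
   using place_abs_mult[OF v] by metis
  also have "\<dots> \<le> 1 * (eps ^ 4 * ?d)" using place_abs_of_int_le_1[OF p, of al] Fk by (intro mult_mono) (auto simp del: place_abs.simps)
  finally have 1: "place_abs ?v (N' * N' - H) * (place_abs ?v t * place_abs ?v t * (place_abs ?v t * place_abs ?v t)) \<le> eps ^ 4 * ?d" by simp
  have "eps ^ 4 \<le> place_abs ?v t * place_abs ?v t * (place_abs ?v t * place_abs ?v t)"
   using power_mono[OF t(1), of 4] e0 by (simp add: power4_eq_xxxx mult.assoc del: place_abs.simps)
  then have "place_abs ?v (N' * N' - H) * eps ^ 4 \<le> place_abs ?v (N' * N' - H) * (place_abs ?v t * place_abs ?v t * (place_abs ?v t * place_abs ?v t))"
   by (intro mult_left_mono) (auto simp del: place_abs.simps)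
  then have "eps ^ 4 * place_abs ?v (N' * N' - H) \<le> eps ^ 4 * ?d" using 1 by (simp only: mult.commute)
  then show ?thesis using e0 by (simp del: place_abs.simps)
 qed
 obtain zm where zm: "padic_near p ?d m' (of_int zm)" using padic_near_exists[OF p] t(2) unfolding m'_def by blast
 obtain ze where ze: "padic_near p ?d e' (of_int ze)" using padic_near_exists[OF p] t(3) unfolding e'_def by blast
 note nr = padic_near_mult[OF p] padic_near_diff[OF p] padic_near_of_int[OF p order.strict_implies_order[OF d0]]
 let ?zH = "al * ((al * zm * zm - a * ze * ze) * (al * zm * zm - a * ze * ze) - (4 * b) * (ze * ze * (ze * ze)))"
 have H: "padic_near p ?d H (of_int ?zH)"
  unfolding H_def of_int_mult of_int_diff by (intro nr zm ze; fact nr(3)[unfolded of_int_mult])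
 then have H1: "place_abs ?v H \<le> 1" unfolding padic_near_def by blast
 \<comment> \<open>Integrality of N' is not part of the normalisation; it follows because its square
   is within ?d of the integral H.\<close>
 have "place_abs ?v (N' * N') \<le> 1" using place_abs_ultra[OF p, of "N' * N' - H" H] small d1 H1 by (simp del: place_abs.simps)
 then have "place_abs ?v N' \<le> 1" by (rule place_abs_square_le_1[OF p])
 then obtain zN where zN: "padic_near p ?d N' (of_int zN)" using padic_near_exists[OF p] by blast
 have "padic_near p ?d (N' * N' - H) (of_int (zN * zN - ?zH))" using nr(2)[OF nr(1)[OF zN zN] H] by simp
 then have "int p ^ Suc M dvd zN * zN - ?zH" by (rule padic_near_pow_dvd[OF p _ small])
 then have "int p ^ M dvd zN * zN - ?zH" by (rule power_le_dvd) simp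
 also have "zN * zN - ?zH = zN^2 - al * ((al * zm^2 - a * ze^2)^2 - 4 * b * ze ^ 4)" by (simp add: power2_eq_square power4_eq_xxxx algebra_simps)
 finally have fin: "int p ^ M dvd zN^2 - al * ((al * zm^2 - a * ze^2)^2 - 4 * b * ze ^ 4)" .
 have "m' = 1 \<or> e' = 1" using t(4) t0 unfolding m'_def e'_def by auto
 then have "~ (int p dvd zm & int p dvd ze)" using zm ze padic_near_one_not_dvd[OF p] by blast
 then show "\<exists>m e N. ~ (int p dvd m & int p dvd e) & int p ^ M dvd N^2 - al * ((al * m^2 - a * e^2)^2 - 4 * b * e ^ 4)" using fin by blast
qed

lemma local_sol_iff_padic_sol:
 "prime p ==> al ~= 0 ==> local_sol (Finite_place p) a b al \<longleftrightarrow> padic_sol (int p) a b al"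
 using local_sol_imp_padic_sol padic_sol_imp_local_sol by blast

section \<open>The real place\<close>

lemma infinite_place: "Infinite_place \<in> places"
 by (simp add: places_def)

lemma real_cauchy_seq: "cauchy_seq Infinite_place f \<longleftrightarrow> Cauchy (%n. of_rat (f n) :: real)"
 unfolding cauchy_seq_def Cauchy_def dist_real_def by (simp flip: of_rat_diff)

lemma real_null_seq: "null_seq Infinite_place f \<longleftrightarrow> (%n. of_rat (f n) :: real) \<longlonglongrightarrow> 0"
 unfolding null_seq_def place_abs.simps by (rule tendsto_rabs_zero_iff)

text \<open>Rationals squeezed towards sqrt(D) from below represent the square root in the
  completion.\<close>

lemma is_square_infinite:
 assumes "D > 0"
 shows "is_square (completion Infinite_place) (of_int_ring (completion Infinite_place) D)"
proof -
 note v = infinite_place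
 interpret K: field "completion Infinite_place" by (rule completion_field[OF v])
 have "\<exists>r. of_rat r \<in> {sqrt (of_int D) - inverse (real (Suc n))<..<sqrt (of_int D)}" for n
  using of_rat_dense[of "sqrt (of_int D) - inverse (real (Suc n))" "sqrt (of_int D)"] by auto
 then obtain r where r: "\<And>n. of_rat (r n) \<in> {sqrt (of_int D) - inverse (real (Suc n))<..<sqrt (of_int D)}" by metis
 have l: "(%n. of_rat (r n)) \<longlonglongrightarrow> sqrt (of_int D)"
 proof (rule tendsto_sandwich)
  show "(%n. sqrt (of_int D) - inverse (real (Suc n))) \<longlonglongrightarrow> sqrt (of_int D)"
   using tendsto_diff[OF tendsto_const LIMSEQ_inverse_real_of_nat, of "sqrt (of_int D)"] by simp
 qed (use r in \<open>auto simp: less_imp_le\<close>)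
 have c: "cauchy_seq Infinite_place r" unfolding real_cauchy_seq using l by (rule LIMSEQ_imp_Cauchy)
 have "(%n. of_rat (r n * r n - of_int D) :: real) \<longlonglongrightarrow> sqrt (of_int D) * sqrt (of_int D) - of_int D"
  unfolding of_rat_diff of_rat_mult of_rat_of_int_eq by (intro tendsto_intros l)
 then have "null_seq Infinite_place (%n. r n * r n - of_int D)" unfolding real_null_seq using assms by simp
 then have "lim_class Infinite_place (%n. r n * r n) = of_int_ring (completion Infinite_place) D"
  unfolding of_int_ring_completion[OF v] using lim_class_eq[OF v cauchy_seq_mult[OF v c c] cauchy_seq_const[OF v]] by blast
 then show ?thesis using lim_class_mult[OF v c c] lim_class_closed[OF v c] unfolding is_square_def by metis
qed

lemma local_sol_infinite_pos:
 assumes "al > 0" shows "local_sol Infinite_place a b al"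
 unfolding local_sol_def kummer_class_def using is_square_infinite[OF assms] by blast

text \<open>The origin supplies the negative class, as its descent value a^2 - 4 b is
  negative.\<close>

lemma local_sol_infinite_neg_disc:
 assumes "al < 0" "a^2 - 4 * b < 0" shows "local_sol Infinite_place a b al"
proof -
 interpret K: field "completion Infinite_place" by (rule completion_field[OF infinite_place])
 have "is_square (completion Infinite_place) (of_int_ring (completion Infinite_place) (al * (a^2 - 4 * b)))"
  by (rule is_square_infinite) (use assms mult_neg_neg in blast)
 then show ?thesis unfolding local_sol_def kummer_class_def K.of_int_ring_mult by blast
qed

text \<open>The witness is the negative abscissa x = a, where the cubic takes the positive value -4
  a b.\<close>

lemma local_sol_infinite_neg_a:
 assumes "al < 0" "a < 0" "b > 0" shows "local_sol Infinite_place a b al"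
proof -
 let ?K = "completion Infinite_place"
 interpret K: field ?K by (rule completion_field[OF infinite_place])
 let ?i = "of_int_ring ?K"
 have "0 < a * (a * a + - 2 * a * a + (a\<^sup>2 - 4 * b))" using assms by (simp add: power2_eq_square algebra_simps mult_neg_pos)
 then have "is_square ?K (?i (a * (a * a + - 2 * a * a + (a\<^sup>2 - 4 * b))))" by (rule is_square_infinite)
 then obtain w where w: "w \<in> carrier ?K" "?i a \<otimes>\<^bsub>?K\<^esub> (?i a \<otimes>\<^bsub>?K\<^esub> ?i a \<oplus>\<^bsub>?K\<^esub> ?i (- 2 * a) \<otimes>\<^bsub>?K\<^esub> ?i a \<oplus>\<^bsub>?K\<^esub> ?i (a\<^sup>2 - 4 * b)) = w \<otimes>\<^bsub>?K\<^esub> w"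
  unfolding is_square_def K.of_int_ring_mult[symmetric] K.of_int_ring_add[symmetric] by (elim bexE)
 have "is_square ?K (?i (al * a))" by (rule is_square_infinite) (use assms mult_neg_neg in blast)
 then have s: "is_square ?K (?i al \<otimes>\<^bsub>?K\<^esub> ?i a)" unfolding K.of_int_ring_mult .
 have "?i a ~= \<zero>\<^bsub>?K\<^esub>" using of_int_ring_completion_eq_0[OF infinite_place] assms by simp
 then show ?thesis unfolding local_sol_def kummer_class_def using w s
  by (rule_tac disjI2, rule_tac disjI2, rule_tac bexI[of _ "?i a"], rule_tac bexI[of _ w], intro conjI) simp_all
qed

text \<open>The quartic would equate a nonpositive left side with a positive right side. For b < 0
  the right side is a square plus -4 b e^4; for a > 0 and negative \<open>al\<close> its expansion
  in m^2 and e^2 has no negative term.\<close>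

lemma not_local_sol_infinite:
 assumes al: "al < 0" and h: "b < 0 \<or> a > 0 & a^2 - 4 * b > 0"
 shows "~ local_sol Infinite_place a b al"
proof
 note v = infinite_place
 have al0: "al ~= 0" using al by simp
 assume "local_sol Infinite_place a b al"
 then obtain m e n where c: "cauchy_seq Infinite_place m" "cauchy_seq Infinite_place e" "cauchy_seq Infinite_place n" and nn: "~ (null_seq Infinite_place m & null_seq Infinite_place e)"
  and eq: "null_seq Infinite_place (%k. of_int al * (n k)^2 - ((of_int al * (m k)^2 - of_int a * (e k)^2)^2 - 4 * of_int b * (e k) ^ 4))"
  unfolding local_sol_iff_seq_sol[OF v al0] seq_sol_def by blast
 obtain m' where m: "(%k. of_rat (m k) :: real) \<longlonglongrightarrow> m'" using c(1) real_cauchy_seq Cauchy_convergent_iff convergent_def by metis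
 obtain e' where e: "(%k. of_rat (e k) :: real) \<longlonglongrightarrow> e'" using c(2) real_cauchy_seq Cauchy_convergent_iff convergent_def by metis
 obtain n' where n: "(%k. of_rat (n k) :: real) \<longlonglongrightarrow> n'" using c(3) real_cauchy_seq Cauchy_convergent_iff convergent_def by metis
 let ?A = "real_of_int al" let ?a = "real_of_int a" let ?b = "real_of_int b"
 have "(%k. of_rat (of_int al * (n k)^2 - ((of_int al * (m k)^2 - of_int a * (e k)^2)^2 - 4 * of_int b * (e k) ^ 4)) :: real)
  \<longlonglongrightarrow> ?A * n'^2 - ((?A * m'^2 - ?a * e'^2)^2 - 4 * ?b * e' ^ 4)"
  unfolding of_rat_diff of_rat_mult of_rat_power of_rat_of_int_eq of_rat_numeral_eq by (intro tendsto_intros m e n)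
 from LIMSEQ_unique[OF this eq[unfolded real_null_seq]]
 have z: "?A * n'^2 = (?A * m'^2 - ?a * e'^2)^2 - 4 * ?b * e' ^ 4" by simp
 have ne: "m' ~= 0 \<or> e' ~= 0" using nn m e unfolding real_null_seq by blast
 have A: "?A < 0" using al by simp
 have L: "?A * n'^2 \<le> 0" using A by (simp add: mult_nonpos_nonneg)
 have "(?A * m'^2 - ?a * e'^2)^2 - 4 * ?b * e' ^ 4 > 0"
  using h
 proof
  assume "b < 0"
  then have b: "?b < 0" by simp
  show ?thesis
  proof (cases "e' = 0")
   case True
   then have "m' ~= 0" using ne by simp
   then show ?thesis using True A by simp
  next
   case False
   then have "e' ^ 4 > 0" by (simp add: zero_less_power_eq)
   then have "?b * e' ^ 4 < 0" using b by (rule mult_neg_pos[rotated])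
   then show ?thesis using zero_le_power2[of "?A * m'^2 - ?a * e'^2"] by linarith
  qed
 next
  assume h': "a > 0 & a^2 - 4 * b > 0"
  then have a: "?a > 0" by simp
  have "real_of_int (a^2 - 4 * b) > 0" using h' by (simp only: of_int_0_less_iff)
  then have c: "?a^2 - 4 * ?b > 0" by simp
  have eq2: "(?A * m'\<^sup>2 - ?a * e'\<^sup>2)\<^sup>2 - 4 * ?b * e' ^ 4 = (?A * m'\<^sup>2)\<^sup>2 + 2 * ((- ?A * ?a) * (m' * e')\<^sup>2) + (?a\<^sup>2 - 4 * ?b) * (e'\<^sup>2)\<^sup>2"
   by (simp add: power2_eq_square power4_eq_xxxx algebra_simps)
  have "(- ?A * ?a) * (m' * e')\<^sup>2 \<ge> 0" using A a by (intro mult_nonneg_nonneg) auto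
  moreover have "(?A * m'^2)^2 \<ge> 0" "(?a^2 - 4 * ?b) * (e'^2)^2 \<ge> 0" using c by auto
  moreover have "(?A * m'^2)^2 > 0 \<or> (?a^2 - 4 * ?b) * (e'^2)^2 > 0" using ne c A by auto
  ultimately show ?thesis unfolding eq2 by linarith
 qed
 then show False using z L by linarith
qed

section \<open>Square classes and Selmer groups\<close>

context field begin

lemma mult_of_comm_group: "comm_group (mult_of R)"
proof -
 have e: "mult_of R = Multiplicative_Group.mult_of R" unfolding Ring_Divisibility.mult_of_def Multiplicative_Group.mult_of_def ..
 show ?thesis unfolding e by (rule group.group_comm_groupI[OF field_mult_group]) (simp add: m_comm)
qed

lemma nonzero_squares_subgroup: "subgroup (nonzero_squares R) (mult_of R)"
proof -
 interpret G: comm_group "mult_of R" by (rule mult_of_comm_group)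
 show ?thesis
 proof (rule G.subgroupI)
  show "nonzero_squares R \<subseteq> carrier (mult_of R)" by (auto simp: nonzero_squares_def integral_iff)
  show "nonzero_squares R ~= {}" using zero_not_one one_closed by (auto simp: nonzero_squares_def)
 next
  fix x assume "x \<in> nonzero_squares R"
  then obtain w where w: "w \<in> carrier (mult_of R)" "x = w \<otimes>\<^bsub>mult_of R\<^esub> w" unfolding nonzero_squares_def by auto
  have "inv\<^bsub>mult_of R\<^esub> x = inv\<^bsub>mult_of R\<^esub> w \<otimes>\<^bsub>mult_of R\<^esub> inv\<^bsub>mult_of R\<^esub> w" unfolding w(2) by (rule G.inv_mult_group[OF w(1) w(1)])
  moreover have "inv\<^bsub>mult_of R\<^esub> w \<in> carrier (mult_of R)" by (rule G.inv_closed[OF w(1)])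
  ultimately show "inv\<^bsub>mult_of R\<^esub> x \<in> nonzero_squares R" unfolding nonzero_squares_def mult_mult_of by (rule image_eqI)
 next
  fix x y assume "x \<in> nonzero_squares R" "y \<in> nonzero_squares R"
  then obtain w z where w: "w \<in> carrier R - {\<zero>}" "x = w \<otimes> w" and z: "z \<in> carrier R - {\<zero>}" "y = z \<otimes> z" unfolding nonzero_squares_def by auto
  have "x \<otimes> y = (w \<otimes> z) \<otimes> (w \<otimes> z)" unfolding w(2) z(2) using w(1) z(1) by (simp add: m_ac)
  moreover have "w \<otimes> z \<in> carrier (mult_of R)" using w(1) z(1) by (simp add: integral_iff)
  ultimately show "x \<otimes>\<^bsub>mult_of R\<^esub> y \<in> nonzero_squares R" unfolding nonzero_squares_def mult_mult_of by (rule image_eqI)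
 qed
qed

lemma square_class_iff: "z \<in> square_class R x \<longleftrightarrow> (\<exists>w\<in>carrier (mult_of R). z = w \<otimes> w \<otimes> x)"
 unfolding square_class_def nonzero_squares_def r_coset_def by auto

lemma square_class_eq_iff:
 assumes x: "x \<in> carrier (mult_of R)" and y: "y \<in> carrier (mult_of R)"
 shows "square_class R x = square_class R y \<longleftrightarrow> is_square R (x \<otimes> y)"
proof
 interpret G: comm_group "mult_of R" by (rule mult_of_comm_group)
 have xc: "x \<in> carrier R" "x ~= \<zero>" "y \<in> carrier R" "y ~= \<zero>" using x y by auto
 {
  assume "square_class R x = square_class R y"
  moreover have "x \<in> square_class R x" unfolding square_class_iff using xc by (intro bexI[of _ \<one>]) auto
  ultimately have "x \<in> square_class R y" by simp
  then obtain w where w: "w \<in> carrier R" "x = w \<otimes> w \<otimes> y" unfolding square_class_iff by auto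
  show "is_square R (x \<otimes> y)" by (rule is_squareI[of "w \<otimes> y"]) (use w xc in \<open>simp_all add: m_ac\<close>)
 next
  assume "is_square R (x \<otimes> y)"
  then obtain w where w: "w \<in> carrier R" "x \<otimes> y = w \<otimes> w" unfolding is_square_def by (elim bexE)
  have w0: "w ~= \<zero>" using w(2) xc by (auto simp: integral_iff)
  let ?i = "inv y"
  have i: "?i \<in> carrier R" "y \<otimes> ?i = \<one>" "?i ~= \<zero>" using inv_closed' inv_r inv_neq_zero xc by auto
  have "(w \<otimes> ?i) \<otimes> (w \<otimes> ?i) \<otimes> y = (w \<otimes> w) \<otimes> ?i \<otimes> (y \<otimes> ?i)" using w(1) i(1) xc by (simp add: m_ac)
  also have "\<dots> = x \<otimes> (y \<otimes> ?i)" unfolding w(2)[symmetric] i(2) using xc i by (simp add: m_assoc)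
  finally have "x = (w \<otimes> ?i) \<otimes> (w \<otimes> ?i) \<otimes> y" using i(2) xc by simp
  then have "x \<in> square_class R y" unfolding square_class_iff using w(1) w0 i by (intro bexI[of _ "w \<otimes> ?i"]) (simp_all add: integral_iff)
  then show "square_class R x = square_class R y" unfolding square_class_def
   using G.repr_independence[OF _ y nonzero_squares_subgroup] by metis
 }
qed

lemma square_class_mult:
 assumes x: "x \<in> carrier (mult_of R)" and y: "y \<in> carrier (mult_of R)"
 shows "square_class R x \<otimes>\<^bsub>square_classes R\<^esub> square_class R y = square_class R (x \<otimes> y)"
proof -
 interpret G: comm_group "mult_of R" by (rule mult_of_comm_group)
 have "nonzero_squares R \<lhd> mult_of R" using G.normal_iff_subgroup nonzero_squares_subgroup by blast
 then show ?thesis unfolding square_classes_def square_class_def FactGroup_def using normal.rcos_sum[OF _ x y] by simp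
qed

lemma square_classes_comm_group: "comm_group (square_classes R)"
 unfolding square_classes_def by (rule comm_group.abelian_FactGroup[OF mult_of_comm_group nonzero_squares_subgroup])

lemma carrier_square_classes: "carrier (square_classes R) = square_class R ` carrier (mult_of R)"
 unfolding square_classes_def FactGroup_def RCOSETS_def square_class_def by auto

lemma one_square_classes: "\<one>\<^bsub>square_classes R\<^esub> = square_class R \<one>"
proof -
 interpret G: comm_group "mult_of R" by (rule mult_of_comm_group)
 have "nonzero_squares R #>\<^bsub>mult_of R\<^esub> \<one>\<^bsub>mult_of R\<^esub> = nonzero_squares R"
  by (rule G.coset_mult_one[OF subgroup.subset[OF nonzero_squares_subgroup]])
 then show ?thesis unfolding square_classes_def square_class_def FactGroup_def by simp
qed

text \<open>\<open>y\<close> is x times the square x y divided by x^2, so closure under products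
  suffices.\<close>

lemma kummer_class_cong:
 assumes x: "x \<in> carrier R" "x ~= \<zero>" and y: "y \<in> carrier R" and AC: "A \<in> carrier R" "C \<in> carrier R" "C ~= \<zero>"
  and s: "is_square R (x \<otimes> y)" and k: "kummer_class R A C x"
 shows "kummer_class R A C y"
proof -
 let ?i = "inv x"
 have i: "?i \<in> carrier R" "x \<otimes> ?i = \<one>" using inv_closed' inv_r x by auto
 have k1: "kummer_class R A C (x \<otimes> y)" unfolding kummer_class_def using s by blast
 have "is_square R (?i \<otimes> ?i)" using i(1) by (intro is_squareI[of ?i]) auto
 then have k2: "kummer_class R A C (?i \<otimes> ?i)" unfolding kummer_class_def by blast
 have "kummer_class R A C (x \<otimes> (x \<otimes> y))" by (rule kummer_class_mult[OF _ _ AC k k1]) (use x y in auto)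
 then have "kummer_class R A C ((x \<otimes> (x \<otimes> y)) \<otimes> (?i \<otimes> ?i))" by (rule kummer_class_mult[OF _ _ AC _ k2, rotated 2]) (use x y i in auto)
 moreover have "(x \<otimes> (x \<otimes> y)) \<otimes> (?i \<otimes> ?i) = (x \<otimes> ?i) \<otimes> ((x \<otimes> ?i) \<otimes> y)" using x(1) y i(1) by (simp add: m_ac)
 ultimately show ?thesis unfolding i(2) using y by simp
qed

lemma kummer_image_iff:
 assumes two: "\<one> \<oplus> \<one> ~= \<zero>" and ab: "of_int_ring R b ~= \<zero>" "of_int_ring R (a^2 - 4 * b) ~= \<zero>" and x: "x \<in> carrier (mult_of R)"
 shows "square_class R x \<in> kummer_image R a b \<longleftrightarrow> kummer_class R (of_int_ring R (- 2 * a)) (of_int_ring R (a\<^sup>2 - 4 * b)) x"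
proof
 note ki = kummer_image_eq[OF field_axioms two ab]
 show "square_class R x \<in> kummer_image R a b" if "kummer_class R (of_int_ring R (- 2 * a)) (of_int_ring R (a\<^sup>2 - 4 * b)) x"
  unfolding ki using that x by blast
 assume "square_class R x \<in> kummer_image R a b"
 then obtain y where y: "y \<in> carrier (mult_of R)" "square_class R y = square_class R x" "kummer_class R (of_int_ring R (- 2 * a)) (of_int_ring R (a\<^sup>2 - 4 * b)) y"
  unfolding ki by (smt (verit) mem_Collect_eq)
 have s: "is_square R (y \<otimes> x)" using square_class_eq_iff[OF y(1) x] y(2) by blast
 show "kummer_class R (of_int_ring R (- 2 * a)) (of_int_ring R (a\<^sup>2 - 4 * b)) x"
  by (rule kummer_class_cong[OF _ _ _ of_int_ring_closed of_int_ring_closed ab(2) s y(3)]) (use x y(1) in auto)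
qed

end

lemma rat_square_class_iff: "z \<in> square_class class_ring (x::rat) \<longleftrightarrow> (\<exists>w. w ~= 0 & z = w * w * x)"
 unfolding field.square_class_iff[OF class_ring_field] by auto

lemma rat_square_class_eq:
 assumes "x ~= 0" "y ~= (0::rat)"
 shows "square_class class_ring x = square_class class_ring y \<longleftrightarrow> (\<exists>w. x * y = w * w)"
 using field.square_class_eq_iff[OF class_ring_field, of x y] assms unfolding is_square_def by simp

lemma rat_square_class_mult:
 assumes "x ~= 0" "y ~= (0::rat)"
 shows "square_class class_ring x \<otimes>\<^bsub>square_classes class_ring\<^esub> square_class class_ring y = square_class class_ring (x * y)"
 using field.square_class_mult[OF class_ring_field, of x y] assms by simp

lemma rat_square_classes_carrier: "carrier (square_classes class_ring) = square_class class_ring ` {x::rat. x ~= 0}"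
 unfolding field.carrier_square_classes[OF class_ring_field] by (rule arg_cong[of _ _ "image _"]) auto

lemma rat_square_classes_one: "\<one>\<^bsub>square_classes class_ring\<^esub> = square_class class_ring (1::rat)"
 by (simp only: field.one_square_classes[OF class_ring_field] class_ring_simps)

lemma of_int_completion_unit:
 assumes v: "v \<in> places" and n: "n ~= 0"
 shows "of_int_ring (completion v) n \<in> carrier (mult_of (completion v))"
proof -
 interpret K: field "completion v" by (rule completion_field[OF v])
 show ?thesis using of_int_ring_completion_eq_0[OF v] n by simp
qed

text \<open>\<open>localize\<close> takes the only element of an image, so all representatives w^2 n
  must be shown to give the same local class.\<close>

lemma localize_square_class:
 assumes v: "v \<in> places" and n: "n ~= 0"
 shows "localize v (square_class class_ring (of_int n)) = square_class (completion v) (of_int_ring (completion v) n)"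
proof -
 interpret K: field "completion v" by (rule completion_field[OF v])
 let ?S = "square_class (class_ring :: rat ring) (of_int n)"
 have "square_class (completion v) (of_rat_completion v z) = square_class (completion v) (of_int_ring (completion v) n)" if "z \<in> ?S" for z
 proof -
  from that obtain w where w: "w ~= 0" "z = w * w * of_int n" unfolding rat_square_class_iff by blast
  have cs: "cauchy_seq v (%k. x)" for x by (rule cauchy_seq_const[OF v])
  have unit: "of_rat_completion v x \<in> carrier (mult_of (completion v))" if "x ~= 0" for x
   using that lim_class_const_eq_0[OF v, of x] lim_class_closed[OF v cs] unfolding of_rat_completion_eq[OF v] by simp
  have z0: "z ~= 0" using w n by simp
  have "of_rat_completion v z \<otimes>\<^bsub>completion v\<^esub> of_int_ring (completion v) n = of_rat_completion v (w * of_int n) \<otimes>\<^bsub>completion v\<^esub> of_rat_completion v (w * of_int n)"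
   unfolding of_rat_completion_eq[OF v] of_int_ring_completion[OF v] lim_class_mult[OF v cs cs] w(2) by (simp add: mult_ac)
  then have "is_square (completion v) (of_rat_completion v z \<otimes>\<^bsub>completion v\<^esub> of_int_ring (completion v) n)"
   using unit[of "w * of_int n"] w n unfolding is_square_def by (intro bexI[of _ "of_rat_completion v (w * of_int n)"]) auto
  then show ?thesis using K.square_class_eq_iff[OF unit[OF z0] of_int_completion_unit[OF v n]] by blast
 qed
 moreover have "of_int n \<in> ?S" unfolding rat_square_class_iff by (intro exI[of _ 1]) simp
 ultimately have "(%x. square_class (completion v) (of_rat_completion v x)) ` ?S = {square_class (completion v) (of_int_ring (completion v) n)}" by blast
 then show ?thesis unfolding localize_def by simp
qed

lemma localize_in_kummer_image_iff:
 assumes v: "v \<in> places" and n: "n ~= 0" and disc: "ell_disc a b ~= 0"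
 shows "localize v (square_class class_ring (of_int n)) \<in> kummer_image (completion v) a b \<longleftrightarrow> local_sol v a b n"
proof -
 interpret K: field "completion v" by (rule completion_field[OF v])
 have "of_int_ring (completion v) (1 + 1) ~= \<zero>\<^bsub>completion v\<^esub>" using of_int_ring_completion_eq_0[OF v] by simp
 then have "\<one>\<^bsub>completion v\<^esub> \<oplus>\<^bsub>completion v\<^esub> \<one>\<^bsub>completion v\<^esub> ~= \<zero>\<^bsub>completion v\<^esub>" unfolding K.of_int_ring_add K.of_int_ring_1 .
 moreover have "of_int_ring (completion v) b ~= \<zero>\<^bsub>completion v\<^esub>" "of_int_ring (completion v) (a^2 - 4 * b) ~= \<zero>\<^bsub>completion v\<^esub>"
  using disc unfolding of_int_ring_completion_eq_0[OF v] ell_disc_def by auto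
 ultimately show ?thesis unfolding localize_square_class[OF v n] local_sol_def
  by (rule K.kummer_image_iff[OF _ _ _ of_int_completion_unit[OF v n]])
qed

lemma rational_square_class:
 assumes "c \<in> carrier (square_classes (class_ring :: rat ring))"
 obtains n where "n ~= 0" "c = square_class class_ring (of_int n)"
proof -
 obtain x where x: "x ~= 0" "c = square_class class_ring x" using assms unfolding rat_square_classes_carrier by blast
 obtain r s where rs: "x = of_int r / of_int s" "s ~= 0" using rat_fraction[of x] by blast
 have r: "r ~= 0" using x(1) rs by auto
 have "x * of_int (r * s) = (of_int r :: rat) * of_int r" unfolding rs(1) using rs(2) by simp
 then have "\<exists>w. x * of_int (r * s) = w * w" by blast
 moreover have "of_int (r * s) ~= (0::rat)" using r rs(2) by simp
 ultimately have "c = square_class class_ring (of_int (r * s))" unfolding x(2) using rat_square_class_eq[OF x(1)] by blast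
 then show ?thesis using that[of "r * s"] r rs(2) by simp
qed

lemma selmer_iff:
 assumes disc: "ell_disc a b ~= 0" and n: "n ~= 0"
 shows "square_class class_ring (of_int n) \<in> selmer a b \<longleftrightarrow> (\<forall>v\<in>places. local_sol v a b n)"
proof -
 have "square_class class_ring (of_int n :: rat) \<in> carrier (square_classes class_ring)" unfolding rat_square_classes_carrier using n by simp
 then show ?thesis unfolding selmer_def using localize_in_kummer_image_iff[OF _ n disc] by blast
qed

lemma relaxed_selmer_iff:
 assumes disc: "ell_disc a b ~= 0" and n: "n ~= 0"
 shows "square_class class_ring (of_int n) \<in> relaxed_selmer a b d \<longleftrightarrow> (\<forall>p. prime p & ~ p dvd d --> local_sol (Finite_place p) a b n)"
proof -
 have "square_class class_ring (of_int n :: rat) \<in> carrier (square_classes class_ring)" unfolding rat_square_classes_carrier using n by simp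
 moreover have "Finite_place p \<in> places" if "prime p" for p using that by (simp add: places_def)
 ultimately show ?thesis unfolding relaxed_selmer_def using localize_in_kummer_image_iff[OF _ n disc] by blast
qed

lemma local_sol_mult:
 assumes v: "v \<in> places" and disc: "ell_disc a b ~= 0" and s: "local_sol v a b m" "local_sol v a b n"
 shows "local_sol v a b (m * n)"
proof -
 interpret K: field "completion v" by (rule completion_field[OF v])
 have "of_int_ring (completion v) (a^2 - 4 * b) ~= \<zero>\<^bsub>completion v\<^esub>"
  using disc unfolding of_int_ring_completion_eq_0[OF v] ell_disc_def by auto
 then show ?thesis using s unfolding local_sol_def K.of_int_ring_mult[of m n] by (intro K.kummer_class_mult K.of_int_ring_closed)
qed

lemma local_sol_square:
 assumes v: "v \<in> places" and s: "is_square (completion v) (of_int_ring (completion v) m)"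
 shows "local_sol v a b m"
 using s unfolding local_sol_def kummer_class_def by blast

lemma local_sol_cong:
 assumes v: "v \<in> places" and disc: "ell_disc a b ~= 0" and n: "n ~= 0" and s: "is_square (completion v) (of_int_ring (completion v) m)" "m ~= 0"
 shows "local_sol v a b (n * m) \<longleftrightarrow> local_sol v a b n"
proof
 interpret K: field "completion v" by (rule completion_field[OF v])
 have C: "of_int_ring (completion v) (a^2 - 4 * b) ~= \<zero>\<^bsub>completion v\<^esub>"
  using disc unfolding of_int_ring_completion_eq_0[OF v] ell_disc_def by auto
 have nz: "of_int_ring (completion v) (n * m) ~= \<zero>\<^bsub>completion v\<^esub>" using n s(2) unfolding of_int_ring_completion_eq_0[OF v] by simp
 have "is_square (completion v) (of_int_ring (completion v) (n * n))" unfolding K.of_int_ring_mult by (rule K.is_squareI[OF K.of_int_ring_closed refl])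
 then have "is_square (completion v) (of_int_ring (completion v) (n * n * m))" unfolding K.of_int_ring_mult[of "n * n" m] using s(1) by (rule K.is_square_mult)
 then have "is_square (completion v) (of_int_ring (completion v) ((n * m) * n))" by (simp add: mult_ac)
 then show "local_sol v a b n" if "local_sol v a b (n * m)" using that unfolding local_sol_def K.of_int_ring_mult[of "n * m" n]
  by (rule K.kummer_class_cong[OF K.of_int_ring_closed nz K.of_int_ring_closed K.of_int_ring_closed K.of_int_ring_closed C])
 show "local_sol v a b (n * m)" if "local_sol v a b n" by (rule local_sol_mult[OF v disc that local_sol_square[OF v s(1)]])
qed

lemma is_square_of_int_square: "v \<in> places ==> is_square (completion v) (of_int_ring (completion v) (x * x))"
 using field.is_squareI[OF completion_field, of v "of_int_ring (completion v) x"] ring.of_int_ring_mult[of "completion v" x x]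
  ring.of_int_ring_closed[of "completion v"] field.is_ring[OF completion_field, of v] by simp

lemma selmer_subgroup:
 assumes disc: "ell_disc a b ~= 0"
 shows "subgroup (selmer a b) (square_classes class_ring)" "\<And>c. c \<in> selmer a b ==> c \<otimes>\<^bsub>square_classes class_ring\<^esub> c = \<one>\<^bsub>square_classes class_ring\<^esub>"
proof -
 interpret G: comm_group "square_classes (class_ring :: rat ring)" by (rule field.square_classes_comm_group[OF class_ring_field])
 let ?c = "%n. square_class (class_ring :: rat ring) (of_int n)"
 have mult: "?c m \<otimes>\<^bsub>square_classes class_ring\<^esub> ?c n = ?c (m * n)" if "m ~= 0" "n ~= 0" for m n
  using rat_square_class_mult[of "of_int m" "of_int n"] that by simp
 have sub: "selmer a b \<subseteq> carrier (square_classes class_ring)" unfolding selmer_def by blast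
 have rep: "\<exists>n. n ~= 0 & c = ?c n" if "c \<in> selmer a b" for c using rational_square_class[of c] that sub by blast
 have one: "\<one>\<^bsub>square_classes class_ring\<^esub> = ?c 1" using rat_square_classes_one by simp
 have sq: "?c (n * n) = ?c 1" if n: "n ~= 0" for n
 proof -
  have "\<exists>w. of_int (n * n) * (of_int 1 :: rat) = w * w" by (intro exI[of _ "of_int n"]) simp
  then show ?thesis using rat_square_class_eq[of "of_int (n * n)" "of_int 1"] n by simp
 qed
 show e2: "c \<otimes>\<^bsub>square_classes class_ring\<^esub> c = \<one>\<^bsub>square_classes class_ring\<^esub>" if cS: "c \<in> selmer a b" for c
 proof -
  obtain n where n: "n ~= 0" "c = ?c n" using rep[OF cS] by blast
  show ?thesis unfolding n(2) mult[OF n(1) n(1)] one using sq[OF n(1)] .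
 qed
 show "subgroup (selmer a b) (square_classes class_ring)"
 proof (rule G.subgroupI[OF sub])
  have "local_sol v a b 1" if "v \<in> places" for v using local_sol_square[OF that] is_square_of_int_square[OF that, of 1] by simp
  then have "?c 1 \<in> selmer a b" using selmer_iff[OF disc, of 1] by simp
  then show "selmer a b ~= {}" by blast
  show "inv\<^bsub>square_classes class_ring\<^esub> c \<in> selmer a b" if "c \<in> selmer a b" for c
   using G.inv_equality[OF e2[OF that]] that sub by auto
  show "c \<otimes>\<^bsub>square_classes class_ring\<^esub> c' \<in> selmer a b" if cS: "c \<in> selmer a b" "c' \<in> selmer a b" for c c'
  proof -
   obtain m where m: "m ~= 0" "c = ?c m" using rep[OF cS(1)] by blast
   obtain n where n: "n ~= 0" "c' = ?c n" using rep[OF cS(2)] by blast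
   note mn = m n
   have "\<forall>v\<in>places. local_sol v a b m" "\<forall>v\<in>places. local_sol v a b n" using cS selmer_iff[OF disc] mn by auto
   then have "\<forall>v\<in>places. local_sol v a b (m * n)" using local_sol_mult[OF _ disc] by blast
   then show ?thesis unfolding mn mult[OF mn(1,3)] using selmer_iff[OF disc, of "m * n"] mn by simp
  qed
 qed
qed

text \<open>After the gcd of x and y is cancelled, x^2 is coprime to y^2 and divides the squarefree
  number t, hence is 1; the same holds with the roles exchanged.\<close>

lemma squarefree_int_eq:
 assumes s: "squarefree (s::int)" "squarefree t" and e: "s * x^2 = t * y^2" and xy: "x ~= 0" "y ~= 0"
 shows "s = t"
proof -
 let ?g = "gcd x y"
 have g: "?g ~= 0" using xy by simp
 define x' where "x' = x div ?g" define y' where "y' = y div ?g"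
 have x: "x = x' * ?g" and y: "y = y' * ?g" unfolding x'_def y'_def by simp_all
 have cop: "coprime x' y'" unfolding x'_def y'_def using xy by (intro div_gcd_coprime) auto
 have "(s * x'^2) * ?g^2 = (t * y'^2) * ?g^2" using e x y by (metis mult.assoc power_mult_distrib)
 moreover have "?g^2 ~= 0" using g by simp
 ultimately have e': "s * x'^2 = t * y'^2" using mult_right_cancel by blast
 have c2: "coprime (x'^2) (y'^2)" using cop by simp
 have "x'^2 dvd t * y'^2" using e' by (metis dvd_triv_right)
 then have "x'^2 dvd t" using c2 by (simp add: coprime_dvd_mult_left_iff)
 then have "is_unit x'" using s(2) squarefreeD by blast
 then have 1: "x'^2 = 1" by (auto simp: zdvd1_eq power2_eq_1_iff abs_if split: if_splits)
 have "y'^2 dvd s * x'^2" using e' by (metis dvd_triv_right)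
 then have "y'^2 dvd s" unfolding 1 by simp
 then have "is_unit y'" using s(1) squarefreeD by blast
 then have "y'^2 = 1" by (auto simp: zdvd1_eq power2_eq_1_iff abs_if split: if_splits)
 then show ?thesis using e' 1 by simp
qed

lemma squarefree_decompose_int:
 "(n::int) ~= 0 ==> \<exists>s x. squarefree s & x ~= 0 & n = s * x^2"
proof (induction "nat \<bar>n\<bar>" arbitrary: n rule: less_induct)
 case less
 show ?case
 proof (cases "squarefree n")
  case True then show ?thesis by (intro exI[of _ n] exI[of _ 1]) simp
 next
  case False
  then obtain y where y: "y^2 dvd n" "~ is_unit y" unfolding squarefree_def by blast
  then obtain m where m: "n = y^2 * m" by blast
  have m0: "m ~= 0" and y0: "y ~= 0" using m less.prems by auto
  have "\<bar>y\<bar> \<ge> 2" using y(2) y0 by (auto simp: zdvd1_eq)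
  then have "\<bar>y\<bar> * \<bar>y\<bar> \<ge> 2 * 2" by (intro mult_mono) auto
  then have "y^2 \<ge> 4" by (simp add: power2_eq_square flip: abs_mult)
  then have "4 * \<bar>m\<bar> \<le> \<bar>n\<bar>" unfolding m abs_mult using mult_right_mono[of 4 "y^2" "\<bar>m\<bar>"] by simp
  then have "nat \<bar>m\<bar> < nat \<bar>n\<bar>" using m0 by linarith
  then obtain s x where sx: "squarefree s" "x ~= 0" "m = s * x^2" using less.hyps m0 by blast
  have "n = s * (x * y)^2" unfolding m sx(3) by (simp add: power_mult_distrib mult_ac)
  then show ?thesis using sx y0 by (intro exI[of _ s] exI[of _ "x * y"]) simp
 qed
qed

text \<open>Each rational square class contains exactly one squarefree integer, so counting these
  counts the Selmer group.\<close>

definition selmer_ints :: "int => int => int set" where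
 "selmer_ints a b = {al. squarefree al & (\<forall>v\<in>places. local_sol v a b al)}"

lemma squarefree_nonzero: "squarefree (al::int) ==> al ~= 0"
 using squarefreeD[of al 2] by auto

lemma squarefree_dvdI:
 assumes s: "squarefree (al::int)" and h: "\<And>p. prime p ==> int p dvd al ==> int p dvd c"
 shows "al dvd c"
proof -
 define g where "g = gcd al c"
 have g: "g dvd al" "g dvd c" "\<And>p. p dvd al ==> p dvd c ==> p dvd g" unfolding g_def by auto
 obtain y where y: "al = g * y" using g(1) by (rule dvdE)
 have y0: "y ~= 0" using squarefree_nonzero[OF s] y by auto
 have "is_unit y"
 proof (rule ccontr)
  assume "~ is_unit y"
  then obtain p where p: "prime p" "p dvd y" using prime_divisor_exists[OF y0] by blast
  have e: "int (nat p) = p" "prime (nat p)" using prime_ge_0_int[OF p(1)] p(1) by (simp_all add: prime_nat_iff_prime)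
  have pa: "p dvd al" unfolding y using p(2) by (rule dvd_mult)
  have "p dvd c" using h[OF e(2)] pa unfolding e(1) .
  then have "p dvd g" using g(3)[OF pa] by blast
  then have "p * p dvd al" unfolding y using p(2) by (rule mult_dvd_mono)
  then have "is_unit p" using squarefreeD[OF s, of p] by (simp add: power2_eq_square)
  then show False using p(1) not_prime_unit by blast
 qed
 then obtain u where u: "1 = y * u" by (rule dvdE)
 have "g = al * u" unfolding y mult.assoc u[symmetric] by simp
 then have "al dvd g" by (rule dvdI)
 then show ?thesis using g(2) by (rule dvd_trans)
qed

text \<open>Finiteness: a prime dividing the class but not a^2 - 4 b would contradict
  \<open>not_padic_sol_ramified\<close>, so the squarefree class divides a^2 - 4 b.\<close>

lemma card_selmer:
 assumes disc: "ell_disc a b ~= 0"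
 shows "finite (selmer_ints a b)" "card (selmer_ints a b) = 2 ^ selmer_rank a b"
proof -
 let ?c = "%n. square_class (class_ring :: rat ring) (of_int n)"
 have cn: "a^2 - 4 * b ~= 0" using disc unfolding ell_disc_def by auto
 have "al dvd a^2 - 4 * b" if al: "al \<in> selmer_ints a b" for al
 proof (rule squarefree_dvdI)
  show s: "squarefree al" using al unfolding selmer_ints_def by simp
  fix p assume p: "prime p" "int p dvd al"
  obtain gam where g: "al = int p * gam" using p(2) by (rule dvdE)
  have "~ int p dvd gam"
  proof
   assume "int p dvd gam"
   then have "(int p)^2 dvd al" unfolding g power2_eq_square by (intro mult_dvd_mono) auto
   then have "is_unit (int p)" by (rule squarefreeD[OF s])
   then show False using p(1) by (metis not_prime_unit prime_nat_int_transfer)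
  qed
  moreover have "padic_sol (int p) a b al"
   by (rule local_sol_imp_padic_sol[OF p(1) squarefree_nonzero[OF s]]) (use al p(1) in \<open>simp add: selmer_ints_def places_def\<close>)
  ultimately show "int p dvd a^2 - 4 * b" using not_padic_sol_ramified[of "int p" a b al gam] g p(1) by auto
 qed
 then have "selmer_ints a b \<subseteq> {al. al dvd a^2 - 4 * b}" by blast
 then show fin: "finite (selmer_ints a b)" using finite_divisors_int[OF cn] finite_subset by blast
 have inj: "inj_on ?c (selmer_ints a b)"
 proof (rule inj_onI)
  fix s t assume st: "s \<in> selmer_ints a b" "t \<in> selmer_ints a b" "?c s = ?c t"
  have sf: "squarefree s" "squarefree t" using st unfolding selmer_ints_def by auto
  note nz = sf[THEN squarefree_nonzero]
  obtain w :: rat where w: "of_int s * of_int t = w * w" using st(3) rat_square_class_eq[of "of_int s" "of_int t"] nz by auto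
  obtain m n where mn: "w = of_int m / of_int n" "n ~= 0" using rat_fraction[of w] by blast
  have "(of_int s :: rat) * of_int t * (of_int n * of_int n) = of_int m * of_int m" unfolding w mn(1) using mn(2) by (simp add: field_simps)
  then have e: "s * t * (n * n) = m * m" by (metis of_int_eq_iff of_int_mult)
  have "s * (t * n)^2 = t * m^2" using arg_cong[OF e, of "%z. t * z"] by (simp add: power2_eq_square mult_ac)
  moreover have "m ~= 0" using e nz mn(2) by auto
  ultimately show "s = t" using squarefree_int_eq[OF sf] nz mn(2) by simp
 qed
 have im: "?c ` selmer_ints a b = selmer a b"
 proof (intro equalityI subsetI)
  fix c assume "c \<in> ?c ` selmer_ints a b"
  then obtain s where s: "s \<in> selmer_ints a b" "c = ?c s" by blast
  then show "c \<in> selmer a b" using selmer_iff[OF disc squarefree_nonzero] unfolding selmer_ints_def by simp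
 next
  fix c assume c: "c \<in> selmer a b"
  then obtain n where n: "n ~= 0" "c = ?c n" using rational_square_class[of c] unfolding selmer_def by blast
  obtain s x where sx: "squarefree s" "x ~= 0" "n = s * x^2" using squarefree_decompose_int[OF n(1)] by blast
  have s0: "s ~= 0" by (rule squarefree_nonzero[OF sx(1)])
  have "\<exists>w. (of_int n :: rat) * of_int s = w * w" unfolding sx(3) by (intro exI[of _ "of_int (s * x)"]) (simp add: power2_eq_square)
  then have e: "?c n = ?c s" using rat_square_class_eq[of "of_int n" "of_int s"] n(1) s0 by simp
  then have "s \<in> selmer_ints a b" using c selmer_iff[OF disc s0] sx(1) unfolding selmer_ints_def n(2) by simp
  then show "c \<in> ?c ` selmer_ints a b" unfolding n(2) e by blast
 qed
 have V: "vectorspace (class_ring :: bit ring) (bit_space (square_classes (class_ring :: rat ring)) (selmer a b))"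
  by (rule bit_space_vectorspace[OF field.square_classes_comm_group[OF class_ring_field] selmer_subgroup(1)[OF disc]]) (rule selmer_subgroup(2)[OF disc])
 have cV: "carrier (bit_space (square_classes (class_ring :: rat ring)) (selmer a b)) = selmer a b" by (simp add: bit_space_def)
 have "finite (selmer a b)" using im fin by (metis finite_imageI)
 then have "card (selmer a b) = 2 ^ selmer_rank a b" using bit_vectorspace_card[OF V] unfolding cV selmer_rank_def by simp
 then show "card (selmer_ints a b) = 2 ^ selmer_rank a b" using card_image[OF inj] im by simp
qed

section \<open>The Hilbert symbol of a local root\<close>

lemma mem_lim_class:
 assumes v: "v \<in> places" and f0: "cauchy_seq v f0" and f: "f \<in> lim_class v f0"
 shows "cauchy_seq v f" "lim_class v f = lim_class v f0"
proof -
 obtain h where h: "null_seq v h" "f = (%n. h n + f0 n)"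
  using f unfolding lim_class_def[OF v] a_r_coset_def' null_sequences_eq by auto
 show c: "cauchy_seq v f" unfolding h(2) by (rule cauchy_seq_add[OF v null_imp_cauchy[OF v h(1)] f0])
 show "lim_class v f = lim_class v f0" unfolding lim_class_eq[OF v c f0] using h by simp
qed

lemma padic_integers_carrierE:
 assumes q: "prime q" and x: "x \<in> carrier (padic_integers q)"
 obtains f where "cauchy_seq (Finite_place q) f" "x = lim_class (Finite_place q) f" "\<And>n. place_abs (Finite_place q) (f n) \<le> 1"
proof -
 have v: "Finite_place q \<in> places" using q by (simp add: places_def)
 from x obtain f where f: "f \<in> x" "\<And>n. place_abs (Finite_place q) (f n) \<le> 1" and xc: "x \<in> carrier (completion (Finite_place q))"
  unfolding padic_integers_def by (auto simp del: place_abs.simps)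
 obtain f0 where f0: "cauchy_seq (Finite_place q) f0" "x = lim_class (Finite_place q) f0" using completion_carrierE[OF v xc] .
 note m = mem_lim_class[OF v f0(1) f(1)[unfolded f0(2)]]
 show ?thesis by (rule that[OF m(1) _ f(2)]) (simp only: m(2) f0(2))
qed

lemma place_abs_less_1_dvd: "prime q ==> place_abs (Finite_place q) (of_int z) < 1 ==> int q dvd z"
 using place_abs_of_int_eq_1[of q z] less_irrefl by metis

lemma place_abs_ultra_less:
 assumes q: "prime q" and l: "place_abs (Finite_place q) (x - y) < r" "place_abs (Finite_place q) (y - z) < r"
 shows "place_abs (Finite_place q) (x - z) < r"
proof -
 have e: "x - y + (y - z) = x - z" by simp
 have "place_abs (Finite_place q) (x - z) \<le> max (place_abs (Finite_place q) (x - y)) (place_abs (Finite_place q) (y - z))"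
  using place_abs_ultra[OF q, of "x - y" "y - z"] unfolding e .
 also have "\<dots> < r" using l by (simp only: max_less_iff_conj simp_thms)
 finally show ?thesis .
qed

lemma prime_powi_neg_less_1: assumes "prime q" shows "real q powi (- int (Suc M)) < 1"
proof -
 have "1 < real q ^ Suc M" using prime_gt_1_nat[OF assms] by (intro one_less_power) auto
 then show ?thesis unfolding power_int_minus power_int_of_nat inverse_less_1_iff by (rule disjI2)
qed

text \<open>The limit itself need not be an integer, so each \<open>M\<close> uses an integer y
  close to it together with a square root of y modulo q^M; compactness makes both converge.\<close>

lemma padic_limit_is_square:
 assumes q: "prime q" "odd q" and f: "cauchy_seq (Finite_place q) f" "\<And>n. place_abs (Finite_place q) (f n) \<le> 1"
  and B: "~ int q dvd B" "QuadRes (int q) B" and N: "\<And>k. k \<ge> N ==> place_abs (Finite_place q) (f k - of_int B) < 1"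
 shows "is_square (completion (Finite_place q)) (lim_class (Finite_place q) f)"
proof -
 let ?v = "Finite_place q"
 have v: "?v \<in> places" using q by (simp add: places_def)
 have q1: "real q > 1" using prime_gt_1_nat[OF q(1)] by simp
 have iq: "prime (int q)" "odd (int q)" using q by auto
 let ?Q = "%M x y z. int q ^ M dvd x\<^sup>2 - y & (\<exists>K. \<forall>k\<ge>K. place_abs ?v (of_int y - f k) \<le> real q powi (- int M))"
 have "\<exists>f' g h. cauchy_seq ?v (%k. of_int (f' k)) & cauchy_seq ?v (%k. of_int (g k)) & cauchy_seq ?v (%k. of_int (h k)) & (\<forall>k. ?Q k (f' k) (g k) (h k))"
 proof (rule padic_compactness[OF q(1), where Q = ?Q])
  fix M
  let ?d = "real q powi (- int M)"
  have d0: "?d > 0" using q1 by simp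
  then obtain K where K: "\<And>m n. m \<ge> K ==> n \<ge> K ==> place_abs ?v (f m - f n) < ?d" using f(1) unfolding cauchy_seq_def by blast
  define k where "k = max K N"
  obtain y where y: "place_abs ?v (f k - of_int y) \<le> real q powi (- int (Suc M))" using padic_integer_approx[OF q(1) f(2)] by blast
  have s1: "real q powi (- int (Suc M)) < 1" by (rule prime_powi_neg_less_1[OF q(1)])
  have s2: "real q powi (- int (Suc M)) \<le> ?d" using q1 by (intro power_int_increasing) auto
  have "place_abs ?v (of_int (y - B)) < 1"
  proof -
   have "place_abs ?v (of_int y - f k) < 1" using y s1 place_abs_minus[OF v, of "f k - of_int y"] by (simp del: place_abs.simps)
   then show ?thesis using place_abs_ultra_less[OF q(1), of "of_int y" "f k" 1 "of_int B"] N[of k] unfolding k_def by (simp del: place_abs.simps)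
  qed
  then have yB: "int q dvd y - B" by (rule place_abs_less_1_dvd[OF q(1)])
  have "~ int q dvd y" using dvd_shift[OF yB] B(1) by blast
  moreover have "QuadRes (int q) y" using QuadRes_cong[OF yB] B(2) by blast
  ultimately obtain x where x: "int q ^ M dvd x^2 - y" using QuadRes_lift[OF iq] by blast
  have "place_abs ?v (of_int y - f l) \<le> ?d" if "l \<ge> K" for l
  proof -
   have "place_abs ?v (of_int y - f k) \<le> ?d" using y s2 place_abs_minus[OF v, of "f k - of_int y"] by (simp del: place_abs.simps)
   moreover have "place_abs ?v (f k - f l) < ?d" using K[of k l] that unfolding k_def by simp
   ultimately show ?thesis using place_abs_ultra[OF q(1), of "of_int y - f k" "f k - f l"] by (simp del: place_abs.simps)
  qed
  then show "\<exists>x y z. ?Q M x y z" using x by blast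
 next
  fix M M' x y z assume M: "M \<le> (M' :: nat)" and Q: "?Q M' x y z"
  have "real q powi (- int M') \<le> real q powi (- int M)" using q1 M by (intro power_int_increasing) auto
  note le = this
  from Q have d: "int q ^ M' dvd x^2 - y" by (rule conjunct1)
  from Q obtain K where K: "\<And>k. k \<ge> K ==> place_abs ?v (of_int y - f k) \<le> real q powi (- int M')" by (elim conjE exE) blast
  have "\<forall>k\<ge>K. place_abs ?v (of_int y - f k) \<le> real q powi (- int M)" using order_trans[OF K le] by blast
  then show "?Q M x y z" using power_le_dvd[OF d M] by blast
 qed
 then obtain x y where c: "cauchy_seq ?v (%k. of_int (x k))" "cauchy_seq ?v (%k. of_int (y k))"
  and Q: "\<And>k. int q ^ k dvd (x k)\<^sup>2 - y k" "\<And>k. \<exists>K. \<forall>l\<ge>K. place_abs ?v (of_int (y k) - f l) \<le> real q powi (- int k)" by blast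
 have "null_seq ?v (%k. of_int ((x k)^2 - y k))" by (rule null_seq_of_dvd[OF q(1) Q(1)])
 moreover have "null_seq ?v (%k. of_int (y k) - f k)" unfolding null_seq_iff[OF v]
 proof (intro allI impI)
  fix e :: real assume e: "e > 0"
  obtain K where K: "\<And>m n. m \<ge> K ==> n \<ge> K ==> place_abs ?v (f m - f n) < e" using f(1) e unfolding cauchy_seq_def by blast
  have "inverse (real q) < 1" using q1 by (simp add: inverse_less_1_iff)
  then obtain j where j: "inverse (real q) ^ j < e" using e real_arch_pow_inv by blast
  show "\<exists>N. \<forall>k\<ge>N. place_abs ?v (of_int (y k) - f k) < e"
  proof (intro exI[of _ "max K j"] allI impI)
   fix k assume k: "max K j \<le> k"
   obtain L where L: "\<And>l. l \<ge> L ==> place_abs ?v (of_int (y k) - f l) \<le> real q powi (- int k)" using Q(2) by blast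
   have "real q powi (- int k) \<le> real q powi (- int j)" using q1 k by (intro power_int_increasing) auto
   also have "\<dots> = inverse (real q) ^ j" by (simp add: power_int_minus power_inverse)
   finally have "place_abs ?v (of_int (y k) - f (max L k)) < e" using L[of "max L k"] j by simp
   then show "place_abs ?v (of_int (y k) - f k) < e"
    using place_abs_ultra_less[OF q(1), of "of_int (y k)" "f (max L k)" e "f k"] K[of "max L k" k] k by (simp del: place_abs.simps)
  qed
 qed
 ultimately have "null_seq ?v (%k. of_int ((x k)^2 - y k) + (of_int (y k) - f k))" by (rule null_seq_add[OF v])
 also have "(%k. of_int ((x k)^2 - y k) + (of_int (y k) - f k)) = (%k. of_int (x k) * of_int (x k) - f k)" by (simp add: power2_eq_square)
 finally have "lim_class ?v (%k. of_int (x k) * of_int (x k)) = lim_class ?v f"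
  using lim_class_eq[OF v cauchy_seq_mult[OF v c(1) c(1)] f(1)] by blast
 then show ?thesis using lim_class_mult[OF v c(1) c(1)] lim_class_closed[OF v c(1)] unfolding is_square_def by metis
qed

text \<open>A solution of z^2 = f x^2 + q y^2 is made integral and primitive and reduced modulo q^2.
  If q divided x, it would divide z and then, by the second power, also y. So x is a unit, and B is
  the square of z / x modulo q.\<close>

lemma hilbert_conic_imp_QuadRes:
 assumes q: "prime q" and f: "cauchy_seq (Finite_place q) f" "\<And>n. place_abs (Finite_place q) (f n) \<le> 1"
  and N: "\<And>k. k \<ge> N ==> place_abs (Finite_place q) (f k - of_int B) < 1"
  and c: "cauchy_seq (Finite_place q) x" "cauchy_seq (Finite_place q) y" "cauchy_seq (Finite_place q) z"
  and nn: "~ (null_seq (Finite_place q) x & null_seq (Finite_place q) y & null_seq (Finite_place q) z)"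
  and eq: "null_seq (Finite_place q) (%k. z k * z k - (f k * (x k * x k) + of_nat q * (y k * y k)))" (is "null_seq _ ?F")
 shows "QuadRes (int q) B"
proof -
 let ?v = "Finite_place q"
 have v: "?v \<in> places" using q by (simp add: places_def)
 have iq: "prime (int q)" using q by simp
 let ?d = "real q powi (- int (Suc 1))"
 have d0: "0 < ?d" using prime_gt_0_nat[OF q] by simp
 from padic_scaled_sequences[OF q c nn] obtain eps K where e0: "eps > 0" and K: "\<And>k. k \<ge> K ==> \<exists>t. place_abs ?v t \<ge> eps & place_abs ?v (x k / t) \<le> 1 &
  place_abs ?v (y k / t) \<le> 1 & place_abs ?v (z k / t) \<le> 1 & (x k = t \<or> y k = t \<or> z k = t)" by blast
 have "eps * eps * ?d > 0" using e0 d0 by simp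
 then obtain K' where K': "\<And>k. k \<ge> K' ==> place_abs ?v (?F k) < eps * eps * ?d" using eq unfolding null_seq_iff[OF v] by blast
 define k where "k = max N (max K K')"
 obtain t where t: "place_abs ?v t \<ge> eps" "place_abs ?v (x k / t) \<le> 1" "place_abs ?v (y k / t) \<le> 1" "place_abs ?v (z k / t) \<le> 1" "x k = t \<or> y k = t \<or> z k = t"
 proof -
  have "K \<le> k" unfolding k_def by simp
  from K[OF this] show ?thesis using that by (elim exE conjE)
 qed
 have Fk: "place_abs ?v (?F k) < eps * eps * ?d" using K' unfolding k_def by simp
 have t0: "t ~= 0" using t(1) e0 by (auto simp del: place_abs.simps)
 define x' where "x' = x k / t" define y' where "y' = y k / t" define z' where "z' = z k / t"
 define H where "H = z' * z' - (f k * (x' * x') + of_int (int q) * (y' * y'))"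
 have small: "place_abs ?v H \<le> ?d"
 proof -
  have "H * (t * t) = ?F k" unfolding H_def x'_def y'_def z'_def using t0 by (simp add: field_simps)
  then have "place_abs ?v H * (place_abs ?v t * place_abs ?v t) = place_abs ?v (?F k)" using place_abs_mult[OF v] by metis
  then have 1: "place_abs ?v H * (place_abs ?v t * place_abs ?v t) \<le> eps * eps * ?d" using Fk by simp
  have "eps * eps \<le> place_abs ?v t * place_abs ?v t" using t(1) e0 by (intro mult_mono) auto
  then have "place_abs ?v H * (eps * eps) \<le> place_abs ?v H * (place_abs ?v t * place_abs ?v t)" by (intro mult_left_mono) (auto simp del: place_abs.simps)
  then have "eps * eps * place_abs ?v H \<le> eps * eps * ?d" using 1 by (simp only: mult.commute)
  then show ?thesis using e0 by (simp del: place_abs.simps)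
 qed
 obtain zx where zx: "padic_near q ?d x' (of_int zx)" using padic_near_exists[OF q t(2)] unfolding x'_def by blast
 obtain zy where zy: "padic_near q ?d y' (of_int zy)" using padic_near_exists[OF q t(3)] unfolding y'_def by blast
 obtain zz where zz: "padic_near q ?d z' (of_int zz)" using padic_near_exists[OF q t(4)] unfolding z'_def by blast
 obtain zf where zf: "padic_near q ?d (f k) (of_int zf)" using padic_near_exists[OF q f(2)] by blast
 note nr = padic_near_mult[OF q] padic_near_diff[OF q] padic_near_add[OF q] padic_near_of_int[OF q order.strict_implies_order[OF d0]]
 have "padic_near q ?d H (of_int (zz * zz - (zf * (zx * zx) + int q * (zy * zy))))"
  unfolding H_def of_int_mult of_int_diff of_int_add by (intro nr zx zy zz zf)
 then have dv: "int q ^ Suc 1 dvd zz * zz - (zf * (zx * zx) + int q * (zy * zy))" by (rule padic_near_pow_dvd[OF q _ small])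
 have "x' = 1 \<or> y' = 1 \<or> z' = 1" using t(5) t0 unfolding x'_def y'_def z'_def by auto
 then have ndv: "~ int q dvd zx \<or> ~ int q dvd zy \<or> ~ int q dvd zz" using zx zy zz padic_near_one_not_dvd[OF q] by blast
 have zfB: "int q dvd zf - B"
 proof (rule place_abs_less_1_dvd[OF q])
  have "?d < 1" by (rule prime_powi_neg_less_1[OF q])
  then have "place_abs ?v (of_int zf - f k) < 1" using zf place_abs_minus[OF v, of "f k - of_int zf"] unfolding padic_near_def by (simp del: place_abs.simps)
  then show "place_abs ?v (of_int (zf - B)) < 1"
   using place_abs_ultra_less[OF q, of "of_int zf" "f k" 1 "of_int B"] N[of k] unfolding k_def by (simp del: place_abs.simps)
 qed
 have dv2: "int q * int q dvd zz * zz - (zf * (zx * zx) + int q * (zy * zy))" using dv by simp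
 then have dv1: "int q dvd zz * zz - (zf * (zx * zx) + int q * (zy * zy))" by (rule dvd_mult_left)
 have dv1': "int q dvd zz * zz - zf * (zx * zx)"
  using dvd_add[OF dv1 dvd_triv_left[of "int q" "zy * zy"]] by (simp add: algebra_simps)
 have nzx: "~ int q dvd zx"
 proof
  assume a: "int q dvd zx"
  have "int q dvd zz * zz" using dvd_add[OF dv1' dvd_mult[OF dvd_mult[OF a]], of zf zx] by simp
  then have zzd: "int q dvd zz" using prime_dvd_mult_iff[OF iq] by blast
  have "int q * int q dvd zz * zz" "int q * int q dvd zf * (zx * zx)" using mult_dvd_mono[OF zzd zzd] mult_dvd_mono[OF a a] by auto
  then have "int q * int q dvd zz * zz - zf * (zx * zx)" by (rule dvd_diff)
  from dvd_diff[OF this dv2] have "int q * int q dvd int q * (zy * zy)" by (simp add: algebra_simps)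
  then have "int q dvd zy * zy" using prime_gt_0_nat[OF q] by simp
  then have "int q dvd zy" using prime_dvd_mult_iff[OF iq] by blast
  then show False using ndv a zzd by blast
 qed
 have "int q dvd (zz * zz - zf * (zx * zx)) + (zf - B) * (zx * zx)" using dv1' zfB by (intro dvd_add dvd_mult2)
 then have "int q dvd zz^2 - B * zx^2" by (simp add: power2_eq_square algebra_simps)
 then show ?thesis using QuadRes_divide_square[OF iq _ nzx] by blast
qed

text \<open>The q-adic root is replaced by an integer B congruent to it. B is prime to q because
  \<beta> has an integral inverse, and the Hilbert symbol of a unit with q is the residue symbol of
  that unit.\<close>

lemma local_root_residue:
 assumes q: "prime q" "odd q" and \<beta>: "\<beta> \<in> Units (padic_integers q)"
  and eq: "\<beta> \<otimes>\<^bsub>completion (Finite_place q)\<^esub> \<beta> \<oplus>\<^bsub>completion (Finite_place q)\<^esub>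
   of_int_ring (completion (Finite_place q)) (- 2 * a) \<otimes>\<^bsub>completion (Finite_place q)\<^esub> \<beta> \<oplus>\<^bsub>completion (Finite_place q)\<^esub>
   of_int_ring (completion (Finite_place q)) (a^2 - 4 * b) = \<zero>\<^bsub>completion (Finite_place q)\<^esub>"
 shows "\<exists>B. ~ int q dvd B & int q dvd (B - a)^2 - 4 * b &
  hilbert_symbol (completion (Finite_place q)) \<beta> (of_rat_completion (Finite_place q) (of_nat q)) = (if QuadRes (int q) B then 1 else - 1)"
proof -
 let ?v = "Finite_place q" let ?K = "completion (Finite_place q)"
 have v: "?v \<in> places" using q by (simp add: places_def)
 interpret K: field ?K by (rule completion_field[OF v])
 have \<beta>c: "\<beta> \<in> carrier (padic_integers q)" using \<beta> unfolding Units_def by simp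
 obtain f where f: "cauchy_seq ?v f" "\<beta> = lim_class ?v f" "\<And>n. place_abs ?v (f n) \<le> 1" 
 proof (rule padic_integers_carrierE[OF q(1) \<beta>c])
  fix h assume "cauchy_seq ?v h" "\<beta> = lim_class ?v h" "\<And>n. place_abs ?v (h n) \<le> 1"
  then show thesis by (rule that)
 qed
 have P: "monoid.mult (padic_integers q) = monoid.mult ?K" "\<one>\<^bsub>padic_integers q\<^esub> = \<one>\<^bsub>?K\<^esub>" unfolding padic_integers_def by simp_all
 have "\<exists>gam\<in>carrier (padic_integers q). gam \<otimes>\<^bsub>?K\<^esub> \<beta> = \<one>\<^bsub>?K\<^esub> & \<beta> \<otimes>\<^bsub>?K\<^esub> gam = \<one>\<^bsub>?K\<^esub>"
  using \<beta> unfolding Units_def mem_Collect_eq P by (rule conjunct2)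
 then obtain gam where gam: "gam \<in> carrier (padic_integers q)" "\<beta> \<otimes>\<^bsub>?K\<^esub> gam = \<one>\<^bsub>?K\<^esub>" by (elim bexE conjE)
 obtain g where g: "cauchy_seq ?v g" "gam = lim_class ?v g" "\<And>n. place_abs ?v (g n) \<le> 1" 
 proof (rule padic_integers_carrierE[OF q(1) gam(1)])
  fix h assume "cauchy_seq ?v h" "gam = lim_class ?v h" "\<And>n. place_abs ?v (h n) \<le> 1"
  then show thesis by (rule that)
 qed
 note cs = cauchy_seq_const[OF v] cauchy_seq_mult[OF v] cauchy_seq_add[OF v]
 note hom = lim_class_mult[OF v] lim_class_add[OF v]
 have "lim_class ?v (%n. f n * g n) = lim_class ?v (%n. 1)" using gam(2) unfolding f(2) g(2) lim_class_one[OF v] lim_class_mult[OF v f(1) g(1)] .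
 then have n1: "null_seq ?v (%n. f n * g n - 1)" using lim_class_eq[OF v cs(2)[OF f(1) g(1)] cs(1)] by blast
 have cl: "cauchy_seq ?v (%n. f n * f n + of_int (- 2 * a) * f n + of_int (a\<^sup>2 - 4 * b))" by (intro cs f)
 have "lim_class ?v (%n. f n * f n + of_int (- 2 * a) * f n + of_int (a\<^sup>2 - 4 * b)) = \<zero>\<^bsub>?K\<^esub>"
  using eq unfolding f(2) of_int_ring_completion[OF v] by (simp only: hom cs f(1))
 then have n2: "null_seq ?v (%n. f n * f n + of_int (- 2 * a) * f n + of_int (a\<^sup>2 - 4 * b))" using lim_class_eq_0[OF v cl] by blast
 have one0: "(0::real) < 1" by simp
 obtain N1 where N1: "\<forall>k\<ge>N1. place_abs ?v (f k * g k - 1) < 1" using n1[unfolded null_seq_iff[OF v], rule_format, of 1, OF one0] by (elim exE)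
 obtain N2 where N2: "\<forall>k\<ge>N2. place_abs ?v (f k * f k + of_int (- 2 * a) * f k + of_int (a\<^sup>2 - 4 * b)) < 1" using n2[unfolded null_seq_iff[OF v], rule_format, of 1, OF one0] by (elim exE)
 obtain N3 where N3: "\<forall>m\<ge>N3. \<forall>n\<ge>N3. place_abs ?v (f m - f n) < 1" using f(1)[unfolded cauchy_seq_def, rule_format, of 1, OF one0] by (elim exE)
 define N where "N = max N1 (max N2 N3)"
 let ?d = "real q powi (- int 1)"
 have d: "?d < 1" "0 \<le> ?d" using prime_gt_1_nat[OF q(1)] by (auto simp: power_int_minus inverse_less_1_iff)
 obtain B where B: "padic_near q ?d (f N) (of_int B)" using padic_near_exists[OF q(1) f(3)] by blast
 have fB: "place_abs ?v (f k - of_int B) < 1" if "k \<ge> N" for k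
  using place_abs_ultra_less[OF q(1), of "f k" "f N" 1 "of_int B"] N3[rule_format, of k N] that B d unfolding N_def padic_near_def by (simp del: place_abs.simps)
 have nB: "~ int q dvd B"
 proof
  assume "int q dvd B"
  then have "place_abs ?v (of_int B) ~= 1" using place_abs_of_int_eq_1[OF q(1)] by blast
  then have "place_abs ?v (of_int B - 0) < 1" using place_abs_of_int_le_1[OF q(1), of B] by (simp del: place_abs.simps)
  then have "place_abs ?v (f N) < 1" using place_abs_ultra_less[OF q(1), of "f N" "of_int B" 1 0] fB[of N] by (simp del: place_abs.simps)
  then have "place_abs ?v (f N * g N) < 1" unfolding place_abs_mult[OF v] using mult_left_mono[OF g(3)[of N], of "place_abs ?v (f N)"] by (simp del: place_abs.simps)
  then have l1: "place_abs ?v (f N * g N - 0) < 1" by simp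
  have "place_abs ?v (1 - f N * g N) < 1" using N1[rule_format, of N] place_abs_minus[OF v, of "f N * g N - 1"] unfolding N_def by (simp del: place_abs.simps)
  then have "place_abs ?v (1 - 0) < 1" using place_abs_ultra_less[OF q(1) _ l1] by blast
  then show False using place_abs_1[OF v] by (simp del: place_abs.simps)
 qed
 note nr = padic_near_mult[OF q(1)] padic_near_add[OF q(1)] padic_near_of_int[OF q(1) d(2)]
 have "padic_near q ?d (f N * f N + of_int (- 2 * a) * f N + of_int (a\<^sup>2 - 4 * b)) (of_int B * of_int B + of_int (- 2 * a) * of_int B + of_int (a\<^sup>2 - 4 * b))"
  by (intro nr B)
 then have near: "place_abs ?v ((f N * f N + of_int (- 2 * a) * f N + of_int (a\<^sup>2 - 4 * b)) - of_int (B * B + (- 2 * a) * B + (a\<^sup>2 - 4 * b))) < 1"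
  unfolding padic_near_def of_int_add of_int_mult using d by linarith
 have "place_abs ?v (of_int (B * B + (- 2 * a) * B + (a\<^sup>2 - 4 * b)) - 0) < 1"
  using place_abs_ultra_less[OF q(1), of "of_int (B * B + (- 2 * a) * B + (a\<^sup>2 - 4 * b))" "f N * f N + of_int (- 2 * a) * f N + of_int (a\<^sup>2 - 4 * b)" 1 0]
   near N2[rule_format, of N] place_abs_minus[OF v, of "(f N * f N + of_int (- 2 * a) * f N + of_int (a\<^sup>2 - 4 * b)) - of_int (B * B + (- 2 * a) * B + (a\<^sup>2 - 4 * b))"]
  unfolding N_def minus_diff_eq by (simp only: diff_0_right max.cobounded1 max.cobounded2 max.coboundedI2)
 then have "int q dvd B * B + (- 2 * a) * B + (a\<^sup>2 - 4 * b)" unfolding diff_0_right by (rule place_abs_less_1_dvd[OF q(1)])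
 then have root: "int q dvd (B - a)^2 - 4 * b" by (simp add: power2_eq_square algebra_simps)
 have qq: "of_rat_completion ?v (of_nat q) = lim_class ?v (%n. of_nat q)" by (rule of_rat_completion_eq[OF v])
 have fc: "lim_class ?v f \<in> carrier ?K" "lim_class ?v (%n. of_nat q) \<in> carrier ?K" using lim_class_closed[OF v] f(1) cs(1) by auto
 have "(\<exists>u\<in>carrier ?K. \<exists>w\<in>carrier ?K. \<exists>z\<in>carrier ?K. (u, w, z) ~= (\<zero>\<^bsub>?K\<^esub>, \<zero>\<^bsub>?K\<^esub>, \<zero>\<^bsub>?K\<^esub>) &
   z \<otimes>\<^bsub>?K\<^esub> z = \<beta> \<otimes>\<^bsub>?K\<^esub> (u \<otimes>\<^bsub>?K\<^esub> u) \<oplus>\<^bsub>?K\<^esub> of_rat_completion ?v (of_nat q) \<otimes>\<^bsub>?K\<^esub> (w \<otimes>\<^bsub>?K\<^esub> w)) \<longleftrightarrow> QuadRes (int q) B" (is "?L \<longleftrightarrow> _")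
 proof
  assume "QuadRes (int q) B"
  then have "is_square ?K (lim_class ?v f)" using padic_limit_is_square[OF q f(1,3) nB _ fB] by blast
  then obtain z where z: "z \<in> carrier ?K" "lim_class ?v f = z \<otimes>\<^bsub>?K\<^esub> z" unfolding is_square_def by (elim bexE)
  show ?L unfolding f(2) qq
   by (rule bexI[of _ "\<one>\<^bsub>?K\<^esub>"], rule bexI[of _ "\<zero>\<^bsub>?K\<^esub>"], rule bexI[of _ z]) (use z fc in simp_all)
 next
  assume ?L
  then obtain u w z where uwz: "u \<in> carrier ?K" "w \<in> carrier ?K" "z \<in> carrier ?K" "(u, w, z) ~= (\<zero>\<^bsub>?K\<^esub>, \<zero>\<^bsub>?K\<^esub>, \<zero>\<^bsub>?K\<^esub>)"
   "z \<otimes>\<^bsub>?K\<^esub> z = \<beta> \<otimes>\<^bsub>?K\<^esub> (u \<otimes>\<^bsub>?K\<^esub> u) \<oplus>\<^bsub>?K\<^esub> of_rat_completion ?v (of_nat q) \<otimes>\<^bsub>?K\<^esub> (w \<otimes>\<^bsub>?K\<^esub> w)" by (elim bexE conjE)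
  obtain x where x: "cauchy_seq ?v x" "u = lim_class ?v x" using completion_carrierE[OF v uwz(1)] .
  obtain y where y: "cauchy_seq ?v y" "w = lim_class ?v y" using completion_carrierE[OF v uwz(2)] .
  obtain t where t: "cauchy_seq ?v t" "z = lim_class ?v t" using completion_carrierE[OF v uwz(3)] .
  have nn: "~ (null_seq ?v x & null_seq ?v y & null_seq ?v t)"
   using uwz(4) unfolding x(2) y(2) t(2) prod.inject lim_class_eq_0[OF v x(1)] lim_class_eq_0[OF v y(1)] lim_class_eq_0[OF v t(1)] .
  have "lim_class ?v (%k. t k * t k) = lim_class ?v (%k. f k * (x k * x k) + of_nat q * (y k * y k))"
   using uwz(5) unfolding x(2) y(2) t(2) f(2) qq by (simp only: hom cs f(1) x(1) y(1) t(1))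
  moreover have "cauchy_seq ?v (%k. t k * t k)" "cauchy_seq ?v (%k. f k * (x k * x k) + of_nat q * (y k * y k))" by (intro cs f x y t)+
  ultimately have "null_seq ?v (%k. t k * t k - (f k * (x k * x k) + of_nat q * (y k * y k)))" using lim_class_eq[OF v] by blast
  then show "QuadRes (int q) B" by (rule hilbert_conic_imp_QuadRes[OF q(1) f(1,3) _ x(1) y(1) t(1) nn, rotated]) (rule fB)
 qed
 then show ?thesis unfolding hilbert_symbol_def using nB root by (intro exI[of _ B]) simp
qed

section \<open>Residue symbols at the twisting primes\<close>

text \<open>Gauss's lemma: for q = 8 k + 7 the doubles of 1, ..., 4 k + 3 that exceed 4 k + 3 come
  from 2 k + 2, ..., 4 k + 3, and their number 2 k + 2 is even.\<close>

lemma Legendre_two: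
 assumes q: "prime q" "q mod 8 = 7"
 shows "Legendre 2 (int q) = 1"
proof -
 obtain k where k: "q = 8 * k + 7" using div_mult_mod_eq[of q 8] q(2) by (intro that[of "q div 8"]) simp
 have "~ int q dvd 2" using zdvd_imp_le[of "int q" 2] k by auto
 then interpret G: GAUSS q 2 by unfold_locales (use q k in \<open>auto simp: cong_0_iff\<close>)
 have half: "(int q - 1) div 2 = 4 * int k + 3" using k by simp
 have "G.C = (%x. x * 2) ` {0<..4 * int k + 3}" unfolding G.C_def G.B_def G.A_def half image_image
  by (rule image_cong[OF refl], rule mod_pos_pos_trivial) (use k in auto)
 then have "G.E = (%x. x * 2) ` {0<..4 * int k + 3} \<inter> {4 * int k + 3<..}" unfolding G.E_def half by simp
 also have "\<dots> = (%x. x * 2) ` {2 * int k + 2..4 * int k + 3}"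
 proof (intro equalityI subsetI)
  fix y assume "y \<in> (%x. x * 2) ` {0<..4 * int k + 3} \<inter> {4 * int k + 3<..}"
  then obtain x where x: "x \<le> 4 * int k + 3" "y = x * 2" "4 * int k + 3 < y" by auto
  then have "2 * int k + 2 \<le> x" by presburger
  then show "y \<in> (%x. x * 2) ` {2 * int k + 2..4 * int k + 3}" using x by auto
 qed auto
 finally have "card G.E = card {2 * int k + 2..4 * int k + 3}" using card_image[of "%x. x * 2 :: int"] by (simp add: inj_on_def)
 also have "\<dots> = 2 * k + 2" by simp
 finally show ?thesis using G.gauss_lemma by simp
qed

lemma Legendre_minus_one:
 assumes p: "prime p" "2 < p"
 shows "Legendre (- 1) (int p) = (- 1) ^ ((p - 1) div 2)"
proof -
 have nd: "~ int p dvd 2" using zdvd_imp_le[of "int p" 2] p by auto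
 have d: "int p dvd Legendre (- 1) (int p) - (- 1) ^ ((p - 1) div 2)"
  using euler_criterion[OF p, of "- 1"] by (simp add: cong_iff_dvd_diff)
 have "~ int p dvd - 1" using p by auto
 then have "Legendre (- 1) (int p) = 1 \<or> Legendre (- 1) (int p) = - 1" unfolding Legendre_def by (auto simp: cong_0_iff)
 moreover have "(- 1 :: int) ^ ((p - 1) div 2) = 1 \<or> (- 1 :: int) ^ ((p - 1) div 2) = - 1" by (cases "even ((p - 1) div 2)") auto
 ultimately show ?thesis using d nd by (elim disjE) auto
qed

lemma QuadRes_imp_Legendre: "~ p dvd u ==> Legendre u p = (if QuadRes p u then 1 else - 1)"
 unfolding Legendre_def by (simp add: cong_0_iff)

text \<open>As q is 3 modulo 4, the reciprocity sign is the symbol of -1 at v, so the symbol of v at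
  q equals that of -q at v.\<close>

lemma QuadRes_reciprocal:
 assumes q: "prime q" "q mod 8 = 7" and v: "prime v" "v ~= 2" and d: "~ v dvd q" "QuadRes (int v) (- int q)"
 shows "QuadRes (int q) (int v)"
proof -
 have v2: "2 < v" using v prime_gt_1_nat[of v] by simp
 have q2: "2 < q" using q(2) mod_less_eq_dividend[of q 8] by simp
 have ne: "v ~= q" using d by auto
 have vi: "prime (int v)" "2 < int v" using v v2 by auto
 have "Legendre (- int q) (int v) = 1" using d by (subst QuadRes_imp_Legendre) (auto simp: int_dvd_int_iff)
 then have 1: "Legendre (- 1) (int v) * Legendre (int q) (int v) = 1" using Legendre_mult_odd_prime[OF vi, of "- 1" "int q"] by simp
 have "odd ((q - 1) div 2)" using q(2) by presburger
 then have "(- 1 :: int) ^ ((v - 1) div 2 * ((q - 1) div 2)) = (- 1) ^ ((v - 1) div 2)"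
  by (cases "even ((v - 1) div 2)") (auto simp: power_mult)
 then have 2: "Legendre (int v) (int q) * Legendre (int q) (int v) = Legendre (- 1) (int v)"
  using Quadratic_Reciprocity[OF v(1) v2 q(1) q2 ne] Legendre_minus_one[OF v(1) v2] by simp
 have "Legendre (int v) (int q) = Legendre (int v) (int q) * (Legendre (- 1) (int v) * Legendre (int q) (int v))" using 1 by simp
 also have "\<dots> = Legendre (- 1) (int v) * Legendre (- 1) (int v)" using 2 by (simp add: mult.left_commute)
 also have "\<dots> = 1" unfolding Legendre_minus_one[OF v(1) v2] by (simp flip: power_add)
 finally show ?thesis unfolding Legendre_def by (auto split: if_splits)
qed

lemma QuadRes_mult: "QuadRes q u ==> QuadRes q v ==> QuadRes q (u * v)"
proof -
 assume "QuadRes q u" "QuadRes q v"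
 then obtain y z where y: "q dvd y^2 - u" and z: "q dvd z^2 - v" unfolding QuadRes_iff_dvd by (elim exE)
 have "(y * z)^2 - u * v = y^2 * (z^2 - v) + v * (y^2 - u)" by (simp add: power_mult_distrib algebra_simps)
 then have "q dvd (y * z)^2 - u * v" using y z by (simp only: dvd_add dvd_mult)
 then show ?thesis unfolding QuadRes_iff_dvd by (rule exI)
qed

lemma QuadRes_one: "QuadRes q 1"
 using QuadRes_square[of q 1] by simp

lemma QuadRes_power: "QuadRes q u ==> QuadRes q (u ^ n)"
 by (induction n) (auto intro: QuadRes_mult QuadRes_one)

lemma QuadRes_prod: "finite A ==> (\<And>x. x \<in> A ==> QuadRes q (f x)) ==> QuadRes q (prod f A)"
 by (induction A rule: finite_induct) (auto intro: QuadRes_mult QuadRes_one)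

lemma QuadRes_of_prime_factors:
 assumes n: "n > 0" and h: "\<And>p. prime p ==> int p dvd n ==> even (multiplicity (int p) n) \<or> QuadRes q (int p)"
 shows "QuadRes q n"
proof -
 have "QuadRes q (p ^ multiplicity p n)" if p: "p \<in> prime_factors n" for p
 proof -
  have pp: "prime p" "p dvd n" using p by (auto simp: in_prime_factors_iff)
  have e: "int (nat p) = p" using prime_ge_0_int[OF pp(1)] by simp
  have "prime (nat p)" using pp(1) by (simp add: prime_nat_iff_prime prime_ge_0_int)
  then have "even (multiplicity p n) \<or> QuadRes q p" using h[of "nat p"] pp(2) unfolding e by blast
  then show ?thesis
  proof
   assume "even (multiplicity p n)"
   then obtain k where "multiplicity p n = 2 * k" by (rule evenE)
   then have "p ^ multiplicity p n = (p ^ k)^2" by (simp add: power_mult mult.commute[of 2])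
   then show ?thesis using QuadRes_square by simp
  qed (rule QuadRes_power)
 qed
 then have "QuadRes q (\<Prod>p\<in>prime_factors n. p ^ multiplicity p n)" by (intro QuadRes_prod) auto
 then show ?thesis using prod_prime_factors[of n] n by simp
qed

text \<open>The absolute value of n is a residue, all primes of odd exponent being residues, and -1
  is none.\<close>

lemma QuadRes_iff_pos:
 assumes q: "prime (q::int)" "2 < q" "~ QuadRes q (- 1)" and n: "n ~= 0" "~ q dvd n"
  and h: "\<And>p. prime p ==> int p dvd n ==> even (multiplicity (int p) n) \<or> QuadRes q (int p)"
 shows "QuadRes q n \<longleftrightarrow> n > 0"
proof (cases "n > 0")
 case True then show ?thesis using QuadRes_of_prime_factors[OF True h] by blast
next
 case False
 then have "0 < - n" using n by simp
 moreover have "even (multiplicity (int p) (- n)) \<or> QuadRes q (int p)" if "prime p" "int p dvd - n" for p using h[OF that(1)] that(2) by simp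
 ultimately have r: "QuadRes q (- n)" by (rule QuadRes_of_prime_factors)
 have "~ q dvd - 1" using q by auto
 then have "QuadRes q (- 1 * (- n)) \<longleftrightarrow> (QuadRes q (- 1) \<longleftrightarrow> QuadRes q (- n))" using n by (intro QuadRes_mult_iff[OF q(1,2)]) auto
 then show ?thesis using r q(3) False by simp
qed

definition twist_prime :: "int => int => nat => bool" where
 "twist_prime a b q \<longleftrightarrow> prime q & (\<forall>v. prime v & v dvd 2 * conductor a b --> splits_in_quadratic_field v (- int q))"

lemma twist_prime_mod_8: "twist_prime a b q ==> q mod 8 = 7"
 unfolding twist_prime_def by (elim conjE, rule splits_two, assumption) (erule allE[of _ 2], simp)

text \<open>A bad q would have to split in Q(sqrt(-q)), where it ramifies.\<close>

lemma twist_prime_not_dvd: "twist_prime a b q ==> ~ q dvd 2 * conductor a b"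
proof
 assume t: "twist_prime a b q" and d: "q dvd 2 * conductor a b"
 have q: "prime q" using t unfolding twist_prime_def by (rule conjunct1)
 have "splits_in_quadratic_field q (- int q)" using t q d unfolding twist_prime_def by simp
 from splits_odd(1)[OF q q this] show False by simp
qed

lemma twist_prime_facts:
 assumes "twist_prime a b q"
 shows "prime q" "prime (int q)" "2 < int q" "odd (int q)" "~ QuadRes (int q) (- 1)"
proof -
 show q: "prime q" using assms unfolding twist_prime_def by blast
 then show "prime (int q)" by simp
 have 8: "q mod 8 = 7" by (rule twist_prime_mod_8[OF assms])
 then have "2 < q" using mod_less_eq_dividend[of q 8] by simp
 then show "2 < int q" by simp
 show "odd (int q)" using 8 by presburger
 have "odd ((q - 1) div 2)" using 8 by presburger
 then have "Legendre (- 1) (int q) = - 1" using Legendre_minus_one[OF q \<open>2 < q\<close>] by simp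
 then show "~ QuadRes (int q) (- 1)" unfolding Legendre_def by (auto split: if_splits)
qed

lemma twist_prime_QuadRes:
 assumes t: "twist_prime a b q" and v: "prime v" "v dvd 2 * conductor a b"
 shows "QuadRes (int q) (int v)"
proof (cases "v = 2")
 case True
 have "Legendre 2 (int q) = 1" using Legendre_two[OF twist_prime_facts(1)[OF t] twist_prime_mod_8[OF t]] .
 then show ?thesis unfolding True Legendre_def by (auto split: if_splits)
next
 case False
 have s: "splits_in_quadratic_field v (- int q)" using t v unfolding twist_prime_def by blast
 show ?thesis by (rule QuadRes_reciprocal[OF twist_prime_facts(1)[OF t] twist_prime_mod_8[OF t] v(1) False splits_odd[OF twist_prime_facts(1)[OF t] v(1) s]])
qed

lemma twist_prime_sign:
 assumes t: "twist_prime a b q" and s: "s ~= 0" "\<And>p. prime p ==> int p dvd s ==> p dvd 2 * conductor a b"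
 shows "QuadRes (int q) s \<longleftrightarrow> s > 0"
proof (rule QuadRes_iff_pos[OF twist_prime_facts(2,3,5)[OF t] s(1)])
 show "~ int q dvd s" using s(2)[OF twist_prime_facts(1)[OF t]] twist_prime_not_dvd[OF t] by blast
 show "even (multiplicity (int p) s) \<or> QuadRes (int q) (int p)" if "prime p" "int p dvd s" for p
  using twist_prime_QuadRes[OF t that(1) s(2)[OF that]] by blast
qed

text \<open>After the power of q is removed, a prime of b' or of a'^2 - 4 b' is either bad, hence a
  residue modulo q, or good, hence of exponent divisible by 4. So these numbers are residues exactly
  when positive, and powers of q^4 do not change the sign.\<close>

lemma twist_prime_scaling:
 assumes t: "twist_prime a b q" and disc: "ell_disc a b ~= 0"
 shows "\<exists>k a' b'. a = int q ^ (2 * k) * a' & b = int q ^ (4 * k) * b' & ~ int q dvd b' & ~ int q dvd a'^2 - 4 * b' &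
  (QuadRes (int q) b' \<longleftrightarrow> b > 0) & (QuadRes (int q) (a'^2 - 4 * b') \<longleftrightarrow> a^2 - 4 * b > 0)"
proof -
 have q: "prime q" by (rule twist_prime_facts(1)[OF t])
 have q0: "0 < int q" using prime_gt_0_nat[OF q] by simp
 obtain k a' b' where k: "a = int q ^ (2 * k) * a'" "b = int q ^ (4 * k) * b'" "~ int q dvd b'" "~ int q dvd a'^2 - 4 * b'"
  using good_reduction_scaling[OF q not_dvd_conductor[OF q disc twist_prime_not_dvd[OF t]] disc] by blast
 have c: "a^2 - 4 * b = int q ^ (4 * k) * (a'^2 - 4 * b')" unfolding k by (simp add: power_mult_distrib right_diff_distrib flip: power_mult)
 have ev: "even (multiplicity (int p) x) \<or> QuadRes (int q) (int p)"
  if p: "prime p" "int p dvd x" and x: "~ int q dvd x" "Y = int q ^ (4 * k) * x" and Y: "Y = b \<or> Y = a^2 - 4 * b" for p x Y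
 proof (cases "p dvd 2 * conductor a b")
  case True then show ?thesis using twist_prime_QuadRes[OF t p(1)] by blast
 next
  case False
  obtain j a2 b2 where j: "a = int p ^ (2 * j) * a2" "b = int p ^ (4 * j) * b2" "~ int p dvd b2" "~ int p dvd a2^2 - 4 * b2"
   using good_reduction_scaling[OF p(1) not_dvd_conductor[OF p(1) disc False] disc] by blast
  have "a^2 - 4 * b = int p ^ (4 * j) * (a2^2 - 4 * b2)" unfolding j by (simp add: power_mult_distrib right_diff_distrib flip: power_mult)
  then obtain y where y: "Y = int p ^ (4 * j) * y" "~ int p dvd y" using Y j by blast
  have pp: "prime_elem (int p)" using p(1) by simp
  have x0: "x ~= 0" "y ~= 0" using x(1) y(2) by auto
  have p0: "int p ~= 0" "~ is_unit (int p)" using p(1) by auto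
  have "p ~= q" using p(2) x(1) by auto
  have "~ int p dvd int q ^ (4 * k)"
  proof
   assume "int p dvd int q ^ (4 * k)"
   then have "int p dvd int q" using p(1) prime_dvd_power[of "int p" "int q"] by simp
   then have "p dvd q" by simp
   then show False using primes_dvd_imp_eq[OF p(1) q] \<open>p ~= q\<close> by simp
  qed
  then have "multiplicity (int p) Y = multiplicity (int p) x"
   unfolding x(2) using prime_elem_multiplicity_mult_distrib[OF pp _ x0(1), of "int q ^ (4 * k)"] q0 by (simp add: not_dvd_imp_multiplicity_0)
  moreover have "multiplicity (int p) Y = 4 * j"
   unfolding y(1) using prime_elem_multiplicity_mult_distrib[OF pp _ x0(2), of "int p ^ (4 * j)"] p0 y(2) by (simp add: not_dvd_imp_multiplicity_0 multiplicity_same_power)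
  ultimately have "multiplicity (int p) x = 4 * j" by simp
  then show ?thesis by simp
 qed
 have nz: "b' ~= 0" "a'^2 - 4 * b' ~= 0" using k(3,4) by auto
 have "QuadRes (int q) b' \<longleftrightarrow> b' > 0"
  by (rule QuadRes_iff_pos[OF twist_prime_facts(2,3,5)[OF t] nz(1) k(3)]) (rule ev[OF _ _ k(3) k(2)], simp_all)
 moreover have "b' > 0 \<longleftrightarrow> b > 0" unfolding k(2) using q0 by (simp add: zero_less_mult_iff)
 moreover have "QuadRes (int q) (a'^2 - 4 * b') \<longleftrightarrow> a'^2 - 4 * b' > 0"
  by (rule QuadRes_iff_pos[OF twist_prime_facts(2,3,5)[OF t] nz(2) k(4)]) (rule ev[OF _ _ k(4) c], simp_all)
 moreover have "a'^2 - 4 * b' > 0 \<longleftrightarrow> a^2 - 4 * b > 0" unfolding c using q0 by (simp add: zero_less_mult_iff del: diff_gt_0_iff_gt)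
 ultimately show ?thesis using k by blast
qed

section \<open>Selmer elements of the twist as pairs of a class and a set of primes\<close>

locale twist_setting =
 fixes a b :: int and S :: "nat set"
 assumes disc: "ell_disc a b ~= 0" and fin: "finite S" and odd_card: "odd (card S)"
  and tp: "\<And>q. q \<in> S ==> twist_prime a b q"
begin

text \<open>The sign attached to each prime makes every \<open>tw Y\<close> a square at the bad
  places. Since \<open>card S\<close> is odd, \<open>tw S\<close> is the twisting factor -d.\<close>

definition tw :: "nat set => int" where "tw Y = (\<Prod>q\<in>Y. - int q)"

lemma S_prime: "q \<in> S ==> prime q" using tp twist_prime_facts(1) by blast

lemma finS: "Y \<subseteq> S ==> finite Y" using fin finite_subset by blast

lemma tw_empty [simp]: "tw {} = 1" by (simp add: tw_def)

lemma tw_insert: "Y \<subseteq> S ==> q \<notin> Y ==> tw (insert q Y) = - int q * tw Y"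
 unfolding tw_def using finS by simp

lemma tw_remove: "Y \<subseteq> S ==> q \<in> Y ==> tw Y = - int q * tw (Y - {q})"
 unfolding tw_def using finS by (simp add: prod.remove)

lemma tw_nonzero: "Y \<subseteq> S ==> tw Y ~= 0"
proof -
 assume Y: "Y \<subseteq> S"
 have "- int q ~= 0" if "q \<in> Y" for q using prime_gt_0_nat[OF S_prime] that Y by auto
 then show ?thesis unfolding tw_def prod_zero_iff[OF finS[OF Y]] by blast
qed

lemma tw_eq: "Y \<subseteq> S ==> tw Y = (- 1) ^ card Y * int (\<Prod>Y)"
proof -
 assume "Y \<subseteq> S"
 then have "finite Y" by (rule finS)
 then show ?thesis unfolding tw_def by (induction rule: finite_induct) auto
qed

lemma tw_S: "tw S = - int (\<Prod>S)"
 using tw_eq[of S] odd_card by simp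

lemma prime_dvd_tw: assumes Y: "Y \<subseteq> S" and p: "prime p" shows "int p dvd tw Y \<longleftrightarrow> p \<in> Y"
proof -
 have pi: "prime (int p)" using p by simp
 have "int p dvd tw Y \<longleftrightarrow> (\<exists>q\<in>Y. int p dvd - int q)" unfolding tw_def using prime_dvd_prod_iff[OF finS[OF Y] pi, of "%q. - int q"] .
 also have "\<dots> \<longleftrightarrow> (\<exists>q\<in>Y. p dvd q)" by simp
 also have "\<dots> \<longleftrightarrow> p \<in> Y"
 proof
  assume "\<exists>q\<in>Y. p dvd q"
  then obtain q where q: "q \<in> Y" "p dvd q" by (elim bexE)
  have "prime q" using S_prime Y q(1) by (simp add: subsetD)
  from primes_dvd_imp_eq[OF p this q(2)] show "p \<in> Y" using q(1) by simp
 next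
  assume "p \<in> Y"
  then show "\<exists>q\<in>Y. p dvd q" by (intro bexI[of _ p]) simp_all
 qed
 finally show ?thesis .
qed

lemma fplace: "prime p ==> Finite_place p \<in> places" by (simp add: places_def)

lemma minus_twist_prime_square:
 assumes v: "prime v" "v dvd 2 * conductor a b" and q: "q \<in> S"
 shows "is_square (completion (Finite_place v)) (of_int_ring (completion (Finite_place v)) (- int q))"
proof (rule of_int_square_in_completion[OF v(1)])
 fix M
 have qp: "prime q" by (rule S_prime[OF q])
 show "\<exists>y. int v ^ M dvd y\<^sup>2 - (- int q)"
 proof (cases "v = 2")
  case True
  have "q mod 8 = 7" by (rule twist_prime_mod_8[OF tp[OF q]])
  then have "(- int q) mod 8 = 1" by presburger
  from hensel_two[OF this, of M] show ?thesis unfolding True by auto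
 next
  case False
  have spl: "splits_in_quadratic_field v (- int q)" using tp[OF q] v unfolding twist_prime_def by simp
  note so = splits_odd[OF qp v(1) spl]
  have "prime (int v)" "odd (int v)" using v(1) False prime_odd_nat[OF v(1)] prime_gt_1_nat[OF v(1)] by auto
  moreover have "~ int v dvd - int q" using so(1) by simp
  ultimately show ?thesis using QuadRes_lift so(2) by blast
 qed
qed

lemma tw_square:
 assumes v: "prime v" "v dvd 2 * conductor a b" and Y: "Y \<subseteq> S"
 shows "is_square (completion (Finite_place v)) (of_int_ring (completion (Finite_place v)) (tw Y))"
proof -
 interpret K: field "completion (Finite_place v)" by (rule completion_field[OF fplace[OF v(1)]])
 show ?thesis using finS[OF Y] Y
 proof (induction rule: finite_induct)
  case empty
  show ?case using is_square_of_int_square[OF fplace[OF v(1)], of 1] by simp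
 next
  case (insert q Y)
  have e: "tw (insert q Y) = - int q * tw Y" using tw_insert insert by simp
  have "is_square (completion (Finite_place v)) (of_int_ring (completion (Finite_place v)) (tw Y))" using insert by simp
  then show ?case unfolding e K.of_int_ring_mult[of "- int q" "tw Y"]
   using minus_twist_prime_square[OF v, of q] insert.prems by (intro K.is_square_mult) auto
 qed
qed

text \<open>Removing p^(2 k) from a and p^(4 k) from b is a twist by the square p^(2 k).\<close>

lemma scaled_twist:
 assumes p: "prime p" and k: "a = int p ^ (2 * k) * a'" "b = int p ^ (4 * k) * b'" and al: "al ~= 0"
 shows "local_sol (Finite_place p) (a * D) (b * D^2) al \<longleftrightarrow> padic_sol (int p) (a' * D) (b' * D^2) al"
proof -
 let ?E = "int p ^ k * int p ^ k"
 have p0: "int p ~= 0" using p by auto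
 have e2: "int p ^ (2 * k) = ?E" by (simp add: mult_2 power_add)
 have "4 * k = k + k + (k + k)" by simp
 note k4 = this
 have e4: "int p ^ (4 * k) = ?E^2" unfolding k4 power2_eq_square power_add ..
 have 1: "a * D = (a' * D) * ?E" unfolding k(1) e2 by (simp add: mult_ac)
 have 2: "b * D^2 = (b' * D^2) * ?E^2" unfolding k(2) e4 by (simp add: mult_ac)
 have E0: "?E ~= 0" using p0 by simp
 show ?thesis unfolding 1 2 local_sol_twist_square[OF fplace[OF p] al E0 is_square_of_int_square[OF fplace[OF p]]]
  by (rule local_sol_iff_padic_sol[OF p al])
qed

lemma squarefree_prime_factor:
 assumes s: "squarefree (al::int)" and p: "prime p" "int p dvd al"
 obtains gam where "al = int p * gam" "~ int p dvd gam"
proof -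
 obtain gam where g: "al = int p * gam" using p(2) by (rule dvdE)
 have "~ int p dvd gam"
 proof
  assume "int p dvd gam"
  then have "(int p)^2 dvd al" unfolding g power2_eq_square by (intro mult_dvd_mono) auto
  then have "is_unit (int p)" by (rule squarefreeD[OF s])
  then show False using p(1) by (metis not_prime_unit prime_nat_int_transfer)
 qed
 then show ?thesis using that g by blast
qed

text \<open>A twist by a p-unit keeps good reduction, and there the local image consists of the
  unramified classes: \<open>padic_sol_unit\<close> and \<open>not_padic_sol_ramified\<close> give
  the two directions.\<close>

lemma unramified:
 assumes p: "prime p" "~ p dvd 2 * conductor a b" and D: "~ int p dvd D" and al: "squarefree al"
 shows "local_sol (Finite_place p) (a * D) (b * D^2) al \<longleftrightarrow> ~ int p dvd al"
proof -
 note nd = not_dvd_conductor[OF p(1) disc p(2)]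
 obtain k a' b' where k: "a = int p ^ (2 * k) * a'" "b = int p ^ (4 * k) * b'" "~ int p dvd b'" "~ int p dvd a'^2 - 4 * b'"
  using good_reduction_scaling[OF p(1) nd disc] by blast
 have pi: "prime (int p)" "odd (int p)" using p(1) nd(1) by auto
 have "(a' * D)^2 - 4 * (b' * D^2) = (a'^2 - 4 * b') * (D * D)" by (simp add: power2_eq_square algebra_simps)
 then have c: "~ int p dvd (a' * D)^2 - 4 * (b' * D^2)" using k(4) D prime_dvd_mult_iff[OF pi(1)] by simp
 have b: "~ int p dvd b' * D^2" using k(3) D prime_dvd_mult_iff[OF pi(1)] by (simp add: power2_eq_square)
 show ?thesis unfolding scaled_twist[OF p(1) k(1,2) squarefree_nonzero[OF al]]
 proof
  assume s: "padic_sol (int p) (a' * D) (b' * D^2) al"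
  show "~ int p dvd al"
  proof
   assume "int p dvd al"
   then obtain gam where "al = int p * gam" "~ int p dvd gam" by (rule squarefree_prime_factor[OF al p(1)])
   then show False using not_padic_sol_ramified[OF pi(1) c] s by blast
  qed
 next
  assume "~ int p dvd al"
  then show "padic_sol (int p) (a' * D) (b' * D^2) al" by (rule padic_sol_unit[OF pi b c])
 qed
qed

definition SF :: "int set" where "SF = {s. squarefree s & (\<forall>q\<in>S. ~ int q dvd s)}"

text \<open>The real condition is left open, because E and its twist impose different ones; the
  finite conditions outside \<open>S\<close> are common to both.\<close>

definition Rset :: "int set" where
 "Rset = {s \<in> SF. \<forall>p. prime p & p \<notin> S --> local_sol (Finite_place p) a b s}"

lemma SF_tw:
 assumes s: "s \<in> SF" and Y: "Y \<subseteq> S"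
 shows "squarefree (s * tw Y)" "\<And>q. q \<in> S ==> int q dvd s * tw Y \<longleftrightarrow> q \<in> Y"
proof -
 have dv: "int q dvd s * tw Z \<longleftrightarrow> q \<in> Z" if "q \<in> S" "Z \<subseteq> S" for q Z
 proof -
  have "prime (int q)" "~ int q dvd s" using S_prime[OF that(1)] s that(1) unfolding SF_def by auto
  then show ?thesis using prime_dvd_tw[OF that(2) S_prime[OF that(1)]] prime_dvd_mult_iff by blast
 qed
 then show "\<And>q. q \<in> S ==> int q dvd s * tw Y \<longleftrightarrow> q \<in> Y" using Y by blast
 show "squarefree (s * tw Y)" using finS[OF Y] Y
 proof (induction rule: finite_induct)
  case empty then show ?case using s unfolding SF_def by simp
 next
  case (insert q Z)
  have Z: "Z \<subseteq> S" "q \<in> S" using insert by auto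
  have q: "prime (int q)" using S_prime[OF Z(2)] by simp
  have "~ int q dvd s * tw Z" using dv[OF Z(2,1)] insert.hyps by simp
  with q have "coprime (int q) (s * tw Z)" by (rule prime_imp_coprime)
  then have cop: "coprime (- int q) (s * tw Z)" unfolding coprime_minus_left_iff .
  have "squarefree (int q)" using q by (rule squarefree_prime)
  then have "squarefree (- int q)" by (simp add: squarefree_def)
  then have "squarefree (- int q * (s * tw Z))" by (rule squarefree_mult_coprime[OF cop _ insert.IH[OF Z(1)]])
  moreover have "s * tw (insert q Z) = - int q * (s * tw Z)" using tw_insert[OF Z(1) insert.hyps(2)] by simp
  ultimately show ?case by simp
 qed
qed

lemma SF_nonzero: "s \<in> SF ==> s ~= 0" unfolding SF_def using squarefree_nonzero by blast

lemma SF_decompose: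
 assumes al: "squarefree al"
 shows "\<exists>s\<in>SF. al = s * tw {q \<in> S. int q dvd al}"
proof -
 define Y where "Y = {q \<in> S. int q dvd al}"
 have Y: "Y \<subseteq> S" "\<And>q. q \<in> Y \<longleftrightarrow> q \<in> S & int q dvd al" unfolding Y_def by auto
 have "~ int q dvd 1" if "q \<in> S" for q using S_prime[OF that] by auto
 then have "1 \<in> SF" unfolding SF_def by auto
 from SF_tw(1)[OF this Y(1)] have sf: "squarefree (tw Y)" by simp
 have "tw Y dvd al" by (rule squarefree_dvdI[OF sf]) (simp only: prime_dvd_tw[OF Y(1)] Y(2))
 then obtain s where s: "al = tw Y * s" by (rule dvdE)
 have "squarefree s" using al squarefree_mono[of s al] s by simp
 moreover have "~ int q dvd s" if q: "q \<in> S" for q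
 proof
  assume d: "int q dvd s"
  then have "int q dvd al" unfolding s by (rule dvd_mult)
  then have "q \<in> Y" using q Y(2) by blast
  then have "int q dvd tw Y" using prime_dvd_tw[OF Y(1) S_prime[OF q]] by blast
  then have "(int q)^2 dvd al" unfolding s power2_eq_square using d by (rule mult_dvd_mono)
  then have "is_unit (int q)" by (rule squarefreeD[OF al])
  then show False using S_prime[OF q] by (metis not_prime_unit prime_nat_int_transfer)
 qed
 ultimately have "s \<in> SF" unfolding SF_def by blast
 moreover have "al = s * tw Y" unfolding s by (rule mult.commute)
 ultimately show ?thesis unfolding Y_def by (rule bexI[rotated])
qed

text \<open>At a bad prime \<open>tw Y\<close> and \<open>tw Z\<close> are squares. At a good prime
  outside \<open>S\<close> only divisibility of the class by p counts, and the factors are prime to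
  p. Keeping Y and Z independent serves the twist, with Z = S, as well as E itself, with Z
  empty.\<close>

lemma off_S:
 assumes s: "s \<in> SF" and Y: "Y \<subseteq> S" "Z \<subseteq> S" and p: "prime p" "p \<notin> S"
 shows "local_sol (Finite_place p) (a * tw Z) (b * (tw Z)^2) (s * tw Y) \<longleftrightarrow> local_sol (Finite_place p) a b s"
proof (cases "p dvd 2 * conductor a b")
 case True
 note v = fplace[OF p(1)]
 have nz: "s * tw Y ~= 0" using SF_nonzero[OF s] tw_nonzero[OF Y(1)] by simp
 have "local_sol (Finite_place p) (a * tw Z) (b * (tw Z)^2) (s * tw Y) \<longleftrightarrow> local_sol (Finite_place p) a b (s * tw Y)"
  by (rule local_sol_twist_square[OF v nz tw_nonzero[OF Y(2)] tw_square[OF p(1) True Y(2)]])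
 also have "\<dots> \<longleftrightarrow> local_sol (Finite_place p) a b s"
  by (rule local_sol_cong[OF v disc SF_nonzero[OF s] tw_square[OF p(1) True Y(1)] tw_nonzero[OF Y(1)]])
 finally show ?thesis .
next
 case False
 have ntw: "~ int p dvd tw Y" "~ int p dvd tw Z" using prime_dvd_tw Y p by auto
 have "local_sol (Finite_place p) (a * tw Z) (b * (tw Z)^2) (s * tw Y) \<longleftrightarrow> ~ int p dvd s * tw Y"
  by (rule unramified[OF p(1) False ntw(2) SF_tw(1)[OF s Y(1)]])
 also have "\<dots> \<longleftrightarrow> ~ int p dvd s" using ntw(1) prime_dvd_mult_iff[of "int p" s "tw Y"] p(1) by simp
 also have "\<dots> \<longleftrightarrow> local_sol (Finite_place p) (a * 1) (b * 1^2) s"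
 proof (rule sym, rule unramified[OF p(1) False])
  show "~ int p dvd 1" using p(1) by auto
  show "squarefree s" using s unfolding SF_def by blast
 qed
 finally show ?thesis by simp
qed

lemma Rset_primes: assumes s: "s \<in> Rset" and p: "prime p" "int p dvd s" shows "p dvd 2 * conductor a b"
proof (rule ccontr)
 assume n: "~ ?thesis"
 have sf: "squarefree s" and "p \<notin> S" using s p unfolding Rset_def SF_def by auto
 then have "local_sol (Finite_place p) (a * 1) (b * 1^2) s" using s p unfolding Rset_def by simp
 moreover have "~ int p dvd 1" using p(1) by auto
 ultimately show False using unramified[OF p(1) n _ sf] p(2) by blast
qed

text \<open>All primes of s are bad by \<open>Rset_primes\<close>, hence residues modulo q, and -1
  is a nonresidue.\<close>

lemma Rset_sign: "s \<in> Rset ==> q \<in> S ==> QuadRes (int q) s \<longleftrightarrow> s > 0"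
proof -
 assume s: "s \<in> Rset" and q: "q \<in> S"
 have "s ~= 0" using s SF_nonzero unfolding Rset_def by simp
 then show ?thesis by (rule twist_prime_sign[OF tp[OF q] _ Rset_primes[OF s]])
qed

text \<open>At primes of \<open>S\<close> the curve E has good reduction, so its condition there is
  indivisibility of s, which is already built into \<open>SF\<close>.\<close>

lemma selmer_ints_eq: "selmer_ints a b = {s \<in> Rset. local_sol Infinite_place a b s}"
proof (intro equalityI subsetI)
 have un: "local_sol (Finite_place q) a b s \<longleftrightarrow> ~ int q dvd s" if "q \<in> S" "squarefree s" for q s
 proof -
  have "~ int q dvd 1" using S_prime[OF that(1)] by auto
  from unramified[OF S_prime[OF that(1)] twist_prime_not_dvd[OF tp[OF that(1)]] this that(2)] show ?thesis by simp
 qed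
 fix s
 {
  assume "s \<in> selmer_ints a b"
  then have s: "squarefree s" "\<And>v. v \<in> places ==> local_sol v a b s" unfolding selmer_ints_def by auto
  then have "s \<in> SF" unfolding SF_def using un fplace[OF S_prime] by blast
  then show "s \<in> {s \<in> Rset. local_sol Infinite_place a b s}" unfolding Rset_def using s(2) fplace infinite_place by blast
 next
  assume s: "s \<in> {s \<in> Rset. local_sol Infinite_place a b s}"
  then have sf: "squarefree s" "\<And>q. q \<in> S ==> ~ int q dvd s" unfolding Rset_def SF_def by auto
  have "local_sol v a b s" if "v \<in> places" for v
  proof (cases v)
   case Infinite_place then show ?thesis using s by simp
  next
   case (Finite_place p)
   then have p: "prime p" using that by (auto simp: places_def)
   show ?thesis unfolding Finite_place using s un[OF _ sf(1)] sf(2) p unfolding Rset_def by blast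
  qed
  then show "s \<in> selmer_ints a b" unfolding selmer_ints_def using sf(1) by blast
 }
qed

definition twist_ok :: "nat => int => nat set => bool" where
 "twist_ok q s Y \<longleftrightarrow> local_sol (Finite_place q) (a * tw S) (b * (tw S)^2) (s * tw Y)"

text \<open>Y collects the primes of \<open>S\<close> that divide the class. By \<open>off_S\<close>
  the finite conditions outside \<open>S\<close> say that s is in \<open>Rset\<close>, so only the
  real condition and those at \<open>S\<close> remain.\<close>

lemma twist_selmer_ints_eq:
 "selmer_ints (a * tw S) (b * (tw S)^2) = (%(s, Y). s * tw Y) ` {(s, Y). s \<in> Rset & Y \<subseteq> S &
   local_sol Infinite_place (a * tw S) (b * (tw S)^2) (s * tw Y) & (\<forall>q\<in>S. twist_ok q s Y)}"
proof (intro equalityI subsetI)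
 fix al assume "al \<in> selmer_ints (a * tw S) (b * (tw S)^2)"
 then have al: "squarefree al" "\<And>v. v \<in> places ==> local_sol v (a * tw S) (b * (tw S)^2) al" unfolding selmer_ints_def by auto
 define Y where "Y = {q \<in> S. int q dvd al}"
 obtain s where s: "s \<in> SF" "al = s * tw Y" using SF_decompose[OF al(1)] unfolding Y_def by (elim bexE)
 have "Y \<subseteq> S" unfolding Y_def by blast
 note Y = this s(2)
 have "local_sol (Finite_place p) a b s" if "prime p" "p \<notin> S" for p
  using off_S[OF s(1) Y(1) subset_refl that] al(2)[OF fplace[OF that(1)]] unfolding Y(2) by blast
 then have "s \<in> Rset" unfolding Rset_def using s(1) by blast
 moreover have "\<forall>q\<in>S. twist_ok q s Y" unfolding twist_ok_def Y(2)[symmetric] using al(2) fplace[OF S_prime] by blast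
 moreover have "local_sol Infinite_place (a * tw S) (b * (tw S)^2) (s * tw Y)" unfolding Y(2)[symmetric] by (rule al(2)[OF infinite_place])
 ultimately show "al \<in> (%(s, Y). s * tw Y) ` {(s, Y). s \<in> Rset & Y \<subseteq> S &
   local_sol Infinite_place (a * tw S) (b * (tw S)^2) (s * tw Y) & (\<forall>q\<in>S. twist_ok q s Y)}" using Y(1) unfolding Y(2) by (intro image_eqI[of _ _ "(s, Y)"]) (simp_all only: mem_Collect_eq prod.case simp_thms)
next
 fix al assume "al \<in> (%(s, Y). s * tw Y) ` {(s, Y). s \<in> Rset & Y \<subseteq> S &
   local_sol Infinite_place (a * tw S) (b * (tw S)^2) (s * tw Y) & (\<forall>q\<in>S. twist_ok q s Y)}"
 then obtain z where z: "z \<in> {(s, Y). s \<in> Rset & Y \<subseteq> S &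
   local_sol Infinite_place (a * tw S) (b * (tw S)^2) (s * tw Y) & (\<forall>q\<in>S. twist_ok q s Y)}" "al = (%(s, Y). s * tw Y) z" by (elim imageE)
 obtain s Y where sY: "z = (s, Y)" by (cases z)
 note zz = z[unfolded sY mem_Collect_eq prod.case]
 note z2 = zz(1)[THEN conjunct2] note z3 = z2[THEN conjunct2]
 note h = zz(2) zz(1)[THEN conjunct1] z2[THEN conjunct1] z3[THEN conjunct1] z3[THEN conjunct2]
 have s: "s \<in> SF" using h(2) unfolding Rset_def by blast
 have "local_sol v (a * tw S) (b * (tw S)^2) al" if "v \<in> places" for v
 proof (cases v)
  case Infinite_place then show ?thesis using h(1,4) by simp
 next
  case (Finite_place p)
  then have p: "prime p" using that by (auto simp: places_def)
  show ?thesis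
  proof (cases "p \<in> S")
   case True then show ?thesis using h(1,5) unfolding Finite_place twist_ok_def by blast
  next
   case False
   then show ?thesis using off_S[OF s h(3) subset_refl p False] h(2) p unfolding Finite_place h(1) Rset_def by blast
  qed
 qed
 then show "al \<in> selmer_ints (a * tw S) (b * (tw S)^2)" unfolding selmer_ints_def using SF_tw(1)[OF s h(3)] h(1) by blast
qed

lemma tw_inj: "inj_on (%(s, Y). s * tw Y) {(s, Y). s \<in> SF & Y \<subseteq> S}"
proof (rule inj_onI, clarify)
 fix s Y s' Y' assume h: "s \<in> SF" "Y \<subseteq> S" "s' \<in> SF" "Y' \<subseteq> S" "s * tw Y = s' * tw Y'"
 have "q \<in> Y \<longleftrightarrow> q \<in> Y'" for q
 proof (cases "q \<in> S")
  case True
  show ?thesis using SF_tw(2)[OF h(1,2) True] SF_tw(2)[OF h(3,4) True] unfolding h(5) by blast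
 qed (use h(2,4) in blast)
 then have "Y = Y'" by blast
 then show "s = s' & Y = Y'" using h(5) tw_nonzero[OF h(4)] by simp
qed

text \<open>(a', b') is the model scaled to good reduction at q. Outside Y the class is a unit at q
  and must come from infinity or the origin; inside Y it must come from another 2-torsion point. The
  clause on a' = a and b' = b is kept because the given local roots belong to the unscaled
  model.\<close>

lemma twist_ok_iff:
 assumes q: "q \<in> S" and s: "s \<in> SF" and Y: "Y \<subseteq> S"
 shows "\<exists>a' b'. ~ int q dvd b' & ~ int q dvd a'^2 - 4 * b' & (QuadRes (int q) b' \<longleftrightarrow> b > 0) &
  (QuadRes (int q) (a'^2 - 4 * b') \<longleftrightarrow> a^2 - 4 * b > 0) & (~ (int q dvd a & int q dvd b) --> a' = a & b' = b) &
  (q \<notin> Y --> (twist_ok q s Y \<longleftrightarrow> QuadRes (int q) (s * tw Y) \<or> QuadRes (int q) (s * tw Y * (a'^2 - 4 * b')))) &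
  (q \<in> Y --> (twist_ok q s Y \<longleftrightarrow> (\<exists>w. int q dvd (w - a')^2 - 4 * b' & QuadRes (int q) (s * tw (Y - {q}) * tw (S - {q}) * w))))"
proof -
 note f = twist_prime_facts[OF tp[OF q]]
 obtain k a' b' where k: "a = int q ^ (2 * k) * a'" "b = int q ^ (4 * k) * b'" "~ int q dvd b'" "~ int q dvd a'^2 - 4 * b'"
  and sg: "QuadRes (int q) b' \<longleftrightarrow> b > 0" "QuadRes (int q) (a'^2 - 4 * b') \<longleftrightarrow> a^2 - 4 * b > 0"
  using twist_prime_scaling[OF tp[OF q] disc] by blast
 have k0: "a' = a & b' = b" if "~ (int q dvd a & int q dvd b)"
 proof (cases k)
  case 0 then show ?thesis using k by simp
 next
  case (Suc j) then show ?thesis using that k(1,2) by simp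
 qed
 define D1 where "D1 = - tw (S - {q})"
 have sub: "S - {q} \<subseteq> S" "Y - {q} \<subseteq> S" using Y by auto
 have D: "tw S = int q * D1" unfolding D1_def using tw_remove[OF subset_refl q] by simp
 have nD1: "~ int q dvd D1" unfolding D1_def using prime_dvd_tw[OF sub(1) f(1)] by simp
 have D10: "tw (S - {q}) ~= 0" by (rule tw_nonzero[OF sub(1)])
 have nz: "s * tw Y ~= 0" using SF_nonzero[OF s] tw_nonzero[OF Y] by simp
 have ok: "twist_ok q s Y \<longleftrightarrow> padic_sol (int q) (a' * tw S) (b' * (tw S)^2) (s * tw Y)"
  unfolding twist_ok_def by (rule scaled_twist[OF f(1) k(1,2) nz])
 have out: "twist_ok q s Y \<longleftrightarrow> QuadRes (int q) (s * tw Y) \<or> QuadRes (int q) (s * tw Y * (a'^2 - 4 * b'))" if nq: "q \<notin> Y"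
 proof -
  have u: "~ int q dvd s * tw Y" using SF_tw(2)[OF s Y q] nq by blast
  have uc: "~ int q dvd s * tw Y * (a'^2 - 4 * b')" using u k(4) prime_dvd_mult_iff[OF f(2)] by blast
  have c: "(a' * tw S)^2 - 4 * (b' * (tw S)^2) = (a'^2 - 4 * b') * (tw S)^2" by (simp add: power_mult_distrib algebra_simps)
  show ?thesis unfolding ok using padic_sol_twist_unit[OF f(2) D nD1 u] padic_sol_square[OF f(2,4) u] padic_sol_origin[OF f(2,4) uc _ c] by blast
 qed
 have inn: "twist_ok q s Y \<longleftrightarrow> (\<exists>w. int q dvd (w - a')^2 - 4 * b' & QuadRes (int q) (s * tw (Y - {q}) * tw (S - {q}) * w))" if qY: "q \<in> Y"
 proof -
  let ?g = "s * tw (Y - {q}) * tw (S - {q})"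
  \<comment> \<open>The class is multiplied by the square of \<open>tw (S - {q})\<close>, which
    brings it to the form D gam with D = \<open>tw S\<close> that
    \<open>padic_sol_twist_ramified\<close> treats.\<close>
  have e1: "(s * tw Y) * (tw (S - {q}) * tw (S - {q})) = tw S * ?g" unfolding tw_remove[OF Y qY] tw_remove[OF subset_refl q] by (simp add: mult_ac)
  have e2: "local_sol (Finite_place q) (a * tw S) (b * (tw S)^2) ((s * tw Y) * (tw (S - {q}) * tw (S - {q}))) \<longleftrightarrow> twist_ok q s Y"
   unfolding twist_ok_def
  proof (rule local_sol_cong[OF fplace[OF f(1)] _ nz is_square_of_int_square[OF fplace[OF f(1)]]])
   have "ell_disc (a * tw S) (b * (tw S)^2) = ell_disc a b * (tw S) ^ 6" unfolding ell_disc_def by (simp add: power2_eq_square eval_nat_numeral algebra_simps)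
   then show "ell_disc (a * tw S) (b * (tw S)^2) ~= 0" using disc tw_nonzero[OF subset_refl] by simp
  qed (use D10 in simp)
  have e3: "tw S * ?g ~= 0" using tw_nonzero[OF subset_refl] tw_nonzero[OF sub(1)] tw_nonzero[OF sub(2)] SF_nonzero[OF s] by simp
  have ok2: "twist_ok q s Y \<longleftrightarrow> padic_sol (int q) (a' * tw S) (b' * (tw S)^2) (tw S * ?g)"
   using e2[unfolded e1] scaled_twist[OF f(1) k(1,2) e3, of "tw S"] by blast
  have "~ int q dvd s * tw (Y - {q})" using SF_tw(2)[OF s sub(2) q] by simp
  moreover have "~ int q dvd tw (S - {q})" using prime_dvd_tw[OF sub(1) f(1)] by simp
  ultimately have g: "~ int q dvd ?g" using prime_dvd_mult_iff[OF f(2)] by blast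
  have w0: "~ int q dvd w" if "int q dvd (w - a')^2 - 4 * b'" for w
  proof
   assume "int q dvd w"
   then have "int q dvd w * (w - 2 * a')" by simp
   from dvd_diff[OF that this] have "int q dvd a'^2 - 4 * b'" by (simp add: power2_eq_square algebra_simps)
   then show False using k(4) by blast
  qed
  show ?thesis unfolding ok2 using padic_sol_twist_ramified[OF f(2) D nD1 g] padic_sol_twist_ramifiedI[OF f(2,4) k(3) g _ w0] by blast
 qed
 show ?thesis by (rule exI[of _ a'], rule exI[of _ b'], intro conjI impI k(3,4) sg k0[THEN conjunct1] k0[THEN conjunct2] out inn)
qed

text \<open>Here b' is a nonresidue, so (w - a')^2 = 4 b' has no root and q cannot lie in Y. As a'^2
  - 4 b' is a residue, the origin adds no class to the squares.\<close>

lemma twist_ok_b_neg: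
 assumes b: "b < 0" and q: "q \<in> S" and s: "s \<in> SF" and Y: "Y \<subseteq> S"
 shows "twist_ok q s Y \<longleftrightarrow> q \<notin> Y & QuadRes (int q) (s * tw Y)"
proof -
 note f = twist_prime_facts[OF tp[OF q]]
 have "a^2 - 4 * b > 0" using b zero_le_power2[of a] by linarith
 note cp = this
 obtain a' b' where h1: "~ int q dvd b'" and h2: "~ int q dvd a'^2 - 4 * b'" and h3: "QuadRes (int q) b' \<longleftrightarrow> b > 0"
  and h4: "QuadRes (int q) (a'^2 - 4 * b') \<longleftrightarrow> a^2 - 4 * b > 0" and h5: "~ (int q dvd a & int q dvd b) --> a' = a & b' = b"
  and h6: "q \<notin> Y --> (twist_ok q s Y \<longleftrightarrow> QuadRes (int q) (s * tw Y) \<or> QuadRes (int q) (s * tw Y * (a'^2 - 4 * b')))"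
  and h7: "q \<in> Y --> (twist_ok q s Y \<longleftrightarrow> (\<exists>w. int q dvd (w - a')^2 - 4 * b' & QuadRes (int q) (s * tw (Y - {q}) * tw (S - {q}) * w)))"
  using twist_ok_iff[OF q s Y] by (elim exE conjE) (rule that)
 have h: "~ int q dvd a'^2 - 4 * b'" "~ QuadRes (int q) b'" "QuadRes (int q) (a'^2 - 4 * b')" using h2 h3 h4 b cp by simp_all
 note h6' = h6[rule_format] note h7' = h7[rule_format]
 show ?thesis
 proof (cases "q \<in> Y")
  case True
  have "~ twist_ok q s Y"
  proof
   assume "twist_ok q s Y"
   then obtain w where "int q dvd (w - a')^2 - 4 * b'" unfolding h7'[OF True] by blast
   then have "int q dvd (w - a')^2 - b' * 2^2" by (simp add: mult.commute)
   then have "QuadRes (int q) b'" by (rule QuadRes_divide_square[OF f(2)]) (rule odd_prime_not_dvd_four(1)[OF f(2,4)])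
   then show False using h(2) by blast
  qed
  then show ?thesis using True by blast
 next
  case False
  have u: "~ int q dvd s * tw Y" using SF_tw(2)[OF s Y q] False by blast
  show ?thesis unfolding h6'[OF False] using QuadRes_mult_iff[OF f(2,3) u h(1)] h(3) False by blast
 qed
qed

text \<open>Here a'^2 - 4 b' is a nonresidue. Outside Y one of the two alternatives therefore always
  holds. Inside Y the two roots w have this nonresidue as product, so one of them has the required
  character.\<close>

lemma twist_ok_disc_neg:
 assumes b: "b > 0" "a^2 - 4 * b < 0" and q: "q \<in> S" and s: "s \<in> SF" and Y: "Y \<subseteq> S"
 shows "twist_ok q s Y"
proof -
 note f = twist_prime_facts[OF tp[OF q]]
 have nc: "~ a^2 - 4 * b > 0" using b(2) by linarith
 obtain a' b' where h1: "~ int q dvd b'" and h2: "~ int q dvd a'^2 - 4 * b'" and h3: "QuadRes (int q) b' \<longleftrightarrow> b > 0"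
  and h4: "QuadRes (int q) (a'^2 - 4 * b') \<longleftrightarrow> a^2 - 4 * b > 0" and h5: "~ (int q dvd a & int q dvd b) --> a' = a & b' = b"
  and h6: "q \<notin> Y --> (twist_ok q s Y \<longleftrightarrow> QuadRes (int q) (s * tw Y) \<or> QuadRes (int q) (s * tw Y * (a'^2 - 4 * b')))"
  and h7: "q \<in> Y --> (twist_ok q s Y \<longleftrightarrow> (\<exists>w. int q dvd (w - a')^2 - 4 * b' & QuadRes (int q) (s * tw (Y - {q}) * tw (S - {q}) * w)))"
  using twist_ok_iff[OF q s Y] by (elim exE conjE) (rule that)
 have h: "~ int q dvd b'" "~ int q dvd a'^2 - 4 * b'" "QuadRes (int q) b'" "~ QuadRes (int q) (a'^2 - 4 * b')" using h1 h2 h3 h4 b nc by simp_all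
 note h6' = h6[rule_format] note h7' = h7[rule_format]
 show ?thesis
 proof (cases "q \<in> Y")
  case False
  have u: "~ int q dvd s * tw Y" using SF_tw(2)[OF s Y q] False by blast
  show ?thesis unfolding h6'[OF False] using QuadRes_mult_iff[OF f(2,3) u h(2)] h(4) by blast
 next
  case True
  let ?g = "s * tw (Y - {q}) * tw (S - {q})"
  have sub: "S - {q} \<subseteq> S" "Y - {q} \<subseteq> S" using Y by auto
  have "~ int q dvd s * tw (Y - {q})" using SF_tw(2)[OF s sub(2) q] by simp
  moreover have "~ int q dvd tw (S - {q})" using prime_dvd_tw[OF sub(1) f(1)] by simp
  ultimately have g: "~ int q dvd ?g" using prime_dvd_mult_iff[OF f(2)] by blast
  obtain y where y: "int q dvd y^2 - b'" using h(3) unfolding QuadRes_iff_dvd by (elim exE)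
  let ?u = "a' + 2 * y" let ?v = "a' - 2 * y"
  have uv': "(?u - a')^2 - 4 * b' = 4 * (y^2 - b')" "(?v - a')^2 - 4 * b' = 4 * (y^2 - b')" by (simp_all add: power2_eq_square)
  have r: "int q dvd (?u - a')^2 - 4 * b'" "int q dvd (?v - a')^2 - 4 * b'" unfolding uv' by (rule dvd_mult[OF y])+
  have e: "?u * ?v - (a'\<^sup>2 - 4 * b') = - 4 * (y\<^sup>2 - b')" by (simp add: power2_eq_square algebra_simps)
  have uv: "int q dvd ?u * ?v - (a'^2 - 4 * b')" unfolding e by (rule dvd_mult[OF y])
  then have nuv: "~ int q dvd ?u * ?v" using dvd_shift[OF uv] h(2) by blast
  have nu: "~ int q dvd ?u" "~ int q dvd ?v" using nuv unfolding prime_dvd_mult_iff[OF f(2)] by blast+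
  have "~ QuadRes (int q) (?u * ?v)" using QuadRes_cong[OF uv] h(4) by blast
  then have "QuadRes (int q) ?u ~= QuadRes (int q) ?v" using QuadRes_mult_iff[OF f(2,3) nu] by blast
  then have "QuadRes (int q) (?g * ?u) \<or> QuadRes (int q) (?g * ?v)" using QuadRes_mult_iff[OF f(2,3) g nu(1)] QuadRes_mult_iff[OF f(2,3) g nu(2)] by blast
  then show ?thesis unfolding h7'[OF True] using r by blast
 qed
qed

text \<open>Both roots have the same character, as their product a^2 - 4 b is a residue, so the
  condition can be tested at the given root. That \<open>B\<close> is a unit prevents q from
  dividing both a and b, so the unscaled model may be used.\<close>

lemma twist_ok_root:
 assumes b: "b > 0" "a^2 - 4 * b > 0" and q: "q \<in> S" and s: "s \<in> SF" and Y: "Y \<subseteq> S"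
  and B: "~ int q dvd B" "int q dvd (B - a)^2 - 4 * b"
 shows "twist_ok q s Y \<longleftrightarrow> (if q \<in> Y then QuadRes (int q) (s * tw (Y - {q}) * tw (S - {q}) * B) else QuadRes (int q) (s * tw Y))"
proof -
 note f = twist_prime_facts[OF tp[OF q]]
 have nd: "~ (int q dvd a & int q dvd b)"
 proof
  assume ab: "int q dvd a & int q dvd b"
  have "B^2 = ((B - a)^2 - 4 * b) + a * (2 * B - a) + 4 * b" by (simp add: power2_eq_square algebra_simps)
  moreover have "int q dvd ((B - a)^2 - 4 * b) + a * (2 * B - a) + 4 * b" using B(2) ab by (intro dvd_add) auto
  ultimately have "int q dvd B^2" by simp
  then show False using B(1) prime_dvd_power[OF f(2)] by blast
 qed
 obtain a' b' where h1: "~ int q dvd b'" and h2: "~ int q dvd a'^2 - 4 * b'" and h3: "QuadRes (int q) b' \<longleftrightarrow> b > 0"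
  and h4: "QuadRes (int q) (a'^2 - 4 * b') \<longleftrightarrow> a^2 - 4 * b > 0" and h5: "~ (int q dvd a & int q dvd b) --> a' = a & b' = b"
  and h6: "q \<notin> Y --> (twist_ok q s Y \<longleftrightarrow> QuadRes (int q) (s * tw Y) \<or> QuadRes (int q) (s * tw Y * (a'^2 - 4 * b')))"
  and h7: "q \<in> Y --> (twist_ok q s Y \<longleftrightarrow> (\<exists>w. int q dvd (w - a')^2 - 4 * b' & QuadRes (int q) (s * tw (Y - {q}) * tw (S - {q}) * w)))"
  using twist_ok_iff[OF q s Y] by (elim exE conjE) (rule that)
 have e: "a' = a" "b' = b" using h5 nd by blast+
 have h: "~ int q dvd a^2 - 4 * b" "QuadRes (int q) (a^2 - 4 * b)" using h2 h4 b unfolding e by simp_all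
 note h6' = h6[rule_format, unfolded e] note h7' = h7[rule_format, unfolded e]
 show ?thesis
 proof (cases "q \<in> Y")
  case False
  have u: "~ int q dvd s * tw Y" using SF_tw(2)[OF s Y q] False by blast
  show ?thesis unfolding h6'[OF False] using QuadRes_mult_iff[OF f(2,3) u h(1)] h(2) False by auto
 next
  case True
  let ?g = "s * tw (Y - {q}) * tw (S - {q})"
  have sub: "S - {q} \<subseteq> S" "Y - {q} \<subseteq> S" using Y by auto
  have "~ int q dvd s * tw (Y - {q})" using SF_tw(2)[OF s sub(2) q] by simp
  moreover have "~ int q dvd tw (S - {q})" using prime_dvd_tw[OF sub(1) f(1)] by simp
  ultimately have g: "~ int q dvd ?g" using prime_dvd_mult_iff[OF f(2)] by blast
  have "QuadRes (int q) (?g * B)" if w: "int q dvd (w - a)^2 - 4 * b" "QuadRes (int q) (?g * w)" for w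
  proof -
   from dvd_diff[OF w(1) B(2)] have "int q dvd (w - B) * (w + B - 2 * a)" by (simp add: power2_eq_square algebra_simps)
   then consider "int q dvd w - B" | "int q dvd w + B - 2 * a" using prime_dvd_mult_iff[OF f(2)] by blast
   then show ?thesis
   proof cases
    case 1
    then have "int q dvd ?g * w - ?g * B" by (simp flip: right_diff_distrib)
    then show ?thesis using QuadRes_cong w(2) by blast
   next
    \<comment> \<open>Here \<open>w\<close> is congruent to the other root 2 a - B.\<close>
    case 2
    have e: "w * B - (a^2 - 4 * b) = (w + B - 2 * a) * B - ((B - a)^2 - 4 * b)" by (simp add: power2_eq_square algebra_simps)
    have wB: "int q dvd w * B - (a^2 - 4 * b)" unfolding e by (rule dvd_diff[OF dvd_mult2[OF 2] B(2)])
    have "~ int q dvd w * B" using dvd_shift[OF wB] h(1) by blast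
    then have nw: "~ int q dvd w" unfolding prime_dvd_mult_iff[OF f(2)] by blast
    have "QuadRes (int q) (w * B)" using QuadRes_cong[OF wB] h(2) by blast
    then show ?thesis using QuadRes_mult_iff[OF f(2,3) nw B(1)] QuadRes_mult_iff[OF f(2,3) g nw] QuadRes_mult_iff[OF f(2,3) g B(1)] w(2) by blast
   qed
  qed
  then show ?thesis unfolding h7'[OF True] using True B(2) by auto
 qed
qed

end

section \<open>Counting the twisted Selmer group\<close>

lemma two_power_eq: "(2::nat) ^ m = 2 ^ n ==> m = n"
 by simp

lemma of_nat_bit: "(of_nat n :: bit) = (if even n then 0 else 1)"
 by (induction n) auto

text \<open>A set Y is identified with its 0-1 vector along the list, so that kernel vectors are
  counted as sets of primes and the order of the columns disappears.\<close>

lemma kernel_card: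
 fixes M :: "bit mat" and L :: "nat list"
 assumes M: "M \<in> carrier_mat nr (length L)" and L: "distinct L"
  and m: "\<And>i j. i < nr ==> j < length L ==> M $$ (i, j) = m i (L ! j)"
 shows "card {Y. Y \<subseteq> set L & (\<forall>i<nr. (\<Sum>p\<in>Y. m i p) = 0)} * 2 ^ bit_rank M = 2 ^ length L"
proof -
 let ?n = "length L"
 let ?f = "%Y. vec ?n (%j. if L ! j \<in> Y then 1 else 0 :: bit)"
 let ?K = "{x \<in> carrier_vec ?n. M *\<^sub>v x = 0\<^sub>v nr}"
 have key: "M *\<^sub>v ?f Y = 0\<^sub>v nr \<longleftrightarrow> (\<forall>i<nr. (\<Sum>p\<in>Y. m i p) = 0)" if Y: "Y \<subseteq> set L" for Y
 proof -
  have "(M *\<^sub>v ?f Y) $ i = (\<Sum>p\<in>Y. m i p)" if i: "i < nr" for i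
  proof -
   have "(M *\<^sub>v ?f Y) $ i = (\<Sum>j\<in>{0..<?n}. M $$ (i, j) * (if L ! j \<in> Y then 1 else 0))"
    using i M by (simp add: scalar_prod_def)
   also have "\<dots> = (\<Sum>j\<in>{0..<?n}. if L ! j \<in> Y then m i (L ! j) else 0)"
    by (rule sum.cong) (use m[OF i] in auto)
   also have "\<dots> = (\<Sum>p\<in>set L. if p \<in> Y then m i p else 0)"
    by (rule sum.reindex_bij_betw[of "(!) L" "{0..<?n}" "set L" "%p. if p \<in> Y then m i p else 0"]) (rule bij_betw_nth[OF L], auto)
   also have "\<dots> = (\<Sum>p\<in>Y. m i p)" using Y by (intro sum.mono_neutral_cong_right) auto
   finally show ?thesis .
  qed
  moreover have "dim_vec (M *\<^sub>v ?f Y) = nr" using M by simp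
  ultimately show ?thesis by (auto simp: vec_eq_iff)
 qed
 have inj: "inj_on ?f (Pow (set L))"
 proof (rule inj_onI)
  fix Y Z assume h: "Y \<in> Pow (set L)" "Z \<in> Pow (set L)" "?f Y = ?f Z"
  have "L ! j \<in> Y \<longleftrightarrow> L ! j \<in> Z" if "j < ?n" for j using arg_cong[OF h(3), of "%v. v $ j"] that by (simp split: if_splits)
  then show "Y = Z" using h(1,2) by (auto simp: in_set_conv_nth subset_iff)
 qed
 have im: "?f ` {Y. Y \<subseteq> set L & (\<forall>i<nr. (\<Sum>p\<in>Y. m i p) = 0)} = ?K"
 proof (intro equalityI subsetI)
  fix x assume "x \<in> ?f ` {Y. Y \<subseteq> set L & (\<forall>i<nr. (\<Sum>p\<in>Y. m i p) = 0)}"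
  then show "x \<in> ?K" using key by auto
 next
  fix x assume x: "x \<in> ?K"
  define Y where "Y = {L ! j | j. j < ?n & x $ j = 1}"
  have Y: "Y \<subseteq> set L" unfolding Y_def by auto
  have "L ! j \<in> Y \<longleftrightarrow> x $ j = 1" if "j < ?n" for j unfolding Y_def using that L nth_eq_iff_index_eq by fastforce
  then have "?f Y = x" using x by (intro eq_vecI) auto
  then show "x \<in> ?f ` {Y. Y \<subseteq> set L & (\<forall>i<nr. (\<Sum>p\<in>Y. m i p) = 0)}" using key[OF Y] x Y by (intro image_eqI[of _ _ Y]) auto
 qed
 have "card {Y. Y \<subseteq> set L & (\<forall>i<nr. (\<Sum>p\<in>Y. m i p) = 0)} = card ?K"
  unfolding im[symmetric] by (rule card_image[symmetric], rule inj_on_subset[OF inj]) auto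
 then show ?thesis using bit_rank_nullity[OF M] by simp
qed

definition qchar :: "nat => int => bit" where "qchar q u = (if QuadRes (int q) u then 0 else 1)"

definition sign_bit :: "int => bit" where "sign_bit s = (if s > 0 then 0 else 1)"

context twist_setting begin

lemma qchar_mult: "q \<in> S ==> ~ int q dvd u ==> ~ int q dvd v ==> qchar q (u * v) = qchar q u + qchar q v"
 using QuadRes_mult_iff[OF twist_prime_facts(2,3)[OF tp], of q u v] unfolding qchar_def by auto

text \<open>Each factor -p contributes the character of p plus 1, because -1 is a
  nonresidue.\<close>

lemma qchar_tw:
 assumes q: "q \<in> S" and Y: "Y \<subseteq> S" "q \<notin> Y"
 shows "qchar q (tw Y) = (\<Sum>p\<in>Y. 1 + qchar q (int p))"
 using finS[OF Y(1)] Y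
proof (induction rule: finite_induct)
 case empty then show ?case by (simp add: qchar_def QuadRes_one)
next
 case (insert p Y)
 note f = twist_prime_facts[OF tp[OF q]]
 have Y: "Y \<subseteq> S" "p \<in> S" "q \<notin> Y" "q ~= p" using insert by auto
 have n: "~ int q dvd int p" using primes_dvd_imp_eq[OF f(1) S_prime[OF Y(2)]] Y(4) by auto
 have n1: "~ int q dvd - 1" using f(3) by auto
 have nt: "~ int q dvd tw Y" using prime_dvd_tw[OF Y(1) f(1)] Y(3) by simp
 have "tw (insert p Y) = - 1 * int p * tw Y" using tw_insert[OF Y(1) insert.hyps(2)] by simp
 moreover have "~ int q dvd - 1 * int p" using n by simp
 ultimately have "qchar q (tw (insert p Y)) = qchar q (- 1 * int p) + qchar q (tw Y)" using qchar_mult[OF q _ nt, of "- 1 * int p"] by simp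
 also have "qchar q (- 1 * int p) = 1 + qchar q (int p)" unfolding qchar_mult[OF q n1 n] using f(5) by (simp add: qchar_def)
 finally show ?case unfolding sum.insert[OF insert.hyps(1,2)] insert.IH[OF Y(1,3)] .
qed

lemma tw_pos: "Y \<subseteq> S ==> tw Y > 0 \<longleftrightarrow> even (card Y)"
proof -
 assume Y: "Y \<subseteq> S"
 have "\<Prod>Y > 0" using Y S_prime prime_gt_0_nat by (intro prod_pos) blast
 then have "int (\<Prod>Y) > 0" by (simp only: of_nat_0_less_iff)
 then show ?thesis unfolding tw_eq[OF Y] by (cases "even (card Y)") simp_all
qed

lemma sign_tw: "s ~= 0 ==> Y \<subseteq> S ==> s * tw Y > 0 \<longleftrightarrow> sign_bit s = of_nat (card Y)"
 using tw_pos[of Y] tw_nonzero[of Y] unfolding sign_bit_def of_nat_bit zero_less_mult_iff by auto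

lemma tw_S_neg: "tw S < 0"
 using tw_pos[of S] tw_nonzero[of S] odd_card by simp

lemma disc_twist: "ell_disc (a * tw S) (b * (tw S)^2) ~= 0"
proof -
 have "ell_disc (a * tw S) (b * (tw S)^2) = ell_disc a b * (tw S) ^ 6" unfolding ell_disc_def by (simp add: power2_eq_square eval_nat_numeral algebra_simps)
 then show ?thesis using disc tw_S_neg by simp
qed

lemma prime_dvd_d: "prime p ==> p dvd \<Prod>S \<longleftrightarrow> p \<in> S"
 using prime_dvd_tw[OF subset_refl, of p] unfolding tw_S dvd_minus_iff int_dvd_int_iff .

lemma d_pos: "\<Prod>S > 0" using S_prime prime_gt_0_nat by (intro prod_pos) blast

lemma prime_factors_d: "prime_factors (\<Prod>S) = S"
 using prime_dvd_d S_prime d_pos by (auto simp: in_prime_factors_iff)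

lemma omega_d: "omega (\<Prod>S) = card S" unfolding omega_def prime_factors_d ..

lemma S_nonempty: "S ~= {}" using odd_card by auto

lemma Rset_nonzero: "s \<in> Rset ==> s ~= 0" unfolding Rset_def using SF_nonzero by blast

lemma Rset_finite: "finite Rset"
proof -
 have c: "a^2 - 4 * b ~= 0" using disc unfolding ell_disc_def by auto
 have "s dvd a^2 - 4 * b" if s: "s \<in> Rset" for s
 proof (rule squarefree_dvdI)
  show sf: "squarefree s" using s unfolding Rset_def SF_def by blast
  fix p assume p: "prime p" "int p dvd s"
  obtain gam where g: "s = int p * gam" "~ int p dvd gam" by (rule squarefree_prime_factor[OF sf p])
  have "p \<notin> S" using s p unfolding Rset_def SF_def by blast
  then have "local_sol (Finite_place p) a b s" using s p unfolding Rset_def by blast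
  then have "padic_sol (int p) a b s" by (rule local_sol_imp_padic_sol[OF p(1) Rset_nonzero[OF s]])
  then show "int p dvd a^2 - 4 * b" using not_padic_sol_ramified[of "int p" a b s gam] g p(1) by auto
 qed
 then show ?thesis using finite_divisors_int[OF c] finite_subset[of Rset "{i. i dvd a^2 - 4 * b}"] by blast
qed

definition Rpos where "Rpos = {s \<in> Rset. s > 0}"
definition Rneg where "Rneg = {s \<in> Rset. s < 0}"

text \<open>\<open>Rset\<close> represents a group of square classes; u is the squarefree part of
  the product.\<close>

lemma Rset_product:
 assumes s: "s \<in> Rset" "t \<in> Rset"
 shows "\<exists>u x. u \<in> Rset & x ~= 0 & s * t = u * x^2"
proof -
 have nz: "s * t ~= 0" using s Rset_nonzero by simp
 obtain u x where u: "squarefree u" "x ~= 0" "s * t = u * x^2" using squarefree_decompose_int[OF nz] by blast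
 have u0: "u ~= 0" by (rule squarefree_nonzero[OF u(1)])
 have "~ int q dvd u" if q: "q \<in> S" for q
 proof
  assume "int q dvd u"
  then have "int q dvd s * t" unfolding u(3) by (rule dvd_mult2)
  moreover have "prime (int q)" using S_prime[OF q] by simp
  ultimately show False using s q prime_dvd_mult_iff unfolding Rset_def SF_def by blast
 qed
 moreover have "local_sol (Finite_place p) a b u" if p: "prime p" "p \<notin> S" for p
 proof -
  have "local_sol (Finite_place p) a b (s * t)" by (rule local_sol_mult[OF fplace[OF p(1)] disc]) (use s p in \<open>auto simp: Rset_def\<close>)
  then have "local_sol (Finite_place p) a b (u * (x * x))" unfolding u(3) power2_eq_square .
  moreover have "x * x ~= 0" using u(2) by simp
  ultimately show ?thesis using local_sol_cong[OF fplace[OF p(1)] disc u0 is_square_of_int_square[OF fplace[OF p(1)]]] by blast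
 qed
 ultimately have "u \<in> Rset" unfolding Rset_def SF_def using u(1) by blast
 then show ?thesis using u by blast
qed

text \<open>Multiplication by a fixed negative element, followed by taking squarefree parts, is
  injective and exchanges the signs.\<close>

lemma card_Rneg: assumes "Rneg ~= {}" shows "card Rneg = card Rpos"
proof -
 obtain t where t: "t \<in> Rset" "t < 0" using assms unfolding Rneg_def by blast
 have "\<forall>s\<in>Rset. \<exists>u. u \<in> Rset & (\<exists>x. x ~= 0 & s * t = u * x^2)" using Rset_product[OF _ t(1)] by blast
 then obtain h where h: "\<And>s. s \<in> Rset ==> h s \<in> Rset & (\<exists>x. x ~= 0 & s * t = h s * x^2)" by metis
 have inj: "inj_on h Rset"
 proof (rule inj_onI)
  fix s s' assume s: "s \<in> Rset" "s' \<in> Rset" "h s = h s'"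
  obtain x where x: "x ~= 0" "s * t = h s * x^2" using h[OF s(1)] by blast
  obtain y where y: "y ~= 0" "s' * t = h s * y^2" using h[OF s(2)] s(3) by auto
  have "(s * y^2) * t = (s * t) * y^2" by (simp add: mult_ac)
  also have "\<dots> = (s' * t) * x^2" unfolding x(2) y(2) by (simp add: mult_ac)
  finally have "(s * y^2) * t = (s' * x^2) * t" by (simp add: mult_ac)
  then have "s * y^2 = s' * x^2" using t(2) by simp
  then show "s = s'" using squarefree_int_eq[of s s' y x] s(1,2) x(1) y(1) unfolding Rset_def SF_def by blast
 qed
 have sg: "h s < 0 \<longleftrightarrow> s > 0" if s: "s \<in> Rset" for s
 proof -
  obtain x where x: "x ~= 0" "s * t = h s * x^2" using h[OF s] by blast
  have "x^2 > 0" using x(1) by simp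
  then have "h s < 0 \<longleftrightarrow> h s * x^2 < 0" by (simp add: mult_less_0_iff)
  also have "\<dots> \<longleftrightarrow> s > 0" unfolding x(2)[symmetric] using t(2) by (simp add: mult_less_0_iff)
  finally show ?thesis .
 qed
 have nz: "h s ~= 0" if "s \<in> Rset" for s using h[OF that] Rset_nonzero by blast
 have fin': "finite Rpos" "finite Rneg" unfolding Rpos_def Rneg_def using Rset_finite by simp_all
 have "h ` Rpos \<subseteq> Rneg" unfolding Rpos_def Rneg_def using h sg by auto
 then have "card Rpos \<le> card Rneg" using fin' by (intro card_inj_on_le[OF inj_on_subset[OF inj]]) (auto simp: Rpos_def)
 moreover have "h ` Rneg \<subseteq> Rpos"
 proof
  fix u assume "u \<in> h ` Rneg"
  then obtain s where s: "s \<in> Rset" "s < 0" "u = h s" unfolding Rneg_def by blast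
  then have "~ h s < 0" using sg[OF s(1)] by simp
  then show "u \<in> Rpos" unfolding Rpos_def using s h[OF s(1)] nz[OF s(1)] by auto
 qed
 then have "card Rneg \<le> card Rpos" using fin' by (intro card_inj_on_le[OF inj_on_subset[OF inj]]) (auto simp: Rneg_def)
 ultimately show ?thesis by simp
qed

lemma card_Rset: "card Rset = card Rpos + card Rneg"
proof -
 have "Rset = Rpos \<union> Rneg" unfolding Rpos_def Rneg_def using Rset_nonzero by force
 moreover have "Rpos \<inter> Rneg = {}" unfolding Rpos_def Rneg_def by auto
 ultimately show ?thesis using card_Un_disjoint[of Rpos Rneg] Rset_finite by (simp add: Rpos_def Rneg_def)
qed

text \<open>Write the class as s times \<open>tw Y\<close>. The sign of \<open>tw Y\<close> is the
  parity of \<open>card Y\<close>, so the condition on sign and parity in \<open>eta\<close> says s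
  < 0, while the relaxed local conditions say that s is in \<open>Rset\<close>.\<close>

lemma eta_iff: "eta a b (\<Prod>S) = (if Rneg ~= {} then 1 else 0)"
proof -
 have "(\<exists>al::int. squarefree al & square_class class_ring (of_int al) \<in> relaxed_selmer a b (\<Prod>S) &
     (al > 0 & odd (card {p \<in> prime_factors (\<Prod>S). int p dvd al}) \<or>
      al < 0 & even (card {p \<in> prime_factors (\<Prod>S). int p dvd al}))) \<longleftrightarrow> Rneg ~= {}"
 proof
  assume "Rneg ~= {}"
  then obtain s where s: "s \<in> Rset" "s < 0" unfolding Rneg_def by blast
  have e: "{p \<in> prime_factors (\<Prod>S). int p dvd s} = {}" unfolding prime_factors_d using s(1) unfolding Rset_def SF_def by blast
  have ev: "even (card {p \<in> prime_factors (\<Prod>S). int p dvd s})" unfolding e by simp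
  have rel: "square_class class_ring (of_int s) \<in> relaxed_selmer a b (\<Prod>S)"
   unfolding relaxed_selmer_iff[OF disc Rset_nonzero[OF s(1)]] using s(1) prime_dvd_d unfolding Rset_def by blast
  have sf: "squarefree s" using s(1) unfolding Rset_def SF_def by blast
  show "\<exists>al::int. squarefree al & square_class class_ring (of_int al) \<in> relaxed_selmer a b (\<Prod>S) &
     (al > 0 & odd (card {p \<in> prime_factors (\<Prod>S). int p dvd al}) \<or>
      al < 0 & even (card {p \<in> prime_factors (\<Prod>S). int p dvd al}))" by (rule exI[of _ s], intro conjI disjI2 sf rel s(2) ev)
 next
  assume "\<exists>al::int. squarefree al & square_class class_ring (of_int al) \<in> relaxed_selmer a b (\<Prod>S) &
     (al > 0 & odd (card {p \<in> prime_factors (\<Prod>S). int p dvd al}) \<or>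
      al < 0 & even (card {p \<in> prime_factors (\<Prod>S). int p dvd al}))"
  then obtain al where al: "squarefree al" "square_class class_ring (of_int al) \<in> relaxed_selmer a b (\<Prod>S)"
   "al > 0 & odd (card {p \<in> S. int p dvd al}) \<or> al < 0 & even (card {p \<in> S. int p dvd al})" unfolding prime_factors_d by blast
  define Y where "Y = {q \<in> S. int q dvd al}"
  have Y: "Y \<subseteq> S" unfolding Y_def by blast
  obtain s where s: "s \<in> SF" "al = s * tw Y" using SF_decompose[OF al(1)] unfolding Y_def by (elim bexE)
  have "local_sol (Finite_place p) a b s" if p: "prime p" "p \<notin> S" for p
  proof -
   have "local_sol (Finite_place p) a b al" using al(2) p prime_dvd_d[OF p(1)] unfolding relaxed_selmer_iff[OF disc squarefree_nonzero[OF al(1)]] by blast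
   then show ?thesis using off_S[OF s(1) Y empty_subsetI p] unfolding s(2) by simp
  qed
  then have "s \<in> Rset" unfolding Rset_def using s(1) by blast
  moreover have "s < 0" using al(3)[folded Y_def, unfolded s(2)] tw_pos[OF Y] by (auto simp: zero_less_mult_iff mult_less_0_iff not_less)
  ultimately show "Rneg ~= {}" unfolding Rneg_def by blast
 qed
 then show ?thesis unfolding eta_def by simp
qed

text \<open>When the conditions see s only through its sign, the pairs form two rectangles, one for
  each sign.\<close>

lemma card_twist_selmer:
 assumes Q: "\<And>s Y. s \<in> Rset ==> Y \<subseteq> S ==>
   local_sol Infinite_place (a * tw S) (b * (tw S)^2) (s * tw Y) & (\<forall>q\<in>S. twist_ok q s Y) \<longleftrightarrow> Q (sign_bit s) Y"
 shows "2 ^ selmer_rank (a * tw S) (b * (tw S)^2) =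
  card Rpos * card {Y. Y \<subseteq> S & Q 0 Y} + card Rneg * card {Y. Y \<subseteq> S & Q 1 Y}"
proof -
 let ?P = "{(s, Y). s \<in> Rset & Y \<subseteq> S & local_sol Infinite_place (a * tw S) (b * (tw S)^2) (s * tw Y) & (\<forall>q\<in>S. twist_ok q s Y)}"
 have "2 ^ selmer_rank (a * tw S) (b * (tw S)^2) = card ((%(s, Y). s * tw Y) ` ?P)"
  using card_selmer(2)[OF disc_twist] unfolding twist_selmer_ints_eq by simp
 also have "\<dots> = card ?P" by (rule card_image[OF inj_on_subset[OF tw_inj]]) (auto simp: Rset_def)
 also have "?P = Rpos \<times> {Y. Y \<subseteq> S & Q 0 Y} \<union> Rneg \<times> {Y. Y \<subseteq> S & Q 1 Y}" (is "_ = ?A \<union> ?B")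
 proof (intro equalityI subsetI)
  fix z assume "z \<in> ?P"
  then obtain s Y where z: "z = (s, Y)" "s \<in> Rset" "Y \<subseteq> S" "Q (sign_bit s) Y" using Q by auto
  then show "z \<in> ?A \<union> ?B" using Rset_nonzero[OF z(2)] unfolding Rpos_def Rneg_def sign_bit_def by (auto split: if_splits)
 next
  fix z assume "z \<in> ?A \<union> ?B"
  then obtain s Y where z: "z = (s, Y)" "s \<in> Rset" "Y \<subseteq> S" "Q (sign_bit s) Y" unfolding Rpos_def Rneg_def sign_bit_def by auto
  then show "z \<in> ?P" using Q[OF z(2,3)] by auto
 qed
 also have "card (?A \<union> ?B) = card ?A + card ?B"
 proof (rule card_Un_disjoint)
  have "finite {Y. Y \<subseteq> S & R Y}" for R using finite_subset[of "{Y. Y \<subseteq> S & R Y}" "Pow S"] fin by auto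
  then show "finite ?A" "finite ?B" using Rset_finite unfolding Rpos_def Rneg_def by auto
  show "?A \<inter> ?B = {}" unfolding Rpos_def Rneg_def by auto
 qed
 finally show ?thesis by (simp add: card_cartesian_product)
qed

text \<open>Every prime of \<open>S\<close> is excluded from Y, and then s must be a residue, that
  is, positive. The real condition of E also selects the positive s, so both groups are
  \<open>Rpos\<close>.\<close>

lemma case_b_neg: assumes b: "b < 0" shows "selmer_rank (a * tw S) (b * (tw S)^2) = selmer_rank a b"
proof -
 have t2: "(tw S)^2 > 0" using tw_S_neg by simp
 have bt: "b * (tw S)^2 < 0" using b t2 by (rule mult_neg_pos)
 have inf: "local_sol Infinite_place a' b' s \<longleftrightarrow> s > 0" if "b' < 0" "s ~= 0" for a' b' s
 proof (cases "s > 0")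
  case True then show ?thesis using local_sol_infinite_pos by blast
 next
  case False
  then have "s < 0" using that by simp
  then show ?thesis using not_local_sol_infinite[of s b' a'] that False by blast
 qed
 have E: "selmer_ints a b = Rpos" unfolding selmer_ints_eq Rpos_def using inf[OF b] Rset_nonzero by blast
 have "2 ^ selmer_rank (a * tw S) (b * (tw S)^2) = card Rpos * card {Y. Y \<subseteq> S & (0::bit) = 0 & Y = {}} + card Rneg * card {Y. Y \<subseteq> S & (1::bit) = 0 & Y = {}}"
 proof (rule card_twist_selmer[where Q = "%e Y. e = 0 & Y = {}"])
  fix s Y assume s: "s \<in> Rset" and Y: "Y \<subseteq> S"
  have sf: "s \<in> SF" using s unfolding Rset_def by blast
  have nz: "s * tw Y ~= 0" using Rset_nonzero[OF s] tw_nonzero[OF Y] by simp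
  have "(\<forall>q\<in>S. twist_ok q s Y) \<longleftrightarrow> (\<forall>q\<in>S. q \<notin> Y & QuadRes (int q) (s * tw Y))" using twist_ok_b_neg[OF b _ sf Y] by blast
  also have "\<dots> \<longleftrightarrow> Y = {} & s > 0"
  proof
   assume h: "\<forall>q\<in>S. q \<notin> Y & QuadRes (int q) (s * tw Y)"
   then have "Y = {}" using Y by blast
   moreover obtain q where "q \<in> S" using S_nonempty by blast
   ultimately show "Y = {} & s > 0" using h Rset_sign[OF s, of q] by auto
  qed (use Rset_sign[OF s] in auto)
  finally show "local_sol Infinite_place (a * tw S) (b * (tw S)^2) (s * tw Y) & (\<forall>q\<in>S. twist_ok q s Y) \<longleftrightarrow> sign_bit s = 0 & Y = {}"
   unfolding inf[OF bt nz] sign_bit_def by auto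
 qed
 also have "\<dots> = card Rpos" by (simp add: Collect_conv_if)
 also have "\<dots> = 2 ^ selmer_rank a b" using card_selmer(2)[OF disc] E by simp
 finally show ?thesis by simp
qed

text \<open>No condition remains at \<open>S\<close> or at the real place, neither for E nor for the
  twist, so every subset Y occurs with every s.\<close>

lemma case_disc_neg:
 assumes b: "b > 0" "a^2 - 4 * b < 0"
 shows "selmer_rank (a * tw S) (b * (tw S)^2) = selmer_rank a b + card S"
proof -
 have t2: "(tw S)^2 > 0" using tw_S_neg by simp
 have "(a * tw S)^2 - 4 * (b * (tw S)^2) = (a^2 - 4 * b) * (tw S)^2" by (simp add: power_mult_distrib algebra_simps)
 then have ct: "(a * tw S)^2 - 4 * (b * (tw S)^2) < 0" using mult_neg_pos[OF b(2) t2] by simp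
 have inf: "local_sol Infinite_place a' b' s" if "a'^2 - 4 * b' < 0" "s ~= 0" for a' b' s
  using local_sol_infinite_pos[of s a' b'] local_sol_infinite_neg_disc[OF _ that(1), of s] that(2) by linarith
 have E: "selmer_ints a b = Rset" unfolding selmer_ints_eq using inf[OF b(2)] Rset_nonzero by blast
 have "2 ^ selmer_rank (a * tw S) (b * (tw S)^2) = card Rpos * card {Y. Y \<subseteq> S & True} + card Rneg * card {Y. Y \<subseteq> S & True}"
 proof (rule card_twist_selmer[where Q = "%e Y. True"])
  fix s Y assume s: "s \<in> Rset" and Y: "Y \<subseteq> S"
  have sf: "s \<in> SF" using s unfolding Rset_def by blast
  have nz: "s * tw Y ~= 0" using Rset_nonzero[OF s] tw_nonzero[OF Y] by simp
  show "local_sol Infinite_place (a * tw S) (b * (tw S)^2) (s * tw Y) & (\<forall>q\<in>S. twist_ok q s Y) \<longleftrightarrow> True"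
   using inf[OF ct nz] twist_ok_disc_neg[OF b _ sf Y] by blast
 qed
 also have "{Y. Y \<subseteq> S & True} = Pow S" by blast
 also have "card Rpos * card (Pow S) + card Rneg * card (Pow S) = card Rset * 2 ^ card S" unfolding card_Rset card_Pow[OF fin] by (simp add: algebra_simps)
 also have "\<dots> = 2 ^ (selmer_rank a b + card S)" using card_selmer(2)[OF disc] E by (simp add: power_add)
 finally show ?thesis by simp
qed

end

section \<open>Linear systems when b and the discriminant are positive\<close>

locale twist_roots = twist_setting +
 fixes \<beta> :: "nat => (nat => rat) set"
 assumes bpos: "b > 0" and cpos: "a^2 - 4 * b > 0" and roots: "local_roots a b (\<Prod>S) \<beta>"
begin

lemma root_exists:
 assumes q: "q \<in> S"
 shows "\<exists>B. ~ int q dvd B & int q dvd (B - a)^2 - 4 * b &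
  hilbert_symbol (completion (Finite_place q)) (\<beta> q) (of_rat_completion (Finite_place q) (of_nat q)) = (if QuadRes (int q) B then 1 else - 1)"
proof (rule local_root_residue)
 show "prime q" by (rule S_prime[OF q])
 show "odd q" using twist_prime_facts(4)[OF tp[OF q]] by simp
qed (use roots q in \<open>simp_all only: local_roots_def prime_factors_d Let_def\<close>)

definition Bt :: "nat => int" where
 "Bt q = (SOME B. ~ int q dvd B & int q dvd (B - a)^2 - 4 * b &
  hilbert_symbol (completion (Finite_place q)) (\<beta> q) (of_rat_completion (Finite_place q) (of_nat q)) = (if QuadRes (int q) B then 1 else - 1))"

lemma Bt_spec:
 assumes "q \<in> S"
 shows "~ int q dvd Bt q & int q dvd (Bt q - a)^2 - 4 * b &
  hilbert_symbol (completion (Finite_place q)) (\<beta> q) (of_rat_completion (Finite_place q) (of_nat q)) = (if QuadRes (int q) (Bt q) then 1 else - 1)"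
 unfolding Bt_def by (rule someI_ex[OF root_exists[OF assms]])

lemmas Bt = Bt_spec[THEN conjunct1] Bt_spec[THEN conjunct2, THEN conjunct1] Bt_spec[THEN conjunct2, THEN conjunct2]

text \<open>The entries of \<open>matA\<close> indexed by the primes themselves, which frees the
  sums from the order of \<open>T_list\<close>.\<close>

definition Aent :: "nat => nat => bit" where
 "Aent q p = (if q = p \<or> Legendre (int p) (int q) = 1 then 0 else 1) + (if q = p & q \<in> T_minus (\<Prod>S) \<beta> then 1 else 0)"

lemma Aent_off: assumes "q \<in> S" "p \<in> S" "p ~= q" shows "Aent q p = qchar q (int p)"
proof -
 have "~ int q dvd int p" using primes_dvd_imp_eq[OF S_prime[OF assms(1)] S_prime[OF assms(2)]] assms(3) by auto
 then have l: "Legendre (int p) (int q) = (if QuadRes (int q) (int p) then 1 else - 1)" by (rule QuadRes_imp_Legendre)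
 have "q ~= p" using assms(3) by simp
 then show ?thesis unfolding Aent_def qchar_def l by (cases "QuadRes (int q) (int p)") simp_all
qed

text \<open>d / q equals \<open>tw (S - {q})\<close>, because an even number of signs is left.
  Membership in \<open>T_minus\<close> then says that this number and the root have equal characters
  modulo q; this is where the identity block of the matrix comes from.\<close>

lemma Aent_diag: assumes q: "q \<in> S" shows "1 + Aent q q = qchar q (tw (S - {q})) + qchar q (Bt q)"
proof -
 have sub: "S - {q} \<subseteq> S" by blast
 have ev: "even (card (S - {q}))" using odd_card q fin by simp
 have "\<Prod>S = q * \<Prod>(S - {q})" using prod.remove[OF fin q, of "%x. x"] by simp
 then have "\<Prod>S div q = \<Prod>(S - {q})" using prime_gt_0_nat[OF S_prime[OF q]] by simp
 then have d: "int (\<Prod>S div q) = tw (S - {q})" using tw_eq[OF sub] ev by simp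
 have nd: "~ int q dvd tw (S - {q})" using prime_dvd_tw[OF sub S_prime[OF q]] by simp
 have "q \<in> T_minus (\<Prod>S) \<beta> \<longleftrightarrow> Legendre (int (\<Prod>S div q)) (int q) =
   hilbert_symbol (completion (Finite_place q)) (\<beta> q) (of_rat_completion (Finite_place q) (of_nat q))"
  unfolding T_minus_def prime_factors_d mem_Collect_eq using q by blast
 also have "\<dots> \<longleftrightarrow> (QuadRes (int q) (tw (S - {q})) \<longleftrightarrow> QuadRes (int q) (Bt q))"
  unfolding d Bt(3)[OF q] QuadRes_imp_Legendre[OF nd] by simp
 finally have "q \<in> T_minus (\<Prod>S) \<beta> \<longleftrightarrow> (QuadRes (int q) (tw (S - {q})) \<longleftrightarrow> QuadRes (int q) (Bt q))" .
 note T = this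
 show ?thesis unfolding Aent_def qchar_def T by (cases "QuadRes (int q) (tw (S - {q}))"; cases "QuadRes (int q) (Bt q)") simp_all
qed

text \<open>For q outside Y the class must be a residue, and each p in Y contributes 1 +
  \<open>Aent q p\<close>. For q in Y the extra factors \<open>tw (S - {q})\<close> and
  \<open>Bt q\<close> contribute exactly the diagonal term, by \<open>Aent_diag\<close>. So one
  linear equation covers both cases.\<close>

lemma twist_ok_bit:
 assumes q: "q \<in> S" and s: "s \<in> Rset" and Y: "Y \<subseteq> S"
 shows "twist_ok q s Y \<longleftrightarrow> sign_bit s + (of_nat (card Y) + (\<Sum>p\<in>Y. Aent q p)) = 0"
proof -
 have sf: "s \<in> SF" using s unfolding Rset_def by blast
 have ns: "~ int q dvd s" using sf q unfolding SF_def by blast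
 have qs: "qchar q s = sign_bit s" unfolding qchar_def sign_bit_def using Rset_sign[OF s q] by simp
 have off: "qchar q (s * tw Z) = sign_bit s + (\<Sum>p\<in>Z. 1 + Aent q p)" if Z: "Z \<subseteq> S" "q \<notin> Z" for Z
 proof -
  have "~ int q dvd tw Z" using prime_dvd_tw[OF Z(1) S_prime[OF q]] Z(2) by simp
  then have "qchar q (s * tw Z) = sign_bit s + (\<Sum>p\<in>Z. 1 + qchar q (int p))" using qchar_mult[OF q ns] qs qchar_tw[OF q Z] by simp
  also have "(\<Sum>p\<in>Z. 1 + qchar q (int p)) = (\<Sum>p\<in>Z. 1 + Aent q p)"
  proof (rule sum.cong[OF refl])
   fix p assume "p \<in> Z"
   then have p: "p \<in> S" "p ~= q" using Z by blast+
   show "1 + qchar q (int p) = 1 + Aent q p" unfolding Aent_off[OF q p] ..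
  qed
  finally show ?thesis .
 qed
 have tot: "(\<Sum>p\<in>Y. 1 + Aent q p) = of_nat (card Y) + (\<Sum>p\<in>Y. Aent q p)" unfolding sum.distrib sum_constant mult_1_right ..
 have Q0: "QuadRes (int q) u \<longleftrightarrow> qchar q u = 0" for u unfolding qchar_def by simp
 have "twist_ok q s Y \<longleftrightarrow> sign_bit s + (\<Sum>p\<in>Y. 1 + Aent q p) = 0"
 proof (cases "q \<in> Y")
  case False
  show ?thesis unfolding twist_ok_root[OF bpos cpos q sf Y Bt(1)[OF q] Bt(2)[OF q]] if_not_P[OF False] Q0 off[OF Y False] ..
 next
  case True
  let ?Y = "Y - {q}"
  have sub: "?Y \<subseteq> S" "q \<notin> ?Y" "S - {q} \<subseteq> S" using Y by auto
  have n1: "~ int q dvd s * tw ?Y" using SF_tw(2)[OF sf sub(1) q] by simp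
  have n2: "~ int q dvd tw (S - {q})" using prime_dvd_tw[OF sub(3) S_prime[OF q]] by simp
  have n3: "~ int q dvd s * tw ?Y * tw (S - {q})" using n1 n2 prime_dvd_mult_iff[OF twist_prime_facts(2)[OF tp[OF q]]] by blast
  have "qchar q (s * tw ?Y * tw (S - {q}) * Bt q) = sign_bit s + (\<Sum>p\<in>?Y. 1 + Aent q p) + qchar q (tw (S - {q})) + qchar q (Bt q)"
   unfolding qchar_mult[OF q n3 Bt(1)[OF q]] qchar_mult[OF q n1 n2] off[OF sub(1,2)] ..
  also have "\<dots> = sign_bit s + ((1 + Aent q q) + (\<Sum>p\<in>?Y. 1 + Aent q p))" unfolding Aent_diag[OF q] by (simp only: add_ac)
  also have "(1 + Aent q q) + (\<Sum>p\<in>?Y. 1 + Aent q p) = (\<Sum>p\<in>Y. 1 + Aent q p)" by (rule sum.remove[OF finS[OF Y] True, symmetric])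
  finally show ?thesis unfolding twist_ok_root[OF bpos cpos q sf Y Bt(1)[OF q] Bt(2)[OF q]] if_P[OF True] Q0 by (simp only:)
 qed
 then show ?thesis unfolding tot .
qed

abbreviation L where "L \<equiv> T_list (\<Prod>S) \<beta>"

lemma L: "distinct L" "set L = S" "length L = card S"
proof -
 have sub: "T_plus (\<Prod>S) \<beta> \<subseteq> S" "T_minus (\<Prod>S) \<beta> \<subseteq> S" unfolding T_plus_def T_minus_def prime_factors_d by auto
 have un: "T_plus (\<Prod>S) \<beta> \<union> T_minus (\<Prod>S) \<beta> = S" and dis: "T_plus (\<Prod>S) \<beta> \<inter> T_minus (\<Prod>S) \<beta> = {}" unfolding T_plus_def T_minus_def prime_factors_d by auto
 show d: "distinct L" and s: "set L = S" unfolding T_list_def using finS[OF sub(1)] finS[OF sub(2)] un dis by auto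
 show "length L = card S" using distinct_card[OF d] s by simp
qed

lemma all_rows: "(\<forall>i<card S. P (L ! i)) \<longleftrightarrow> (\<forall>q\<in>S. P q)"
 using L by (metis in_set_conv_nth)

lemma matA_entry: "i < card S ==> j < card S ==> matA (\<Prod>S) \<beta> $$ (i, j) = Aent (L ! i) (L ! j)"
 unfolding matA_def omega_d Aent_def Let_def by simp

lemma matA_carrier: "matA (\<Prod>S) \<beta> \<in> carrier_mat (card S) (card S)"
 unfolding matA_def omega_d by simp

definition rowsum :: "nat => nat set => bit" where "rowsum q Y = (\<Sum>p\<in>Y. Aent q p)"

lemma kernel_A: "card {Y. Y \<subseteq> S & (\<forall>q\<in>S. rowsum q Y = 0)} * 2 ^ bit_rank (matA (\<Prod>S) \<beta>) = 2 ^ card S"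
proof -
 have "card {Y. Y \<subseteq> set L & (\<forall>i<card S. (\<Sum>p\<in>Y. Aent (L ! i) p) = 0)} * 2 ^ bit_rank (matA (\<Prod>S) \<beta>) = 2 ^ length L"
 proof (rule kernel_card)
  show "matA (\<Prod>S) \<beta> \<in> carrier_mat (card S) (length L)" unfolding L(3) by (rule matA_carrier)
  show "matA (\<Prod>S) \<beta> $$ (i, j) = Aent (L ! i) (L ! j)" if "i < card S" "j < length L" for i j
   using that unfolding L(3) by (rule matA_entry)
 qed (rule L(1))
 then show ?thesis unfolding rowsum_def[symmetric] L(2,3) all_rows[of "%q. rowsum q _ = 0"] .
qed

lemma bar_entry: "i < card S ==> j < card S ==> mat_bar (matA (\<Prod>S) \<beta>) $$ (i, j) = Aent (L ! i) (L ! j) + 1"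
 unfolding mat_bar_def by (simp add: matA_entry carrier_matD[OF matA_carrier])

lemma bar_carrier: "mat_bar (matA (\<Prod>S) \<beta>) \<in> carrier_mat (card S) (card S)"
 unfolding mat_bar_def by (rule carrier_matI) (simp_all add: carrier_matD[OF matA_carrier])

lemma bar_sum: "(\<Sum>p\<in>Y. Aent q p + 1) = of_nat (card Y) + rowsum q Y"
 unfolding rowsum_def sum.distrib sum_constant mult_1_right by (rule add.commute)

text \<open>Adding 1 to all entries adds the parity of \<open>card Y\<close> to every row
  sum.\<close>

lemma kernel_bar: "card {Y. Y \<subseteq> S & (\<forall>q\<in>S. of_nat (card Y) + rowsum q Y = 0)} * 2 ^ bit_rank (mat_bar (matA (\<Prod>S) \<beta>)) = 2 ^ card S"
proof -
 have "card {Y. Y \<subseteq> set L & (\<forall>i<card S. (\<Sum>p\<in>Y. Aent (L ! i) p + 1) = 0)} * 2 ^ bit_rank (mat_bar (matA (\<Prod>S) \<beta>)) = 2 ^ length L"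
 proof (rule kernel_card)
  show "mat_bar (matA (\<Prod>S) \<beta>) \<in> carrier_mat (card S) (length L)" unfolding L(3) by (rule bar_carrier)
  show "mat_bar (matA (\<Prod>S) \<beta>) $$ (i, j) = Aent (L ! i) (L ! j) + 1" if "i < card S" "j < length L" for i j
   using that unfolding L(3) by (rule bar_entry)
 qed (rule L(1))
 then show ?thesis unfolding bar_sum L(2,3) all_rows[of "%q. of_nat (card _) + rowsum q _ = 0"] .
qed

text \<open>The additional row of ones expresses that \<open>card Y\<close> is even.\<close>

lemma kernel_hat: "card {Y. Y \<subseteq> S & of_nat (card Y) = (0::bit) & (\<forall>q\<in>S. of_nat (card Y) + rowsum q Y = 0)} * 2 ^ bit_rank (matA_hat (\<Prod>S) \<beta>) = 2 ^ card S"
proof -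
 let ?m = "%i p. if i = 0 then 1 else Aent (L ! (i - 1)) p + 1"
 have "card {Y. Y \<subseteq> set L & (\<forall>i<card S + 1. (\<Sum>p\<in>Y. ?m i p) = 0)} * 2 ^ bit_rank (matA_hat (\<Prod>S) \<beta>) = 2 ^ length L"
 proof (rule kernel_card)
  show "matA_hat (\<Prod>S) \<beta> \<in> carrier_mat (card S + 1) (length L)" unfolding matA_hat_def omega_d L by simp
  fix i j assume i: "i < card S + 1" and j: "j < length L"
  show "matA_hat (\<Prod>S) \<beta> $$ (i, j) = ?m i (L ! j)"
  proof (cases i)
   case 0 then show ?thesis unfolding matA_hat_def omega_d using i j L(3) by simp
  next
   case (Suc k)
   then have k: "k < card S" "j < card S" using i j L(3) by simp_all
   then have "matA_hat (\<Prod>S) \<beta> $$ (Suc k, j) = mat_bar (matA (\<Prod>S) \<beta>) $$ (k, j)" unfolding matA_hat_def omega_d by simp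
   then show ?thesis unfolding Suc bar_entry[OF k] by (simp only: nat.distinct if_False diff_Suc_1)
  qed
 qed (rule L)
 moreover have "(\<forall>i<card S + 1. (\<Sum>p\<in>Y. ?m i p) = 0) \<longleftrightarrow> of_nat (card Y) = (0::bit) & (\<forall>q\<in>S. of_nat (card Y) + rowsum q Y = 0)" for Y
 proof -
  have "(\<forall>i<card S + 1. (\<Sum>p\<in>Y. ?m i p) = 0) \<longleftrightarrow> (\<Sum>p\<in>Y. ?m 0 p) = 0 & (\<forall>i<card S. (\<Sum>p\<in>Y. ?m (Suc i) p) = 0)"
   unfolding Suc_eq_plus1[symmetric] All_less_Suc2 ..
  also have "(\<Sum>p\<in>Y. ?m 0 p) = of_nat (card Y)" by simp
  also have "(\<forall>i<card S. (\<Sum>p\<in>Y. ?m (Suc i) p) = 0) \<longleftrightarrow> (\<forall>i<card S. of_nat (card Y) + rowsum (L ! i) Y = 0)"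
   unfolding bar_sum[symmetric] by (simp only: nat.distinct if_False diff_Suc_1)
  also have "\<dots> \<longleftrightarrow> (\<forall>q\<in>S. of_nat (card Y) + rowsum q Y = 0)" by (rule all_rows)
  finally show ?thesis .
 qed
 ultimately show ?thesis unfolding L by simp
qed

lemma finite_sub: "finite {Y. Y \<subseteq> S & R Y}"
 using finite_subset[of "{Y. Y \<subseteq> S & R Y}" "Pow S"] fin by auto

text \<open>The column of ones is indexed by 0, which is no prime. A kernel set without 0 solves the
  homogeneous system, one with 0 the system with constant term 1, so this kernel counts both systems
  together.\<close>

lemma kernel_tilde: "(card {Y. Y \<subseteq> S & (\<forall>q\<in>S. rowsum q Y = 0)} + card {Y. Y \<subseteq> S & (\<forall>q\<in>S. 1 + rowsum q Y = 0)}) * 2 ^ bit_rank (matA_tilde (\<Prod>S) \<beta>) = 2 ^ (card S + 1)"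
proof -
 let ?L = "0 # L"
 let ?m = "%i p. if p = 0 then 1 else Aent (L ! i) p"
 have z: "0 \<notin> S" using S_prime not_prime_0 by blast
 have f1: "card {Y. Y \<subseteq> set ?L & (\<forall>i<card S. (\<Sum>p\<in>Y. ?m i p) = 0)} * 2 ^ bit_rank (matA_tilde (\<Prod>S) \<beta>) = 2 ^ length ?L"
 proof (rule kernel_card)
  show "matA_tilde (\<Prod>S) \<beta> \<in> carrier_mat (card S) (length ?L)" unfolding matA_tilde_def omega_d using L by simp
  show "distinct ?L" using L z by simp
  fix i j assume i: "i < card S" and j: "j < length ?L"
  show "matA_tilde (\<Prod>S) \<beta> $$ (i, j) = ?m i (?L ! j)"
  proof (cases j)
   case 0 then show ?thesis unfolding matA_tilde_def omega_d using i by simp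
  next
   case (Suc k)
   then have k: "k < card S" using j L by simp
   have "L ! k \<in> S" using nth_mem[of k L] k unfolding L(2,3) by blast
   with z have Lk: "L ! k ~= 0" by (cases "L ! k") simp_all
   have "matA_tilde (\<Prod>S) \<beta> $$ (i, Suc k) = matA (\<Prod>S) \<beta> $$ (i, k)" unfolding matA_tilde_def omega_d using i k by simp
   then show ?thesis unfolding Suc nth_Cons_Suc matA_entry[OF i k] if_not_P[OF Lk] .
  qed
 qed
 have f2: "{Y. Y \<subseteq> set ?L & (\<forall>i<card S. (\<Sum>p\<in>Y. ?m i p) = 0)} =
  {Y. Y \<subseteq> S & (\<forall>q\<in>S. rowsum q Y = 0)} \<union> insert 0 ` {Y. Y \<subseteq> S & (\<forall>q\<in>S. 1 + rowsum q Y = 0)}" (is "?X = ?A \<union> insert 0 ` ?B")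
 proof -
  have s0: "(\<Sum>p\<in>Y. ?m i p) = rowsum (L ! i) Y" if "Y \<subseteq> S" for i Y
   unfolding rowsum_def
  proof (rule sum.cong[OF refl])
   fix p assume "p \<in> Y"
   then have "p \<in> S" using that by (rule subsetD[rotated])
   with z have "p ~= 0" by (cases p) simp_all
   then show "?m i p = Aent (L ! i) p" by (rule if_not_P)
  qed
  have s1: "(\<Sum>p\<in>insert 0 Y. ?m i p) = 1 + rowsum (L ! i) Y" if Y: "Y \<subseteq> S" for i Y
  proof -
   have "0 \<notin> Y" using Y z by blast
   then have "(\<Sum>p\<in>insert 0 Y. ?m i p) = ?m i 0 + (\<Sum>p\<in>Y. ?m i p)" using finS[OF Y] by (intro sum.insert)
   then show ?thesis unfolding s0[OF Y] if_P[OF refl] .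
  qed
  have r0: "(\<forall>i<card S. (\<Sum>p\<in>Y. ?m i p) = 0) \<longleftrightarrow> (\<forall>q\<in>S. rowsum q Y = 0)" if "Y \<subseteq> S" for Y
   unfolding s0[OF that] by (rule all_rows[of "%q. rowsum q Y = 0"])
  have r1: "(\<forall>i<card S. (\<Sum>p\<in>insert 0 Y. ?m i p) = 0) \<longleftrightarrow> (\<forall>q\<in>S. 1 + rowsum q Y = 0)" if "Y \<subseteq> S" for Y
   unfolding s1[OF that] by (rule all_rows[of "%q. 1 + rowsum q Y = 0"])
  have sL: "set ?L = insert 0 S" unfolding list.set L(2) ..
  show ?thesis
  proof (rule Set.set_eqI)
   fix Y
   show "Y \<in> ?X \<longleftrightarrow> Y \<in> ?A \<union> insert 0 ` ?B"
   proof (cases "0 \<in> Y")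
    case False
    have 1: "Y \<subseteq> insert 0 S \<longleftrightarrow> Y \<subseteq> S" using False by (rule subset_insert)
    have 2: "Y \<notin> insert 0 ` ?B"
    proof
     assume "Y \<in> insert 0 ` ?B"
     then obtain V where "Y = insert 0 V" by (rule imageE)
     then show False using False by simp
    qed
    have 3: "Y \<in> ?X \<longleftrightarrow> Y \<in> ?A" unfolding mem_Collect_eq sL 1 by (rule conj_cong[OF refl r0])
    show ?thesis unfolding Un_iff 3 using 2 by (simp only: simp_thms)
   next
    case True
    define Z where "Z = Y - {0}"
    have Z: "Y = insert 0 Z" "0 \<notin> Z" unfolding Z_def using True by auto
    have 1: "Y \<subseteq> insert 0 S \<longleftrightarrow> Z \<subseteq> S" unfolding Z_def by blast
    have 2: "Y \<notin> ?A"
    proof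
     assume "Y \<in> ?A"
     then have "Y \<subseteq> S" unfolding mem_Collect_eq by (rule conjunct1)
     then have "0 \<in> S" using True by (rule subsetD)
     with z show False by (rule notE)
    qed
    have 3: "Y \<in> insert 0 ` ?B \<longleftrightarrow> Z \<in> ?B"
    proof
     assume "Y \<in> insert 0 ` ?B"
     then obtain V where V: "Y = insert 0 V" "V \<in> ?B" by (rule imageE)
     have "V \<subseteq> S" using V(2) unfolding mem_Collect_eq by (rule conjunct1)
     then have "0 \<notin> V" using z by (rule contra_subsetD)
     then have "Z = V" unfolding Z_def V(1) by simp
     then show "Z \<in> ?B" using V(2) by (simp only:)
    next
     assume "Z \<in> ?B"
     then show "Y \<in> insert 0 ` ?B" unfolding Z(1) by (rule imageI)
    qed
    have 4: "Y \<in> ?X \<longleftrightarrow> Z \<in> ?B" unfolding mem_Collect_eq sL 1 unfolding Z(1) by (rule conj_cong[OF refl r1])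
    show ?thesis unfolding Un_iff 3 4 using 2 by (simp only: simp_thms)
   qed
  qed
 qed
 have f3: "card (?A \<union> insert 0 ` ?B) = card ?A + card ?B"
 proof -
  have n0: "0 \<notin> Y" if "Y \<in> {Y. Y \<subseteq> S & R Y}" for Y R
  proof -
   have "Y \<subseteq> S" using that unfolding mem_Collect_eq by (rule conjunct1)
   then show ?thesis using z by (rule contra_subsetD)
  qed
  have "?A \<inter> insert 0 ` ?B = {}"
  proof (rule equals0I)
   fix Y assume Y: "Y \<in> ?A \<inter> insert 0 ` ?B"
   obtain V where "Y = insert 0 V" using IntD2[OF Y] by (rule imageE)
   then show False using n0[OF IntD1[OF Y]] by simp
  qed
  then have "card (?A \<union> insert 0 ` ?B) = card ?A + card (insert 0 ` ?B)"
   by (rule card_Un_disjoint[OF finite_sub finite_imageI[OF finite_sub]])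
  moreover have "card (insert 0 ` ?B) = card ?B"
  proof (rule card_image, rule inj_onI)
   fix U V assume UV: "U \<in> ?B" "V \<in> ?B" "insert 0 U = insert 0 V"
   show "U = V" using insert_ident[OF n0[OF UV(1)] n0[OF UV(2)]] UV(3) by (rule iffD1)
  qed
  ultimately show ?thesis by (simp only:)
 qed
 have f4: "length ?L = card S + 1" using L(3) by simp
 show ?thesis using f1 unfolding f2 f3 f4 .
qed

text \<open>For even \<open>card Y\<close> the two systems on the left are those on the right; for
  odd \<open>card Y\<close> they are exchanged. The unions therefore agree, and each is disjoint
  because \<open>S\<close> is nonempty.\<close>

lemma bit_card_sum:
 shows "card {Y. Y \<subseteq> S & (\<forall>q\<in>S. (0::bit) + (of_nat (card Y) + rowsum q Y) = 0)} + card {Y. Y \<subseteq> S & (\<forall>q\<in>S. 1 + (of_nat (card Y) + rowsum q Y) = 0)}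
  = card {Y. Y \<subseteq> S & (\<forall>q\<in>S. rowsum q Y = 0)} + card {Y. Y \<subseteq> S & (\<forall>q\<in>S. 1 + rowsum q Y = 0)}" (is "card ?U0 + card ?U1 = card ?K0 + card ?K1")
proof -
 obtain q0 where q0: "q0 \<in> S" using S_nonempty by blast
 have r1: "(0::bit) + (of_nat n + x) = 0 \<longleftrightarrow> x = (if even n then 0 else 1)" for n x
  by (cases x; cases "even n") (simp_all add: of_nat_bit)
 have r2: "(1::bit) + (of_nat n + x) = 0 \<longleftrightarrow> x = (if even n then 1 else 0)" for n x
  by (cases x; cases "even n") (simp_all add: of_nat_bit)
 have r3: "1 + x = 0 \<longleftrightarrow> x = 1" for x :: bit by (cases x) simp_all
 have U0: "Y \<in> ?U0 \<longleftrightarrow> Y \<subseteq> S & (\<forall>q\<in>S. rowsum q Y = (if even (card Y) then 0 else 1))" for Y unfolding mem_Collect_eq r1 ..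
 have U1: "Y \<in> ?U1 \<longleftrightarrow> Y \<subseteq> S & (\<forall>q\<in>S. rowsum q Y = (if even (card Y) then 1 else 0))" for Y unfolding mem_Collect_eq r2 ..
 have K1: "Y \<in> ?K1 \<longleftrightarrow> Y \<subseteq> S & (\<forall>q\<in>S. rowsum q Y = 1)" for Y unfolding mem_Collect_eq r3 ..
 have un: "?U0 \<union> ?U1 = ?K0 \<union> ?K1"
 proof (rule Set.set_eqI)
  fix Y
  show "Y \<in> ?U0 \<union> ?U1 \<longleftrightarrow> Y \<in> ?K0 \<union> ?K1"
  proof (cases "even (card Y)")
   case True show ?thesis unfolding Un_iff U0 U1 K1 mem_Collect_eq if_P[OF True] ..
  next
   case False show ?thesis unfolding Un_iff U0 U1 K1 mem_Collect_eq if_not_P[OF False] by (rule disj_commute)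
  qed
 qed
 have dU: "?U0 \<inter> ?U1 = {}"
 proof (rule equals0I)
  fix Y assume "Y \<in> ?U0 \<inter> ?U1"
  note h = IntD1[OF this] IntD2[OF this]
  have "rowsum q0 Y = (if even (card Y) then 0 else 1)" using h(1)[unfolded U0, THEN conjunct2] q0 by (rule bspec)
  moreover have "rowsum q0 Y = (if even (card Y) then 1 else 0)" using h(2)[unfolded U1, THEN conjunct2] q0 by (rule bspec)
  ultimately show False by (cases "even (card Y)") simp_all
 qed
 have dK: "?K0 \<inter> ?K1 = {}"
 proof (rule equals0I)
  fix Y assume Y: "Y \<in> ?K0 \<inter> ?K1"
  have "rowsum q0 Y = 0" using IntD1[OF Y, unfolded mem_Collect_eq, THEN conjunct2] q0 by (rule bspec)
  moreover have "rowsum q0 Y = 1" using IntD2[OF Y, unfolded K1, THEN conjunct2] q0 by (rule bspec)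
  ultimately show False by simp
 qed
 show ?thesis unfolding card_Un_disjoint[OF finite_sub finite_sub dU, symmetric] card_Un_disjoint[OF finite_sub finite_sub dK, symmetric] un ..
qed

lemma disc_twist_pos: "(a * tw S)^2 - 4 * (b * (tw S)^2) > 0" "b * (tw S)^2 > 0"
proof -
 have t2: "(tw S)^2 > 0" using tw_S_neg by simp
 have "(a * tw S)^2 - 4 * (b * (tw S)^2) = (a^2 - 4 * b) * (tw S)^2" by (simp add: power_mult_distrib algebra_simps)
 then show "(a * tw S)^2 - 4 * (b * (tw S)^2) > 0" using mult_pos_pos[OF cpos t2] by simp
 show "b * (tw S)^2 > 0" using mult_pos_pos[OF bpos t2] .
qed

lemma inf_neg: assumes "a' < 0" "b' > 0" "s ~= 0" shows "local_sol Infinite_place a' b' s"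
 using local_sol_infinite_pos[of s a' b'] local_sol_infinite_neg_a[of s a' b'] assms by linarith

lemma inf_pos: assumes "a' > 0" "a'^2 - 4 * b' > 0" "s ~= 0" shows "local_sol Infinite_place a' b' s \<longleftrightarrow> s > 0"
proof (cases "s > 0")
 case True then show ?thesis using local_sol_infinite_pos by blast
next
 case False
 then have "s < 0" using assms by simp
 then show ?thesis using not_local_sol_infinite[of s b' a'] assms False by blast
qed

text \<open>E has no real condition, while the twist, whose middle coefficient is positive, demands
  that s times \<open>tw Y\<close> be positive: the sign bit of s is the parity of
  \<open>card Y\<close>. The two cancel in every row and leave A. If negative s exist, both parities
  together fill the kernel of A, and the summand 1 reflects that \<open>Rpos\<close> is half of
  \<open>Rset\<close>. Otherwise \<open>card Y\<close> must be even, which is the extra row of the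
  hat matrix.\<close>

lemma case_a_neg:
 assumes a: "a < 0"
 shows "Rneg ~= {} ==> selmer_rank (a * tw S) (b * (tw S)^2) + 1 + bit_rank (matA (\<Prod>S) \<beta>) = selmer_rank a b + card S"
  "Rneg = {} ==> selmer_rank (a * tw S) (b * (tw S)^2) + bit_rank (matA_hat (\<Prod>S) \<beta>) = selmer_rank a b + card S"
proof -
 let ?rt = "selmer_rank (a * tw S) (b * (tw S)^2)"
 have E: "selmer_ints a b = Rset" unfolding selmer_ints_eq using inf_neg[OF a bpos] Rset_nonzero by blast
 have cE: "card Rset = 2 ^ selmer_rank a b" using card_selmer(2)[OF disc] E by simp
 have at: "a * tw S > 0" using a tw_S_neg by (rule mult_neg_neg)
 let ?Q = "%(e::bit) Y. e = of_nat (card Y) & (\<forall>q\<in>S. e + (of_nat (card Y) + rowsum q Y) = 0)"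
 have T: "2 ^ ?rt = card Rpos * card {Y. Y \<subseteq> S & ?Q 0 Y} + card Rneg * card {Y. Y \<subseteq> S & ?Q 1 Y}"
 proof (rule card_twist_selmer[where Q = ?Q])
  fix s Y assume s: "s \<in> Rset" and Y: "Y \<subseteq> S"
  have nz: "s * tw Y ~= 0" using Rset_nonzero[OF s] tw_nonzero[OF Y] by simp
  show "local_sol Infinite_place (a * tw S) (b * (tw S)^2) (s * tw Y) & (\<forall>q\<in>S. twist_ok q s Y) \<longleftrightarrow> ?Q (sign_bit s) Y"
   unfolding inf_pos[OF at disc_twist_pos(1) nz] sign_tw[OF Rset_nonzero[OF s] Y] rowsum_def using twist_ok_bit[OF _ s Y] by blast
 qed
 have K: "card {Y. Y \<subseteq> S & ?Q 0 Y} + card {Y. Y \<subseteq> S & ?Q 1 Y} = card {Y. Y \<subseteq> S & (\<forall>q\<in>S. rowsum q Y = 0)}"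
 proof -
  have x: "(e::bit) + (e + y) = 0 \<longleftrightarrow> y = 0" for e y by (cases e; cases y) simp_all
  have Q: "?Q e Y \<longleftrightarrow> e = of_nat (card Y) & (\<forall>q\<in>S. rowsum q Y = 0)" for e Y using x by auto
  have "{Y. Y \<subseteq> S & ?Q 0 Y} \<union> {Y. Y \<subseteq> S & ?Q 1 Y} = {Y. Y \<subseteq> S & (\<forall>q\<in>S. rowsum q Y = 0)}" unfolding Q of_nat_bit by auto
  note un = this
  have "{Y. Y \<subseteq> S & ?Q 0 Y} \<inter> {Y. Y \<subseteq> S & ?Q 1 Y} = {}" by (auto split: if_splits simp: of_nat_bit)
  note d = this
  show ?thesis unfolding card_Un_disjoint[OF finite_sub finite_sub d, symmetric] by (rule arg_cong[OF un])
 qed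
 {
  assume n: "Rneg ~= {}"
  have "2 ^ ?rt = card Rpos * card {Y. Y \<subseteq> S & (\<forall>q\<in>S. rowsum q Y = 0)}" unfolding T card_Rneg[OF n] K[symmetric] by (simp add: algebra_simps)
  then have "2 ^ ?rt * 2 * 2 ^ bit_rank (matA (\<Prod>S) \<beta>) = (2 * card Rpos) * (card {Y. Y \<subseteq> S & (\<forall>q\<in>S. rowsum q Y = 0)} * 2 ^ bit_rank (matA (\<Prod>S) \<beta>))" by simp
  also have "\<dots> = 2 ^ selmer_rank a b * 2 ^ card S" unfolding kernel_A using cE card_Rset card_Rneg[OF n] by simp
  finally have "(2::nat) ^ (?rt + 1 + bit_rank (matA (\<Prod>S) \<beta>)) = 2 ^ (selmer_rank a b + card S)" by (simp add: power_add)
  then show "?rt + 1 + bit_rank (matA (\<Prod>S) \<beta>) = selmer_rank a b + card S" by (rule two_power_eq)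
 next
  assume n: "Rneg = {}"
  have e: "{Y. Y \<subseteq> S & ?Q 0 Y} = {Y. Y \<subseteq> S & of_nat (card Y) = (0::bit) & (\<forall>q\<in>S. of_nat (card Y) + rowsum q Y = 0)}" by auto
  have "2 ^ ?rt * 2 ^ bit_rank (matA_hat (\<Prod>S) \<beta>) = card Rset * 2 ^ card S" unfolding T e card_Rset n using kernel_hat by simp
  also have "\<dots> = 2 ^ (selmer_rank a b + card S)" unfolding cE by (simp add: power_add)
  finally have "(2::nat) ^ (?rt + bit_rank (matA_hat (\<Prod>S) \<beta>)) = 2 ^ (selmer_rank a b + card S)" by (simp add: power_add)
  then show "?rt + bit_rank (matA_hat (\<Prod>S) \<beta>) = selmer_rank a b + card S" by simp
 }
qed

text \<open>The roles at the real place are exchanged: E demands s > 0 and the twist demands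
  nothing. If negative s exist, the two signs yield the two parts of the kernel of the matrix with
  the added column, and the summand 1 comes from that column. With positive s only, the rows are
  those of the barred matrix.\<close>

lemma case_a_pos:
 assumes a: "a > 0"
 shows "Rneg ~= {} ==> selmer_rank (a * tw S) (b * (tw S)^2) + bit_rank (matA_tilde (\<Prod>S) \<beta>) = selmer_rank a b + card S + 1"
  "Rneg = {} ==> selmer_rank (a * tw S) (b * (tw S)^2) + bit_rank (mat_bar (matA (\<Prod>S) \<beta>)) = selmer_rank a b + card S"
proof -
 let ?rt = "selmer_rank (a * tw S) (b * (tw S)^2)"
 have E: "selmer_ints a b = Rpos" unfolding selmer_ints_eq Rpos_def using inf_pos[OF a cpos] Rset_nonzero by blast
 have cE: "card Rpos = 2 ^ selmer_rank a b" using card_selmer(2)[OF disc] E by simp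
 have at: "a * tw S < 0" using a tw_S_neg by (rule mult_pos_neg)
 let ?Q = "%(e::bit) Y. (\<forall>q\<in>S. e + (of_nat (card Y) + rowsum q Y) = 0)"
 have T: "2 ^ ?rt = card Rpos * card {Y. Y \<subseteq> S & ?Q 0 Y} + card Rneg * card {Y. Y \<subseteq> S & ?Q 1 Y}"
 proof (rule card_twist_selmer[where Q = ?Q])
  fix s Y assume s: "s \<in> Rset" and Y: "Y \<subseteq> S"
  have nz: "s * tw Y ~= 0" using Rset_nonzero[OF s] tw_nonzero[OF Y] by simp
  show "local_sol Infinite_place (a * tw S) (b * (tw S)^2) (s * tw Y) & (\<forall>q\<in>S. twist_ok q s Y) \<longleftrightarrow> ?Q (sign_bit s) Y"
   using inf_neg[OF at disc_twist_pos(2) nz] twist_ok_bit[OF _ s Y] unfolding rowsum_def by blast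
 qed
 {
  assume n: "Rneg ~= {}"
  have "2 ^ ?rt = card Rpos * (card {Y. Y \<subseteq> S & ?Q 0 Y} + card {Y. Y \<subseteq> S & ?Q 1 Y})" unfolding T card_Rneg[OF n] by (simp only: distrib_left)
  then have "2 ^ ?rt * 2 ^ bit_rank (matA_tilde (\<Prod>S) \<beta>) = card Rpos * 2 ^ (card S + 1)" unfolding bit_card_sum kernel_tilde[symmetric] by simp
  then have "(2::nat) ^ (?rt + bit_rank (matA_tilde (\<Prod>S) \<beta>)) = 2 ^ (selmer_rank a b + card S + 1)" unfolding cE by (simp add: power_add)
  then show "?rt + bit_rank (matA_tilde (\<Prod>S) \<beta>) = selmer_rank a b + card S + 1" by (rule two_power_eq)
 next
  assume n: "Rneg = {}"
  have e: "{Y. Y \<subseteq> S & ?Q 0 Y} = {Y. Y \<subseteq> S & (\<forall>q\<in>S. of_nat (card Y) + rowsum q Y = 0)}" by simp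
  have "2 ^ ?rt * 2 ^ bit_rank (mat_bar (matA (\<Prod>S) \<beta>)) = card Rpos * 2 ^ card S" unfolding T e n using kernel_bar by simp
  then have "(2::nat) ^ (?rt + bit_rank (mat_bar (matA (\<Prod>S) \<beta>))) = 2 ^ (selmer_rank a b + card S)" unfolding cE by (simp add: power_add)
  then show "?rt + bit_rank (mat_bar (matA (\<Prod>S) \<beta>)) = selmer_rank a b + card S" by simp
 }
qed

end

theorem theorem5p2:
  fixes a b :: int and d :: nat
  assumes "ell_disc a b \<noteq> 0"
    and "ell_torsion (class_ring :: rat ring) a b 2 \<cong> integer_mod_group 2"
    and "d \<in> twist_set a b"
  shows "(b < 0 \<longrightarrow> twist_selmer_rank a b (- int d) = selmer_rank a b) \<and>
    (ell_disc a b < 0 \<and> b > 0 \<longrightarrow>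
       twist_selmer_rank a b (- int d) = selmer_rank a b + omega d) \<and>
    (ell_disc a b > 0 \<and> b > 0 \<and> a < 0 \<longrightarrow>
       (\<forall>\<beta>. local_roots a b d \<beta> \<longrightarrow>
          (eta a b d = 1 \<longrightarrow>
             int (twist_selmer_rank a b (- int d)) =
               int (selmer_rank a b) + int (omega d) - (1 + int (bit_rank (matA d \<beta>)))) \<and>
          (eta a b d = 0 \<longrightarrow>
             int (twist_selmer_rank a b (- int d)) =
               int (selmer_rank a b) + int (omega d) - int (bit_rank (matA_hat d \<beta>))))) \<and>
    (ell_disc a b > 0 \<and> b > 0 \<and> a > 0 \<longrightarrow>
       (\<forall>\<beta>. local_roots a b d \<beta> \<longrightarrow>
          (eta a b d = 1 \<longrightarrow>
             int (twist_selmer_rank a b (- int d)) =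
               int (selmer_rank a b) + int (omega d) + 1 - int (bit_rank (matA_tilde d \<beta>))) \<and>
          (eta a b d = 0 \<longrightarrow>
             int (twist_selmer_rank a b (- int d)) =
               int (selmer_rank a b) + int (omega d) - int (bit_rank (mat_bar (matA d \<beta>))))))"
proof -
  from assms(3) obtain S where S: "d = \<Prod>S" "finite S" "odd (card S)" "\<And>q. q \<in> S \<Longrightarrow> twist_prime a b q"
    unfolding twist_set_def twist_prime_def by blast
  interpret T: twist_setting a b S by unfold_locales (rule assms(1), rule S(2), rule S(3), rule S(4))
  have tr: "twist_selmer_rank a b (- int d) = selmer_rank (a * T.tw S) (b * (T.tw S)\<^sup>2)" unfolding twist_selmer_rank_def T.tw_S S(1) ..
  have om: "omega d = card S" unfolding S(1) by (rule T.omega_d)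
  have b0: "16 * b\<^sup>2 > 0" if "b > 0" using that by simp
  have dn: "a\<^sup>2 - 4 * b < 0" if "ell_disc a b < 0" "b > 0" using that b0[OF that(2)] unfolding ell_disc_def mult_less_0_iff by linarith
  have dp: "a\<^sup>2 - 4 * b > 0" if "ell_disc a b > 0" "b > 0" using that b0[OF that(2)] unfolding ell_disc_def zero_less_mult_iff by linarith
  have e1: "T.Rneg \<noteq> {}" if "eta a b d = 1" using that unfolding S(1) T.eta_iff by (auto split: if_splits)
  have e0: "T.Rneg = {}" if "eta a b d = 0" using that unfolding S(1) T.eta_iff by (auto split: if_splits)
  have R: "twist_roots a b S \<beta>" if "ell_disc a b > 0" "b > 0" "local_roots a b d \<beta>" for \<beta>
    by unfold_locales (use that dp S(1) in auto)
  show ?thesis unfolding tr om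
  proof (intro conjI impI allI)
    show "selmer_rank (a * T.tw S) (b * (T.tw S)\<^sup>2) = selmer_rank a b" if "b < 0" by (rule T.case_b_neg[OF that])
    show "selmer_rank (a * T.tw S) (b * (T.tw S)\<^sup>2) = selmer_rank a b + card S" if "ell_disc a b < 0 \<and> b > 0"
      by (rule T.case_disc_neg) (use that dn in auto)
  next
    fix \<beta> assume h: "ell_disc a b > 0 \<and> b > 0 \<and> a < 0" "local_roots a b d \<beta>"
    interpret U: twist_roots a b S \<beta> by (rule R) (use h in auto)
    note c = U.case_a_neg[OF h(1)[THEN conjunct2, THEN conjunct2], folded S(1)]
    show "int (selmer_rank (a * T.tw S) (b * (T.tw S)\<^sup>2)) = int (selmer_rank a b) + int (card S) - (1 + int (bit_rank (matA d \<beta>)))" if "eta a b d = 1"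
      using c(1)[OF e1[OF that]] by linarith
    show "int (selmer_rank (a * T.tw S) (b * (T.tw S)\<^sup>2)) = int (selmer_rank a b) + int (card S) - int (bit_rank (matA_hat d \<beta>))" if "eta a b d = 0"
      using c(2)[OF e0[OF that]] by linarith
  next
    fix \<beta> assume h: "ell_disc a b > 0 \<and> b > 0 \<and> a > 0" "local_roots a b d \<beta>"
    interpret U: twist_roots a b S \<beta> by (rule R) (use h in auto)
    note c = U.case_a_pos[OF h(1)[THEN conjunct2, THEN conjunct2], folded S(1)]
    show "int (selmer_rank (a * T.tw S) (b * (T.tw S)\<^sup>2)) = int (selmer_rank a b) + int (card S) + 1 - int (bit_rank (matA_tilde d \<beta>))" if "eta a b d = 1"
      using c(1)[OF e1[OF that]] by linarith
    show "int (selmer_rank (a * T.tw S) (b * (T.tw S)\<^sup>2)) = int (selmer_rank a b) + int (card S) - int (bit_rank (mat_bar (matA d \<beta>)))" if "eta a b d = 0"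
      using c(2)[OF e0[OF that]] by linarith
  qed
qed

end
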